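(* Assume (H$k$), (H$A$) and (H$\varphi$) (stated in the context), with $l$ the function appearing in (H$k$), and let $b:=\varphi^{-1}$. For $i=1,2$ let $u_{0,i}\in L^1(\Omega)$, $f_i\in L^1(Q_T)$, and let $v_i$ be an entropy solution to $P(u_{0,i},f_i)$ such that $v_i$ is the limit (the iterated a.e. limit $\lim_{n\to\infty}\lim_{m\to\infty}$ in $Q_T$) of $\varphi(u^i_{m,n})$, where for each $m,n\in\mathbb{N}$, $u^i_{m,n}$ is a weak solution to $P(u_{0,i}^{m,n},f_i^{m,n})$ with $k\ast(u^i_{m,n}-u_{0,i}^{m,n})\in{}_0W^{1,1}(0,T;L^1(\Omega))$. Then $$\|b(v_1)-b(v_2)\|_{L^1(Q_T)}\le T\,\|u_{0,1}-u_{0,2}\|_{L^1(\Omega)}+\|l\|_{L^1(0,T)}\,\|f_1-f_2\|_{L^1(Q_T)}.$$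
   Context: Setting: $T>0$, $\Omega\subseteq\mathbb{R}^d$ is a bounded domain, $d\in\mathbb{N}$, $Q_T=(0,T)\times\Omega$, $\Sigma=(0,T)\times\partial\Omega$; $(k\ast w)(t)=\int_0^t k(t-\tau)w(\tau)\,d\tau$ is convolution in time; $\nabla$, $\operatorname{div}$ act in $x$; $(\cdot,\cdot)$ is the Euclidean inner product. For $u_0\in L^1(\Omega)$, $f\in L^1(Q_T)$, problem $P(u_0,f)$ is $$\partial_t[k\ast(u-u_0)]-\operatorname{div}(A(t,x)\nabla\varphi(u))=f\ \text{in }Q_T,\quad u=0\ \text{in }\Sigma,\quad u(0,\cdot)=u_0\ \text{in }\Omega.$$ Assumptions. (H$k$): $k\in L^1_{\mathrm{loc}}(\mathbb{R}^+)$ is non-negative and non-increasing, and there is $l\in L^1_{\mathrm{loc}}(\mathbb{R}^+)$ with $l|_{(0,T)}\in L^p(0,T)$ for some $p>1$ and $k\ast l=1$ in $(0,\infty)$. (H$A$): $A\in L^\infty(Q_T;\mathbb{R}^{d\times d})$ and there is $\nu>0$ with $(A(t,x)\xi,\xi)\ge\nu|\xi|^2$ for all $\xi\in\mathbb{R}^d$ and a.e. $(t,x)\in Q_T$. (H$\varphi$): $\varphi\in C^1(\mathbb{R})$, $\varphi'\ge0$, $\varphi(0)=0$, $\varphi$ is strictly increasing, and there are $\mu,R>0$ with $0<\mu\le\varphi'(r)$ for all $|r|>R$. For $V\subseteq W^{1,1}(0,T;X)$, $X$ a Banach space, ${}_0V$ is the set of $\psi\in V$ vanishing at $t=0$. Weak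 solution: $W_\varphi(T,u_0)$ is the set of $w\in L^2(0,T;L^2(\Omega))$ with $k\ast(w-u_0)\in{}_0W^{1,1}(0,T;H^{-1}(\Omega))$ and $\varphi(w)\in L^2(0,T;H^1_0(\Omega))$. A function $u\in W_\varphi(T,u_0)$ is a weak solution to $P(u_0,f)$ if for all $\eta\in W^{1,1}(0,T;L^2(\Omega))\cap L^2(0,T;H^1_0(\Omega))$ with $\eta(T,\cdot)=0$, $$\int_0^T\int_\Omega-\eta_t[k\ast(u-u_0)]+(A\nabla\varphi(u),\nabla\eta)\,dx\,dt=\int_0^T\int_\Omega f\eta\,dx\,dt.$$ Entropy solution: let $v_0:=\varphi(u_0)$, $T_K(r):=\max\{-K,\min\{K,r\}\}$ for $K>0$, and $\mathcal{P}:=\{S\in C^1(\mathbb{R}):0\le S'\le1,\ \operatorname{supp}S'\text{ compact},\ S(0)=0\}$. A measurable $v:Q_T\to\mathbb{R}$ is an entropy solution to $P(u_0,f)$ if $b(v)\in L^1(Q_T)$, $T_K(v)\in L^2(0,T;H^1_0(\Omega))$ for all $K>0$, and $$-\int_{Q_T}\zeta_t\Big[k_1\ast\int_{v_0}^vS(\sigma-\phi)\,db(\sigma)\Big]+\int_{Q_T}\zeta\,\partial_t[k_2\ast(b(v)-b(v_0))]\,S(v-\phi)+\int_{Q_T}\zeta\,(A\nabla v,\nabla S(v-\phi))\le\int_{Q_T}\zeta fS(v-\phi)$$ for all $\phi\in H^1_0(\Omega)\cap L^\infty(\Omega)$, all $\zeta\in\mathcal{D}([0,T))$ (smooth with compact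 support in $[0,T)$) with $\zeta\ge0$, all $S\in\mathcal{P}$, and all non-increasing non-negative $k_1,k_2\in L^1(0,T)$ with $k=k_1+k_2$ and $k_2(0^+)<\infty$. Here $\int\cdot\,db(\sigma)$ is the Stieltjes integral, and $\nabla v$ is the generalized gradient, given by $\nabla v=\nabla T_K(v)$ a.e. on $\{|v|<K\}$ for every $K>0$. Approximation: for $m,n\in\mathbb{N}$ and $i=1,2$, $u_{0,i}^{m,n}:=\max\{-n,\min\{m,u_{0,i}\}\}$ and $f_i^{m,n}:=\max\{-n,\min\{m,f_i\}\}$. *)

theory Defs
  imports "HOL-Analysis.Analysis"
begin

section \<open>Test functions and weak derivatives\<close>

text \<open>Functions of time and space are curried, \<open>u :: real \<Rightarrow> real ^ 'd \<Rightarrow> real\<close>. Elements of Lebesgue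
  and Sobolev spaces are represented by Lebesgue measurable functions; two functions represent the
  same element iff the (semi)norm of their difference is zero.\<close>

primrec Ck :: "nat \<Rightarrow> ('a::euclidean_space \<Rightarrow> real) \<Rightarrow> bool" where
  "Ck 0 f \<longleftrightarrow> continuous_on UNIV f"
| "Ck (Suc k) f \<longleftrightarrow> f differentiable_on UNIV \<and>
     (\<forall>e\<in>Basis. Ck k (\<lambda>x. frechet_derivative f (at x) e))"

definition smooth_fun :: "('a::euclidean_space \<Rightarrow> real) \<Rightarrow> bool" where
  "smooth_fun f \<longleftrightarrow> (\<forall>k. Ck k f)"

definition test_funs :: "'a::euclidean_space set \<Rightarrow> ('a \<Rightarrow> real) set" where
  "test_funs \<Omega> = {\<psi>. smooth_fun \<psi> \<and> compact (closure {x. \<psi> x \<noteq> 0}) \<and> closure {x. \<psi> x \<noteq> 0} \<subseteq> \<Omega>}"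

definition L1_loc :: "'a::euclidean_space set \<Rightarrow> ('a \<Rightarrow> 'b::euclidean_space) \<Rightarrow> bool" where
  "L1_loc \<Omega> f \<longleftrightarrow> (\<forall>K. compact K \<and> K \<subseteq> \<Omega> \<longrightarrow> integrable (lebesgue_on K) f)"

definition has_weak_gradient ::
  "'a::euclidean_space set \<Rightarrow> ('a \<Rightarrow> real) \<Rightarrow> ('a \<Rightarrow> 'a) \<Rightarrow> bool" where
  "has_weak_gradient \<Omega> u g \<longleftrightarrow> L1_loc \<Omega> u \<and> L1_loc \<Omega> g \<and>
     (\<forall>\<psi>\<in>test_funs \<Omega>. \<forall>e\<in>Basis.
        (\<integral>x. u x * frechet_derivative \<psi> (at x) e \<partial>lebesgue_on \<Omega>)
        = - (\<integral>x. (g x \<bullet> e) * \<psi> x \<partial>lebesgue_on \<Omega>))"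

definition weak_gradient :: "'a::euclidean_space set \<Rightarrow> ('a \<Rightarrow> real) \<Rightarrow> ('a \<Rightarrow> 'a)" where
  "weak_gradient \<Omega> u = (SOME g. has_weak_gradient \<Omega> u g)"


section \<open>Function spaces on the spatial domain\<close>

text \<open>A (semi)normed space whose elements are real-valued functions with pointwise operations. This
  covers spaces of functions on \<open>\<Omega>\<close> as well as the space \<open>H\<^sup>-\<^sup>1\<close> of functionals on \<open>H\<^sup>1\<^sub>0\<close>.\<close>

record 'b fun_space =
  elts :: "('b \<Rightarrow> real) set"
  nrm :: "('b \<Rightarrow> real) \<Rightarrow> real"

definition Lp_space :: "real \<Rightarrow> 'a::euclidean_space set \<Rightarrow> 'a fun_space" where
  "Lp_space p \<Omega> =
     \<lparr>elts = {f. f \<in> borel_measurable (lebesgue_on \<Omega>) \<and>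
                 integrable (lebesgue_on \<Omega>) (\<lambda>x. \<bar>f x\<bar> powr p)},
      nrm = (\<lambda>f. (\<integral>x. \<bar>f x\<bar> powr p \<partial>lebesgue_on \<Omega>) powr (1 / p))\<rparr>"

definition H1 :: "'a::euclidean_space set \<Rightarrow> ('a \<Rightarrow> real) set" where
  "H1 \<Omega> = {u \<in> elts (Lp_space 2 \<Omega>).
     \<exists>g. has_weak_gradient \<Omega> u g \<and> integrable (lebesgue_on \<Omega>) (\<lambda>x. (norm (g x))\<^sup>2)}"

definition norm_H1 :: "'a::euclidean_space set \<Rightarrow> ('a \<Rightarrow> real) \<Rightarrow> real" where
  "norm_H1 \<Omega> u = sqrt ((\<integral>x. (u x)\<^sup>2 \<partial>lebesgue_on \<Omega>)
                      + (\<integral>x. (norm (weak_gradient \<Omega> u x))\<^sup>2 \<partial>lebesgue_on \<Omega>))"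

definition H10 :: "'a::euclidean_space set \<Rightarrow> 'a fun_space" where
  "H10 \<Omega> =
     \<lparr>elts = {u \<in> H1 \<Omega>. \<exists>\<psi>. (\<forall>n. \<psi> n \<in> test_funs \<Omega>) \<and>
                 (\<lambda>n::nat. norm_H1 \<Omega> (\<lambda>x. \<psi> n x - u x)) \<longlonglongrightarrow> 0},
      nrm = norm_H1 \<Omega>\<rparr>"

definition Hminus1 :: "'a::euclidean_space set \<Rightarrow> ('a \<Rightarrow> real) fun_space" where
  "Hminus1 \<Omega> =
     \<lparr>elts = {F. (\<forall>u\<in>elts (H10 \<Omega>). \<forall>v\<in>elts (H10 \<Omega>). \<forall>a c.
                    F (\<lambda>x. a * u x + c * v x) = a * F u + c * F v) \<and>
                 (\<exists>C. \<forall>u\<in>elts (H10 \<Omega>). \<bar>F u\<bar> \<le> C * nrm (H10 \<Omega>) u)},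
      nrm = (\<lambda>F. SUP u\<in>{u \<in> elts (H10 \<Omega>). nrm (H10 \<Omega>) u \<le> 1}. \<bar>F u\<bar>)\<rparr>"


section \<open>Bochner spaces over the time interval\<close>

definition simple_fun :: "real \<Rightarrow> 'b fun_space \<Rightarrow> (real \<Rightarrow> 'b \<Rightarrow> real) \<Rightarrow> bool" where
  "simple_fun T X s \<longleftrightarrow>
     simple_function (lebesgue_on {0<..<T}) s \<and> (\<forall>t\<in>{0<..<T}. s t \<in> elts X)"

definition bochner_measurable :: "real \<Rightarrow> 'b fun_space \<Rightarrow> (real \<Rightarrow> 'b \<Rightarrow> real) \<Rightarrow> bool" where
  "bochner_measurable T X f \<longleftrightarrow>
     (\<exists>s. (\<forall>n::nat. simple_fun T X (s n)) \<and>
        (AE t in lebesgue_on {0<..<T}. f t \<in> elts X \<and>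
           (\<lambda>n. nrm X (\<lambda>b. f t b - s n t b)) \<longlonglongrightarrow> 0))"

definition bochner_Lp :: "real \<Rightarrow> real \<Rightarrow> 'b fun_space \<Rightarrow> (real \<Rightarrow> 'b \<Rightarrow> real) set" where
  "bochner_Lp p T X =
     {f. bochner_measurable T X f \<and> integrable (lebesgue_on {0<..<T}) (\<lambda>t. nrm X (f t) powr p)}"

text \<open>The integral of a simple function over \<open>(0,T)\<close> is a finite linear combination of its values,
  so it can be computed pointwise.\<close>

definition has_bochner_integral_in ::
  "real \<Rightarrow> 'b fun_space \<Rightarrow> (real \<Rightarrow> 'b \<Rightarrow> real) \<Rightarrow> ('b \<Rightarrow> real) \<Rightarrow> bool" where
  "has_bochner_integral_in T X f y \<longleftrightarrow>
     bochner_measurable T X f \<and> y \<in> elts X \<and>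
     (\<exists>s. (\<forall>n::nat. simple_fun T X (s n)) \<and>
        (\<lambda>n. \<integral>\<^sup>+ t. ennreal (nrm X (\<lambda>b. f t b - s n t b)) \<partial>lebesgue_on {0<..<T}) \<longlonglongrightarrow> 0 \<and>
        (\<lambda>n. nrm X (\<lambda>b. (\<integral>t. s n t b \<partial>lebesgue_on {0<..<T}) - y b)) \<longlonglongrightarrow> 0)"

text \<open>\<open>f \<in> W\<^sup>1\<^sup>,\<^sup>1(0,T;X)\<close> with weak derivative \<open>g\<close>.\<close>

definition has_W11_deriv ::
  "real \<Rightarrow> 'b fun_space \<Rightarrow> (real \<Rightarrow> 'b \<Rightarrow> real) \<Rightarrow> (real \<Rightarrow> 'b \<Rightarrow> real) \<Rightarrow> bool" where
  "has_W11_deriv T X f g \<longleftrightarrow> f \<in> bochner_Lp 1 T X \<and> g \<in> bochner_Lp 1 T X \<and>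
     (\<forall>\<rho>\<in>test_funs {0<..<T}. \<exists>y.
        has_bochner_integral_in T X (\<lambda>t b. deriv \<rho> t * f t b) y \<and>
        has_bochner_integral_in T X (\<lambda>t b. - (\<rho> t * g t b)) y)"

definition W11 :: "real \<Rightarrow> 'b fun_space \<Rightarrow> (real \<Rightarrow> 'b \<Rightarrow> real) set" where
  "W11 T X = {f. \<exists>g. has_W11_deriv T X f g}"

text \<open>The value of \<open>f \<in> W\<^sup>1\<^sup>,\<^sup>1(0,T;X)\<close> at \<open>t\<^sub>0 \<in> [0,T]\<close> is that of its representative in \<open>C([0,T];X)\<close>.\<close>

definition vanishes_at ::
  "real \<Rightarrow> 'b fun_space \<Rightarrow> real \<Rightarrow> (real \<Rightarrow> 'b \<Rightarrow> real) \<Rightarrow> bool" where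
  "vanishes_at T X t0 f \<longleftrightarrow>
     (\<exists>g. (\<forall>t\<in>{0..T}. g t \<in> elts X \<and>
             ((\<lambda>s. nrm X (\<lambda>b. g s b - g t b)) \<longlongrightarrow> 0) (at t within {0..T})) \<and>
          (AE t in lebesgue_on {0<..<T}. f t \<in> elts X \<and> nrm X (\<lambda>b. f t b - g t b) = 0) \<and>
          nrm X (g t0) = 0)"

definition W11_zero :: "real \<Rightarrow> 'b fun_space \<Rightarrow> (real \<Rightarrow> 'b \<Rightarrow> real) set" where
  "W11_zero T X = {f \<in> W11 T X. vanishes_at T X 0 f}"


section \<open>The problem and its data\<close>

definition bounded_domain :: "(real ^ 'd) set \<Rightarrow> bool" where
  "bounded_domain \<Omega> \<longleftrightarrow> open \<Omega> \<and> connected \<Omega> \<and> bounded \<Omega> \<and> \<Omega> \<noteq> {}"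

abbreviation cylinder :: "real \<Rightarrow> (real ^ 'd) set \<Rightarrow> (real \<times> (real ^ 'd)) set" where
  "cylinder T \<Omega> \<equiv> {0<..<T} \<times> \<Omega>"

definition conv :: "(real \<Rightarrow> real) \<Rightarrow> (real \<Rightarrow> real) \<Rightarrow> real \<Rightarrow> real" where
  "conv k w t = (\<integral>\<tau>. k (t - \<tau>) * w \<tau> \<partial>lebesgue_on {0<..<t})"

definition norm_L1 :: "'a::euclidean_space set \<Rightarrow> ('a \<Rightarrow> real) \<Rightarrow> real" where
  "norm_L1 S f = (\<integral>x. \<bar>f x\<bar> \<partial>lebesgue_on S)"

text \<open>\<open>L\<^sup>1\<^sub>l\<^sub>o\<^sub>c(\<real>\<^sup>+)\<close> with \<open>\<real>\<^sup>+ = [0,\<infinity>)\<close>, i.e. integrability up to \<open>0\<close> (needed for \<open>k * l\<close> to make sense).\<close>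

definition L1_loc_half_line :: "(real \<Rightarrow> real) \<Rightarrow> bool" where
  "L1_loc_half_line k \<longleftrightarrow> (\<forall>r>0. integrable (lebesgue_on {0<..<r}) k)"

definition kernel_assumption :: "real \<Rightarrow> (real \<Rightarrow> real) \<Rightarrow> (real \<Rightarrow> real) \<Rightarrow> bool" where
  "kernel_assumption T k l \<longleftrightarrow>
     L1_loc_half_line k \<and> (\<forall>t>0. 0 \<le> k t) \<and> antimono_on {0<..} k \<and>
     L1_loc_half_line l \<and> (\<exists>p>1. l \<in> elts (Lp_space p {0<..<T})) \<and>
     (AE t in lebesgue_on {0<..}. conv k l t = 1)"

definition diffusion_assumption ::
  "real \<Rightarrow> (real ^ 'd) set \<Rightarrow> (real \<Rightarrow> real ^ 'd \<Rightarrow> real ^ 'd ^ 'd) \<Rightarrow> bool" where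
  "diffusion_assumption T \<Omega> A \<longleftrightarrow>
     case_prod A \<in> borel_measurable (lebesgue_on (cylinder T \<Omega>)) \<and>
     (\<exists>C. AE (t, x) in lebesgue_on (cylinder T \<Omega>). norm (A t x) \<le> C) \<and>
     (\<exists>\<nu>>0. AE (t, x) in lebesgue_on (cylinder T \<Omega>).
        \<forall>\<xi>. (A t x *v \<xi>) \<bullet> \<xi> \<ge> \<nu> * (norm \<xi>)\<^sup>2)"

definition nonlinearity_assumption :: "(real \<Rightarrow> real) \<Rightarrow> bool" where
  "nonlinearity_assumption \<phi> \<longleftrightarrow>
     \<phi> C1_differentiable_on UNIV \<and> (\<forall>r. 0 \<le> deriv \<phi> r) \<and> \<phi> 0 = 0 \<and> strict_mono \<phi> \<and>
     (\<exists>\<mu>>0. \<exists>R>0. \<forall>r. \<bar>r\<bar> > R \<longrightarrow> \<mu> \<le> deriv \<phi> r)"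

definition Q_measurable ::
  "real \<Rightarrow> (real ^ 'd) set \<Rightarrow> (real \<Rightarrow> real ^ 'd \<Rightarrow> 'b::euclidean_space) \<Rightarrow> bool" where
  "Q_measurable T \<Omega> w \<longleftrightarrow> case_prod w \<in> borel_measurable (lebesgue_on (cylinder T \<Omega>))"

definition spatial_gradient ::
  "real \<Rightarrow> (real ^ 'd) set \<Rightarrow> (real \<Rightarrow> real ^ 'd \<Rightarrow> real) \<Rightarrow> (real \<Rightarrow> real ^ 'd \<Rightarrow> real ^ 'd) \<Rightarrow> bool"
  where
  "spatial_gradient T \<Omega> w G \<longleftrightarrow> Q_measurable T \<Omega> G \<and>
     (AE t in lebesgue_on {0<..<T}. has_weak_gradient \<Omega> (w t) (G t))"

text \<open>The function \<open>k * (w - w\<^sub>0)\<close> of time and space.\<close>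

definition conv_diff ::
  "(real \<Rightarrow> real) \<Rightarrow> (real \<Rightarrow> 'a \<Rightarrow> real) \<Rightarrow> ('a \<Rightarrow> real) \<Rightarrow> real \<Rightarrow> 'a \<Rightarrow> real" where
  "conv_diff k w w0 t x = conv k (\<lambda>\<tau>. w \<tau> x - w0 x) t"


section \<open>Weak solutions\<close>

text \<open>A function \<open>h\<close> on \<open>Q\<^sub>T\<close> belongs to \<open>\<^sub>0W\<^sup>1\<^sup>,\<^sup>1(0,T;H\<^sup>-\<^sup>1(\<Omega>))\<close> if for a.e. \<open>t\<close> the distribution \<open>h(t)\<close> is
  the restriction to test functions of \<open>F(t) \<in> H\<^sup>-\<^sup>1(\<Omega>)\<close> (which is unique by density) with
  \<open>F\<close> in that space.\<close>

definition in_W11_zero_Hminus1 ::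
  "real \<Rightarrow> (real ^ 'd) set \<Rightarrow> (real \<Rightarrow> real ^ 'd \<Rightarrow> real) \<Rightarrow> bool" where
  "in_W11_zero_Hminus1 T \<Omega> h \<longleftrightarrow>
     (\<exists>F\<in>W11_zero T (Hminus1 \<Omega>). AE t in lebesgue_on {0<..<T}. L1_loc \<Omega> (h t) \<and>
        (\<forall>\<psi>\<in>test_funs \<Omega>. F t \<psi> = (\<integral>x. h t x * \<psi> x \<partial>lebesgue_on \<Omega>)))"

definition W_phi ::
  "real \<Rightarrow> (real ^ 'd) set \<Rightarrow> (real \<Rightarrow> real) \<Rightarrow> (real \<Rightarrow> real) \<Rightarrow> (real ^ 'd \<Rightarrow> real) \<Rightarrow>
   (real \<Rightarrow> real ^ 'd \<Rightarrow> real) set" where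
  "W_phi T \<Omega> k \<phi> u0 =
     {w. Q_measurable T \<Omega> w \<and> w \<in> bochner_Lp 2 T (Lp_space 2 \<Omega>) \<and>
         in_W11_zero_Hminus1 T \<Omega> (conv_diff k w u0) \<and>
         (\<lambda>t x. \<phi> (w t x)) \<in> bochner_Lp 2 T (H10 \<Omega>)}"

text \<open>\<open>\<eta>\<^sub>t\<close> and \<open>G\<^sub>\<eta>\<close> below are the weak time derivative and spatial gradient of \<open>\<eta>\<close>. For data merely in
  \<open>L\<^sup>1\<close>, neither \<open>\<eta>\<^sub>t (k * (u - u\<^sub>0))\<close> nor \<open>f \<eta>\<close> is integrable for every \<open>\<eta>\<close> in the test space, and the
  integral of a nonintegrable function is \<open>0\<close> by convention in HOL; the identity is therefore required
  for exactly those \<open>\<eta>\<close> for which its integrals exist. (The product \<open>(A\<nabla>\<phi>(u), \<nabla>\<eta>)\<close> is always integrable.)\<close>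

definition weak_solution ::
  "real \<Rightarrow> (real ^ 'd) set \<Rightarrow> (real \<Rightarrow> real) \<Rightarrow> (real \<Rightarrow> real ^ 'd \<Rightarrow> real ^ 'd ^ 'd) \<Rightarrow>
   (real \<Rightarrow> real) \<Rightarrow> (real ^ 'd \<Rightarrow> real) \<Rightarrow> (real \<Rightarrow> real ^ 'd \<Rightarrow> real) \<Rightarrow>
   (real \<Rightarrow> real ^ 'd \<Rightarrow> real) \<Rightarrow> bool" where
  "weak_solution T \<Omega> k A \<phi> u0 f u \<longleftrightarrow> u \<in> W_phi T \<Omega> k \<phi> u0 \<and>
     (\<exists>G. spatial_gradient T \<Omega> (\<lambda>t x. \<phi> (u t x)) G \<and>
       (\<forall>\<eta> \<eta>\<^sub>t G\<^sub>\<eta>.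
          Q_measurable T \<Omega> \<eta> \<and> \<eta> \<in> bochner_Lp 2 T (H10 \<Omega>) \<and> spatial_gradient T \<Omega> \<eta> G\<^sub>\<eta> \<and>
          Q_measurable T \<Omega> \<eta>\<^sub>t \<and> has_W11_deriv T (Lp_space 2 \<Omega>) \<eta> \<eta>\<^sub>t \<and>
          vanishes_at T (Lp_space 2 \<Omega>) T \<eta> \<and>
          integrable (lebesgue_on (cylinder T \<Omega>)) (\<lambda>(t, x). \<eta>\<^sub>t t x * conv_diff k u u0 t x) \<and>
          integrable (lebesgue_on (cylinder T \<Omega>)) (\<lambda>(t, x). f t x * \<eta> t x)
          \<longrightarrow>
          (\<integral>(t, x). - \<eta>\<^sub>t t x * conv_diff k u u0 t x + (A t x *v G t x) \<bullet> G\<^sub>\<eta> t x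
             \<partial>lebesgue_on (cylinder T \<Omega>))
          = (\<integral>(t, x). f t x * \<eta> t x \<partial>lebesgue_on (cylinder T \<Omega>))))"


section \<open>Entropy solutions\<close>

definition cutoff :: "real \<Rightarrow> real \<Rightarrow> real" where
  "cutoff K r = max (- K) (min K r)"

definition entropy_class :: "(real \<Rightarrow> real) set" where
  "entropy_class = {S. S C1_differentiable_on UNIV \<and> (\<forall>r. 0 \<le> deriv S r \<and> deriv S r \<le> 1) \<and>
     compact (closure {r. deriv S r \<noteq> 0}) \<and> S 0 = 0}"

definition generalized_gradient ::
  "real \<Rightarrow> (real ^ 'd) set \<Rightarrow> (real \<Rightarrow> real ^ 'd \<Rightarrow> real) \<Rightarrow> (real \<Rightarrow> real ^ 'd \<Rightarrow> real ^ 'd) \<Rightarrow> bool"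
  where
  "generalized_gradient T \<Omega> v G \<longleftrightarrow> Q_measurable T \<Omega> G \<and>
     (\<forall>K>0. \<exists>G\<^sub>K. spatial_gradient T \<Omega> (\<lambda>t x. cutoff K (v t x)) G\<^sub>K \<and>
        (AE (t, x) in lebesgue_on (cylinder T \<Omega>). \<bar>v t x\<bar> < K \<longrightarrow> G t x = G\<^sub>K t x))"

text \<open>The Stieltjes integral of \<open>g\<close> from \<open>a\<close> to \<open>c\<close> with respect to the increasing function \<open>b\<close> (with the usual
  sign if \<open>c < a\<close>). Only used for continuous \<open>b\<close>, for which single points have measure zero.\<close>

definition stieltjes :: "(real \<Rightarrow> real) \<Rightarrow> real \<Rightarrow> real \<Rightarrow> (real \<Rightarrow> real) \<Rightarrow> real" where
  "stieltjes b a c g = interval_lebesgue_integral (interval_measure b) (ereal a) (ereal c) g"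

text \<open>Nonnegative elements of \<open>\<D>([0,T))\<close>, each represented by a smooth extension to \<open>\<real>\<close>.\<close>

definition time_test_funs :: "real \<Rightarrow> (real \<Rightarrow> real) set" where
  "time_test_funs T =
     {\<zeta>. smooth_fun \<zeta> \<and> (\<exists>s<T. \<forall>t\<in>{0..<T}. s \<le> t \<longrightarrow> \<zeta> t = 0) \<and> (\<forall>t\<in>{0..<T}. 0 \<le> \<zeta> t)}"

definition kernel_splitting ::
  "real \<Rightarrow> (real \<Rightarrow> real) \<Rightarrow> (real \<Rightarrow> real) \<Rightarrow> (real \<Rightarrow> real) \<Rightarrow> bool" where
  "kernel_splitting T k k1 k2 \<longleftrightarrow>
     (\<forall>\<kappa>\<in>{k1, k2}. integrable (lebesgue_on {0<..<T}) \<kappa> \<and>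
        antimono_on {0<..<T} \<kappa> \<and> (\<forall>t\<in>{0<..<T}. 0 \<le> \<kappa> t)) \<and>
     (AE t in lebesgue_on {0<..<T}. k t = k1 t + k2 t) \<and>
     (\<exists>L. (k2 \<longlongrightarrow> L) (at_right 0))"

text \<open>Below, \<open>G\<close>, \<open>D\<close> and \<open>G\<^sub>S\<close> are \<open>\<nabla>v\<close>, \<open>\<partial>\<^sub>t[k\<^sub>2 * (b(v) - b(v\<^sub>0))]\<close> and \<open>\<nabla>S(v - \<psi>)\<close>; each is determined up
  to null sets, and existence of \<open>D\<close> and \<open>G\<^sub>S\<close> is automatic: \<open>k\<^sub>2\<close> is of bounded variation, and
  \<open>S(v - \<psi>) = S(cutoff K v - \<psi>)\<close> for large \<open>K\<close>.\<close>

definition entropy_solution ::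
  "real \<Rightarrow> (real ^ 'd) set \<Rightarrow> (real \<Rightarrow> real) \<Rightarrow> (real \<Rightarrow> real ^ 'd \<Rightarrow> real ^ 'd ^ 'd) \<Rightarrow>
   (real \<Rightarrow> real) \<Rightarrow> (real ^ 'd \<Rightarrow> real) \<Rightarrow> (real \<Rightarrow> real ^ 'd \<Rightarrow> real) \<Rightarrow>
   (real \<Rightarrow> real ^ 'd \<Rightarrow> real) \<Rightarrow> bool" where
  "entropy_solution T \<Omega> k A \<phi> u0 f v \<longleftrightarrow>
     (let b = inv \<phi>; v0 = (\<lambda>x. \<phi> (u0 x)); Q = lebesgue_on (cylinder T \<Omega>) in
      Q_measurable T \<Omega> v \<and> integrable Q (\<lambda>(t, x). b (v t x)) \<and>
      (\<forall>K>0. (\<lambda>t x. cutoff K (v t x)) \<in> bochner_Lp 2 T (H10 \<Omega>)) \<and>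
      (\<exists>G. generalized_gradient T \<Omega> v G \<and>
        (\<forall>\<psi> \<zeta> S k1 k2.
           \<psi> \<in> elts (H10 \<Omega>) \<and> (\<exists>C. AE x in lebesgue_on \<Omega>. \<bar>\<psi> x\<bar> \<le> C) \<and>
           \<zeta> \<in> time_test_funs T \<and> S \<in> entropy_class \<and> kernel_splitting T k k1 k2
           \<longrightarrow>
           (\<exists>D G\<^sub>S.
              Q_measurable T \<Omega> D \<and>
              has_W11_deriv T (Lp_space 1 \<Omega>)
                (conv_diff k2 (\<lambda>t x. b (v t x)) (\<lambda>x. b (v0 x))) D \<and>
              spatial_gradient T \<Omega> (\<lambda>t x. S (v t x - \<psi> x)) G\<^sub>S \<and>
              - (\<integral>(t, x). deriv \<zeta> t *
                   conv k1 (\<lambda>\<tau>. stieltjes b (v0 x) (v \<tau> x) (\<lambda>\<sigma>. S (\<sigma> - \<psi> x))) t \<partial>Q)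
              + (\<integral>(t, x). \<zeta> t * D t x * S (v t x - \<psi> x) \<partial>Q)
              + (\<integral>(t, x). \<zeta> t * ((A t x *v G t x) \<bullet> G\<^sub>S t x) \<partial>Q)
              \<le> (\<integral>(t, x). \<zeta> t * f t x * S (v t x - \<psi> x) \<partial>Q)))))"


section \<open>Bilateral truncation of the data\<close>

definition trunc :: "nat \<Rightarrow> nat \<Rightarrow> real \<Rightarrow> real" where
  "trunc m n r = max (- real n) (min (real m) r)"

end

theory Submission
  imports Defs
begin

text \<open>
  For fixed truncation parameters, the hypothesis on \<open>k * (u\<^sub>i - u\<^sub>0\<^sub>i)\<close> makes its time derivative \<open>D\<^sub>i\<close> a
  function in \<open>L\<^sup>1(Q\<^sub>T)\<close>. Testing with \<open>\<theta>(t) e(x)\<close>, \<open>e = tanh (c (s\<^sub>1 - s\<^sub>2))\<close>, where \<open>s\<^sub>i\<close> runs through the countably many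
  values of the simple functions approximating \<open>\<phi>(u\<^sub>i)\<close> in \<open>L\<^sup>2(0,T;H\<^sup>1\<^sub>0)\<close>, gives the equation on almost
  every time slice for all these \<open>e\<close> simultaneously. Let \<open>s\<^sub>i \<rightarrow> \<phi>(u\<^sub>i(t))\<close> and then \<open>c \<rightarrow> \<infinity>\<close>: the elliptic
  part is nonnegative, and \<open>sgn (\<phi>(u\<^sub>1) - \<phi>(u\<^sub>2)) = sgn (u\<^sub>1 - u\<^sub>2)\<close> since \<open>\<phi>\<close> is strictly increasing, so at
  almost every time \<open>\<integral> (D\<^sub>1 - D\<^sub>2) sgn (u\<^sub>1 - u\<^sub>2) dx \<le> \<integral> \<bar>f\<^sub>1 - f\<^sub>2\<bar> dx\<close>.

  For almost every \<open>x\<close>, write \<open>u\<^sub>1 - u\<^sub>2 = y\<^sub>0 + w\<close> and \<open>D = D\<^sub>1 - D\<^sub>2 = \<partial>\<^sub>t(k * w)\<close>. Since \<open>k\<close> is nonincreasing,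
  \<open>k * \<partial>\<^sub>tJ(y\<^sub>0 + w) \<le> D J'(y\<^sub>0 + w)\<close> for convex \<open>J\<close>. Integrate against \<open>Z(t) = \<integral>\<^sub>0\<^sup>T\<^sup>-\<^sup>t l\<close>, which is nonnegative and
  undoes the convolution with \<open>k\<close> because \<open>k * l = 1\<close>; with \<open>J \<rightarrow> \<bar>\<cdot>\<bar>\<close> this becomes
  \<open>\<integral> \<bar>y\<^sub>0 + w\<bar> dt - T \<bar>y\<^sub>0\<bar> \<le> \<integral> Z D sgn (y\<^sub>0 + w) dt\<close>. Integration over \<open>x\<close> and \<open>0 \<le> Z \<le> \<parallel>l\<parallel>\<close> give the contraction
  for the approximating solutions, and Fatou's lemma, applied twice, carries it over to the limits.
\<close>

section \<open>Smooth functions\<close>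

text \<open>Neither u nor \<phi>(u) is known to be differentiable in time, so neither is an
  admissible test function. The argument in space and the argument in time are therefore kept apart,
  linked only by the quantity D sgn (u1 - u2). In space, sgn does not preserve \<open>H10\<close>,
  while tanh (c r) is smooth, bounded by 1, increasing, zero at 0 and tends to sgn r. The null set
  of times at which a tested equation fails depends on the test function, which forces a countable
  family to be fixed before a time is selected. In time, k may be unbounded at 0 and need not be
  differentiable, and l carries no sign assumption. The second mean value theorem replaces an
  integration by parts with k, and the nonnegativity of the integrals of l over (0,t), which is what
  Z \<ge> 0 means, is derived from a minimum principle for k. The convex inequality is first shown
  for smooth D and extended by density, because the monotonicity argument evaluates k * w' at single
  times.\<close>

lemma Ck_SucI:
  assumes "\<And>x. (f has_derivative D x) (at x)" and "\<And>e. e \<in> Basis \<Longrightarrow> Ck k (\<lambda>x. D x e)"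
  shows "Ck (Suc k) f"
proof -
  have "frechet_derivative f (at x) = D x" for x
    using assms(1) frechet_derivative_at by metis
  then show ?thesis
    using assms by (auto simp: differentiable_on_def differentiable_def intro: has_derivative_at_withinI)
qed

lemma Ck_Suc_has_derivative:
  "Ck (Suc k) f \<Longrightarrow> (f has_derivative frechet_derivative f (at x)) (at x)"
  by (simp add: differentiable_on_def frechet_derivative_works)

lemma Ck_SucD: "Ck (Suc k) f \<Longrightarrow> Ck k f"
  by (induction k arbitrary: f) (auto intro: differentiable_imp_continuous_on)

lemma Ck_const: "Ck k (\<lambda>_. c)"
  by (induction k arbitrary: c) (auto intro!: Ck_SucI[where D="\<lambda>_ _. 0"] simp del: Ck.simps(2))

lemma Ck_add: "Ck k f \<Longrightarrow> Ck k g \<Longrightarrow> Ck k (\<lambda>x. f x + g x)"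
proof (induction k arbitrary: f g)
  case (Suc k)
  show ?case
    by (rule Ck_SucI[OF has_derivative_add[OF Ck_Suc_has_derivative[OF Suc.prems(1)] Ck_Suc_has_derivative[OF Suc.prems(2)]]])
       (use Suc in auto)
qed (auto intro: continuous_intros)

lemma Ck_mult: "Ck k f \<Longrightarrow> Ck k g \<Longrightarrow> Ck k (\<lambda>x. f x * g x)"
proof (induction k arbitrary: f g)
  case (Suc k)
  note IH = Suc.IH
  have "Ck k f" "Ck k g" using Suc.prems Ck_SucD by blast+
  then show ?case
    by (intro Ck_SucI[OF has_derivative_mult[OF Ck_Suc_has_derivative[OF Suc.prems(1)] Ck_Suc_has_derivative[OF Suc.prems(2)]]]
          Ck_add Suc.IH) (use Suc.prems in auto)
qed (auto intro: continuous_intros)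

lemma Ck_tanh: "Ck k f \<Longrightarrow> Ck k (\<lambda>x. tanh (f x))"
proof (induction k arbitrary: f)
  case (Suc k)
  have f: "Ck k f" using Suc.prems Ck_SucD by blast
  have der: "((\<lambda>x. tanh (f x)) has_derivative (\<lambda>e. frechet_derivative f (at x) e * (1 - (tanh (f x))\<^sup>2))) (at x)" for x
    by (rule DERIV_compose_FDERIV[OF _ Ck_Suc_has_derivative[OF Suc.prems]])
       (auto intro!: derivative_eq_intros simp: cosh_real_nonzero)
  have "Ck k (\<lambda>x. 1 - (tanh (f x))\<^sup>2)"
    using Ck_add[OF Ck_const[of k 1] Ck_mult[OF Ck_const[of k "-1"] Ck_mult[OF Suc.IH[OF f] Suc.IH[OF f]]]]
    by (simp add: power2_eq_square)
  then show ?case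
    by (intro Ck_SucI[OF der] Ck_mult) (use Suc.prems in auto)
qed (auto intro: continuous_intros simp: cosh_real_nonzero)

lemma Ck_prod: "finite I \<Longrightarrow> (\<And>i. i \<in> I \<Longrightarrow> Ck k (f i)) \<Longrightarrow> Ck k (\<lambda>x. \<Prod>i\<in>I. f i x)"
  by (induction I rule: finite_induct) (auto intro: Ck_const Ck_mult)

lemma Ck_compose_inner:
  fixes v :: "'a::euclidean_space"
  shows "Ck k g \<Longrightarrow> Ck k (\<lambda>x. g (x \<bullet> v + a))"
proof (induction k arbitrary: g)
  case 0
  then show ?case by (auto intro!: continuous_intros continuous_on_compose2[of UNIV g])
next
  case (Suc k)
  have der: "((\<lambda>x. g (x \<bullet> v + a)) has_derivative (\<lambda>e. frechet_derivative g (at (x \<bullet> v + a)) (e \<bullet> v))) (at x)" for x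
  proof -
    have "((\<lambda>x. x \<bullet> v + a) has_derivative (\<lambda>e. e \<bullet> v)) (at x)"
      by (rule has_derivative_eq_rhs[OF has_derivative_add[OF has_derivative_inner_left[OF has_derivative_ident] has_derivative_const]]) simp
    then show ?thesis
      by (rule has_derivative_compose[OF _ Ck_Suc_has_derivative[OF Suc.prems]])
  qed
  \<comment> \<open>\<open>Ck\<close> on the real line speaks of the derivative in the direction 1,
    while the chain rule produces the direction e \<bullet> v.\<close>
  have lin: "frechet_derivative g (at y) r = frechet_derivative g (at y) 1 * r" for y r
    using linear_cmul[OF has_derivative_linear[OF Ck_Suc_has_derivative[OF Suc.prems, of y]], of r 1]
    by (simp add: mult.commute)
  show ?case
  proof (rule Ck_SucI[OF der])
    fix e :: 'a
    have "Ck k (\<lambda>x. frechet_derivative g (at (x \<bullet> v + a)) 1 * (e \<bullet> v))"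
      by (intro Ck_mult Ck_const Suc.IH) (use Suc.prems in auto)
    then show "Ck k (\<lambda>x. frechet_derivative g (at (x \<bullet> v + a)) (e \<bullet> v))"
      by (subst lin)
  qed
qed

text \<open>The family is closed under differentiation up to linear combinations (the derivative of
  index n involves the indices n + 1 and n + 2), so \<open>Ck_flat_fun\<close> is a single induction
  that treats all n together. Index 0 is the classical smooth function that is flat at 0.\<close>

definition flat_fun :: "nat \<Rightarrow> real \<Rightarrow> real" where
  "flat_fun n x = (if x > 0 then exp (- (1 / x)) / x ^ n else 0)"

text \<open>With y = 1/x the limit from the right becomes that of y^n / exp y at infinity.\<close>

lemma flat_fun_tendsto: "(flat_fun n \<longlongrightarrow> 0) (at 0)"
proof -
  have "((\<lambda>x::real. (inverse x) ^ n / exp (inverse x)) \<longlongrightarrow> 0) (at_right 0)"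
    using filterlim_compose[OF tendsto_power_div_exp_0 filterlim_inverse_at_top_right] .
  then have "(flat_fun n \<longlongrightarrow> 0) (at_right 0)"
    by (rule Lim_transform_eventually)
       (auto simp: flat_fun_def eventually_at_right_field exp_minus field_simps intro!: exI[of _ 1])
  moreover have "(flat_fun n \<longlongrightarrow> 0) (at_left 0)"
    by (rule Lim_transform_eventually[of "\<lambda>_. 0"])
       (auto simp: flat_fun_def eventually_at_left_field intro!: exI[of _ "-1"])
  ultimately show ?thesis
    by (simp add: filterlim_at_split)
qed

lemma flat_fun_has_derivative:
  "(flat_fun n has_real_derivative flat_fun (n + 2) x - n * flat_fun (n + 1) x) (at x)"
proof -
  consider "x > 0" | "x < 0" | "x = 0" by linarith
  then show ?thesis
  proof cases
    case 1
    have "((\<lambda>x. exp (- (1 / x)) / x ^ n) has_real_derivative flat_fun (n + 2) x - n * flat_fun (n + 1) x) (at x)"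
    proof (rule DERIV_cong)
      have d: "((\<lambda>x::real. - (1 / x)) has_real_derivative 1 / x\<^sup>2) (at x)"
        using 1 by (auto intro!: derivative_eq_intros simp: power2_eq_square)
      show "((\<lambda>x. exp (- (1 / x)) / x ^ n) has_real_derivative
          (exp (- (1 / x)) * (1 / x\<^sup>2) * x ^ n - exp (- (1 / x)) * (real n * (1 * x ^ (n - Suc 0)))) / (x ^ n * x ^ n)) (at x)"
        using 1 by (intro DERIV_divide DERIV_fun_exp d DERIV_power DERIV_ident) auto
      show "(exp (- (1 / x)) * (1 / x\<^sup>2) * x ^ n - exp (- (1 / x)) * (real n * (1 * x ^ (n - Suc 0)))) / (x ^ n * x ^ n)
        = flat_fun (n + 2) x - n * flat_fun (n + 1) x"
        using 1 by (cases n) (simp_all add: flat_fun_def field_simps power2_eq_square)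
    qed
    then show ?thesis
      by (rule DERIV_cong_ev[THEN iffD1, rotated 3])
         (use 1 in \<open>auto simp: flat_fun_def intro!: eventually_mono[OF eventually_nhds_in_open[of "{0<..}"]]\<close>)
  next
    case 2
    have "((\<lambda>x. 0) has_real_derivative flat_fun (n + 2) x - n * flat_fun (n + 1) x) (at x)"
      using 2 by (auto simp: flat_fun_def)
    then show ?thesis
      by (rule DERIV_cong_ev[THEN iffD1, rotated 3])
         (use 2 in \<open>auto simp: flat_fun_def intro!: eventually_mono[OF eventually_nhds_in_open[of "{..<0}"]]\<close>)
  next
    case 3
    \<comment> \<open>Dividing by h raises the index: the difference quotient at 0 is
      \<open>flat_fun (n + 1)\<close>.\<close>
    have "((\<lambda>h. (flat_fun n h - flat_fun n 0) / (h - 0)) \<longlongrightarrow> 0) (at 0)"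
      by (rule Lim_transform_eventually[OF flat_fun_tendsto[of "n + 1"]])
         (auto simp: flat_fun_def eventually_at_filter field_simps)
    then show ?thesis
      using 3 by (simp add: has_field_derivative_iff flat_fun_def)
  qed
qed

lemma Ck_flat_fun: "Ck k (flat_fun n)"
proof (induction k arbitrary: n)
  case 0
  show ?case
    by (auto intro!: continuous_at_imp_continuous_on DERIV_isCont flat_fun_has_derivative)
next
  case (Suc k)
  have "Ck k (\<lambda>x. flat_fun (n + 2) x + - real n * flat_fun (n + 1) x)"
    by (intro Ck_add Ck_mult Ck_const Suc.IH)
  then show ?case
    by (intro Ck_SucI[OF flat_fun_has_derivative[THEN has_field_derivative_imp_has_derivative]])
       auto
qed

text \<open>Each factor is positive exactly on one side of one face, so the product is positive
  exactly on the open box. Its size is irrelevant, because \<open>cutoff_box\<close> rescales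
  it.\<close>

definition box_bump :: "'a::euclidean_space \<Rightarrow> 'a \<Rightarrow> 'a \<Rightarrow> real" where
  "box_bump a b x = (\<Prod>e\<in>Basis. flat_fun 0 (x \<bullet> e - a \<bullet> e) * flat_fun 0 (b \<bullet> e - x \<bullet> e))"

lemma Ck_box_bump: "Ck k (box_bump a b)"
proof -
  have "Ck k (\<lambda>x. flat_fun 0 (x \<bullet> e + - (a \<bullet> e)) * flat_fun 0 (x \<bullet> - e + b \<bullet> e))" for e
    by (intro Ck_mult Ck_compose_inner Ck_flat_fun)
  then show ?thesis
    unfolding box_bump_def by (intro Ck_prod) auto
qed

lemma box_bump_pos_iff: "box_bump a b x > 0 \<longleftrightarrow> x \<in> box a b"
  and box_bump_nonneg: "box_bump a b x \<ge> 0"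
proof -
  have nn: "flat_fun 0 r \<ge> 0" for r by (auto simp: flat_fun_def)
  have z: "flat_fun 0 r = 0 \<longleftrightarrow> \<not> r > 0" for r by (auto simp: flat_fun_def)
  show *: "box_bump a b x \<ge> 0"
    unfolding box_bump_def by (intro prod_nonneg mult_nonneg_nonneg nn)
  have "box_bump a b x \<noteq> 0 \<longleftrightarrow> x \<in> box a b"
    by (auto simp: box_bump_def z mem_box)
  then show "box_bump a b x > 0 \<longleftrightarrow> x \<in> box a b" using * by linarith
qed

text \<open>Smooth functions with values in [0,1] that tend to the indicator of the open box; they
  make integrals over boxes limits of integrals against test functions.\<close>

definition cutoff_box :: "'a::euclidean_space \<Rightarrow> 'a \<Rightarrow> nat \<Rightarrow> 'a \<Rightarrow> real" where
  "cutoff_box a b n x = tanh (real n * box_bump a b x)"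

lemma cutoff_box_eq_0: "x \<notin> box a b \<Longrightarrow> cutoff_box a b n x = 0"
  using box_bump_pos_iff[of a b x] box_bump_nonneg[of a b x] by (auto simp: cutoff_box_def)

lemma cutoff_box_bounds: "0 \<le> cutoff_box a b n x" "cutoff_box a b n x \<le> 1"
  using box_bump_nonneg[of a b x] tanh_real_lt_1[of "n * box_bump a b x"]
  by (auto simp: cutoff_box_def tanh_real_nonneg_iff)

lemma cutoff_box_tendsto: "(\<lambda>n. cutoff_box a b n x) \<longlonglongrightarrow> indicator (box a b) x"
proof (cases "x \<in> box a b")
  case True
  then have "box_bump a b x > 0" using box_bump_pos_iff by blast
  then have "filterlim (\<lambda>n. box_bump a b x * real n) at_top sequentially"
    by (intro filterlim_tendsto_pos_mult_at_top[OF tendsto_const _ filterlim_real_sequentially])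
  then have "(\<lambda>n. tanh (box_bump a b x * real n)) \<longlonglongrightarrow> 1"
    by (rule filterlim_compose[OF tanh_real_at_top])
  then show ?thesis using True by (simp add: cutoff_box_def mult.commute)
qed (simp add: cutoff_box_eq_0)

section \<open>Closure properties of test functions\<close>

lemma test_funsI:
  assumes "\<And>k. Ck k \<psi>" "closed C" "bounded C" "C \<subseteq> \<Omega>" "\<And>x. x \<notin> C \<Longrightarrow> \<psi> x = 0"
  shows "\<psi> \<in> test_funs \<Omega>"
proof -
  have "{x. \<psi> x \<noteq> 0} \<subseteq> C" using assms(5) by auto
  then have "closure {x. \<psi> x \<noteq> 0} \<subseteq> C" using assms(2) closure_minimal by blast
  then show ?thesis
    using assms bounded_subset[OF assms(3), of "closure {x. \<psi> x \<noteq> 0}"]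
    unfolding test_funs_def smooth_fun_def compact_eq_bounded_closed by auto
qed

lemma test_funsE:
  assumes "\<psi> \<in> test_funs \<Omega>"
  obtains C where "compact C" "C \<subseteq> \<Omega>" "\<And>x. x \<notin> C \<Longrightarrow> \<psi> x = 0" "\<And>k. Ck k \<psi>"
  using assms closure_subset[of "{x. \<psi> x \<noteq> 0}"] unfolding test_funs_def smooth_fun_def by blast

lemma cutoff_box_test_fun: "cbox a b \<subseteq> \<Omega> \<Longrightarrow> cutoff_box a b n \<in> test_funs \<Omega>"
proof (rule test_funsI)
  show "Ck k (cutoff_box a b n)" for k
    unfolding cutoff_box_def by (intro Ck_tanh Ck_mult Ck_const Ck_box_bump)
qed (auto intro: cutoff_box_eq_0 simp: box_subset_cbox[THEN subsetD] intro!: bounded_cbox)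

lemma test_funs_continuous: "\<psi> \<in> test_funs \<Omega> \<Longrightarrow> continuous_on UNIV \<psi>"
  by (auto simp: test_funs_def smooth_fun_def dest: spec[of _ 0])

lemma test_funs_mono: "\<Omega> \<subseteq> \<Omega>' \<Longrightarrow> \<psi> \<in> test_funs \<Omega> \<Longrightarrow> \<psi> \<in> test_funs \<Omega>'"
  by (auto simp: test_funs_def)

lemma continuous_compact_support_bounded:
  fixes g :: "'a::euclidean_space \<Rightarrow> real"
  assumes "continuous_on UNIV g" "compact C" "\<And>x. x \<notin> C \<Longrightarrow> g x = 0"
  obtains B where "\<And>x. \<bar>g x\<bar> \<le> B" "B \<ge> 0"
proof -
  have "compact (g ` C)" using assms by (intro compact_continuous_image) (auto intro: continuous_on_subset)
  then obtain B where B: "\<And>y. y \<in> g ` C \<Longrightarrow> norm y \<le> B" "B > 0"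
    using compact_imp_bounded bounded_pos by metis
  show ?thesis
  proof (rule that[of B])
    show "\<bar>g x\<bar> \<le> B" for x using B assms(3)[of x] by (cases "x \<in> C") auto
  qed (use B in auto)
qed

lemma test_funs_bounded:
  assumes "\<psi> \<in> test_funs \<Omega>" obtains B where "\<And>x. \<bar>\<psi> x\<bar> \<le> B" "B \<ge> 0"
  using assms by (metis test_funsE continuous_compact_support_bounded test_funs_continuous)

lemma test_funs_diff_scale:
  assumes "\<psi> \<in> test_funs \<Omega>" "\<rho> \<in> test_funs \<Omega>"
  shows "(\<lambda>x. a * \<psi> x + c * \<rho> x) \<in> test_funs \<Omega>"
proof -
  obtain C C' where C: "compact C" "C \<subseteq> \<Omega>" "\<And>x. x \<notin> C \<Longrightarrow> \<psi> x = 0" "\<And>k. Ck k \<psi>"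
    and C': "compact C'" "C' \<subseteq> \<Omega>" "\<And>x. x \<notin> C' \<Longrightarrow> \<rho> x = 0" "\<And>k. Ck k \<rho>"
    using assms by (metis test_funsE)
  show ?thesis
  proof (rule test_funsI[of _ "C \<union> C'"])
    show "Ck k (\<lambda>x. a * \<psi> x + c * \<rho> x)" for k
      by (intro Ck_add Ck_mult Ck_const C C')
  qed (use C C' compact_Un[of C C'] in \<open>auto simp: compact_eq_bounded_closed\<close>)
qed

lemma test_funs_derivative_support:
  assumes "\<And>k. Ck k \<psi>" "compact C" "\<And>x. x \<notin> C \<Longrightarrow> \<psi> x = 0" "x \<notin> C"
  shows "frechet_derivative \<psi> (at x) e = 0"
proof -
  have "open (- C)" using assms compact_imp_closed by auto
  then have "(\<psi> has_derivative (\<lambda>_. 0)) (at x)"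
    using has_derivative_transform_within_open[of "\<lambda>_. 0" "\<lambda>_. 0" x UNIV "- C" \<psi>] assms by auto
  then show ?thesis using frechet_derivative_at by metis
qed

lemma test_funs_derivative:
  assumes "\<psi> \<in> test_funs \<Omega>" "e \<in> Basis"
  shows "(\<lambda>x. frechet_derivative \<psi> (at x) e) \<in> test_funs \<Omega>"
proof -
  obtain C where C: "compact C" "C \<subseteq> \<Omega>" "\<And>x. x \<notin> C \<Longrightarrow> \<psi> x = 0" "\<And>k. Ck k \<psi>"
    using assms by (metis test_funsE)
  show ?thesis
  proof (rule test_funsI[of _ C])
    show "Ck k (\<lambda>x. frechet_derivative \<psi> (at x) e)" for k
      using C(4)[of "Suc k"] assms by simp
  qed (use C in \<open>auto simp: compact_eq_bounded_closed intro: test_funs_derivative_support\<close>)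
qed

lemma test_funs_mult:
  assumes "\<psi> \<in> test_funs \<Omega>" "\<rho> \<in> test_funs \<Omega>"
  shows "(\<lambda>x. \<psi> x * \<rho> x) \<in> test_funs \<Omega>"
proof -
  obtain C C' where C: "compact C" "C \<subseteq> \<Omega>" "\<And>x. x \<notin> C \<Longrightarrow> \<psi> x = 0" "\<And>k. Ck k \<psi>"
    and C': "\<And>k. Ck k \<rho>"
    using assms by (metis test_funsE)
  show ?thesis
    by (rule test_funsI[of _ C])
       (use C C' in \<open>auto simp: compact_eq_bounded_closed intro: Ck_mult\<close>)
qed

lemma test_funs_tanh:
  assumes "\<psi> \<in> test_funs \<Omega>"
  shows "(\<lambda>x. tanh (c * \<psi> x)) \<in> test_funs \<Omega>"
proof -
  obtain C where C: "compact C" "C \<subseteq> \<Omega>" "\<And>x. x \<notin> C \<Longrightarrow> \<psi> x = 0" "\<And>k. Ck k \<psi>"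
    using assms by (metis test_funsE)
  show ?thesis
    by (rule test_funsI[of _ C])
       (use C in \<open>auto simp: compact_eq_bounded_closed intro!: Ck_tanh Ck_mult Ck_const\<close>)
qed

section \<open>The fundamental lemma of the calculus of variations\<close>

lemma L1_loc_integrable_box:
  assumes "L1_loc \<Omega> g" "cbox a b \<subseteq> \<Omega>"
  shows "integrable lebesgue (\<lambda>x. indicator (cbox a b) x *\<^sub>R g x)"
  using assms(1)[unfolded L1_loc_def, rule_format, of "cbox a b"] assms(2)
  by (simp add: integrable_restrict_space)

text \<open>By Lebesgue differentiation, off a null set g x is the limit of averages over small
  cubes with corner x, and these averages vanish by hypothesis. The argument runs inside one box,
  where g is integrable; countably many such boxes cover \<Omega>.\<close>

lemma fundamental_lemma_boxes:
  fixes g :: "'a::euclidean_space \<Rightarrow> real"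
  assumes "open \<Omega>" "L1_loc \<Omega> g"
    and zero: "\<And>a b. cbox a b \<subseteq> \<Omega> \<Longrightarrow> (\<integral>x. g x \<partial>lebesgue_on (cbox a b)) = 0"
  shows "AE x in lebesgue_on \<Omega>. g x = 0"
proof -
  have main: "AE x in lebesgue. x \<in> box a b \<longrightarrow> g x = 0" if ab: "cbox a b \<subseteq> \<Omega>" for a b
  proof -
    define f where "f = (\<lambda>x. indicator (cbox a b) x *\<^sub>R g x)"
    have fi: "integrable lebesgue f"
      unfolding f_def using L1_loc_integrable_box[OF assms(2) ab] .
    have "f integrable_on cbox c d" for c d
      using fi by (meson integrable_on_lebesgue integrable_on_subcbox subset_UNIV)
    then obtain N where N: "negligible N"
      "\<And>x e. \<lbrakk>x \<notin> N; 0 < e\<rbrakk> \<Longrightarrow> \<exists>d>0. \<forall>h. 0 < h \<and> h < d \<longrightarrow>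
          norm(integral (cbox x (x + h *\<^sub>R One)) f /\<^sub>R h ^ DIM('a) - f x) < e"
      using integrable_ccontinuous_explicit[of f] by blast
    have "g x = 0" if x: "x \<notin> N" "x \<in> box a b" for x
    proof (rule ccontr)
      assume "g x \<noteq> 0"
      moreover have fx: "f x = g x" using x box_subset_cbox[of a b] by (auto simp: f_def)
      ultimately obtain d where d: "d > 0" "\<And>h. 0 < h \<and> h < d \<Longrightarrow>
          norm(integral (cbox x (x + h *\<^sub>R One)) f /\<^sub>R h ^ DIM('a) - f x) < \<bar>g x\<bar>"
        using N(2)[OF x(1), of "\<bar>g x\<bar>"] by auto
      obtain r where r: "r > 0" "ball x r \<subseteq> box a b" using x(2) open_box openE by blast
      \<comment> \<open>The cube of side h at x has diagonal h * norm One, which has to stay below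
        r; h \<le> d/2 keeps h in the range where the average is close to f x.\<close>
      define h where "h = min (d/2) (r / (2 * (norm (One::'a) + 1)))"
      have np: "norm (One::'a) + 1 > 0" by (smt (verit) norm_ge_zero)
      have h: "0 < h" "h < d" using d r np by (auto simp: h_def)
      have "h * norm (One::'a) < r"
      proof -
        have "h * norm (One::'a) \<le> h * (norm (One::'a) + 1)" using h by simp
        also have "\<dots> \<le> r / (2 * (norm (One::'a) + 1)) * (norm (One::'a) + 1)"
          using np by (intro mult_right_mono) (auto simp: h_def)
        also have "\<dots> = r / 2"
        proof -
          have "r / (2 * n) * n = r / 2" if "n > 0" for n :: real using that by simp
          then show ?thesis using np .
        qed
        also have "\<dots> < r" using r by simp
        finally show ?thesis .
      qed
      then have "x + h *\<^sub>R One \<in> ball x r" using h by (simp add: dist_norm)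
      then have sub: "cbox x (x + h *\<^sub>R One) \<subseteq> cbox a b"
        using r x(2) unfolding subset_box by (auto simp: mem_box less_imp_le subset_iff)
      have "integral (cbox x (x + h *\<^sub>R One)) f = (\<integral>y. f y \<partial>lebesgue_on (cbox x (x + h *\<^sub>R One)))"
        using integrable_mult_indicator[OF _ fi, of "cbox x (x + h *\<^sub>R One)"]
        by (intro lebesgue_integral_eq_integral[symmetric]) (auto simp: integrable_restrict_space)
      also have "\<dots> = (\<integral>y. g y \<partial>lebesgue_on (cbox x (x + h *\<^sub>R One)))"
        using sub by (intro Bochner_Integration.integral_cong) (auto simp: f_def indicator_def)
      also have "\<dots> = 0" using zero sub ab by auto
      finally show False using d(2)[of h] h fx by auto
    qed
    then show ?thesis
      using N(1) by (auto simp: negligible_iff_null_sets intro!: AE_I'[of N])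
  qed
  define F where "F = {box a b | a b. cbox a b \<subseteq> \<Omega>}"
  obtain D where D: "D \<subseteq> F" "countable D" "\<Union>D = \<Union>F"
    using Lindelof[of F] unfolding F_def by (auto simp: open_box)
  have cover: "\<Union>F = \<Omega>"
  proof
    show "\<Union>F \<subseteq> \<Omega>" unfolding F_def using box_subset_cbox by blast
    show "\<Omega> \<subseteq> \<Union>F"
    proof
      fix x assume "x \<in> \<Omega>"
      then obtain a b where "cbox a b \<subseteq> \<Omega>" "x \<in> box a b"
        using open_contains_cbox[OF assms(1)] by metis
      then show "x \<in> \<Union>F" unfolding F_def by blast
    qed
  qed
  have "AE x in lebesgue. x \<in> X \<longrightarrow> g x = 0" if "X \<in> D" for X
    using that D(1) main unfolding F_def by blast
  then have "AE x in lebesgue. \<forall>X\<in>D. x \<in> X \<longrightarrow> g x = 0"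
    by (subst AE_ball_countable[OF D(2)]) blast
  then have "AE x in lebesgue. x \<in> \<Omega> \<longrightarrow> g x = 0"
    using D(3) cover by (auto elim!: eventually_mono)
  then show ?thesis
    using assms(1) by (subst AE_restrict_space_iff) auto
qed

lemma L1_loc_times_test_integrable:
  assumes "open \<Omega>" "L1_loc \<Omega> g" "\<psi> \<in> test_funs \<Omega>"
  shows "integrable (lebesgue_on \<Omega>) (\<lambda>x. \<psi> x *\<^sub>R g x)"
proof -
  obtain C where C: "compact C" "C \<subseteq> \<Omega>" "\<And>x. x \<notin> C \<Longrightarrow> \<psi> x = 0"
    using assms(3) test_funsE by metis
  obtain B where B: "\<And>x. \<bar>\<psi> x\<bar> \<le> B" using test_funs_bounded[OF assms(3)] by blast
  have gi: "integrable (lebesgue_on C) g" using assms(2) C unfolding L1_loc_def by auto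
  have "integrable (lebesgue_on C) (\<lambda>x. \<psi> x *\<^sub>R g x)"
  proof (rule Bochner_Integration.integrable_bound)
    show "integrable (lebesgue_on C) (\<lambda>x. B *\<^sub>R g x)" using gi by simp
    have "\<psi> \<in> borel_measurable (lebesgue_on C)"
      using test_funs_continuous[OF assms(3)] by (intro continuous_imp_measurable_on_sets_lebesgue)
        (use C lmeasurable_compact fmeasurableD in \<open>auto intro: continuous_on_subset\<close>)
    then show "(\<lambda>x. \<psi> x *\<^sub>R g x) \<in> borel_measurable (lebesgue_on C)" using gi by measurable
    show "AE x in lebesgue_on C. norm (\<psi> x *\<^sub>R g x) \<le> norm (B *\<^sub>R g x)"
      by (intro AE_I2) (auto intro!: mult_right_mono order_trans[OF B abs_ge_self])
  qed
  then have "integrable lebesgue (\<lambda>x. indicator C x *\<^sub>R (\<psi> x *\<^sub>R g x))"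
    using C(1) lmeasurable_compact fmeasurableD by (subst (asm) integrable_restrict_space) auto
  moreover have "(\<lambda>x. indicator C x *\<^sub>R (\<psi> x *\<^sub>R g x)) = (\<lambda>x. indicator \<Omega> x *\<^sub>R (\<psi> x *\<^sub>R g x))"
    using C by (auto simp: indicator_def fun_eq_iff)
  ultimately have "integrable lebesgue (\<lambda>x. indicator \<Omega> x *\<^sub>R (\<psi> x *\<^sub>R g x))" by metis
  then show ?thesis
    using assms(1) by (subst integrable_restrict_space) auto
qed

text \<open>The test functions \<open>cutoff_box a b n\<close> tend to the indicator of the open box
  and the faces have measure zero, so the integral over every closed box in \<Omega>
  vanishes.\<close>

lemma fundamental_lemma:
  fixes g :: "'a::euclidean_space \<Rightarrow> real"
  assumes "open \<Omega>" "L1_loc \<Omega> g"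
    and zero: "\<And>\<psi>. \<psi> \<in> test_funs \<Omega> \<Longrightarrow> (\<integral>x. \<psi> x * g x \<partial>lebesgue_on \<Omega>) = 0"
  shows "AE x in lebesgue_on \<Omega>. g x = 0"
proof (rule fundamental_lemma_boxes[OF assms(1,2)])
  fix a b :: 'a assume ab: "cbox a b \<subseteq> \<Omega>"
  have gi: "integrable (lebesgue_on (cbox a b)) g"
    using assms(2) ab unfolding L1_loc_def by auto
  have test: "cutoff_box a b n \<in> test_funs \<Omega>" for n using cutoff_box_test_fun[OF ab] .
  have ind: "indicat_real (box a b) \<in> borel_measurable (lebesgue_on (cbox a b))"
    by (rule measurable_restrict_space1, rule borel_measurable_indicator) simp
  have meas: "cutoff_box a b n \<in> borel_measurable (lebesgue_on (cbox a b))" for n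
    using test_funs_continuous[OF test] by (intro continuous_imp_measurable_on_sets_lebesgue)
      (auto intro: continuous_on_subset)
  have "(\<integral>x. cutoff_box a b n x * g x \<partial>lebesgue_on (cbox a b)) = 0" for n
  proof -
    have "(\<integral>x. cutoff_box a b n x * g x \<partial>lebesgue_on (cbox a b))
        = (\<integral>x. indicator (cbox a b) x *\<^sub>R (cutoff_box a b n x * g x) \<partial>lebesgue)"
      by (subst integral_restrict_space) auto
    also have "\<dots> = (\<integral>x. indicator \<Omega> x *\<^sub>R (cutoff_box a b n x * g x) \<partial>lebesgue)"
    proof (rule Bochner_Integration.integral_cong)
      fix x
      show "indicator (cbox a b) x *\<^sub>R (cutoff_box a b n x * g x) = indicator \<Omega> x *\<^sub>R (cutoff_box a b n x * g x)"
        using ab cutoff_box_eq_0[of x a b n] box_subset_cbox[of a b] by (auto simp: indicator_def)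
    qed simp
    also have "\<dots> = (\<integral>x. cutoff_box a b n x * g x \<partial>lebesgue_on \<Omega>)"
      using assms(1) by (subst integral_restrict_space) auto
    finally show ?thesis using zero[OF test] by simp
  qed
  moreover have "(\<lambda>n. \<integral>x. cutoff_box a b n x * g x \<partial>lebesgue_on (cbox a b))
      \<longlonglongrightarrow> (\<integral>x. indicator (box a b) x * g x \<partial>lebesgue_on (cbox a b))"
  proof (rule integral_dominated_convergence[where w = "\<lambda>x. norm (g x)"])
    show "AE x in lebesgue_on (cbox a b). norm (cutoff_box a b n x * g x) \<le> norm (g x)" for n
      using cutoff_box_bounds[of a b n] by (auto simp: abs_mult intro!: mult_left_le_one_le)
    show "(\<lambda>x. indicat_real (box a b) x * g x) \<in> borel_measurable (lebesgue_on (cbox a b))"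
      using gi ind by (intro borel_measurable_times) auto
  qed (use gi meas in \<open>auto intro!: tendsto_intros cutoff_box_tendsto\<close>)
  ultimately have "(\<integral>x. indicator (box a b) x * g x \<partial>lebesgue_on (cbox a b)) = 0"
    by (simp add: LIMSEQ_const_iff)
  moreover have "(\<integral>x. indicator (box a b) x * g x \<partial>lebesgue_on (cbox a b)) = (\<integral>x. g x \<partial>lebesgue_on (cbox a b))"
  proof (rule integral_cong_AE)
    have "AE x in lebesgue. x \<notin> cbox a b - box a b"
      using negligible_frontier_interval[of a b] by (auto simp only: negligible_iff_null_sets intro: AE_not_in)
    then show "AE x in lebesgue_on (cbox a b). indicator (box a b) x * g x = g x"
      by (subst AE_restrict_space_iff) (auto elim!: eventually_mono simp: indicator_def)
    show "(\<lambda>x. indicat_real (box a b) x * g x) \<in> borel_measurable (lebesgue_on (cbox a b))"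
      using gi ind by (intro borel_measurable_times) auto
  qed (use gi in auto)
  ultimately show "(\<integral>x. g x \<partial>lebesgue_on (cbox a b)) = 0" by simp
qed

section \<open>Square integrable functions\<close>

text \<open>\<open>Lp_space 2\<close> contains real functions only; this predicate also serves for
  gradients and fluxes.\<close>

definition L2fun :: "'a::euclidean_space set \<Rightarrow> ('a \<Rightarrow> 'b::euclidean_space) \<Rightarrow> bool" where
  "L2fun \<Omega> f \<longleftrightarrow> f \<in> borel_measurable (lebesgue_on \<Omega>) \<and> integrable (lebesgue_on \<Omega>) (\<lambda>x. (norm (f x))\<^sup>2)"

lemma L2funD:
  assumes "L2fun \<Omega> f"
  shows "f \<in> borel_measurable (lebesgue_on \<Omega>)" "integrable (lebesgue_on \<Omega>) (\<lambda>x. (norm (f x))\<^sup>2)"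
  using assms by (auto simp: L2fun_def)

lemma L2fun_bound:
  assumes "L2fun \<Omega> f" "g \<in> borel_measurable (lebesgue_on \<Omega>)" "AE x in lebesgue_on \<Omega>. norm (g x) \<le> C * norm (f x)"
  shows "L2fun \<Omega> g"
  unfolding L2fun_def
proof
  show "integrable (lebesgue_on \<Omega>) (\<lambda>x. (norm (g x))\<^sup>2)"
  proof (rule Bochner_Integration.integrable_bound)
    show "integrable (lebesgue_on \<Omega>) (\<lambda>x. C\<^sup>2 * (norm (f x))\<^sup>2)" using L2funD[OF assms(1)] by simp
    show "(\<lambda>x. (norm (g x))\<^sup>2) \<in> borel_measurable (lebesgue_on \<Omega>)" using assms(2) by measurable
    show "AE x in lebesgue_on \<Omega>. norm ((norm (g x))\<^sup>2) \<le> norm (C\<^sup>2 * (norm (f x))\<^sup>2)"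
      using assms(3)
    proof eventually_elim
      case (elim x)
      then have "(norm (g x))\<^sup>2 \<le> (C * norm (f x))\<^sup>2" by (intro power_mono) auto
      then show ?case by (simp add: power_mult_distrib)
    qed
  qed
qed fact

lemma norm_add_square_le: "(norm (a + b :: 'a::real_normed_vector))\<^sup>2 \<le> 2 * (norm a)\<^sup>2 + 2 * (norm b)\<^sup>2"
proof -
  have "(norm (a + b))\<^sup>2 \<le> (norm a + norm b)\<^sup>2" by (intro power_mono norm_triangle_ineq) auto
  also have "\<dots> \<le> 2 * (norm a)\<^sup>2 + 2 * (norm b)\<^sup>2"
    using sum_squares_bound[of "norm a" "norm b"] by (simp add: power2_sum)
  finally show ?thesis .
qed

lemma L2fun_add: assumes "L2fun \<Omega> f" "L2fun \<Omega> g" shows "L2fun \<Omega> (\<lambda>x. f x + g x)"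
  unfolding L2fun_def
proof
  note [measurable] = L2funD(1)[OF assms(1)] L2funD(1)[OF assms(2)]
  show "(\<lambda>x. f x + g x) \<in> borel_measurable (lebesgue_on \<Omega>)" by measurable
  show "integrable (lebesgue_on \<Omega>) (\<lambda>x. (norm (f x + g x))\<^sup>2)"
  proof (rule Bochner_Integration.integrable_bound)
    show "integrable (lebesgue_on \<Omega>) (\<lambda>x. 2 * (norm (f x))\<^sup>2 + 2 * (norm (g x))\<^sup>2)"
      using L2funD[OF assms(1)] L2funD[OF assms(2)] by simp
  qed (use norm_add_square_le in auto)
qed

lemma L2fun_scaleR: "L2fun \<Omega> f \<Longrightarrow> L2fun \<Omega> (\<lambda>x. c *\<^sub>R f x)"
  by (rule L2fun_bound[of _ f _ "\<bar>c\<bar>"]) (auto dest: L2funD(1))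

lemma L2fun_minus: "L2fun \<Omega> f \<Longrightarrow> L2fun \<Omega> (\<lambda>x. - f x)"
  using L2fun_scaleR[of \<Omega> f "-1"] by simp

lemma L2fun_diff: "L2fun \<Omega> f \<Longrightarrow> L2fun \<Omega> g \<Longrightarrow> L2fun \<Omega> (\<lambda>x. f x - g x)"
  using L2fun_add[OF _ L2fun_minus, of \<Omega> f g] by simp

lemma L2fun_cong_AE:
  assumes "AE x in lebesgue_on \<Omega>. f x = g x" "f \<in> borel_measurable (lebesgue_on \<Omega>)" "L2fun \<Omega> g"
  shows "L2fun \<Omega> f"
  by (rule L2fun_bound[OF assms(3,2), of 1]) (use assms(1) in auto)

lemma mult_le_sum_squares: "(a::real) \<ge> 0 \<Longrightarrow> b \<ge> 0 \<Longrightarrow> a * b \<le> a\<^sup>2 + b\<^sup>2"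
  using sum_squares_bound[of a b] mult_nonneg_nonneg[of a b] by linarith

lemma norm_inner_le_squares: "\<bar>a \<bullet> b\<bar> \<le> (norm a)\<^sup>2 + (norm b)\<^sup>2"
  using Cauchy_Schwarz_ineq2[of a b] mult_le_sum_squares[of "norm a" "norm b"] by simp

lemma L2fun_inner_integrable:
  assumes "L2fun \<Omega> f" "L2fun \<Omega> g" shows "integrable (lebesgue_on \<Omega>) (\<lambda>x. f x \<bullet> g x)"
proof (rule Bochner_Integration.integrable_bound)
  show "integrable (lebesgue_on \<Omega>) (\<lambda>x. (norm (f x))\<^sup>2 + (norm (g x))\<^sup>2)"
    using L2funD[OF assms(1)] L2funD[OF assms(2)] by simp
  show "AE x in lebesgue_on \<Omega>. norm (f x \<bullet> g x) \<le> norm ((norm (f x))\<^sup>2 + (norm (g x))\<^sup>2)"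
    using norm_inner_le_squares by auto
qed (use L2funD(1)[OF assms(1)] L2funD(1)[OF assms(2)] in measurable)

text \<open>The difference is estimated by Young's inequality under the integral, with a weight
  depending on n that plays the part of the optimal one in Cauchy-Schwarz.\<close>

lemma L2fun_inner_tendsto:
  assumes f: "\<And>n. L2fun \<Omega> (f n)" "L2fun \<Omega> F" "L2fun \<Omega> g"
    and lim: "(\<lambda>n. \<integral>x. (norm (f n x - F x))\<^sup>2 \<partial>lebesgue_on \<Omega>) \<longlonglongrightarrow> 0"
  shows "(\<lambda>n. \<integral>x. f n x \<bullet> g x \<partial>lebesgue_on \<Omega>) \<longlonglongrightarrow> (\<integral>x. F x \<bullet> g x \<partial>lebesgue_on \<Omega>)"
proof -
  define a where "a n = (\<integral>x. (norm (f n x - F x))\<^sup>2 \<partial>lebesgue_on \<Omega>)" for n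
  define B where "B = (\<integral>x. (norm (g x))\<^sup>2 \<partial>lebesgue_on \<Omega>)"
  \<comment> \<open>Since s n dominates sqrt (a n) and tends to 0, both a n / s n and s n * B tend
    to 0. The summand 1/(n+1) keeps s n positive when a n = 0.\<close>
  define s where "s n = sqrt (a n) + 1 / real (Suc n)" for n
  have a0: "a n \<ge> 0" for n unfolding a_def by (intro integral_nonneg_AE) auto
  have s0: "s n > 0" "sqrt (a n) \<le> s n" for n using a0[of n] by (auto simp: s_def add_nonneg_pos)
  have d: "L2fun \<Omega> (\<lambda>x. f n x - F x)" for n using f by (intro L2fun_diff)
  have bound: "\<bar>(\<integral>x. f n x \<bullet> g x \<partial>lebesgue_on \<Omega>) - (\<integral>x. F x \<bullet> g x \<partial>lebesgue_on \<Omega>)\<bar> \<le> sqrt (a n) + s n * B" for n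
  proof -
    have "\<bar>(\<integral>x. f n x \<bullet> g x \<partial>lebesgue_on \<Omega>) - (\<integral>x. F x \<bullet> g x \<partial>lebesgue_on \<Omega>)\<bar>
        = \<bar>\<integral>x. (f n x - F x) \<bullet> g x \<partial>lebesgue_on \<Omega>\<bar>"
      using f by (subst Bochner_Integration.integral_diff[symmetric]) (auto intro!: L2fun_inner_integrable simp: inner_diff_left)
    also have "\<dots> \<le> (\<integral>x. \<bar>(f n x - F x) \<bullet> g x\<bar> \<partial>lebesgue_on \<Omega>)" by (rule integral_abs_bound)
    also have "\<dots> \<le> (\<integral>x. (norm (f n x - F x))\<^sup>2 / s n + s n * (norm (g x))\<^sup>2 \<partial>lebesgue_on \<Omega>)"
    proof (rule integral_mono)
      fix x
      have r: "0 < sqrt (s n)" "(sqrt (s n))\<^sup>2 = s n" using s0[of n] by auto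
      have "(f n x - F x) \<bullet> g x = ((1 / sqrt (s n)) *\<^sub>R (f n x - F x)) \<bullet> (sqrt (s n) *\<^sub>R g x)"
        using r by simp
      then have "\<bar>(f n x - F x) \<bullet> g x\<bar> \<le> (norm ((1 / sqrt (s n)) *\<^sub>R (f n x - F x)))\<^sup>2 + (norm (sqrt (s n) *\<^sub>R g x))\<^sup>2"
        using norm_inner_le_squares by metis
      also have "\<dots> = (norm (f n x - F x))\<^sup>2 / s n + s n * (norm (g x))\<^sup>2"
        using r s0[of n] by (simp add: power_mult_distrib power_divide)
      finally show "\<bar>(f n x - F x) \<bullet> g x\<bar> \<le> (norm (f n x - F x))\<^sup>2 / s n + s n * (norm (g x))\<^sup>2" .
    qed (use L2funD(2)[OF d[of n]] L2funD(2)[OF f(3)] L2fun_inner_integrable[OF d[of n] f(3)] in auto)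
    also have "\<dots> = a n / s n + s n * B"
      using L2funD(2)[OF d[of n]] L2funD(2)[OF f(3)] by (simp add: a_def B_def)
    also have "a n / s n \<le> sqrt (a n)"
      using s0[of n] a0[of n] by (simp add: divide_le_eq) (metis mult_left_mono real_sqrt_ge_zero real_sqrt_mult_self abs_of_nonneg)
    finally show ?thesis by simp
  qed
  have sa: "(\<lambda>n. sqrt (a n)) \<longlonglongrightarrow> 0" using tendsto_real_sqrt[OF lim] by (simp add: a_def)
  have "(\<lambda>n. sqrt (a n) + s n * B) \<longlonglongrightarrow> 0 + (0 + 0) * B"
    unfolding s_def by (intro tendsto_intros sa LIMSEQ_Suc[OF lim_1_over_n])
  then have "(\<lambda>n. sqrt (a n) + s n * B) \<longlonglongrightarrow> 0" by simp
  then have "(\<lambda>n. (\<integral>x. f n x \<bullet> g x \<partial>lebesgue_on \<Omega>) - (\<integral>x. F x \<bullet> g x \<partial>lebesgue_on \<Omega>)) \<longlonglongrightarrow> 0"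
    by (rule Lim_null_comparison[rotated]) (use bound in auto)
  then show ?thesis using LIM_zero_iff by blast
qed

lemma nonneg_squeeze_tendsto_0:
  fixes f g :: "nat \<Rightarrow> real"
  assumes "g \<longlonglongrightarrow> 0" "\<And>n. 0 \<le> f n" "\<And>n. f n \<le> g n"
  shows "f \<longlonglongrightarrow> 0"
  by (rule tendsto_sandwich[OF _ _ tendsto_const assms(1)]) (use assms in auto)

lemma L2_tendsto_add:
  assumes "\<And>n. L2fun \<Omega> (f n)" "\<And>n. L2fun \<Omega> (g n)"
    and "(\<lambda>n. \<integral>x. (norm (f n x))\<^sup>2 \<partial>lebesgue_on \<Omega>) \<longlonglongrightarrow> 0"
    and "(\<lambda>n. \<integral>x. (norm (g n x))\<^sup>2 \<partial>lebesgue_on \<Omega>) \<longlonglongrightarrow> 0"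
  shows "(\<lambda>n. \<integral>x. (norm (f n x + g n x))\<^sup>2 \<partial>lebesgue_on \<Omega>) \<longlonglongrightarrow> 0"
proof (rule nonneg_squeeze_tendsto_0)
  show "(\<lambda>n. 2 * (\<integral>x. (norm (f n x))\<^sup>2 \<partial>lebesgue_on \<Omega>) + 2 * (\<integral>x. (norm (g n x))\<^sup>2 \<partial>lebesgue_on \<Omega>)) \<longlonglongrightarrow> 0"
    using tendsto_add[OF tendsto_mult_left[OF assms(3), of 2] tendsto_mult_left[OF assms(4), of 2]] by simp
  have "(\<integral>x. (norm (f n x + g n x))\<^sup>2 \<partial>lebesgue_on \<Omega>) \<le> (\<integral>x. 2 * (norm (f n x))\<^sup>2 + 2 * (norm (g n x))\<^sup>2 \<partial>lebesgue_on \<Omega>)" for n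
    using L2funD[OF L2fun_add[OF assms(1,2), of n n]] L2funD[OF assms(1)[of n]] L2funD[OF assms(2)[of n]]
    by (intro integral_mono norm_add_square_le) auto
  also have "(\<integral>x. 2 * (norm (f n x))\<^sup>2 + 2 * (norm (g n x))\<^sup>2 \<partial>lebesgue_on \<Omega>)
     = 2 * (\<integral>x. (norm (f n x))\<^sup>2 \<partial>lebesgue_on \<Omega>) + 2 * (\<integral>x. (norm (g n x))\<^sup>2 \<partial>lebesgue_on \<Omega>)" for n
    using L2funD[OF assms(1)[of n]] L2funD[OF assms(2)[of n]] by simp
  finally show "(\<integral>x. (norm (f n x + g n x))\<^sup>2 \<partial>lebesgue_on \<Omega>)
     \<le> 2 * (\<integral>x. (norm (f n x))\<^sup>2 \<partial>lebesgue_on \<Omega>) + 2 * (\<integral>x. (norm (g n x))\<^sup>2 \<partial>lebesgue_on \<Omega>)" for n .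
qed auto

lemma L2_tendsto_bound:
  fixes f :: "nat \<Rightarrow> 'a::euclidean_space \<Rightarrow> 'b::euclidean_space" and g :: "nat \<Rightarrow> 'a \<Rightarrow> 'c::euclidean_space"
  assumes "\<And>n. L2fun \<Omega> (f n)" "\<And>n. g n \<in> borel_measurable (lebesgue_on \<Omega>)"
    and "\<And>n x. norm (g n x) \<le> C * norm (f n x)"
    and lim: "(\<lambda>n. \<integral>x. (norm (f n x))\<^sup>2 \<partial>lebesgue_on \<Omega>) \<longlonglongrightarrow> 0"
  shows "(\<lambda>n. \<integral>x. (norm (g n x))\<^sup>2 \<partial>lebesgue_on \<Omega>) \<longlonglongrightarrow> 0"
proof (rule nonneg_squeeze_tendsto_0)
  show "(\<lambda>n. C\<^sup>2 * (\<integral>x. (norm (f n x))\<^sup>2 \<partial>lebesgue_on \<Omega>)) \<longlonglongrightarrow> 0"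
    using tendsto_mult_left[OF lim, of "C\<^sup>2"] by simp
  show "(\<integral>x. (norm (g n x))\<^sup>2 \<partial>lebesgue_on \<Omega>) \<le> C\<^sup>2 * (\<integral>x. (norm (f n x))\<^sup>2 \<partial>lebesgue_on \<Omega>)" for n
  proof -
    have "(\<integral>x. (norm (g n x))\<^sup>2 \<partial>lebesgue_on \<Omega>) \<le> (\<integral>x. C\<^sup>2 * (norm (f n x))\<^sup>2 \<partial>lebesgue_on \<Omega>)"
  proof (rule integral_mono)
    show "integrable (lebesgue_on \<Omega>) (\<lambda>x. (norm (g n x))\<^sup>2)"
      by (rule L2funD(2)[OF L2fun_bound[OF assms(1)[of n] assms(2)[of n], of C]]) (use assms(3) in auto)
    show "integrable (lebesgue_on \<Omega>) (\<lambda>x. C\<^sup>2 * (norm (f n x))\<^sup>2)" using L2funD(2)[OF assms(1)] by simp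
    show "(norm (g n x))\<^sup>2 \<le> C\<^sup>2 * (norm (f n x))\<^sup>2" for x
      using power_mono[OF assms(3)[of n x], of 2] by (simp add: power_mult_distrib)
  qed
  then show ?thesis by simp
  qed
qed auto

lemma L2_tendsto_AE_subseq:
  fixes f :: "nat \<Rightarrow> 'a::euclidean_space \<Rightarrow> 'b::euclidean_space"
  assumes "\<And>n. L2fun \<Omega> (f n)" "(\<lambda>n. \<integral>x. (norm (f n x))\<^sup>2 \<partial>lebesgue_on \<Omega>) \<longlonglongrightarrow> 0"
  obtains r :: "nat \<Rightarrow> nat" where "strict_mono r" "AE x in lebesgue_on \<Omega>. (\<lambda>n. f (r n) x) \<longlonglongrightarrow> 0"
proof -
  obtain r :: "nat \<Rightarrow> nat" where r: "strict_mono r" "AE x in lebesgue_on \<Omega>. (\<lambda>n. (norm (f (r n) x))\<^sup>2) \<longlonglongrightarrow> 0"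
    using tendsto_L1_AE_subseq[of "lebesgue_on \<Omega>" "\<lambda>n x. (norm (f n x))\<^sup>2"] L2funD(2)[OF assms(1)] assms(2) by auto
  have "AE x in lebesgue_on \<Omega>. (\<lambda>n. f (r n) x) \<longlonglongrightarrow> 0"
    using r(2)
  proof (rule eventually_mono)
    fix x assume "(\<lambda>n. (norm (f (r n) x))\<^sup>2) \<longlonglongrightarrow> 0"
    then have "(\<lambda>n. sqrt ((norm (f (r n) x))\<^sup>2)) \<longlonglongrightarrow> sqrt 0" by (rule tendsto_real_sqrt)
    then show "(\<lambda>n. f (r n) x) \<longlonglongrightarrow> 0" by (simp add: tendsto_norm_zero_iff)
  qed
  then show thesis using r(1) that by blast
qed

section \<open>Weak gradients\<close>

lemma integrable_L1_loc:
  fixes f :: "'a::euclidean_space \<Rightarrow> 'b::euclidean_space"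
  assumes S: "S \<in> sets lebesgue" and f: "integrable (lebesgue_on S) f"
  shows "L1_loc S f"
  unfolding L1_loc_def
proof (intro allI impI)
  fix K :: "'a set" assume K: "compact K \<and> K \<subseteq> S"
  then have KS: "K \<in> sets lebesgue" using lmeasurable_compact fmeasurableD by blast
  have "integrable lebesgue (\<lambda>t. indicator S t *\<^sub>R f t)" using f S by (simp add: integrable_restrict_space)
  from integrable_mult_indicator[OF KS this]
  have "integrable lebesgue (\<lambda>t. indicator K t *\<^sub>R (indicator S t *\<^sub>R f t))" .
  moreover have "(\<lambda>t. indicator K t *\<^sub>R (indicator S t *\<^sub>R f t)) = (\<lambda>t. indicator K t *\<^sub>R f t)"
    using K by (auto simp: indicator_def fun_eq_iff)
  ultimately show "integrable (lebesgue_on K) f" using KS by (subst integrable_restrict_space) auto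
qed

lemma L1_loc_lincomb:
  "L1_loc \<Omega> f \<Longrightarrow> L1_loc \<Omega> g \<Longrightarrow> L1_loc \<Omega> (\<lambda>x. a *\<^sub>R f x + c *\<^sub>R g x)"
  unfolding L1_loc_def by auto

lemma L1_loc_inner: "L1_loc \<Omega> f \<Longrightarrow> L1_loc \<Omega> (\<lambda>x. f x \<bullet> e)"
  unfolding L1_loc_def by auto

text \<open>Local integrability yields measurability on compact boxes; by Lindelof, countably many
  of their interiors cover \<Omega>.\<close>

lemma L1_loc_measurable:
  assumes "open \<Omega>" "L1_loc \<Omega> f" shows "f \<in> borel_measurable (lebesgue_on \<Omega>)"
proof -
  define F where "F = {box a b | a b. cbox a b \<subseteq> \<Omega>}"
  obtain D where D: "D \<subseteq> F" "countable D" "\<Union>D = \<Union>F"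
    using Lindelof[of F] unfolding F_def by (auto simp: open_box)
  have cover: "\<Union>F = \<Omega>"
  proof
    show "\<Union>F \<subseteq> \<Omega>" unfolding F_def using box_subset_cbox by blast
    show "\<Omega> \<subseteq> \<Union>F"
    proof
      fix x assume "x \<in> \<Omega>"
      then obtain a b where "cbox a b \<subseteq> \<Omega>" "x \<in> box a b"
        using open_contains_cbox[OF assms(1)] by metis
      then show "x \<in> \<Union>F" unfolding F_def by blast
    qed
  qed
  show ?thesis
  proof (rule measurable_piecewise_restrict[of D])
    fix X assume "X \<in> D"
    then obtain a b where X: "X = box a b" "cbox a b \<subseteq> \<Omega>" using D(1) unfolding F_def by auto
    then have "X \<subseteq> \<Omega>" using box_subset_cbox[of a b] by auto
    then show "X \<inter> space (lebesgue_on \<Omega>) \<in> sets (lebesgue_on \<Omega>)"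
      using X assms(1) by (auto simp: sets_restrict_space intro!: image_eqI[of _ _ X])
    have "f \<in> borel_measurable (lebesgue_on (cbox a b))"
      using assms(2)[unfolded L1_loc_def, rule_format, of "cbox a b"] X by auto
    then have "f \<in> borel_measurable (lebesgue_on X)"
      using X box_subset_cbox[of a b] measurable_restrict_mono by blast
    moreover have "restrict_space (lebesgue_on \<Omega>) X = lebesgue_on X"
      using \<open>X \<subseteq> \<Omega>\<close> X assms(1) by (simp add: restrict_restrict_space Int_absorb1)
    ultimately show "f \<in> borel_measurable (restrict_space (lebesgue_on \<Omega>) X)" by simp
  qed (use D cover in auto)
qed

lemma weak_gradient_eqD:
  assumes "has_weak_gradient \<Omega> u g" "\<psi> \<in> test_funs \<Omega>" "e \<in> Basis"
  shows "(\<integral>x. u x * frechet_derivative \<psi> (at x) e \<partial>lebesgue_on \<Omega>) = - (\<integral>x. (g x \<bullet> e) * \<psi> x \<partial>lebesgue_on \<Omega>)"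
  using assms unfolding has_weak_gradient_def by blast

lemma has_weak_gradient_integrable:
  assumes "open \<Omega>" "has_weak_gradient \<Omega> u g" "\<psi> \<in> test_funs \<Omega>" "e \<in> Basis"
  shows "integrable (lebesgue_on \<Omega>) (\<lambda>x. u x * frechet_derivative \<psi> (at x) e)"
    "integrable (lebesgue_on \<Omega>) (\<lambda>x. (g x \<bullet> e) * \<psi> x)"
  using assms L1_loc_times_test_integrable[of \<Omega> u, OF _ _ test_funs_derivative[OF assms(3,4)]]
    L1_loc_times_test_integrable[OF assms(1) L1_loc_inner assms(3), of g e]
  unfolding has_weak_gradient_def by (auto simp: mult.commute)

lemma has_weak_gradient_lincomb:
  assumes "open \<Omega>" "has_weak_gradient \<Omega> u g" "has_weak_gradient \<Omega> w h"
  shows "has_weak_gradient \<Omega> (\<lambda>x. a * u x + c * w x) (\<lambda>x. a *\<^sub>R g x + c *\<^sub>R h x)"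
  unfolding has_weak_gradient_def
proof (intro conjI ballI)
  show "L1_loc \<Omega> (\<lambda>x. a * u x + c * w x)" "L1_loc \<Omega> (\<lambda>x. a *\<^sub>R g x + c *\<^sub>R h x)"
    using assms L1_loc_lincomb[of \<Omega> u w a c] L1_loc_lincomb[of \<Omega> g h a c] unfolding has_weak_gradient_def by auto
next
  fix \<psi> and e :: 'a assume \<psi>: "\<psi> \<in> test_funs \<Omega>" "e \<in> Basis"
  note i = has_weak_gradient_integrable[OF assms(1,2) \<psi>] has_weak_gradient_integrable[OF assms(1,3) \<psi>]
  have "(\<integral>x. (a * u x + c * w x) * frechet_derivative \<psi> (at x) e \<partial>lebesgue_on \<Omega>)
     = (\<integral>x. a * (u x * frechet_derivative \<psi> (at x) e) + c * (w x * frechet_derivative \<psi> (at x) e) \<partial>lebesgue_on \<Omega>)"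
    by (simp add: algebra_simps)
  also have "\<dots> = - (\<integral>x. a * ((g x \<bullet> e) * \<psi> x) + c * ((h x \<bullet> e) * \<psi> x) \<partial>lebesgue_on \<Omega>)"
    using i weak_gradient_eqD[OF assms(2) \<psi>] weak_gradient_eqD[OF assms(3) \<psi>] by simp
  also have "\<dots> = - (\<integral>x. ((a *\<^sub>R g x + c *\<^sub>R h x) \<bullet> e) * \<psi> x \<partial>lebesgue_on \<Omega>)"
    by (simp add: algebra_simps)
  finally show "(\<integral>x. (a * u x + c * w x) * frechet_derivative \<psi> (at x) e \<partial>lebesgue_on \<Omega>)
    = - (\<integral>x. ((a *\<^sub>R g x + c *\<^sub>R h x) \<bullet> e) * \<psi> x \<partial>lebesgue_on \<Omega>)" .
qed

lemma weak_gradient_unique: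
  assumes "open \<Omega>" "has_weak_gradient \<Omega> u g" "has_weak_gradient \<Omega> u h"
  shows "AE x in lebesgue_on \<Omega>. g x = h x"
proof -
  have "AE x in lebesgue_on \<Omega>. (g x - h x) \<bullet> e = 0" if e: "e \<in> Basis" for e
  proof (rule fundamental_lemma[OF assms(1)])
    show "L1_loc \<Omega> (\<lambda>x. (g x - h x) \<bullet> e)"
      using assms L1_loc_inner[OF L1_loc_lincomb[of \<Omega> g h 1 "-1"]] unfolding has_weak_gradient_def by auto
    fix \<psi> assume \<psi>: "\<psi> \<in> test_funs \<Omega>"
    note i = has_weak_gradient_integrable[OF assms(1,2) \<psi> e] has_weak_gradient_integrable[OF assms(1,3) \<psi> e]
    have "(\<integral>x. \<psi> x * ((g x - h x) \<bullet> e) \<partial>lebesgue_on \<Omega>) = (\<integral>x. (g x \<bullet> e) * \<psi> x - (h x \<bullet> e) * \<psi> x \<partial>lebesgue_on \<Omega>)"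
      by (simp add: algebra_simps)
    also have "\<dots> = 0"
      using i weak_gradient_eqD[OF assms(2) \<psi> e] weak_gradient_eqD[OF assms(3) \<psi> e] by simp
    finally show "(\<integral>x. \<psi> x * ((g x - h x) \<bullet> e) \<partial>lebesgue_on \<Omega>) = 0" .
  qed
  then have "AE x in lebesgue_on \<Omega>. \<forall>e\<in>Basis. (g x - h x) \<bullet> e = 0"
    by (simp add: AE_ball_countable countable_finite)
  then show ?thesis
    by eventually_elim (simp add: euclidean_eq_iff[where 'a='a] inner_diff_left)
qed

text \<open>Supplies the majorant for the passage from difference quotients to derivatives under the
  integral.\<close>

lemma test_funs_difference_quotient_bound:
  fixes f :: "'a::euclidean_space \<Rightarrow> real"
  assumes der: "\<And>x. (f has_derivative f' x) (at x)" and B: "\<And>x. \<bar>f' x e\<bar> \<le> B" and "h > 0"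
  shows "\<bar>f (x + h *\<^sub>R e) - f x\<bar> \<le> B * h"
proof -
  have d: "((\<lambda>t. f (x + t *\<^sub>R e)) has_real_derivative f' (x + t *\<^sub>R e) e) (at t)" for t
  proof -
    have "((\<lambda>t. x + t *\<^sub>R e) has_derivative (\<lambda>s. s *\<^sub>R e)) (at t)"
      by (rule has_derivative_eq_rhs[OF has_derivative_add[OF has_derivative_const has_derivative_scaleR_left[OF has_derivative_ident]]]) simp
    from has_derivative_compose[OF this der]
    have "((\<lambda>t. f (x + t *\<^sub>R e)) has_derivative (\<lambda>s. f' (x + t *\<^sub>R e) (s *\<^sub>R e))) (at t)" .
    moreover have "f' (x + t *\<^sub>R e) (s *\<^sub>R e) = f' (x + t *\<^sub>R e) e * s" for s
      using linear_cmul[OF has_derivative_linear[OF der]] by (simp add: mult.commute)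
    ultimately show ?thesis by (simp add: has_field_derivative_def)
  qed
  obtain z where "f (x + h *\<^sub>R e) - f (x + 0 *\<^sub>R e) = (h - 0) * f' (x + z *\<^sub>R e) e"
    using MVT2[OF \<open>h > 0\<close>, of "\<lambda>t. f (x + t *\<^sub>R e)" "\<lambda>t. f' (x + t *\<^sub>R e) e"] d by auto
  then have "\<bar>f (x + h *\<^sub>R e) - f x\<bar> = h * \<bar>f' (x + z *\<^sub>R e) e\<bar>" using \<open>h > 0\<close> by (simp add: abs_mult)
  also have "\<dots> \<le> h * B" using B \<open>h > 0\<close> by (intro mult_left_mono) auto
  finally show ?thesis by (simp add: mult.commute)
qed

text \<open>Translation invariance makes the integral of every difference quotient zero, and
  dominated convergence carries this over to the derivative. This is the only form of integration by
  parts in space that is established directly.\<close>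

lemma integral_partial_derivative_eq_0:
  fixes f :: "'a::euclidean_space \<Rightarrow> real"
  assumes f: "f \<in> test_funs UNIV" and e: "e \<in> Basis"
  shows "(\<integral>x. frechet_derivative f (at x) e \<partial>lborel) = 0"
proof -
  obtain C where C: "compact C" "\<And>x. x \<notin> C \<Longrightarrow> f x = 0" "\<And>k. Ck k f"
    using test_funsE[OF f] by metis
  have der: "(f has_derivative frechet_derivative f (at x)) (at x)" for x
    using Ck_Suc_has_derivative[OF C(3)] .
  obtain B where B: "\<And>x. \<bar>frechet_derivative f (at x) e\<bar> \<le> B" "B \<ge> 0"
    using test_funs_bounded[OF test_funs_derivative[OF f e]] by metis
  obtain R where R: "\<And>x. x \<in> C \<Longrightarrow> norm x \<le> R" "R > 0"
    using compact_imp_bounded[OF C(1)] bounded_pos by metis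
  have cont: "continuous_on UNIV f" using test_funs_continuous[OF f] .
  then have [measurable]: "f \<in> borel_measurable borel" by (rule borel_measurable_continuous_onI)
  have fi: "integrable lborel f"
  proof -
    have "integrable lborel (\<lambda>x. indicator C x *\<^sub>R f x)"
      using borel_integrable_compact[OF C(1)] continuous_on_subset[OF cont] by blast
    moreover have "(\<lambda>x. indicator C x *\<^sub>R f x) = f" using C(2) by (auto simp: indicator_def fun_eq_iff)
    ultimately show ?thesis by simp
  qed
  define h where "h n = 1 / real (Suc n)" for n
  have h: "0 < h n" "h n \<le> 1" for n by (auto simp: h_def)
  define q where "q n x = (f (x + h n *\<^sub>R e) - f x) / h n" for n x
  have translate: "integrable lborel (\<lambda>x. f (x + y)) \<and> (\<integral>x. f (x + y) \<partial>lborel) = (\<integral>x. f x \<partial>lborel)" for y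
  proof -
    have "integrable (distr lborel borel ((+) y)) f" "(\<integral>x. f x \<partial>distr lborel borel ((+) y)) = (\<integral>x. f x \<partial>lborel)"
      using fi by (simp_all add: lborel_distr_plus)
    then show ?thesis by (simp add: integrable_distr_eq integral_distr add.commute)
  qed
  have q0: "(\<integral>x. q n x \<partial>lborel) = 0" for n
    unfolding q_def using translate[of "h n *\<^sub>R e"] fi by simp
  have "(\<lambda>n. \<integral>x. q n x \<partial>lborel) \<longlonglongrightarrow> (\<integral>x. frechet_derivative f (at x) e \<partial>lborel)"
  \<comment> \<open>All quotients vanish outside the ball of radius R + 1, because h n \<le>
    1.\<close>
  proof (rule integral_dominated_convergence[where w = "\<lambda>x. indicator (cball 0 (R + 1)) x *\<^sub>R B"])
    show "(\<lambda>x. frechet_derivative f (at x) e) \<in> borel_measurable lborel"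
      using test_funs_continuous[OF test_funs_derivative[OF f e]] by (auto intro: borel_measurable_continuous_onI)
    show "q n \<in> borel_measurable lborel" for n unfolding q_def by measurable
    show "integrable lborel (\<lambda>x. indicat_real (cball 0 (R + 1)) x *\<^sub>R B)"
      by (rule borel_integrable_compact) auto
    show "AE x in lborel. (\<lambda>n. q n x) \<longlonglongrightarrow> frechet_derivative f (at x) e"
    proof (rule AE_I2)
      fix x
      have lim: "(\<lambda>t. (f (x + t *\<^sub>R e) - f x) / t) \<midarrow>0\<rightarrow> frechet_derivative f (at x) e"
      proof -
        have "((\<lambda>t. x + t *\<^sub>R e) has_derivative (\<lambda>s. s *\<^sub>R e)) (at 0)"
          by (rule has_derivative_eq_rhs[OF has_derivative_add[OF has_derivative_const has_derivative_scaleR_left[OF has_derivative_ident]]]) simp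
        moreover have "(f has_derivative frechet_derivative f (at x)) (at (x + 0 *\<^sub>R e))" using der by simp
        ultimately have "((\<lambda>t. f (x + t *\<^sub>R e)) has_derivative (\<lambda>s. frechet_derivative f (at x) (s *\<^sub>R e))) (at 0)"
          by (rule has_derivative_compose)
        moreover have "frechet_derivative f (at x) (s *\<^sub>R e) = frechet_derivative f (at x) e * s" for s
          using linear_cmul[OF has_derivative_linear[OF der]] by (simp add: mult.commute)
        ultimately have "((\<lambda>t. f (x + t *\<^sub>R e)) has_real_derivative frechet_derivative f (at x) e) (at 0)"
          by (simp add: has_field_derivative_def)
        then show ?thesis by (simp add: has_field_derivative_iff)
      qed
      have "filterlim h (at 0) sequentially"
        unfolding filterlim_at using h lim_1_over_n[where 'a=real, THEN LIMSEQ_Suc]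
        by (auto simp: h_def[abs_def] simp del: of_nat_Suc intro!: eventuallyI)
      from filterlim_compose[OF lim this] show "(\<lambda>n. q n x) \<longlonglongrightarrow> frechet_derivative f (at x) e"
        by (simp add: q_def)
    qed
    show "AE x in lborel. norm (q n x) \<le> indicat_real (cball 0 (R + 1)) x *\<^sub>R B" for n
    proof (rule AE_I2)
      fix x
      show "norm (q n x) \<le> indicat_real (cball 0 (R + 1)) x *\<^sub>R B"
      proof (cases "norm x \<le> R + 1")
        case True
        have "\<bar>f (x + h n *\<^sub>R e) - f x\<bar> \<le> B * h n"
          by (rule test_funs_difference_quotient_bound[OF der B(1) h(1)])
        then show ?thesis using True h(1)[of n] by (simp add: q_def divide_le_eq)
      next
        case False
        have "norm x \<le> norm (x + h n *\<^sub>R e) + norm (h n *\<^sub>R e)"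
          by (metis add_diff_cancel_right' norm_triangle_ineq4)
        then have "x + h n *\<^sub>R e \<notin> C" "x \<notin> C" using False R(1)[of x] R(1)[of "x + h n *\<^sub>R e"] h[of n] e by auto
        then show ?thesis using C(2) B by (simp add: q_def)
      qed
    qed
  qed
  then show ?thesis using q0 by (simp add: LIMSEQ_const_iff)
qed

definition grad :: "('a::euclidean_space \<Rightarrow> real) \<Rightarrow> 'a \<Rightarrow> 'a" where
  "grad \<psi> x = (\<Sum>e\<in>Basis. frechet_derivative \<psi> (at x) e *\<^sub>R e)"

lemma grad_inner: "e \<in> Basis \<Longrightarrow> grad \<psi> x \<bullet> e = frechet_derivative \<psi> (at x) e"
  by (simp add: grad_def)

lemma test_funs_grad_continuous: "\<psi> \<in> test_funs \<Omega> \<Longrightarrow> continuous_on UNIV (grad \<psi>)"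
  unfolding grad_def by (intro continuous_intros test_funs_continuous[OF test_funs_derivative])

lemma continuous_L1_loc:
  fixes f :: "'a::euclidean_space \<Rightarrow> 'b::euclidean_space"
  assumes "continuous_on UNIV f" shows "L1_loc \<Omega> f"
  unfolding L1_loc_def
proof (intro allI impI)
  fix K :: "'a set" assume K: "compact K \<and> K \<subseteq> \<Omega>"
  then have "integrable lborel (\<lambda>x. indicator K x *\<^sub>R f x)"
    using borel_integrable_compact continuous_on_subset[OF assms] by blast
  then have "integrable lebesgue (\<lambda>x. indicator K x *\<^sub>R f x)"
    by (subst integrable_completion) (auto dest: borel_measurable_integrable)
  then show "integrable (lebesgue_on K) f"
    using K lmeasurable_compact fmeasurableD by (subst integrable_restrict_space) auto
qed

lemma integral_lebesgue_on_support:
  fixes f :: "'a::euclidean_space \<Rightarrow> real"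
  assumes "\<Omega> \<in> sets lebesgue" "f \<in> borel_measurable borel" "\<And>x. x \<notin> \<Omega> \<Longrightarrow> f x = 0"
  shows "(\<integral>x. f x \<partial>lebesgue_on \<Omega>) = (\<integral>x. f x \<partial>lborel)"
proof -
  have "(\<lambda>x. indicator \<Omega> x *\<^sub>R f x) = f" using assms(3) by (auto simp: indicator_def fun_eq_iff)
  then show ?thesis
    using assms by (simp add: integral_restrict_space integral_completion)
qed

text \<open>A partial derivative of the product \<psi> \<rho> has integral zero; the product rule
  splits it into the two sides of the defining identity.\<close>

lemma has_weak_gradient_test_fun:
  assumes "open \<Omega>" "\<psi> \<in> test_funs \<Omega>"
  shows "has_weak_gradient \<Omega> \<psi> (grad \<psi>)"
  unfolding has_weak_gradient_def
proof (intro conjI ballI)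
  show "L1_loc \<Omega> \<psi>" "L1_loc \<Omega> (grad \<psi>)"
    using continuous_L1_loc test_funs_continuous test_funs_grad_continuous assms by blast+
next
  fix \<rho> and e :: 'a assume r: "\<rho> \<in> test_funs \<Omega>" and e: "e \<in> Basis"
  obtain C where C: "compact C" "C \<subseteq> \<Omega>" "\<And>x. x \<notin> C \<Longrightarrow> \<psi> x = 0" "\<And>k. Ck k \<psi>"
    using test_funsE[OF assms(2)] by metis
  have Cr: "\<And>k. Ck k \<rho>" using r test_funsE by metis
  note dp = Ck_Suc_has_derivative[OF C(4)] and dr = Ck_Suc_has_derivative[OF Cr]
  have prod: "frechet_derivative (\<lambda>x. \<psi> x * \<rho> x) (at x) e
      = \<psi> x * frechet_derivative \<rho> (at x) e + frechet_derivative \<psi> (at x) e * \<rho> x" for x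
    using frechet_derivative_at[OF has_derivative_mult[OF dp dr], of x] by metis
  have c: "continuous_on UNIV \<psi>" "continuous_on UNIV \<rho>"
    "continuous_on UNIV (\<lambda>x. frechet_derivative \<rho> (at x) e)" "continuous_on UNIV (\<lambda>x. frechet_derivative \<psi> (at x) e)"
    using test_funs_continuous test_funs_derivative[OF assms(2) e] test_funs_derivative[OF r e] r assms(2) by blast+
  have m: "(\<lambda>x. \<psi> x * frechet_derivative \<rho> (at x) e) \<in> borel_measurable borel"
      "(\<lambda>x. frechet_derivative \<psi> (at x) e * \<rho> x) \<in> borel_measurable borel"
    using c by (auto intro!: borel_measurable_continuous_onI continuous_intros)
  have "test_funs \<Omega> \<subseteq> test_funs UNIV" using test_funs_mono[of \<Omega> UNIV] by auto
  then have "0 = (\<integral>x. frechet_derivative (\<lambda>x. \<psi> x * \<rho> x) (at x) e \<partial>lborel)"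
    using integral_partial_derivative_eq_0[OF _ e] test_funs_mult[OF assms(2) r] by auto
  also have "\<dots> = (\<integral>x. \<psi> x * frechet_derivative \<rho> (at x) e + frechet_derivative \<psi> (at x) e * \<rho> x \<partial>lebesgue_on \<Omega>)"
    unfolding prod
  proof (rule integral_lebesgue_on_support[symmetric])
    show "(\<lambda>x. \<psi> x * frechet_derivative \<rho> (at x) e + frechet_derivative \<psi> (at x) e * \<rho> x) \<in> borel_measurable borel"
      using m by measurable
    show "\<psi> x * frechet_derivative \<rho> (at x) e + frechet_derivative \<psi> (at x) e * \<rho> x = 0" if "x \<notin> \<Omega>" for x
    proof -
      have "x \<notin> C" using that C(2) by blast
      then show ?thesis using C(3) test_funs_derivative_support[OF C(4,1,3), of x e] by simp
    qed
  qed (use assms in auto)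
  also have "\<dots> = (\<integral>x. \<psi> x * frechet_derivative \<rho> (at x) e \<partial>lebesgue_on \<Omega>) + (\<integral>x. frechet_derivative \<psi> (at x) e * \<rho> x \<partial>lebesgue_on \<Omega>)"
  proof (rule Bochner_Integration.integral_add)
    show "integrable (lebesgue_on \<Omega>) (\<lambda>x. \<psi> x * frechet_derivative \<rho> (at x) e)"
      using L1_loc_times_test_integrable[OF assms(1) continuous_L1_loc[OF c(3)] assms(2)] by simp
    show "integrable (lebesgue_on \<Omega>) (\<lambda>x. frechet_derivative \<psi> (at x) e * \<rho> x)"
      using L1_loc_times_test_integrable[OF assms(1) continuous_L1_loc[OF c(4)] r] by (simp add: mult.commute)
  qed
  finally show "(\<integral>x. \<psi> x * frechet_derivative \<rho> (at x) e \<partial>lebesgue_on \<Omega>) = - (\<integral>x. (grad \<psi> x \<bullet> e) * \<rho> x \<partial>lebesgue_on \<Omega>)"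
    using e by (simp add: grad_inner)
qed

lemma test_fun_bounded_support_L2:
  fixes f :: "'a::euclidean_space \<Rightarrow> 'b::euclidean_space"
  assumes "continuous_on UNIV f" "compact C" "\<And>x. x \<notin> C \<Longrightarrow> f x = 0" "\<Omega> \<in> sets lebesgue"
  shows "L2fun \<Omega> f"
proof -
  have b: "f \<in> borel_measurable borel" using assms(1) by (rule borel_measurable_continuous_onI)
  have "continuous_on C (\<lambda>x. (norm (f x))\<^sup>2)" using continuous_on_subset[OF assms(1)] by (intro continuous_intros) auto
  then have "integrable lborel (\<lambda>x. indicator C x *\<^sub>R (norm (f x))\<^sup>2)"
    using borel_integrable_compact[OF assms(2)] by blast
  moreover have "(\<lambda>x. indicator C x *\<^sub>R (norm (f x))\<^sup>2) = (\<lambda>x. (norm (f x))\<^sup>2)"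
    using assms(3) by (auto simp: indicator_def fun_eq_iff)
  ultimately have "integrable lborel (\<lambda>x. (norm (f x))\<^sup>2)" by simp
  then have "integrable lebesgue (\<lambda>x. (norm (f x))\<^sup>2)"
    by (subst integrable_completion) (auto dest: borel_measurable_integrable)
  then show ?thesis
    unfolding L2fun_def
    using integrable_mult_indicator[OF assms(4), of "\<lambda>x. (norm (f x))\<^sup>2"] assms(4) b
    by (auto simp: integrable_restrict_space intro!: measurable_restrict_space1 measurable_completion)
qed

lemma test_funs_L2:
  assumes "open \<Omega>" "\<psi> \<in> test_funs \<Omega>" shows "L2fun \<Omega> \<psi>" "L2fun \<Omega> (grad \<psi>)"
proof -
  obtain C where C: "compact C" "C \<subseteq> \<Omega>" "\<And>x. x \<notin> C \<Longrightarrow> \<psi> x = 0" "\<And>k. Ck k \<psi>"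
    using test_funsE[OF assms(2)] by metis
  show "L2fun \<Omega> \<psi>"
    using assms C by (intro test_fun_bounded_support_L2[OF _ C(1)] test_funs_continuous[OF assms(2)]) auto
  show "L2fun \<Omega> (grad \<psi>)"
    using assms C by (intro test_fun_bounded_support_L2[OF _ C(1)] test_funs_grad_continuous[OF assms(2)])
      (auto simp: grad_def test_funs_derivative_support[OF C(4,1,3)])
qed

lemma L2fun_L1_loc:
  assumes "open \<Omega>" "L2fun \<Omega> f" shows "L1_loc \<Omega> f"
  unfolding L1_loc_def
proof (intro allI impI)
  fix K :: "'a set" assume K: "compact K \<and> K \<subseteq> \<Omega>"
  then have KL: "K \<in> lmeasurable" using lmeasurable_compact by blast
  have KS: "K \<in> sets lebesgue" using KL by auto
  have eq: "restrict_space (lebesgue_on \<Omega>) K = lebesgue_on K"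
    using K assms(1) by (simp add: restrict_restrict_space Int_absorb1 KS)
  have KO: "K \<inter> space (lebesgue_on \<Omega>) \<in> sets (lebesgue_on \<Omega>)"
    using K KS assms(1) by (auto simp: sets_restrict_space intro!: image_eqI[of _ _ K])
  have KO': "K \<in> sets (lebesgue_on \<Omega>)" using KO K by (simp add: Int_absorb2)
  interpret finite_measure "lebesgue_on K" using KL by (rule finite_measure_lebesgue_on)
  show "integrable (lebesgue_on K) f"
  proof (rule Bochner_Integration.integrable_bound)
    have "integrable (lebesgue_on K) (\<lambda>x. (norm (f x))\<^sup>2)"
      using integrable_mult_indicator[OF _ L2funD(2)[OF assms(2)], of "K"] KO KO' K
      unfolding eq[symmetric] by (subst integrable_restrict_space) (auto simp: Int_absorb1 space_restrict_space)
    then show "integrable (lebesgue_on K) (\<lambda>x. 1 + (norm (f x))\<^sup>2)" by simp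
    show "f \<in> borel_measurable (lebesgue_on K)"
      using measurable_restrict_mono[OF L2funD(1)[OF assms(2)]] K by blast
    have "norm (f x) \<le> 1 + (norm (f x))\<^sup>2" for x
      using mult_le_sum_squares[of 1 "norm (f x)"] by simp
    then show "AE x in lebesgue_on K. norm (f x) \<le> norm (1 + (norm (f x))\<^sup>2)" by (auto intro!: AE_I2 order_trans[OF _ abs_ge_self])
  qed
qed

text \<open>Both sides of the defining identity are L2 pairings with a fixed function and so pass to
  the limit: the weak gradient is a closed operator in L2.\<close>

lemma has_weak_gradient_L2_limit:
  assumes "open \<Omega>" and hw: "\<And>n. has_weak_gradient \<Omega> (u n) (g n)"
    and L2: "\<And>n. L2fun \<Omega> (u n)" "\<And>n. L2fun \<Omega> (g n)" "L2fun \<Omega> U" "L2fun \<Omega> G"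
    and lim: "(\<lambda>n. \<integral>x. (norm (u n x - U x))\<^sup>2 \<partial>lebesgue_on \<Omega>) \<longlonglongrightarrow> 0"
      "(\<lambda>n. \<integral>x. (norm (g n x - G x))\<^sup>2 \<partial>lebesgue_on \<Omega>) \<longlonglongrightarrow> 0"
  shows "has_weak_gradient \<Omega> U G"
  unfolding has_weak_gradient_def
proof (intro conjI ballI)
  show "L1_loc \<Omega> U" "L1_loc \<Omega> G" using assms L2fun_L1_loc by blast+
next
  fix \<psi> and e :: 'a assume p: "\<psi> \<in> test_funs \<Omega>" and e: "e \<in> Basis"
  have "(\<lambda>n. \<integral>x. u n x \<bullet> frechet_derivative \<psi> (at x) e \<partial>lebesgue_on \<Omega>)
     \<longlonglongrightarrow> (\<integral>x. U x \<bullet> frechet_derivative \<psi> (at x) e \<partial>lebesgue_on \<Omega>)"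
    using test_funs_L2(1)[OF assms(1) test_funs_derivative[OF p e]] by (intro L2fun_inner_tendsto L2 lim)
  moreover have pe: "L2fun \<Omega> (\<lambda>x. \<psi> x *\<^sub>R e)"
    using test_funs_L2(1)[OF assms(1) p] e
    by (rule_tac L2fun_bound[of \<Omega> \<psi> _ 1]) (auto dest: L2funD(1))
  have "(\<lambda>n. \<integral>x. g n x \<bullet> (\<psi> x *\<^sub>R e) \<partial>lebesgue_on \<Omega>) \<longlonglongrightarrow> (\<integral>x. G x \<bullet> (\<psi> x *\<^sub>R e) \<partial>lebesgue_on \<Omega>)"
    by (intro L2fun_inner_tendsto L2 lim pe)
  then have "(\<lambda>n. \<integral>x. (g n x \<bullet> e) * \<psi> x \<partial>lebesgue_on \<Omega>) \<longlonglongrightarrow> (\<integral>x. (G x \<bullet> e) * \<psi> x \<partial>lebesgue_on \<Omega>)"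
    by (simp add: mult.commute)
  moreover have "(\<lambda>n. \<integral>x. u n x \<bullet> frechet_derivative \<psi> (at x) e \<partial>lebesgue_on \<Omega>)
      = (\<lambda>n. - (\<integral>x. (g n x \<bullet> e) * \<psi> x \<partial>lebesgue_on \<Omega>))"
    using weak_gradient_eqD[OF hw p e] by simp
  ultimately have "(\<lambda>n. - (\<integral>x. (g n x \<bullet> e) * \<psi> x \<partial>lebesgue_on \<Omega>))
      \<longlonglongrightarrow> (\<integral>x. U x \<bullet> frechet_derivative \<psi> (at x) e \<partial>lebesgue_on \<Omega>)"
    and "(\<lambda>n. - (\<integral>x. (g n x \<bullet> e) * \<psi> x \<partial>lebesgue_on \<Omega>)) \<longlonglongrightarrow> - (\<integral>x. (G x \<bullet> e) * \<psi> x \<partial>lebesgue_on \<Omega>)"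
    by (simp_all only: tendsto_minus)
  then show "(\<integral>x. U x * frechet_derivative \<psi> (at x) e \<partial>lebesgue_on \<Omega>) = - (\<integral>x. (G x \<bullet> e) * \<psi> x \<partial>lebesgue_on \<Omega>)"
    using LIMSEQ_unique unfolding inner_real_def by blast
qed

section \<open>The spaces H1 and H10\<close>

lemma abs_powr_2: "\<bar>x::real\<bar> powr 2 = x\<^sup>2"
  by (cases "x = 0") auto

lemma elts_L2: "u \<in> elts (Lp_space 2 \<Omega>) \<longleftrightarrow> L2fun \<Omega> u"
  by (auto simp: Lp_space_def L2fun_def abs_powr_2)

lemma nrm_L2: "nrm (Lp_space 2 \<Omega>) u = sqrt (\<integral>x. (u x)\<^sup>2 \<partial>lebesgue_on \<Omega>)"
  by (simp add: Lp_space_def abs_powr_2 powr_half_sqrt)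

text \<open>Carries the gradient along explicitly, since \<open>weak_gradient\<close> is an
  arbitrary choice among functions that agree almost everywhere.\<close>

definition H1_grad :: "'a::euclidean_space set \<Rightarrow> ('a \<Rightarrow> real) \<Rightarrow> ('a \<Rightarrow> 'a) \<Rightarrow> bool" where
  "H1_grad \<Omega> u g \<longleftrightarrow> L2fun \<Omega> u \<and> L2fun \<Omega> g \<and> has_weak_gradient \<Omega> u g"

lemma H1_gradI:
  assumes "open \<Omega>" "u \<in> H1 \<Omega>" "has_weak_gradient \<Omega> u g"
  shows "H1_grad \<Omega> u g"
proof -
  obtain h where h: "has_weak_gradient \<Omega> u h" "integrable (lebesgue_on \<Omega>) (\<lambda>x. (norm (h x))\<^sup>2)"
    and u: "L2fun \<Omega> u"
    using assms(2) by (auto simp: H1_def elts_L2)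
  have m: "g \<in> borel_measurable (lebesgue_on \<Omega>)" "h \<in> borel_measurable (lebesgue_on \<Omega>)"
    using assms h L1_loc_measurable unfolding has_weak_gradient_def by blast+
  have "L2fun \<Omega> g"
    by (rule L2fun_cong_AE[OF weak_gradient_unique[OF assms(1,3) h(1)] m(1)]) (use h m in \<open>auto simp: L2fun_def\<close>)
  then show ?thesis using u assms(3) by (simp add: H1_grad_def)
qed

lemma H1_I: "H1_grad \<Omega> u g \<Longrightarrow> u \<in> H1 \<Omega>"
  by (auto simp: H1_grad_def H1_def elts_L2 dest: L2funD(2))

lemma H1_E: assumes "open \<Omega>" "u \<in> H1 \<Omega>" obtains g where "H1_grad \<Omega> u g"
  using assms H1_gradI[OF assms] by (auto simp: H1_def)

lemma norm_H1_eq: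
  assumes "open \<Omega>" "H1_grad \<Omega> u g"
  shows "norm_H1 \<Omega> u = sqrt ((\<integral>x. (norm (u x))\<^sup>2 \<partial>lebesgue_on \<Omega>) + (\<integral>x. (norm (g x))\<^sup>2 \<partial>lebesgue_on \<Omega>))"
proof -
  have w: "has_weak_gradient \<Omega> u g" using assms by (simp add: H1_grad_def)
  have ww: "has_weak_gradient \<Omega> u (weak_gradient \<Omega> u)"
    unfolding weak_gradient_def by (rule someI[of "has_weak_gradient \<Omega> u", OF w])
  have "H1_grad \<Omega> u (weak_gradient \<Omega> u)" using H1_gradI[OF assms(1) H1_I[OF assms(2)] ww] .
  then have "(\<integral>x. (norm (weak_gradient \<Omega> u x))\<^sup>2 \<partial>lebesgue_on \<Omega>) = (\<integral>x. (norm (g x))\<^sup>2 \<partial>lebesgue_on \<Omega>)"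
    using weak_gradient_unique[OF assms(1) ww w] assms(2)
    by (intro integral_cong_AE) (auto simp: H1_grad_def L2fun_def elim!: eventually_mono)
  then show ?thesis by (simp add: norm_H1_def)
qed

lemma norm_H1_tendsto_iff:
  assumes "open \<Omega>" "\<And>n. H1_grad \<Omega> (u n) (g n)"
  shows "(\<lambda>n::nat. norm_H1 \<Omega> (u n)) \<longlonglongrightarrow> 0 \<longleftrightarrow>
    (\<lambda>n. \<integral>x. (norm (u n x))\<^sup>2 \<partial>lebesgue_on \<Omega>) \<longlonglongrightarrow> 0 \<and> (\<lambda>n. \<integral>x. (norm (g n x))\<^sup>2 \<partial>lebesgue_on \<Omega>) \<longlonglongrightarrow> 0"
    (is "?L \<longleftrightarrow> ?a \<longlonglongrightarrow> 0 \<and> ?b \<longlonglongrightarrow> 0")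
proof -
  have nn: "?a n \<ge> 0" "?b n \<ge> 0" for n by (auto intro!: integral_nonneg_AE)
  have eq: "(\<lambda>n. norm_H1 \<Omega> (u n)) = (\<lambda>n. sqrt (?a n + ?b n))"
    using norm_H1_eq[OF assms(1) assms(2)] by simp
  have "?L \<longleftrightarrow> (\<lambda>n. ?a n + ?b n) \<longlonglongrightarrow> 0"
  proof
    assume ?L
    then have "(\<lambda>n. (sqrt (?a n + ?b n))\<^sup>2) \<longlonglongrightarrow> 0\<^sup>2" unfolding eq by (rule tendsto_power)
    then show "(\<lambda>n. ?a n + ?b n) \<longlonglongrightarrow> 0" using nn by (simp add: add_nonneg_nonneg)
  next
    assume "(\<lambda>n. ?a n + ?b n) \<longlonglongrightarrow> 0"
    then show ?L unfolding eq using tendsto_real_sqrt[of "\<lambda>n. ?a n + ?b n" 0 sequentially] by simp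
  qed
  also have "\<dots> \<longleftrightarrow> ?a \<longlonglongrightarrow> 0 \<and> ?b \<longlonglongrightarrow> 0"
  proof
    assume l: "(\<lambda>n. ?a n + ?b n) \<longlonglongrightarrow> 0"
    have "?a \<longlonglongrightarrow> 0" by (rule nonneg_squeeze_tendsto_0[of "\<lambda>n. ?a n + ?b n" ?a]) (use l nn in auto)
    moreover have "?b \<longlonglongrightarrow> 0" by (rule nonneg_squeeze_tendsto_0[of "\<lambda>n. ?a n + ?b n" ?b]) (use l nn in auto)
    ultimately show "?a \<longlonglongrightarrow> 0 \<and> ?b \<longlonglongrightarrow> 0" ..
  next
    assume "?a \<longlonglongrightarrow> 0 \<and> ?b \<longlonglongrightarrow> 0"
    then show "(\<lambda>n. ?a n + ?b n) \<longlonglongrightarrow> 0" using tendsto_add[of ?a 0 _ ?b 0] by simp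
  qed
  finally show ?thesis .
qed

lemma H1_grad_lincomb:
  assumes "open \<Omega>" "H1_grad \<Omega> u g" "H1_grad \<Omega> w h"
  shows "H1_grad \<Omega> (\<lambda>x. a * u x + c * w x) (\<lambda>x. a *\<^sub>R g x + c *\<^sub>R h x)"
  using assms has_weak_gradient_lincomb[OF assms(1), of u g w h a c]
    L2fun_add[OF L2fun_scaleR L2fun_scaleR, of \<Omega> u w a c]
    L2fun_add[OF L2fun_scaleR L2fun_scaleR, of \<Omega> g h a c]
  unfolding H1_grad_def by auto

lemma H1_grad_diff:
  assumes "open \<Omega>" "H1_grad \<Omega> u g" "H1_grad \<Omega> w h"
  shows "H1_grad \<Omega> (\<lambda>x. u x - w x) (\<lambda>x. g x - h x)"
  using H1_grad_lincomb[OF assms, of 1 "-1"] by simp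

lemma H1_grad_test: "open \<Omega> \<Longrightarrow> \<psi> \<in> test_funs \<Omega> \<Longrightarrow> H1_grad \<Omega> \<psi> (grad \<psi>)"
  by (simp add: H1_grad_def test_funs_L2 has_weak_gradient_test_fun)

lemma H10_imp_H1: "u \<in> elts (H10 \<Omega>) \<Longrightarrow> u \<in> H1 \<Omega>"
  by (simp add: H10_def)

lemma nrm_H10: "nrm (H10 \<Omega>) = norm_H1 \<Omega>"
  by (simp add: H10_def)

lemma H10_approx:
  assumes "open \<Omega>" "u \<in> elts (H10 \<Omega>)" "H1_grad \<Omega> u g"
  obtains \<psi> where "\<And>n::nat. \<psi> n \<in> test_funs \<Omega>"
    "(\<lambda>n. \<integral>x. (norm (\<psi> n x - u x))\<^sup>2 \<partial>lebesgue_on \<Omega>) \<longlonglongrightarrow> 0"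
    "(\<lambda>n. \<integral>x. (norm (grad (\<psi> n) x - g x))\<^sup>2 \<partial>lebesgue_on \<Omega>) \<longlonglongrightarrow> 0"
proof -
  obtain \<psi> where p: "\<And>n::nat. \<psi> n \<in> test_funs \<Omega>" "(\<lambda>n. norm_H1 \<Omega> (\<lambda>x. \<psi> n x - u x)) \<longlonglongrightarrow> 0"
    using assms(2) by (auto simp: H10_def)
  have H: "H1_grad \<Omega> (\<lambda>x. \<psi> n x - u x) (\<lambda>x. grad (\<psi> n) x - g x)" for n
    by (intro H1_grad_diff assms H1_grad_test p)
  note iff = norm_H1_tendsto_iff[of \<Omega> "\<lambda>n x. \<psi> n x - u x" "\<lambda>n x. grad (\<psi> n) x - g x", OF assms(1) H]
  show thesis by (rule that[of \<psi>]) (use p iff in blast)+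
qed

lemma H10_I:
  assumes "open \<Omega>" "H1_grad \<Omega> u g" "\<And>n::nat. \<psi> n \<in> test_funs \<Omega>"
    "(\<lambda>n. \<integral>x. (norm (\<psi> n x - u x))\<^sup>2 \<partial>lebesgue_on \<Omega>) \<longlonglongrightarrow> 0"
    "(\<lambda>n. \<integral>x. (norm (grad (\<psi> n) x - g x))\<^sup>2 \<partial>lebesgue_on \<Omega>) \<longlonglongrightarrow> 0"
  shows "u \<in> elts (H10 \<Omega>)"
proof -
  have H: "H1_grad \<Omega> (\<lambda>x. \<psi> n x - u x) (\<lambda>x. grad (\<psi> n) x - g x)" for n
    by (intro H1_grad_diff assms H1_grad_test)
  note norm_H1_tendsto_iff[of \<Omega> "\<lambda>n x. \<psi> n x - u x" "\<lambda>n x. grad (\<psi> n) x - g x", OF assms(1) H]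
  then have "(\<lambda>n. norm_H1 \<Omega> (\<lambda>x. \<psi> n x - u x)) \<longlonglongrightarrow> 0" using assms(4,5) by blast
  then show ?thesis using assms(3) H1_I[OF assms(2)] unfolding H10_def by auto
qed

lemma H10_lincomb:
  assumes O: "open \<Omega>" and u: "u \<in> elts (H10 \<Omega>)" and w: "w \<in> elts (H10 \<Omega>)"
  shows "(\<lambda>x. a * u x + c * w x) \<in> elts (H10 \<Omega>)"
proof -
  obtain g h where g: "H1_grad \<Omega> u g" and h: "H1_grad \<Omega> w h"
    using H1_E[OF O] H10_imp_H1 u w by metis
  obtain \<psi> \<rho> where p: "\<And>n::nat. \<psi> n \<in> test_funs \<Omega>" "(\<lambda>n. norm_H1 \<Omega> (\<lambda>x. \<psi> n x - u x)) \<longlonglongrightarrow> 0"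
    and r: "\<And>n::nat. \<rho> n \<in> test_funs \<Omega>" "(\<lambda>n. norm_H1 \<Omega> (\<lambda>x. \<rho> n x - w x)) \<longlonglongrightarrow> 0"
    using u w by (auto simp: H10_def)
  define d1 where "d1 n x = \<psi> n x - u x" for n x
  define d2 where "d2 n x = \<rho> n x - w x" for n x
  define D1 where "D1 n x = grad (\<psi> n) x - g x" for n x
  define D2 where "D2 n x = grad (\<rho> n) x - h x" for n x
  have H: "H1_grad \<Omega> (d1 n) (D1 n)" "H1_grad \<Omega> (d2 n) (D2 n)" for n
    unfolding d1_def D1_def d2_def D2_def using g h O p r by (auto intro!: H1_grad_diff H1_grad_test)
  have l: "(\<lambda>n. \<integral>x. (norm (d1 n x))\<^sup>2 \<partial>lebesgue_on \<Omega>) \<longlonglongrightarrow> 0" "(\<lambda>n. \<integral>x. (norm (D1 n x))\<^sup>2 \<partial>lebesgue_on \<Omega>) \<longlonglongrightarrow> 0"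
    "(\<lambda>n. \<integral>x. (norm (d2 n x))\<^sup>2 \<partial>lebesgue_on \<Omega>) \<longlonglongrightarrow> 0" "(\<lambda>n. \<integral>x. (norm (D2 n x))\<^sup>2 \<partial>lebesgue_on \<Omega>) \<longlonglongrightarrow> 0"
    using norm_H1_tendsto_iff[OF O H(1)] norm_H1_tendsto_iff[OF O H(2)] p(2) r(2)
    by (auto simp: d1_def[abs_def] d2_def[abs_def])
  have sc: "(\<lambda>n. \<integral>x. (norm (a *\<^sub>R F n x))\<^sup>2 \<partial>lebesgue_on \<Omega>) \<longlonglongrightarrow> 0"
    if "(\<lambda>n. \<integral>x. (norm (F n x))\<^sup>2 \<partial>lebesgue_on \<Omega>) \<longlonglongrightarrow> 0" for a and F :: "nat \<Rightarrow> 'a \<Rightarrow> 'b::euclidean_space"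
    using tendsto_mult_left[OF that, of "a\<^sup>2"] by (simp add: power_mult_distrib)
  have L: "L2fun \<Omega> (d1 n)" "L2fun \<Omega> (D1 n)" "L2fun \<Omega> (d2 n)" "L2fun \<Omega> (D2 n)" for n
    using H unfolding H1_grad_def by auto
  have "(\<lambda>n. \<integral>x. (norm (a *\<^sub>R d1 n x + c *\<^sub>R d2 n x))\<^sup>2 \<partial>lebesgue_on \<Omega>) \<longlonglongrightarrow> 0"
    "(\<lambda>n. \<integral>x. (norm (a *\<^sub>R D1 n x + c *\<^sub>R D2 n x))\<^sup>2 \<partial>lebesgue_on \<Omega>) \<longlonglongrightarrow> 0"
    by (intro L2_tendsto_add L2fun_scaleR L sc l)+
  then have "(\<lambda>n. norm_H1 \<Omega> (\<lambda>x. a * d1 n x + c * d2 n x)) \<longlonglongrightarrow> 0"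
    using norm_H1_tendsto_iff[OF O H1_grad_lincomb[OF O H]] by simp
  moreover have "a * d1 n x + c * d2 n x = (a * \<psi> n x + c * \<rho> n x) - (a * u x + c * w x)" for n x
    by (simp add: d1_def d2_def algebra_simps)
  ultimately have "(\<lambda>n. norm_H1 \<Omega> (\<lambda>x. (a * \<psi> n x + c * \<rho> n x) - (a * u x + c * w x))) \<longlonglongrightarrow> 0" by simp
  then show ?thesis
    using H1_I[OF H1_grad_lincomb[OF O g h, of a c]] test_funs_diff_scale[OF p(1) r(1)]
    unfolding H10_def by (auto intro!: exI[of _ "\<lambda>n x. a * \<psi> n x + c * \<rho> n x"])
qed

lemma norm_H1_scale:
  assumes "open \<Omega>" "u \<in> H1 \<Omega>"
  shows "norm_H1 \<Omega> (\<lambda>x. c * u x) = \<bar>c\<bar> * norm_H1 \<Omega> u"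
proof -
  obtain g where g: "H1_grad \<Omega> u g" using H1_E[OF assms] by metis
  have "H1_grad \<Omega> (\<lambda>x. c * u x) (\<lambda>x. c *\<^sub>R g x)" using H1_grad_lincomb[OF assms(1) g g, of c 0] by simp
  from norm_H1_eq[OF assms(1) this] norm_H1_eq[OF assms(1) g]
  have "norm_H1 \<Omega> (\<lambda>x. c * u x) = sqrt (c\<^sup>2 * ((\<integral>x. (norm (u x))\<^sup>2 \<partial>lebesgue_on \<Omega>) + (\<integral>x. (norm (g x))\<^sup>2 \<partial>lebesgue_on \<Omega>)))"
    by (simp add: power_mult_distrib distrib_left)
  then show ?thesis using norm_H1_eq[OF assms(1) g] by (simp add: real_sqrt_mult)
qed

lemma norm_H1_nonneg: "norm_H1 \<Omega> u \<ge> 0"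
  by (simp add: norm_H1_def integral_nonneg_AE)

section \<open>Composition of \<open>H10\<close> functions with tanh\<close>

lemma tanh_lipschitz: "\<bar>tanh a - tanh (b::real)\<bar> \<le> \<bar>a - b\<bar>"
proof -
  have "norm (tanh a - tanh b) \<le> 1 * norm (a - b)"
  proof (rule field_differentiable_bound[of UNIV tanh "\<lambda>x. 1 - (tanh x)\<^sup>2"])
    show "(tanh has_field_derivative 1 - (tanh z)\<^sup>2) (at z)" for z :: real
      by (auto intro!: derivative_eq_intros simp: cosh_real_nonzero)
    show "norm (1 - (tanh z)\<^sup>2) \<le> 1" for z :: real
      using abs_square_less_1[of "tanh z"] tanh_real_abs[of z] tanh_real_lt_1[of "\<bar>z\<bar>"] by (simp add: abs_if)
  qed auto
  then show ?thesis by simp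
qed

lemma abs_tanh_le: "\<bar>tanh (x::real)\<bar> \<le> 1" "\<bar>tanh (x::real)\<bar> \<le> \<bar>x\<bar>" "0 \<le> 1 - (tanh x)\<^sup>2" "1 - (tanh x)\<^sup>2 \<le> 1"
  using tanh_lipschitz[of x 0] tanh_real_lt_1[of x] tanh_real_gt_neg1[of x] abs_square_le_1[of "tanh x"] by auto

text \<open>The chain rule gradient is a product of a bounded factor a_n that converges only almost
  everywhere and a factor g_n that converges in L2. In a_n g_n - A G = a_n (g_n - G) + (a_n - A) G
  the first term is controlled by the bound on a_n and the second by dominated convergence, which is
  why a subsequence appears.\<close>

lemma tanh_chain_limit:
  fixes u :: "nat \<Rightarrow> 'a::euclidean_space \<Rightarrow> real" and g :: "nat \<Rightarrow> 'a \<Rightarrow> 'a"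
  assumes L2: "\<And>n. L2fun \<Omega> (u n)" "\<And>n. L2fun \<Omega> (g n)" "L2fun \<Omega> U" "L2fun \<Omega> G"
    and lim: "(\<lambda>n. \<integral>x. (norm (u n x - U x))\<^sup>2 \<partial>lebesgue_on \<Omega>) \<longlonglongrightarrow> 0"
      "(\<lambda>n. \<integral>x. (norm (g n x - G x))\<^sup>2 \<partial>lebesgue_on \<Omega>) \<longlonglongrightarrow> 0"
  obtains r :: "nat \<Rightarrow> nat" where "strict_mono r"
    "AE x in lebesgue_on \<Omega>. (\<lambda>n. u (r n) x) \<longlonglongrightarrow> U x"
    "(\<lambda>n. \<integral>x. (norm (tanh (c * u (r n) x) - tanh (c * U x)))\<^sup>2 \<partial>lebesgue_on \<Omega>) \<longlonglongrightarrow> 0"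
    "(\<lambda>n. \<integral>x. (norm ((c * (1 - (tanh (c * u (r n) x))\<^sup>2)) *\<^sub>R g (r n) x - (c * (1 - (tanh (c * U x))\<^sup>2)) *\<^sub>R G x))\<^sup>2 \<partial>lebesgue_on \<Omega>) \<longlonglongrightarrow> 0"
proof -
  have d: "L2fun \<Omega> (\<lambda>x. u n x - U x)" "L2fun \<Omega> (\<lambda>x. g n x - G x)" for n using L2 by (auto intro: L2fun_diff)
  note [measurable] = L2funD(1)[OF L2(1)] L2funD(1)[OF L2(2)] L2funD(1)[OF L2(3)] L2funD(1)[OF L2(4)]
  have tm: "(\<lambda>x. tanh (c * w x)) \<in> borel_measurable (lebesgue_on \<Omega>)"
    if [measurable]: "w \<in> borel_measurable (lebesgue_on \<Omega>)" for w :: "'a \<Rightarrow> real"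
  proof -
    have "(\<lambda>y::real. tanh (c * y)) \<in> borel_measurable borel"
      by (intro borel_measurable_continuous_onI continuous_intros) (auto simp: cosh_real_nonzero)
    from measurable_compose[OF that this] show ?thesis .
  qed
  note [measurable] = tm[OF L2funD(1)[OF L2(1)]] tm[OF L2funD(1)[OF L2(3)]]
  obtain r :: "nat \<Rightarrow> nat" where r: "strict_mono r" "AE x in lebesgue_on \<Omega>. (\<lambda>n. u (r n) x - U x) \<longlonglongrightarrow> 0"
    by (rule L2_tendsto_AE_subseq[OF d(1) lim(1)])
  have AE: "AE x in lebesgue_on \<Omega>. (\<lambda>n. u (r n) x) \<longlonglongrightarrow> U x"
    by (rule eventually_mono[OF r(2)]) (simp add: LIM_zero_iff)
  note lr = LIMSEQ_subseq_LIMSEQ[OF lim(1) r(1), unfolded o_def] LIMSEQ_subseq_LIMSEQ[OF lim(2) r(1), unfolded o_def]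
  have 1: "(\<lambda>n. \<integral>x. (norm (tanh (c * u (r n) x) - tanh (c * U x)))\<^sup>2 \<partial>lebesgue_on \<Omega>) \<longlonglongrightarrow> 0"
  proof (rule L2_tendsto_bound[OF d(1) _ _ lr(1), of _ "\<bar>c\<bar>"])
    show "norm (tanh (c * u (r n) x) - tanh (c * U x)) \<le> \<bar>c\<bar> * norm (u (r n) x - U x)" for n x
      using tanh_lipschitz[of "c * u (r n) x" "c * U x"] by (simp add: abs_mult[symmetric] right_diff_distrib)
  qed measurable
  define a where "a n x = c * (1 - (tanh (c * u (r n) x))\<^sup>2)" for n x
  define A where "A x = c * (1 - (tanh (c * U x))\<^sup>2)" for x
  have [measurable]: "a n \<in> borel_measurable (lebesgue_on \<Omega>)" "A \<in> borel_measurable (lebesgue_on \<Omega>)" for n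
    unfolding a_def[abs_def] A_def[abs_def] by measurable
  have ab: "\<bar>a n x\<bar> \<le> \<bar>c\<bar>" "\<bar>A x\<bar> \<le> \<bar>c\<bar>" for n x
    using abs_tanh_le(3,4) unfolding a_def A_def abs_mult by (auto intro!: mult_left_le)
  have 2: "(\<lambda>n. \<integral>x. (norm (a n x *\<^sub>R (g (r n) x - G x)))\<^sup>2 \<partial>lebesgue_on \<Omega>) \<longlonglongrightarrow> 0"
    by (rule L2_tendsto_bound[OF d(2) _ _ lr(2), of _ "\<bar>c\<bar>"]) (use ab in \<open>auto intro!: mult_right_mono\<close>)
  have aA: "\<bar>a n x - A x\<bar> \<le> 2 * \<bar>c\<bar>" for n x using ab(1)[of n x] ab(2)[of x] by linarith
  have 3: "(\<lambda>n. \<integral>x. (norm ((a n x - A x) *\<^sub>R G x))\<^sup>2 \<partial>lebesgue_on \<Omega>) \<longlonglongrightarrow> (\<integral>x. 0 \<partial>lebesgue_on \<Omega>)"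
  proof (rule integral_dominated_convergence[where w = "\<lambda>x. (2 * \<bar>c\<bar>)\<^sup>2 * (norm (G x))\<^sup>2"])
    show "integrable (lebesgue_on \<Omega>) (\<lambda>x. (2 * \<bar>c\<bar>)\<^sup>2 * (norm (G x))\<^sup>2)" using L2funD(2)[OF L2(4)] by simp
    show "AE x in lebesgue_on \<Omega>. norm ((norm ((a n x - A x) *\<^sub>R G x))\<^sup>2) \<le> (2 * \<bar>c\<bar>)\<^sup>2 * (norm (G x))\<^sup>2" for n
    proof (rule AE_I2)
      fix x
      have "(\<bar>a n x - A x\<bar> * norm (G x))\<^sup>2 \<le> (2 * \<bar>c\<bar> * norm (G x))\<^sup>2"
        by (intro power_mono mult_right_mono aA) auto
      then show "norm ((norm ((a n x - A x) *\<^sub>R G x))\<^sup>2) \<le> (2 * \<bar>c\<bar>)\<^sup>2 * (norm (G x))\<^sup>2"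
        by (simp add: power_mult_distrib)
    qed
    show "AE x in lebesgue_on \<Omega>. (\<lambda>n. (norm ((a n x - A x) *\<^sub>R G x))\<^sup>2) \<longlonglongrightarrow> 0"
      using AE
    proof (rule eventually_mono)
      fix x assume "(\<lambda>n. u (r n) x) \<longlonglongrightarrow> U x"
      then have "(\<lambda>n. a n x) \<longlonglongrightarrow> A x"
        unfolding a_def A_def by (intro tendsto_intros) (auto simp: cosh_real_nonzero)
      then have "(\<lambda>n. (norm ((a n x - A x) *\<^sub>R G x))\<^sup>2) \<longlonglongrightarrow> (norm ((A x - A x) *\<^sub>R G x))\<^sup>2"
        by (intro tendsto_intros)
      then show "(\<lambda>n. (norm ((a n x - A x) *\<^sub>R G x))\<^sup>2) \<longlonglongrightarrow> 0" by simp
    qed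
  qed measurable
  have "(\<lambda>n. \<integral>x. (norm (a n x *\<^sub>R (g (r n) x - G x) + (a n x - A x) *\<^sub>R G x))\<^sup>2 \<partial>lebesgue_on \<Omega>) \<longlonglongrightarrow> 0"
  proof (rule L2_tendsto_add[OF _ _ 2])
    show "L2fun \<Omega> (\<lambda>x. a n x *\<^sub>R (g (r n) x - G x))" for n
      by (rule L2fun_bound[OF d(2)[of "r n"], of _ "\<bar>c\<bar>"]) (use ab in \<open>auto intro!: mult_right_mono\<close>)
    show "L2fun \<Omega> (\<lambda>x. (a n x - A x) *\<^sub>R G x)" for n
      by (rule L2fun_bound[OF L2(4), of _ "2 * \<bar>c\<bar>"]) (use aA in \<open>auto intro!: mult_right_mono\<close>)
  qed (use 3 in simp)
  moreover have "a n x *\<^sub>R (g (r n) x - G x) + (a n x - A x) *\<^sub>R G x = a n x *\<^sub>R g (r n) x - A x *\<^sub>R G x" for n x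
    by (simp add: algebra_simps)
  ultimately have 4: "(\<lambda>n. \<integral>x. (norm (a n x *\<^sub>R g (r n) x - A x *\<^sub>R G x))\<^sup>2 \<partial>lebesgue_on \<Omega>) \<longlonglongrightarrow> 0" by simp
  show thesis using that[OF r(1) AE 1] 4 unfolding a_def A_def by blast
qed

lemma grad_tanh:
  assumes "\<psi> \<in> test_funs \<Omega>"
  shows "grad (\<lambda>x. tanh (c * \<psi> x)) x = (c * (1 - (tanh (c * \<psi> x))\<^sup>2)) *\<^sub>R grad \<psi> x"
proof -
  have "\<And>k. Ck k \<psi>" using assms test_funsE by metis
  note dp = Ck_Suc_has_derivative[OF this]
  have "((\<lambda>y. tanh (c * y)) has_real_derivative (1 - (tanh (c * \<psi> x))\<^sup>2) * c) (at (\<psi> x))"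
    by (auto intro!: derivative_eq_intros simp: cosh_real_nonzero)
  from DERIV_compose_FDERIV[OF this dp]
  have "frechet_derivative (\<lambda>x. tanh (c * \<psi> x)) (at x) = (\<lambda>e. frechet_derivative \<psi> (at x) e * ((1 - (tanh (c * \<psi> x))\<^sup>2) * c))"
    by (rule frechet_derivative_at[symmetric])
  then show ?thesis by (simp add: grad_def scaleR_sum_right mult_ac)
qed

text \<open>For a test function \<psi>, tanh (c \<psi>) is again a test function, with the classical
  gradient; \<open>tanh_chain_limit\<close> carries this along a sequence of test functions
  approximating u.\<close>

lemma H10_tanh:
  assumes O: "open \<Omega>" and u: "u \<in> elts (H10 \<Omega>)" and g: "H1_grad \<Omega> u g"
  shows "H1_grad \<Omega> (\<lambda>x. tanh (c * u x)) (\<lambda>x. (c * (1 - (tanh (c * u x))\<^sup>2)) *\<^sub>R g x)"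
    and "(\<lambda>x. tanh (c * u x)) \<in> elts (H10 \<Omega>)"
proof -
  obtain \<psi> where p: "\<And>n::nat. \<psi> n \<in> test_funs \<Omega>"
    "(\<lambda>n. \<integral>x. (norm (\<psi> n x - u x))\<^sup>2 \<partial>lebesgue_on \<Omega>) \<longlonglongrightarrow> 0"
    "(\<lambda>n. \<integral>x. (norm (grad (\<psi> n) x - g x))\<^sup>2 \<partial>lebesgue_on \<Omega>) \<longlonglongrightarrow> 0"
    by (rule H10_approx[OF O u g]) (rule that; assumption)
  have L2: "L2fun \<Omega> u" "L2fun \<Omega> g" using g by (auto simp: H1_grad_def)
  obtain r :: "nat \<Rightarrow> nat" where "strict_mono r"
    "AE x in lebesgue_on \<Omega>. (\<lambda>n. \<psi> (r n) x) \<longlonglongrightarrow> u x"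
    and r: "(\<lambda>n. \<integral>x. (norm (tanh (c * \<psi> (r n) x) - tanh (c * u x)))\<^sup>2 \<partial>lebesgue_on \<Omega>) \<longlonglongrightarrow> 0"
    "(\<lambda>n. \<integral>x. (norm ((c * (1 - (tanh (c * \<psi> (r n) x))\<^sup>2)) *\<^sub>R grad (\<psi> (r n)) x - (c * (1 - (tanh (c * u x))\<^sup>2)) *\<^sub>R g x))\<^sup>2 \<partial>lebesgue_on \<Omega>) \<longlonglongrightarrow> 0"
    by (rule tanh_chain_limit[OF test_funs_L2(1)[OF O p(1)] test_funs_L2(2)[OF O p(1)] L2 p(2,3), where c = c])
  note [measurable] = L2funD(1)[OF L2(1)] L2funD(1)[OF L2(2)]
  have [measurable]: "(\<lambda>x. tanh (c * u x)) \<in> borel_measurable (lebesgue_on \<Omega>)"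
  proof -
    have "(\<lambda>y::real. tanh (c * y)) \<in> borel_measurable borel"
      by (intro borel_measurable_continuous_onI continuous_intros) (auto simp: cosh_real_nonzero)
    from measurable_compose[OF L2funD(1)[OF L2(1)] this] show ?thesis .
  qed
  have L1: "L2fun \<Omega> (\<lambda>x. tanh (c * u x))"
    by (rule L2fun_bound[OF L2(1), of _ "\<bar>c\<bar>"]) (use abs_tanh_le(2) in \<open>auto simp: abs_mult[symmetric]\<close>)
  have L3: "L2fun \<Omega> (\<lambda>x. (c * (1 - (tanh (c * u x))\<^sup>2)) *\<^sub>R g x)"
  proof (rule L2fun_bound[OF L2(2), of _ "\<bar>c\<bar>"])
    have "\<bar>c * (1 - (tanh (c * u x))\<^sup>2)\<bar> \<le> \<bar>c\<bar>" for x
      using abs_tanh_le(3,4) unfolding abs_mult by (auto intro!: mult_left_le)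
    then show "AE x in lebesgue_on \<Omega>. norm ((c * (1 - (tanh (c * u x))\<^sup>2)) *\<^sub>R g x) \<le> \<bar>c\<bar> * norm (g x)"
      by (auto intro!: mult_right_mono)
  qed measurable
  have t: "(\<lambda>x. tanh (c * \<psi> (r n) x)) \<in> test_funs \<Omega>" for n using test_funs_tanh[OF p(1)] .
  have lim2: "(\<lambda>n. \<integral>x. (norm (grad (\<lambda>x. tanh (c * \<psi> (r n) x)) x - (c * (1 - (tanh (c * u x))\<^sup>2)) *\<^sub>R g x))\<^sup>2 \<partial>lebesgue_on \<Omega>) \<longlonglongrightarrow> 0"
    using r(2) grad_tanh[OF p(1)] by simp
  show H: "H1_grad \<Omega> (\<lambda>x. tanh (c * u x)) (\<lambda>x. (c * (1 - (tanh (c * u x))\<^sup>2)) *\<^sub>R g x)"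
    unfolding H1_grad_def
    using has_weak_gradient_L2_limit[OF O has_weak_gradient_test_fun[OF O t] test_funs_L2(1)[OF O t] test_funs_L2(2)[OF O t] L1 L3 r(1) lim2] L1 L3
    by blast
  show "(\<lambda>x. tanh (c * u x)) \<in> elts (H10 \<Omega>)"
    by (rule H10_I[OF O H t r(1) lim2])
qed

section \<open>Fubini's theorem for Lebesgue measure on product sets\<close>

lemma AE_lebesgue_on_iff_lborel:
  "S \<in> sets lebesgue \<Longrightarrow> (AE x in lebesgue_on S. P x) \<longleftrightarrow> (AE x in lborel. x \<in> S \<longrightarrow> P x)"
  by (subst AE_restrict_space_iff) (auto simp: AE_completion_iff)

lemma open_Times_lebesgue: "open A \<Longrightarrow> open B \<Longrightarrow> A \<times> B \<in> sets lebesgue"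
  using open_Times[of A B] by auto

text \<open>The exceptional set is null for the completed product measure; it is enclosed in a null
  set N of the product sigma-algebra, almost all of whose sections are null.\<close>

lemma AE_lebesgue_on_prodD:
  fixes A :: "'a::euclidean_space set" and B :: "'b::euclidean_space set"
  assumes AB: "open A" "open B" and P: "AE z in lebesgue_on (A \<times> B). P z"
  shows "AE t in lebesgue_on A. AE x in lebesgue_on B. P (t, x)"
    and "AE x in lebesgue_on B. AE t in lebesgue_on A. P (t, x)"
proof -
  have "AE z in lborel \<Otimes>\<^sub>M lborel. z \<in> A \<times> B \<longrightarrow> P z"
    using P unfolding AE_lebesgue_on_iff_lborel[OF open_Times_lebesgue[OF AB]] lborel_prod .
  then obtain N where N: "N \<in> sets (lborel \<Otimes>\<^sub>M lborel)" "emeasure (lborel \<Otimes>\<^sub>M lborel) N = 0"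
    "\<And>z. z \<notin> N \<Longrightarrow> z \<in> A \<times> B \<longrightarrow> P z"
    by (auto simp: eventually_ae_filter null_sets_def space_pair_measure)
  have N': "AE z in lborel \<Otimes>\<^sub>M lborel. z \<notin> N"
    using N by (intro AE_not_in) auto
  have 1: "AE t in lborel. AE x in lborel. (t, x) \<notin> N"
    by (rule lborel_pair.AE_pair[OF N'])
  have "{z \<in> space (lborel \<Otimes>\<^sub>M lborel). (fst z, snd z) \<notin> N} \<in> sets (lborel \<Otimes>\<^sub>M lborel)"
    using sets.compl_sets[OF N(1)] by (simp add: set_diff_eq Collect_conj_eq)
  then have 2: "AE x in lborel. AE t in lborel. (t, x) \<notin> N"
    using lborel_pair.AE_commute[of "\<lambda>t x. (t, x) \<notin> N"] 1 by simp
  have L: "A \<in> sets lebesgue" "B \<in> sets lebesgue" using AB by auto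
  show "AE t in lebesgue_on A. AE x in lebesgue_on B. P (t, x)"
    unfolding AE_lebesgue_on_iff_lborel[OF L(1)] AE_lebesgue_on_iff_lborel[OF L(2)]
    using 1
  proof (rule eventually_mono, intro impI)
    fix t assume "AE x in lborel. (t, x) \<notin> N" "t \<in> A"
    then show "AE x in lborel. x \<in> B \<longrightarrow> P (t, x)" using N(3) by (auto elim!: eventually_mono)
  qed
  show "AE x in lebesgue_on B. AE t in lebesgue_on A. P (t, x)"
    unfolding AE_lebesgue_on_iff_lborel[OF L(1)] AE_lebesgue_on_iff_lborel[OF L(2)]
    using 2
  proof (rule eventually_mono, intro impI)
    fix x assume "AE t in lborel. (t, x) \<notin> N" "x \<in> B"
    then show "AE t in lborel. t \<in> A \<longrightarrow> P (t, x)" using N(3) by (auto elim!: eventually_mono)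
  qed
qed

lemma AE_lebesgue_on_prod_fst:
  fixes A :: "'a::euclidean_space set" and B :: "'b::euclidean_space set"
  assumes AB: "open A" "open B" and P: "AE t in lebesgue_on A. P t"
  shows "AE z in lebesgue_on (A \<times> B). P (fst z)"
proof -
  have "AE t in lborel. t \<in> A \<longrightarrow> P t" using P AB by (subst (asm) AE_lebesgue_on_iff_lborel) auto
  then obtain N where N: "N \<in> sets lborel" "emeasure lborel N = 0" "\<And>t. t \<notin> N \<Longrightarrow> t \<in> A \<longrightarrow> P t"
    by (auto simp: eventually_ae_filter null_sets_def)
  have "emeasure (lborel \<Otimes>\<^sub>M lborel) (N \<times> (UNIV :: 'b set)) = 0"
    using N by (subst lborel.emeasure_pair_measure_Times) auto
  then have "AE z in lborel. z \<notin> N \<times> (UNIV :: 'b set)"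
    using N by (intro AE_not_in) (auto simp: null_sets_def lborel_prod[symmetric] intro: pair_measureI)
  then have "AE z in lborel. z \<in> A \<times> B \<longrightarrow> P (fst z)"
  proof (rule eventually_mono, intro impI)
    fix z :: "'a \<times> 'b" assume "z \<notin> N \<times> UNIV" "z \<in> A \<times> B"
    then have "fst z \<notin> N" "fst z \<in> A" by (auto simp: mem_Times_iff)
    then show "P (fst z)" using N(3) by blast
  qed
  then show ?thesis
    unfolding AE_lebesgue_on_iff_lborel[OF open_Times_lebesgue[OF AB]] .
qed

lemma AE_lebesgue_on_prod_snd:
  fixes A :: "'a::euclidean_space set" and B :: "'b::euclidean_space set"
  assumes AB: "open A" "open B" and P: "AE x in lebesgue_on B. P x"
  shows "AE z in lebesgue_on (A \<times> B). P (snd z)"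
proof -
  have "AE x in lborel. x \<in> B \<longrightarrow> P x" using P AB by (subst (asm) AE_lebesgue_on_iff_lborel) auto
  then obtain N where N: "N \<in> sets lborel" "emeasure lborel N = 0" "\<And>x. x \<notin> N \<Longrightarrow> x \<in> B \<longrightarrow> P x"
    by (auto simp: eventually_ae_filter null_sets_def)
  have "emeasure (lborel \<Otimes>\<^sub>M lborel) ((UNIV :: 'a set) \<times> N) = 0"
    using N by (subst lborel.emeasure_pair_measure_Times) auto
  then have "AE z in lborel. z \<notin> (UNIV :: 'a set) \<times> N"
    using N by (intro AE_not_in) (auto simp: null_sets_def lborel_prod[symmetric] intro: pair_measureI)
  then have "AE z in lborel. z \<in> A \<times> B \<longrightarrow> P (snd z)"
  proof (rule eventually_mono, intro impI)
    fix z :: "'a \<times> 'b" assume "z \<notin> UNIV \<times> N" "z \<in> A \<times> B"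
    then have "snd z \<notin> N" "snd z \<in> B" by (auto simp: mem_Times_iff)
    then show "P (snd z)" using N(3) by blast
  qed
  then show ?thesis
    unfolding AE_lebesgue_on_iff_lborel[OF open_Times_lebesgue[OF AB]] .
qed

lemma borel_measurable_lebesgue_on_AE:
  fixes f g :: "'a::euclidean_space \<Rightarrow> 'b::euclidean_space"
  assumes S: "S \<in> sets lebesgue" and f: "f \<in> borel_measurable (lebesgue_on S)"
    and ae: "AE x in lebesgue_on S. f x = g x"
  shows "g \<in> borel_measurable (lebesgue_on S)"
proof -
  have "(\<lambda>x. if x \<in> S then f x else 0) \<in> borel_measurable lebesgue"
    using f S by (simp add: borel_measurable_if)
  moreover have "AE x in lebesgue. (if x \<in> S then f x else 0) = (if x \<in> S then g x else 0)"
    using ae S by (subst (asm) AE_restrict_space_iff) (auto elim!: eventually_mono)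
  ultimately have "(\<lambda>x. if x \<in> S then g x else 0) \<in> borel_measurable lebesgue"
    by (rule borel_measurable_AE)
  then show ?thesis using S by (simp add: borel_measurable_if)
qed

lemma lebesgue_on_ex_borel:
  fixes f :: "'a::euclidean_space \<Rightarrow> real"
  assumes S: "S \<in> sets lebesgue" and f: "f \<in> borel_measurable (lebesgue_on S)"
  obtains f' where "f' \<in> borel_measurable borel" "AE x in lebesgue_on S. f x = f' x"
proof -
  have "(\<lambda>x. if x \<in> S then f x else 0) \<in> borel_measurable lebesgue"
    using f S by (simp add: borel_measurable_if)
  then obtain f' where f': "f' \<in> borel_measurable lborel" "AE x in lborel. (if x \<in> S then f x else 0) = f' x"
    using completion_ex_borel_measurable_real by blast
  show thesis
  proof (rule that[of f'])
    show "AE x in lebesgue_on S. f x = f' x"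
      using f'(2) S by (subst AE_lebesgue_on_iff_lborel) (auto elim!: eventually_mono)
  qed (use f' in simp)
qed

text \<open>Each factor is replaced by a Borel set that differs from it on a null set; by
  \<open>AE_lebesgue_on_prod_fst\<close> and \<open>AE_lebesgue_on_prod_snd\<close> the products
  then differ on a null set as well.\<close>

lemma Times_sets_lebesgue:
  fixes X :: "'a::euclidean_space set" and Y :: "'b::euclidean_space set"
  assumes "X \<in> sets lebesgue" "Y \<in> sets lebesgue"
  shows "X \<times> Y \<in> sets lebesgue"
proof -
  have null: "AE z in lebesgue. (fst z \<in> U \<and> snd z \<in> V) = (fst z \<in> U' \<and> snd z \<in> V')"
    if u: "AE t in lebesgue. (t \<in> U) = (t \<in> U')" and v: "AE x in lebesgue. (x \<in> V) = (x \<in> V')"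
    for U U' :: "'a set" and V V' :: "'b set"
  proof -
    have "AE z in lebesgue. (fst (z :: 'a \<times> 'b) \<in> U) = (fst z \<in> U')"
      using AE_lebesgue_on_prod_fst[of "UNIV :: 'a set" "UNIV :: 'b set" "\<lambda>t. (t \<in> U) = (t \<in> U')", unfolded lebesgue_on_UNIV_eq UNIV_Times_UNIV] u
      by simp
    moreover have "AE z in lebesgue. (snd (z :: 'a \<times> 'b) \<in> V) = (snd z \<in> V')"
      using AE_lebesgue_on_prod_snd[of "UNIV :: 'a set" "UNIV :: 'b set" "\<lambda>x. (x \<in> V) = (x \<in> V')", unfolded lebesgue_on_UNIV_eq UNIV_Times_UNIV] v
      by simp
    ultimately show ?thesis by eventually_elim auto
  qed
  have ex: "\<exists>U'\<in>sets borel. AE t in lebesgue. (t \<in> U) = (t \<in> U')" if "U \<in> sets lebesgue" for U :: "'c::euclidean_space set"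
  proof -
    have "indicat_real U \<in> borel_measurable lebesgue" "UNIV \<in> sets lebesgue" using that by auto
    then obtain f' where f': "f' \<in> borel_measurable borel" "AE x in lebesgue. indicat_real U x = f' x"
      using lebesgue_on_ex_borel[of UNIV "indicat_real U", unfolded lebesgue_on_UNIV_eq] by blast
    have "f' -` {1} \<inter> space borel \<in> sets borel" using f'(1) by (rule measurable_sets) auto
    moreover have "AE t in lebesgue. (t \<in> U) = (t \<in> f' -` {1})"
      using f'(2) by eventually_elim (auto simp: indicator_def split: if_splits)
    ultimately show ?thesis by (intro bexI[of _ "f' -` {1}"]) auto
  qed
  obtain U V where U: "U \<in> sets borel" "AE t in lebesgue. (t \<in> X) = (t \<in> U)"
    and V: "V \<in> sets borel" "AE x in lebesgue. (x \<in> Y) = (x \<in> V)"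
    using ex[OF assms(1)] ex[OF assms(2)] by blast
  have "U \<times> V \<in> sets (borel \<Otimes>\<^sub>M borel)" using U V by (intro pair_measureI) auto
  then have UV: "U \<times> V \<in> sets lebesgue" unfolding borel_prod by auto
  have "indicat_real (X \<times> Y) \<in> borel_measurable lebesgue"
  proof (rule borel_measurable_AE)
    show "indicat_real (U \<times> V) \<in> borel_measurable lebesgue" using UV by simp
    show "AE z in lebesgue. indicat_real (U \<times> V) z = indicat_real (X \<times> Y) z"
      using null[OF U(2) V(2)] by eventually_elim (auto simp: indicator_def mem_Times_iff)
  qed
  then show ?thesis by (simp add: borel_measurable_indicator_iff)
qed

text \<open>Measurability with respect to the completed sigma-algebras: preimages under the
  projection are products with one Lebesgue measurable factor, covered by
  \<open>Times_sets_lebesgue\<close>.\<close>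

lemma measurable_lebesgue_on_fst:
  fixes A :: "'a::euclidean_space set" and B :: "'b::euclidean_space set"
  assumes "open A" "open B" "f \<in> measurable (lebesgue_on A) M"
  shows "(\<lambda>z. f (fst z)) \<in> measurable (lebesgue_on (A \<times> B)) M"
proof (rule measurable_compose[OF _ assms(3)], rule measurableI)
  fix X assume "X \<in> sets (lebesgue_on A)"
  then have "X \<in> sets lebesgue" "X \<subseteq> A" using assms by (auto simp: sets_restrict_space_iff)
  moreover have "fst -` X \<inter> space (lebesgue_on (A \<times> B)) = X \<times> B" using \<open>X \<subseteq> A\<close> by auto
  ultimately show "fst -` X \<inter> space (lebesgue_on (A \<times> B)) \<in> sets (lebesgue_on (A \<times> B))"
    using assms Times_sets_lebesgue[of X B] by (auto simp: sets_restrict_space_iff open_Times)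
qed (use assms in auto)

lemma measurable_lebesgue_on_snd:
  fixes A :: "'a::euclidean_space set" and B :: "'b::euclidean_space set"
  assumes "open A" "open B" "f \<in> measurable (lebesgue_on B) M"
  shows "(\<lambda>z. f (snd z)) \<in> measurable (lebesgue_on (A \<times> B)) M"
proof (rule measurable_compose[OF _ assms(3)], rule measurableI)
  fix X assume "X \<in> sets (lebesgue_on B)"
  then have "X \<in> sets lebesgue" "X \<subseteq> B" using assms by (auto simp: sets_restrict_space_iff)
  moreover have "snd -` X \<inter> space (lebesgue_on (A \<times> B)) = A \<times> X" using \<open>X \<subseteq> B\<close> by auto
  ultimately show "snd -` X \<inter> space (lebesgue_on (A \<times> B)) \<in> sets (lebesgue_on (A \<times> B))"
    using assms Times_sets_lebesgue[of A X] by (auto simp: sets_restrict_space_iff open_Times)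
qed (use assms in auto)

lemma nn_integral_lebesgue_on:
  "S \<in> sets lebesgue \<Longrightarrow> (\<integral>\<^sup>+x. f x \<partial>lebesgue_on S) = (\<integral>\<^sup>+x. f x * indicator S x \<partial>lborel)"
  by (simp add: nn_integral_restrict_space nn_integral_completion)

text \<open>Lebesgue measure on the product is a completion, so f is exchanged for a Borel function
  f', extended by 0 to a function F on the whole space, where the theorem for product measures
  applies. Almost every section of f agrees almost everywhere with that of f'.\<close>

lemma Tonelli_lebesgue_on:
  fixes A :: "'a::euclidean_space set" and B :: "'b::euclidean_space set" and f :: "'a \<times> 'b \<Rightarrow> real"
  assumes AB: "open A" "open B" and f: "f \<in> borel_measurable (lebesgue_on (A \<times> B))"
  shows "(\<integral>\<^sup>+z. ennreal (f z) \<partial>lebesgue_on (A \<times> B)) = (\<integral>\<^sup>+t. \<integral>\<^sup>+x. ennreal (f (t, x)) \<partial>lebesgue_on B \<partial>lebesgue_on A)"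
    and "(\<integral>\<^sup>+z. ennreal (f z) \<partial>lebesgue_on (A \<times> B)) = (\<integral>\<^sup>+x. \<integral>\<^sup>+t. ennreal (f (t, x)) \<partial>lebesgue_on A \<partial>lebesgue_on B)"
proof -
  have L: "A \<in> sets lebesgue" "B \<in> sets lebesgue" "A \<times> B \<in> sets lebesgue" using AB open_Times_lebesgue[OF AB] by auto
  obtain f' where f'[measurable]: "f' \<in> borel_measurable borel" and eq: "AE z in lebesgue_on (A \<times> B). f z = f' z"
    using lebesgue_on_ex_borel[OF L(3) f] by blast
  define F where "F z = ennreal (f' z) * indicator (A \<times> B) z" for z
  have "open (A \<times> B)" using AB by (rule open_Times)
  then have [measurable]: "A \<times> B \<in> sets borel" by auto
  have F0: "F \<in> borel_measurable borel" unfolding F_def[abs_def] by measurable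
  then have F: "F \<in> borel_measurable (lborel \<Otimes>\<^sub>M lborel)" by (simp add: lborel_prod)
  have Q: "(\<integral>\<^sup>+z. ennreal (f z) \<partial>lebesgue_on (A \<times> B)) = (\<integral>\<^sup>+z. F z \<partial>(lborel \<Otimes>\<^sub>M lborel))"
  proof -
    have "(\<integral>\<^sup>+z. ennreal (f z) \<partial>lebesgue_on (A \<times> B)) = (\<integral>\<^sup>+z. ennreal (f' z) \<partial>lebesgue_on (A \<times> B))"
      by (intro nn_integral_cong_AE) (use eq in \<open>auto elim!: eventually_mono\<close>)
    then show ?thesis by (simp add: nn_integral_lebesgue_on[OF L(3)] F_def lborel_prod)
  qed
  note sec = AE_lebesgue_on_prodD[OF AB eq]
  show "(\<integral>\<^sup>+z. ennreal (f z) \<partial>lebesgue_on (A \<times> B)) = (\<integral>\<^sup>+t. \<integral>\<^sup>+x. ennreal (f (t, x)) \<partial>lebesgue_on B \<partial>lebesgue_on A)"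
  proof -
    have "(\<integral>\<^sup>+t. \<integral>\<^sup>+x. ennreal (f (t, x)) \<partial>lebesgue_on B \<partial>lebesgue_on A) = (\<integral>\<^sup>+t. \<integral>\<^sup>+x. ennreal (f' (t, x)) \<partial>lebesgue_on B \<partial>lebesgue_on A)"
    proof (rule nn_integral_cong_AE, rule eventually_mono[OF sec(1)])
      fix t assume "AE x in lebesgue_on B. f (t, x) = f' (t, x)"
      then show "(\<integral>\<^sup>+x. ennreal (f (t, x)) \<partial>lebesgue_on B) = (\<integral>\<^sup>+x. ennreal (f' (t, x)) \<partial>lebesgue_on B)"
        by (intro nn_integral_cong_AE) (auto elim!: eventually_mono)
    qed
    also have "\<dots> = (\<integral>\<^sup>+t. (\<integral>\<^sup>+x. ennreal (f' (t, x)) * indicator B x \<partial>lborel) * indicator A t \<partial>lborel)"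
      unfolding nn_integral_lebesgue_on[OF L(1)] nn_integral_lebesgue_on[OF L(2)] ..
    also have "\<dots> = (\<integral>\<^sup>+t. (\<integral>\<^sup>+x. F (t, x) \<partial>lborel) \<partial>lborel)"
    proof (rule nn_integral_cong)
      fix t
      have F_eq: "F (t, x) = (ennreal (f' (t, x)) * indicator B x) * indicator A t" for x
        by (auto simp: F_def indicator_def)
      show "(\<integral>\<^sup>+x. ennreal (f' (t, x)) * indicator B x \<partial>lborel) * indicator A t = (\<integral>\<^sup>+x. F (t, x) \<partial>lborel)"
        by (cases "t \<in> A") (simp_all add: F_eq)
    qed
    also have "\<dots> = (\<integral>\<^sup>+z. F z \<partial>(lborel \<Otimes>\<^sub>M lborel))" by (rule lborel.nn_integral_fst[OF F])
    finally show ?thesis using Q by simp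
  qed
  show "(\<integral>\<^sup>+z. ennreal (f z) \<partial>lebesgue_on (A \<times> B)) = (\<integral>\<^sup>+x. \<integral>\<^sup>+t. ennreal (f (t, x)) \<partial>lebesgue_on A \<partial>lebesgue_on B)"
  proof -
    have "(\<integral>\<^sup>+x. \<integral>\<^sup>+t. ennreal (f (t, x)) \<partial>lebesgue_on A \<partial>lebesgue_on B) = (\<integral>\<^sup>+x. \<integral>\<^sup>+t. ennreal (f' (t, x)) \<partial>lebesgue_on A \<partial>lebesgue_on B)"
    proof (rule nn_integral_cong_AE, rule eventually_mono[OF sec(2)])
      fix x assume "AE t in lebesgue_on A. f (t, x) = f' (t, x)"
      then show "(\<integral>\<^sup>+t. ennreal (f (t, x)) \<partial>lebesgue_on A) = (\<integral>\<^sup>+t. ennreal (f' (t, x)) \<partial>lebesgue_on A)"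
        by (intro nn_integral_cong_AE) (auto elim!: eventually_mono)
    qed
    also have "\<dots> = (\<integral>\<^sup>+x. (\<integral>\<^sup>+t. ennreal (f' (t, x)) * indicator A t \<partial>lborel) * indicator B x \<partial>lborel)"
      unfolding nn_integral_lebesgue_on[OF L(1)] nn_integral_lebesgue_on[OF L(2)] ..
    also have "\<dots> = (\<integral>\<^sup>+x. (\<integral>\<^sup>+t. F (t, x) \<partial>lborel) \<partial>lborel)"
    proof (rule nn_integral_cong)
      fix x
      have F_eq: "F (t, x) = (ennreal (f' (t, x)) * indicator A t) * indicator B x" for t
        by (auto simp: F_def indicator_def)
      show "(\<integral>\<^sup>+t. ennreal (f' (t, x)) * indicator A t \<partial>lborel) * indicator B x = (\<integral>\<^sup>+t. F (t, x) \<partial>lborel)"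
        by (cases "x \<in> B") (simp_all add: F_eq)
    qed
    also have "\<dots> = (\<integral>\<^sup>+z. F z \<partial>(lborel \<Otimes>\<^sub>M lborel))" by (rule lborel_pair.nn_integral_snd[OF F[unfolded split_beta'[symmetric]], unfolded split_beta'])
    finally show ?thesis using Q by simp
  qed
qed

lemma integrable_lebesgue_on_lborel:
  fixes f :: "'a::euclidean_space \<Rightarrow> real"
  assumes S: "S \<in> sets borel" and f: "f \<in> borel_measurable borel"
  shows "integrable (lebesgue_on S) f \<longleftrightarrow> integrable lborel (\<lambda>x. indicator S x * f x)"
    and "(\<integral>x. f x \<partial>lebesgue_on S) = (\<integral>x. indicator S x * f x \<partial>lborel)"
proof -
  have m: "(\<lambda>x. indicator S x * f x) \<in> borel_measurable lborel" using S f by measurable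
  show "integrable (lebesgue_on S) f \<longleftrightarrow> integrable lborel (\<lambda>x. indicator S x * f x)"
    using S integrable_completion[OF m] by (simp add: integrable_restrict_space)
  show "(\<integral>x. f x \<partial>lebesgue_on S) = (\<integral>x. indicator S x * f x \<partial>lborel)"
    using S integral_completion[OF m] by (simp add: integral_restrict_space)
qed

text \<open>The same transfer to a Borel version as in \<open>Tonelli_lebesgue_on\<close>. The inner
  integrals are measurable because they agree almost everywhere with those of f', which are Borel
  functions of the outer variable.\<close>

lemma Fubini_lebesgue_on:
  fixes A :: "'a::euclidean_space set" and B :: "'b::euclidean_space set" and f :: "'a \<times> 'b \<Rightarrow> real"
  assumes AB: "open A" "open B" and f: "integrable (lebesgue_on (A \<times> B)) f"
  shows "AE t in lebesgue_on A. integrable (lebesgue_on B) (\<lambda>x. f (t, x))"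
    and "integrable (lebesgue_on A) (\<lambda>t. \<integral>x. f (t, x) \<partial>lebesgue_on B)"
    and "(\<integral>t. \<integral>x. f (t, x) \<partial>lebesgue_on B \<partial>lebesgue_on A) = (\<integral>z. f z \<partial>lebesgue_on (A \<times> B))"
    and "AE x in lebesgue_on B. integrable (lebesgue_on A) (\<lambda>t. f (t, x))"
    and "integrable (lebesgue_on B) (\<lambda>x. \<integral>t. f (t, x) \<partial>lebesgue_on A)"
    and "(\<integral>x. \<integral>t. f (t, x) \<partial>lebesgue_on A \<partial>lebesgue_on B) = (\<integral>z. f z \<partial>lebesgue_on (A \<times> B))"
proof -
  have L: "A \<in> sets lebesgue" "B \<in> sets lebesgue" "A \<times> B \<in> sets lebesgue" using AB open_Times_lebesgue[OF AB] by auto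
  have [measurable]: "A \<in> sets borel" "B \<in> sets borel" using AB by auto
  have "open (A \<times> B)" using AB by (rule open_Times)
  then have [measurable]: "A \<times> B \<in> sets borel" by auto
  obtain f' where f'[measurable]: "f' \<in> borel_measurable borel" and eq: "AE z in lebesgue_on (A \<times> B). f z = f' z"
    using lebesgue_on_ex_borel[OF L(3)] f by blast
  define F where "F z = indicator (A \<times> B) z * f' z" for z
  have fi': "integrable (lebesgue_on (A \<times> B)) f'"
    by (rule integrable_cong_AE_imp[OF f _ eq]) (auto intro!: measurable_restrict_space1 measurable_completion)
  then have Fi: "integrable (lborel \<Otimes>\<^sub>M lborel) F"
    unfolding F_def[abs_def] by (subst (asm) integrable_lebesgue_on_lborel(1)) (auto simp: lborel_prod)
  have FI: "(\<integral>z. f z \<partial>lebesgue_on (A \<times> B)) = (\<integral>z. F z \<partial>(lborel \<Otimes>\<^sub>M lborel))"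
  proof -
    have "(\<integral>z. f z \<partial>lebesgue_on (A \<times> B)) = (\<integral>z. f' z \<partial>lebesgue_on (A \<times> B))"
      by (rule integral_cong_AE) (use f fi' eq in auto)
    then show ?thesis unfolding F_def[abs_def] by (subst (asm) integrable_lebesgue_on_lborel(2)) (auto simp: lborel_prod)
  qed
  have Ft: "F (t, x) = indicator A t * (indicator B x * f' (t, x))" for t x by (auto simp: F_def indicator_def)
  have sm: "(\<lambda>x. f' (t, x)) \<in> borel_measurable borel" "(\<lambda>t. f' (t, x)) \<in> borel_measurable borel" for t x
    using f' by (simp_all add: borel_prod[symmetric])
  have smL: "(\<lambda>x. f' (t, x)) \<in> borel_measurable (lebesgue_on B)" "(\<lambda>t. f' (t, x)) \<in> borel_measurable (lebesgue_on A)" for t x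
    using sm(1)[of t] sm(2)[of x] by (auto intro!: measurable_restrict_space1 measurable_completion)
  note sec = AE_lebesgue_on_prodD[OF AB eq]
  have int1: "AE t in lborel. integrable lborel (\<lambda>x. F (t, x))" by (rule lborel_pair.AE_integrable_fst'[OF Fi])
  have t_int: "AE t in lebesgue_on A. integrable (lebesgue_on B) (\<lambda>x. f' (t, x))"
    unfolding AE_lebesgue_on_iff_lborel[OF L(1)]
    using int1 by eventually_elim (auto simp: Ft integrable_lebesgue_on_lborel(1)[OF _ sm(1)])
  have t_eq: "(\<integral>x. F (t, x) \<partial>lborel) = indicator A t * (\<integral>x. f' (t, x) \<partial>lebesgue_on B)" for t
    by (simp add: Ft integrable_lebesgue_on_lborel(2)[OF _ sm(1)])
  have swap: "integrable (lborel \<Otimes>\<^sub>M lborel) (\<lambda>(x, t). F (t, x))"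
    using lborel_pair.integrable_product_swap[OF Fi] .
  have int2: "AE x in lborel. integrable lborel (\<lambda>t. F (t, x))" using lborel_pair.AE_integrable_fst'[OF swap] by simp
  have x_int: "AE x in lebesgue_on B. integrable (lebesgue_on A) (\<lambda>t. f' (t, x))"
    unfolding AE_lebesgue_on_iff_lborel[OF L(2)]
    using int2 by eventually_elim (auto simp: Ft mult.left_commute[of "indicator A _"] integrable_lebesgue_on_lborel(1)[OF _ sm(2)])
  have x_eq: "(\<integral>t. F (t, x) \<partial>lborel) = indicator B x * (\<integral>t. f' (t, x) \<partial>lebesgue_on A)" for x
    by (simp add: Ft mult.left_commute[of "indicator A _"] integrable_lebesgue_on_lborel(2)[OF _ sm(2)])
  have meas: "AE t in lebesgue_on A. (\<lambda>x. f (t, x)) \<in> borel_measurable (lebesgue_on B)"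
    using sec(1)
  proof (rule eventually_mono)
    fix t assume "AE x in lebesgue_on B. f (t, x) = f' (t, x)"
    then have "AE x in lebesgue_on B. f' (t, x) = f (t, x)" by (auto elim!: eventually_mono)
    then show "(\<lambda>x. f (t, x)) \<in> borel_measurable (lebesgue_on B)"
      by (rule borel_measurable_lebesgue_on_AE[OF L(2), rotated])
        (intro measurable_restrict_space1 measurable_completion, use sm in simp)
  qed
  have meas2: "AE x in lebesgue_on B. (\<lambda>t. f (t, x)) \<in> borel_measurable (lebesgue_on A)"
    using sec(2)
  proof (rule eventually_mono)
    fix x assume "AE t in lebesgue_on A. f (t, x) = f' (t, x)"
    then have "AE t in lebesgue_on A. f' (t, x) = f (t, x)" by (auto elim!: eventually_mono)
    then show "(\<lambda>t. f (t, x)) \<in> borel_measurable (lebesgue_on A)"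
      by (rule borel_measurable_lebesgue_on_AE[OF L(1), rotated])
        (intro measurable_restrict_space1 measurable_completion, use sm in simp)
  qed
  show "AE t in lebesgue_on A. integrable (lebesgue_on B) (\<lambda>x. f (t, x))"
    using sec(1) t_int meas
  proof eventually_elim
    case (elim t)
    then show ?case by (intro integrable_cong_AE_imp[OF elim(2) elim(3)]) (auto elim!: eventually_mono)
  qed
  show "AE x in lebesgue_on B. integrable (lebesgue_on A) (\<lambda>t. f (t, x))"
    using sec(2) x_int meas2
  proof eventually_elim
    case (elim x)
    then show ?case by (intro integrable_cong_AE_imp[OF elim(2) elim(3)]) (auto elim!: eventually_mono)
  qed
  have ieq: "AE t in lebesgue_on A. (\<integral>x. f' (t, x) \<partial>lebesgue_on B) = (\<integral>x. f (t, x) \<partial>lebesgue_on B)"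
    using sec(1) meas
  proof eventually_elim
    case (elim t)
    then show ?case
      by (intro integral_cong_AE smL) (auto elim!: eventually_mono)
  qed
  have ieq2: "AE x in lebesgue_on B. (\<integral>t. f' (t, x) \<partial>lebesgue_on A) = (\<integral>t. f (t, x) \<partial>lebesgue_on A)"
    using sec(2) meas2
  proof eventually_elim
    case (elim x)
    then show ?case
      by (intro integral_cong_AE smL) (auto elim!: eventually_mono)
  qed
  have g1: "(\<lambda>t. \<integral>x. f' (t, x) \<partial>lebesgue_on B) \<in> borel_measurable borel"
  proof -
    have "(\<lambda>t. \<integral>x. indicator B x * f' (t, x) \<partial>lborel) \<in> borel_measurable lborel"
      using f' by (intro lborel.borel_measurable_lebesgue_integral) (auto simp: split_beta' borel_prod[symmetric] lborel_prod intro!: borel_measurable_times)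
    then show ?thesis by (simp add: integrable_lebesgue_on_lborel(2)[OF _ sm(1)])
  qed
  have g2: "(\<lambda>x. \<integral>t. f' (t, x) \<partial>lebesgue_on A) \<in> borel_measurable borel"
  proof -
    have "(\<lambda>x. \<integral>t. indicator A t * f' (t, x) \<partial>lborel) \<in> borel_measurable lborel"
      using f' by (intro lborel.borel_measurable_lebesgue_integral) (auto simp: split_beta' borel_prod[symmetric] lborel_prod intro!: borel_measurable_times)
    then show ?thesis by (simp add: integrable_lebesgue_on_lborel(2)[OF _ sm(2)])
  qed
  have i1: "integrable (lebesgue_on A) (\<lambda>t. \<integral>x. f' (t, x) \<partial>lebesgue_on B)"
    using lborel_pair.integrable_fst'[OF Fi] g1 by (subst integrable_lebesgue_on_lborel(1)) (auto simp: t_eq)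
  have i2: "integrable (lebesgue_on B) (\<lambda>x. \<integral>t. f' (t, x) \<partial>lebesgue_on A)"
    using lborel_pair.integrable_fst'[OF swap] g2 by (subst integrable_lebesgue_on_lborel(1)) (auto simp: x_eq)
  have m1: "(\<lambda>t. \<integral>x. f (t, x) \<partial>lebesgue_on B) \<in> borel_measurable (lebesgue_on A)"
    by (rule borel_measurable_lebesgue_on_AE[OF L(1) _ ieq]) (use i1 in auto)
  have m2: "(\<lambda>x. \<integral>t. f (t, x) \<partial>lebesgue_on A) \<in> borel_measurable (lebesgue_on B)"
    by (rule borel_measurable_lebesgue_on_AE[OF L(2) _ ieq2]) (use i2 in auto)
  show "integrable (lebesgue_on A) (\<lambda>t. \<integral>x. f (t, x) \<partial>lebesgue_on B)"
    by (rule integrable_cong_AE_imp[OF i1 m1 ieq])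
  show "integrable (lebesgue_on B) (\<lambda>x. \<integral>t. f (t, x) \<partial>lebesgue_on A)"
    by (rule integrable_cong_AE_imp[OF i2 m2 ieq2])
  have "(\<integral>t. \<integral>x. f (t, x) \<partial>lebesgue_on B \<partial>lebesgue_on A) = (\<integral>t. \<integral>x. f' (t, x) \<partial>lebesgue_on B \<partial>lebesgue_on A)"
    by (rule integral_cong_AE[OF m1]) (use i1 ieq in \<open>auto elim!: eventually_mono\<close>)
  also have "\<dots> = (\<integral>t. \<integral>x. F (t, x) \<partial>lborel \<partial>lborel)"
    by (subst integrable_lebesgue_on_lborel(2)) (auto simp: t_eq g1)
  also have "\<dots> = (\<integral>z. F z \<partial>(lborel \<Otimes>\<^sub>M lborel))" by (rule lborel_pair.integral_fst'[OF Fi])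
  finally show "(\<integral>t. \<integral>x. f (t, x) \<partial>lebesgue_on B \<partial>lebesgue_on A) = (\<integral>z. f z \<partial>lebesgue_on (A \<times> B))" using FI by simp
  have "(\<integral>x. \<integral>t. f (t, x) \<partial>lebesgue_on A \<partial>lebesgue_on B) = (\<integral>x. \<integral>t. f' (t, x) \<partial>lebesgue_on A \<partial>lebesgue_on B)"
    by (rule integral_cong_AE[OF m2]) (use i2 ieq2 in \<open>auto elim!: eventually_mono\<close>)
  also have "\<dots> = (\<integral>x. \<integral>t. F (t, x) \<partial>lborel \<partial>lborel)"
    by (subst integrable_lebesgue_on_lborel(2)) (auto simp: x_eq g2)
  also have "\<dots> = (\<integral>z. (\<lambda>(x, t). F (t, x)) z \<partial>(lborel \<Otimes>\<^sub>M lborel))"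
    using lborel_pair.integral_fst'[OF swap] by simp
  also have "\<dots> = (\<integral>z. F z \<partial>(lborel \<Otimes>\<^sub>M lborel))"
    using Fi by (intro lborel_pair.integral_product_swap) auto
  finally show "(\<integral>x. \<integral>t. f (t, x) \<partial>lebesgue_on A \<partial>lebesgue_on B) = (\<integral>z. f z \<partial>lebesgue_on (A \<times> B))" using FI by simp
qed

text \<open>Tonelli in a form suited to Bochner spaces, where only the norms of the slices are known
  to be integrable in time.\<close>

lemma integrable_lebesgue_on_prodI:
  fixes A :: "'a::euclidean_space set" and B :: "'b::euclidean_space set" and f :: "'a \<times> 'b \<Rightarrow> real"
  assumes AB: "open A" "open B" and f: "f \<in> borel_measurable (lebesgue_on (A \<times> B))"
    and bound: "AE t in lebesgue_on A. integrable (lebesgue_on B) (\<lambda>x. f (t, x)) \<and> (\<integral>x. \<bar>f (t, x)\<bar> \<partial>lebesgue_on B) \<le> g t"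
    and g: "integrable (lebesgue_on A) g"
  shows "integrable (lebesgue_on (A \<times> B)) f"
proof (rule integrableI_bounded[OF f])
  have "(\<integral>\<^sup>+z. ennreal (norm (f z)) \<partial>lebesgue_on (A \<times> B)) = (\<integral>\<^sup>+t. \<integral>\<^sup>+x. ennreal (norm (f (t, x))) \<partial>lebesgue_on B \<partial>lebesgue_on A)"
    by (rule Tonelli_lebesgue_on(1)[OF AB]) (use f in measurable)
  also have "\<dots> \<le> (\<integral>\<^sup>+t. ennreal (norm (g t)) \<partial>lebesgue_on A)"
  proof (rule nn_integral_mono_AE, rule eventually_mono[OF bound])
    fix t assume t: "integrable (lebesgue_on B) (\<lambda>x. f (t, x)) \<and> (\<integral>x. \<bar>f (t, x)\<bar> \<partial>lebesgue_on B) \<le> g t"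
    then have "(\<integral>\<^sup>+x. ennreal (norm (f (t, x))) \<partial>lebesgue_on B) = ennreal (\<integral>x. norm (f (t, x)) \<partial>lebesgue_on B)"
      by (intro nn_integral_eq_integral integrable_norm) auto
    also have "\<dots> \<le> ennreal (norm (g t))" using t by (intro ennreal_leI) auto
    finally show "(\<integral>\<^sup>+x. ennreal (norm (f (t, x))) \<partial>lebesgue_on B) \<le> ennreal (norm (g t))" .
  qed
  also have "\<dots> < \<infinity>" using g by (simp add: integrable_iff_bounded)
  finally show "(\<integral>\<^sup>+z. ennreal (norm (f z)) \<partial>lebesgue_on (A \<times> B)) < \<infinity>" .
qed

lemma integrable_tensor:
  fixes A :: "'a::euclidean_space set" and B :: "'b::euclidean_space set" and f :: "'a \<Rightarrow> real" and g :: "'b \<Rightarrow> real"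
  assumes AB: "open A" "open B" and f: "integrable (lebesgue_on A) f" and g: "integrable (lebesgue_on B) g"
  shows "integrable (lebesgue_on (A \<times> B)) (\<lambda>z. f (fst z) * g (snd z))"
proof (rule integrable_lebesgue_on_prodI[OF AB])
  show "(\<lambda>z. f (fst z) * g (snd z)) \<in> borel_measurable (lebesgue_on (A \<times> B))"
    using measurable_lebesgue_on_fst[OF AB, of f] measurable_lebesgue_on_snd[OF AB, of g] f g
    by (intro borel_measurable_times) auto
  show "AE t in lebesgue_on A. integrable (lebesgue_on B) (\<lambda>x. f (fst (t, x)) * g (snd (t, x))) \<and>
     (\<integral>x. \<bar>f (fst (t, x)) * g (snd (t, x))\<bar> \<partial>lebesgue_on B) \<le> \<bar>f t\<bar> * (\<integral>x. \<bar>g x\<bar> \<partial>lebesgue_on B)"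
    using g by (auto simp: abs_mult)
qed (use f in auto)

section \<open>Convolution on the real line\<close>

text \<open>The integral runs over the whole line. For two functions that vanish on (-\<infinity>,0]
  it is the convolution over (0,t), while commutativity and associativity can be treated without end
  points.\<close>

definition cv :: "(real \<Rightarrow> real) \<Rightarrow> (real \<Rightarrow> real) \<Rightarrow> real \<Rightarrow> real" where
  "cv f g t = (\<integral>\<tau>. f (t - \<tau>) * g \<tau> \<partial>lborel)"

lemma integrable_shift_reflect:
  fixes f :: "real \<Rightarrow> real" assumes "integrable lborel f"
  shows "integrable lborel (\<lambda>t. f (t - s))" "(\<integral>t. f (t - s) \<partial>lborel) = (\<integral>t. f t \<partial>lborel)"
    "integrable lborel (\<lambda>t. f (s - t))" "(\<integral>t. f (s - t) \<partial>lborel) = (\<integral>t. f t \<partial>lborel)"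
  using lborel_integrable_real_affine[OF assms, of 1 "-s"] lborel_integral_real_affine[of 1 f "-s"]
    lborel_integrable_real_affine[OF assms, of "-1" s] lborel_integral_real_affine[of "-1" f s]
  by (simp_all add: add.commute)

lemma cv_commute: "cv f g t = cv g f t"
  using lborel_integral_real_affine[of "-1" "\<lambda>\<tau>. f (t - \<tau>) * g \<tau>" t] by (simp add: cv_def mult.commute)

lemma cv_measurable [measurable]:
  fixes f g :: "real \<Rightarrow> real"
  assumes [measurable]: "f \<in> borel_measurable borel" "g \<in> borel_measurable borel"
  shows "cv f g \<in> borel_measurable borel"
proof -
  have "(\<lambda>t. \<integral>\<tau>. f (t - \<tau>) * g \<tau> \<partial>lborel) \<in> borel_measurable borel" by measurable
  then show ?thesis by (simp add: cv_def[abs_def])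
qed

lemma cv_pair_integrable:
  fixes f g :: "real \<Rightarrow> real"
  assumes f: "integrable lborel f" and g: "integrable lborel g"
  shows "integrable (lborel \<Otimes>\<^sub>M lborel) (\<lambda>(\<tau>, t). f (t - \<tau>) * g \<tau>)"
proof (rule lborel_pair.Fubini_integrable)
  have [measurable]: "f \<in> borel_measurable borel" "g \<in> borel_measurable borel" using f g by auto
  show "(\<lambda>(\<tau>, t). f (t - \<tau>) * g \<tau>) \<in> borel_measurable (lborel \<Otimes>\<^sub>M lborel)" by measurable
  have "(\<integral>t. \<bar>f (t - \<tau>)\<bar> \<partial>lborel) = (\<integral>t. \<bar>f t\<bar> \<partial>lborel)" for \<tau>
    using integrable_shift_reflect(2)[of "\<lambda>t. \<bar>f t\<bar>" \<tau>] f by simp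
  then show "integrable lborel (\<lambda>\<tau>. \<integral>t. norm (case (\<tau>, t) of (\<tau>, t) \<Rightarrow> f (t - \<tau>) * g \<tau>) \<partial>lborel)"
    using g by (simp add: abs_mult)
  show "AE \<tau> in lborel. integrable lborel (\<lambda>t. case (\<tau>, t) of (\<tau>, t) \<Rightarrow> f (t - \<tau>) * g \<tau>)"
    using integrable_shift_reflect(1)[OF f] by simp
qed

lemma cv_integrable:
  fixes f g :: "real \<Rightarrow> real"
  assumes f: "integrable lborel f" and g: "integrable lborel g"
  shows "AE t in lborel. integrable lborel (\<lambda>\<tau>. f (t - \<tau>) * g \<tau>)"
    and "integrable lborel (cv f g)"
    and "(\<integral>t. cv f g t \<partial>lborel) = (\<integral>t. f t \<partial>lborel) * (\<integral>t. g t \<partial>lborel)"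
proof -
  note p = cv_pair_integrable[OF f g]
  note s = lborel_pair.integrable_product_swap[OF p]
  show "AE t in lborel. integrable lborel (\<lambda>\<tau>. f (t - \<tau>) * g \<tau>)"
    using lborel_pair.AE_integrable_fst'[OF s] by simp
  show "integrable lborel (cv f g)"
    using lborel_pair.integrable_fst'[OF s] by (simp add: cv_def[abs_def])
  have "(\<integral>t. cv f g t \<partial>lborel) = (\<integral>z. (case z of (x, y) \<Rightarrow> case (y, x) of (\<tau>, t) \<Rightarrow> f (t - \<tau>) * g \<tau>) \<partial>(lborel \<Otimes>\<^sub>M lborel))"
    using lborel_pair.integral_fst'[OF s] by (simp add: cv_def)
  also have "\<dots> = (\<integral>z. (case z of (\<tau>, t) \<Rightarrow> f (t - \<tau>) * g \<tau>) \<partial>(lborel \<Otimes>\<^sub>M lborel))"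
    using p by (intro lborel_pair.integral_product_swap) auto
  also have "\<dots> = (\<integral>\<tau>. \<integral>t. f (t - \<tau>) * g \<tau> \<partial>lborel \<partial>lborel)"
    using lborel_pair.integral_fst'[OF p] by simp
  also have "\<dots> = (\<integral>t. f t \<partial>lborel) * (\<integral>t. g t \<partial>lborel)"
    using integrable_shift_reflect(2)[OF f] by simp
  finally show "(\<integral>t. cv f g t \<partial>lborel) = (\<integral>t. f t \<partial>lborel) * (\<integral>t. g t \<partial>lborel)" .
qed

lemma cv_norm_le:
  fixes f g :: "real \<Rightarrow> real"
  assumes f: "integrable lborel f" and g: "integrable lborel g"
  shows "(\<integral>t. \<bar>cv f g t\<bar> \<partial>lborel) \<le> (\<integral>t. \<bar>f t\<bar> \<partial>lborel) * (\<integral>t. \<bar>g t\<bar> \<partial>lborel)"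
proof -
  have "(\<integral>t. \<bar>cv f g t\<bar> \<partial>lborel) \<le> (\<integral>t. cv (\<lambda>t. \<bar>f t\<bar>) (\<lambda>t. \<bar>g t\<bar>) t \<partial>lborel)"
  proof (rule integral_mono)
    show "\<bar>cv f g t\<bar> \<le> cv (\<lambda>t. \<bar>f t\<bar>) (\<lambda>t. \<bar>g t\<bar>) t" for t
      unfolding cv_def using integral_abs_bound[of lborel "\<lambda>\<tau>. f (t - \<tau>) * g \<tau>"] by (simp add: abs_mult)
  qed (use cv_integrable(2) f g in auto)
  then show ?thesis using cv_integrable(3)[of "\<lambda>t. \<bar>f t\<bar>" "\<lambda>t. \<bar>g t\<bar>"] f g by simp
qed

text \<open>For fixed t the triple integrand is dominated by \<bar>f (t - s)\<bar> times
  \<open>gh\<close> s, the convolution of the absolute values of g and h, after integration in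
  \<tau>. This is integrable in s for almost every t, and for such t Fubini and a translation give
  the identity.\<close>

lemma cv_assoc:
  fixes f g h :: "real \<Rightarrow> real"
  assumes f: "integrable lborel f" and g: "integrable lborel g" and h: "integrable lborel h"
  shows "AE t in lborel. cv (cv f g) h t = cv f (cv g h) t"
proof -
  have [measurable]: "f \<in> borel_measurable borel" "g \<in> borel_measurable borel" "h \<in> borel_measurable borel"
    using f g h by auto
  define gh where "gh = cv (\<lambda>t. \<bar>g t\<bar>) (\<lambda>t. \<bar>h t\<bar>)"
  have gh: "integrable lborel gh" unfolding gh_def using g h by (intro cv_integrable(2)) auto
  have gh0: "gh t \<ge> 0" for t unfolding gh_def cv_def by (intro integral_nonneg_AE) auto
  have "AE t in lborel. integrable lborel (\<lambda>s. f (t - s) * gh s)" using cv_integrable(1)[OF f gh] .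
  moreover have ghi: "AE s in lborel. integrable lborel (\<lambda>\<tau>. g (s - \<tau>) * h \<tau>)" using cv_integrable(1)[OF g h] .
  ultimately show ?thesis
  proof (rule_tac eventually_mono)
    fix t assume t: "integrable lborel (\<lambda>s. f (t - s) * gh s)"
    have pi: "integrable (lborel \<Otimes>\<^sub>M lborel) (\<lambda>(s, \<tau>). f (t - s) * (g (s - \<tau>) * h \<tau>))"
    proof (rule lborel_pair.Fubini_integrable)
      show "(\<lambda>(s, \<tau>). f (t - s) * (g (s - \<tau>) * h \<tau>)) \<in> borel_measurable (lborel \<Otimes>\<^sub>M lborel)" by measurable
      have "(\<integral>\<tau>. norm (f (t - s) * (g (s - \<tau>) * h \<tau>)) \<partial>lborel) = \<bar>f (t - s) * gh s\<bar>" for s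
        using gh0[of s] by (simp add: abs_mult gh_def cv_def)
      then show "integrable lborel (\<lambda>s. \<integral>\<tau>. norm (case (s, \<tau>) of (s, \<tau>) \<Rightarrow> f (t - s) * (g (s - \<tau>) * h \<tau>)) \<partial>lborel)"
        using t by simp
      show "AE s in lborel. integrable lborel (\<lambda>\<tau>. case (s, \<tau>) of (s, \<tau>) \<Rightarrow> f (t - s) * (g (s - \<tau>) * h \<tau>))"
        using ghi by eventually_elim simp
    qed
    note ps = lborel_pair.integrable_product_swap[OF pi]
    have "cv f (cv g h) t = (\<integral>s. \<integral>\<tau>. f (t - s) * (g (s - \<tau>) * h \<tau>) \<partial>lborel \<partial>lborel)"
      by (simp add: cv_def)
    also have "\<dots> = (\<integral>z. (case z of (s, \<tau>) \<Rightarrow> f (t - s) * (g (s - \<tau>) * h \<tau>)) \<partial>(lborel \<Otimes>\<^sub>M lborel))"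
      using lborel_pair.integral_fst'[OF pi] by simp
    also have "\<dots> = (\<integral>z. (case z of (\<tau>, s) \<Rightarrow> case (s, \<tau>) of (s, \<tau>) \<Rightarrow> f (t - s) * (g (s - \<tau>) * h \<tau>)) \<partial>(lborel \<Otimes>\<^sub>M lborel))"
      using pi by (intro lborel_pair.integral_product_swap[symmetric]) auto
    also have "\<dots> = (\<integral>\<tau>. \<integral>s. f (t - s) * (g (s - \<tau>) * h \<tau>) \<partial>lborel \<partial>lborel)"
      using lborel_pair.integral_fst'[OF ps] by simp
    also have "\<dots> = (\<integral>\<tau>. cv f g (t - \<tau>) * h \<tau> \<partial>lborel)"
    proof (rule Bochner_Integration.integral_cong)
      fix \<tau>
      have "(\<integral>s. f (t - s) * (g (s - \<tau>) * h \<tau>) \<partial>lborel) = (\<integral>s. f (t - (\<tau> + 1 * s)) * (g (\<tau> + 1 * s - \<tau>) * h \<tau>) \<partial>lborel)"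
        using lborel_integral_real_affine[of 1 "\<lambda>s. f (t - s) * (g (s - \<tau>) * h \<tau>)" \<tau>] by simp
      also have "\<dots> = (\<integral>s. (f (t - \<tau> - s) * g s) * h \<tau> \<partial>lborel)"
        by (simp add: algebra_simps)
      also have "\<dots> = cv f g (t - \<tau>) * h \<tau>" by (simp add: cv_def)
      finally show "(\<integral>s. f (t - s) * (g (s - \<tau>) * h \<tau>) \<partial>lborel) = cv f g (t - \<tau>) * h \<tau>" .
    qed simp
    finally show "cv (cv f g) h t = cv f (cv g h) t" by (simp add: cv_def)
  qed
qed

lemma cv_causal: "\<lbrakk>\<And>t. t \<le> 0 \<Longrightarrow> f t = 0; \<And>t. t \<le> 0 \<Longrightarrow> g t = 0; t \<le> 0\<rbrakk> \<Longrightarrow> cv f g t = 0"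
proof -
  assume fg: "\<And>t. t \<le> 0 \<Longrightarrow> f t = 0" "\<And>t. t \<le> 0 \<Longrightarrow> g t = 0" "t \<le> 0"
  have "f (t - \<tau>) * g \<tau> = 0" for \<tau>
    using fg(1)[of "t - \<tau>"] fg(2)[of \<tau>] fg(3) by (cases "\<tau> \<le> 0") auto
  then show "cv f g t = 0" unfolding cv_def by (simp only: Bochner_Integration.integral_zero)
qed

text \<open>Causality: at a time t \<le> T the factor f (t - s) vanishes for s \<ge> T and the other
  factor for s \<le> 0, so only the values on (0,T) matter.\<close>

lemma cv_cong_right:
  fixes f g g' :: "real \<Rightarrow> real"
  assumes f: "\<And>t. t \<le> 0 \<Longrightarrow> f t = 0" and g: "\<And>t. t \<le> 0 \<Longrightarrow> g t = 0" "\<And>t. t \<le> 0 \<Longrightarrow> g' t = 0"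
    and eq: "AE s in lborel. 0 < s \<and> s < T \<longrightarrow> g s = g' s" and t: "t \<le> T"
    and [measurable]: "f \<in> borel_measurable borel" "g \<in> borel_measurable borel" "g' \<in> borel_measurable borel"
  shows "cv f g t = cv f g' t"
  unfolding cv_def
proof (rule integral_cong_AE)
  show "AE \<tau> in lborel. f (t - \<tau>) * g \<tau> = f (t - \<tau>) * g' \<tau>"
    using eq
  proof eventually_elim
    case (elim s)
    consider "s \<le> 0" | "s \<ge> T" | "0 < s" "s < T" by linarith
    then show ?case
    proof cases
      case 2 then show ?thesis using f[of "t - s"] t by simp
    qed (use g elim in auto)
  qed
qed measurable

text \<open>After commuting, the dependence on t sits in the bounded continuous factor, and
  continuity is dominated convergence.\<close>

lemma cv_bounded_continuous:
  fixes f g :: "real \<Rightarrow> real"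
  assumes f: "integrable lborel f" and g: "continuous_on UNIV g" "\<And>t. \<bar>g t\<bar> \<le> B"
  shows "continuous_on UNIV (cv f g)" and "\<bar>cv f g t\<bar> \<le> (\<integral>s. \<bar>f s\<bar> \<partial>lborel) * B"
proof -
  have [measurable]: "f \<in> borel_measurable borel" "g \<in> borel_measurable borel"
    using f g by (auto intro: borel_measurable_continuous_onI)
  have eq: "cv f g t = (\<integral>s. f s * g (t - s) \<partial>lborel)" for t
    using cv_commute[of f g t] by (simp add: cv_def mult.commute)
  have i: "integrable lborel (\<lambda>s. \<bar>f s\<bar> * B)" using f by simp
  have b: "AE s in lborel. norm (f s * g (t - s)) \<le> \<bar>f s\<bar> * B" for t
    using g(2) by (auto simp: abs_mult intro!: mult_left_mono)
  show "continuous_on UNIV (cv f g)"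
  proof (rule continuous_at_imp_continuous_on, rule ballI)
    fix t
    show "isCont (cv f g) t"
      unfolding continuous_at_sequentially o_def
    proof (intro allI impI)
      fix x assume x: "x \<longlonglongrightarrow> t"
      show "(\<lambda>n. cv f g (x n)) \<longlonglongrightarrow> cv f g t"
        unfolding eq
      proof (rule integral_dominated_convergence[OF _ _ i _ b])
        show "AE s in lborel. (\<lambda>n. f s * g (x n - s)) \<longlonglongrightarrow> f s * g (t - s)"
        proof (rule AE_I2)
          fix s
          have "isCont g (t - s)" using g(1) by (simp add: continuous_on_eq_continuous_at)
          then have "(\<lambda>n. g (x n - s)) \<longlonglongrightarrow> g (t - s)"
            by (rule isCont_tendsto_compose) (intro tendsto_intros x)
          then show "(\<lambda>n. f s * g (x n - s)) \<longlonglongrightarrow> f s * g (t - s)" by (intro tendsto_intros)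
        qed
      qed measurable
    qed
  qed
  have "\<bar>cv f g t\<bar> \<le> (\<integral>s. \<bar>f s * g (t - s)\<bar> \<partial>lborel)" unfolding eq by (rule integral_abs_bound)
  also have "\<dots> \<le> (\<integral>s. \<bar>f s\<bar> * B \<partial>lborel)"
  proof (rule integral_mono_AE[OF _ i])
    show "integrable lborel (\<lambda>s. \<bar>f s * g (t - s)\<bar>)"
      by (rule Bochner_Integration.integrable_bound[OF i]) (use b[of t] in \<open>auto elim!: eventually_mono\<close>)
  qed (use b[of t] in auto)
  finally show "\<bar>cv f g t\<bar> \<le> (\<integral>s. \<bar>f s\<bar> \<partial>lborel) * B" by simp
qed

text \<open>The set where f and g agree is closed and has full measure in (a,b), so it contains the
  interval.\<close>

lemma continuous_AE_eq:
  fixes f g :: "real \<Rightarrow> real"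
  assumes "continuous_on UNIV f" "continuous_on UNIV g"
    and ae: "AE s in lborel. a < s \<and> s < b \<longrightarrow> f s = g s" and t: "a < t" "t < b"
  shows "f t = g t"
proof -
  have "closed {s. f s = g s}" using assms(1,2) by (rule closed_Collect_eq)
  then have "t \<in> {s. f s = g s}"
    by (rule mem_closed_if_AE_lebesgue_open[of "{a<..<b}", rotated]) (use ae t in \<open>auto simp: AE_completion_iff\<close>)
  then show ?thesis by simp
qed

text \<open>Convolution with the unit step is integration from 0; through this, k * l = 1 turns a
  convolution with k and then with l into a primitive.\<close>

lemma cv_step:
  assumes f0: "\<And>t. t \<le> 0 \<Longrightarrow> f t = 0" and t: "t \<le> T"
  shows "cv (indicator {0<..<T}) f t = (\<integral>s. indicator {0<..<t} s * f s \<partial>lborel)"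
  unfolding cv_def
proof (rule Bochner_Integration.integral_cong)
  fix s show "indicator {0<..<T} (t - s) * f s = indicator {0<..<t} s * f s"
    using f0[of s] t by (cases "s \<le> 0") (auto simp: indicator_def)
qed simp

text \<open>Fubini and the translation t \<mapsto> \<tau> + t. The inner integral of l over (0,T -
  \<tau>) is the origin of \<open>weight\<close>.\<close>

lemma integral_cv_interval:
  fixes l h :: "real \<Rightarrow> real"
  assumes l: "integrable lborel l" "\<And>t. t \<le> 0 \<Longrightarrow> l t = 0" and h: "integrable lborel h" "\<And>t. t \<le> 0 \<Longrightarrow> h t = 0"
  shows "(\<integral>t. indicator {0<..<T} t * cv l h t \<partial>lborel)
    = (\<integral>t. indicator {0<..<T} t * ((\<integral>s. indicator {0<..<T - t} s * l s \<partial>lborel) * h t) \<partial>lborel)"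
proof -
  have [measurable]: "l \<in> borel_measurable borel" "h \<in> borel_measurable borel" using l h by auto
  have p: "integrable (lborel \<Otimes>\<^sub>M lborel) (\<lambda>(\<tau>, t). indicator {0<..<T} t * (l (t - \<tau>) * h \<tau>))"
  proof (rule Bochner_Integration.integrable_bound[OF cv_pair_integrable[OF l(1) h(1)]])
    show "AE z in lborel \<Otimes>\<^sub>M lborel. norm (case z of (\<tau>, t) \<Rightarrow> indicator {0<..<T} t * (l (t - \<tau>) * h \<tau>))
        \<le> norm (case z of (\<tau>, t) \<Rightarrow> l (t - \<tau>) * h \<tau>)"
      by (auto simp: indicator_def)
  qed measurable
  note s = lborel_pair.integrable_product_swap[OF p]
  have "(\<integral>t. indicator {0<..<T} t * cv l h t \<partial>lborel) = (\<integral>t. \<integral>\<tau>. indicator {0<..<T} t * (l (t - \<tau>) * h \<tau>) \<partial>lborel \<partial>lborel)"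
    by (simp add: cv_def)
  also have "\<dots> = (\<integral>z. (case z of (t, \<tau>) \<Rightarrow> case (\<tau>, t) of (\<tau>, t) \<Rightarrow> indicator {0<..<T} t * (l (t - \<tau>) * h \<tau>)) \<partial>(lborel \<Otimes>\<^sub>M lborel))"
    using lborel_pair.integral_fst'[OF s] by simp
  also have "\<dots> = (\<integral>z. (case z of (\<tau>, t) \<Rightarrow> indicator {0<..<T} t * (l (t - \<tau>) * h \<tau>)) \<partial>(lborel \<Otimes>\<^sub>M lborel))"
    using p by (intro lborel_pair.integral_product_swap) auto
  also have "\<dots> = (\<integral>\<tau>. \<integral>t. indicator {0<..<T} t * (l (t - \<tau>) * h \<tau>) \<partial>lborel \<partial>lborel)"
    using lborel_pair.integral_fst'[OF p] by simp
  also have "\<dots> = (\<integral>\<tau>. indicator {0<..<T} \<tau> * ((\<integral>s. indicator {0<..<T - \<tau>} s * l s \<partial>lborel) * h \<tau>) \<partial>lborel)"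
  proof (rule Bochner_Integration.integral_cong)
    fix \<tau>
    have "(\<integral>t. indicator {0<..<T} t * (l (t - \<tau>) * h \<tau>) \<partial>lborel) = (\<integral>t. indicator {0<..<T} (\<tau> + 1 * t) * (l (\<tau> + 1 * t - \<tau>) * h \<tau>) \<partial>lborel)"
      using lborel_integral_real_affine[of 1 "\<lambda>t. indicator {0<..<T} t * (l (t - \<tau>) * h \<tau>)" \<tau>] by simp
    also have "\<dots> = (\<integral>t. indicator {0<..<T} \<tau> * ((indicator {0<..<T - \<tau>} t * l t) * h \<tau>) \<partial>lborel)"
    proof (rule Bochner_Integration.integral_cong)
      fix t show "indicator {0<..<T} (\<tau> + 1 * t) * (l (\<tau> + 1 * t - \<tau>) * h \<tau>) = indicator {0<..<T} \<tau> * ((indicator {0<..<T - \<tau>} t * l t) * h \<tau>)"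
        using h(2)[of \<tau>] l(2)[of t] by (cases "\<tau> \<le> 0"; cases "t \<le> 0") (auto simp: indicator_def)
    qed simp
    finally show "(\<integral>t. indicator {0<..<T} t * (l (t - \<tau>) * h \<tau>) \<partial>lborel) = indicator {0<..<T} \<tau> * ((\<integral>s. indicator {0<..<T - \<tau>} s * l s \<partial>lborel) * h \<tau>)"
      by simp
  qed simp
  finally show ?thesis .
qed

section \<open>Monotone kernels\<close>

text \<open>Formally an integration by parts: \<tau> \<mapsto> k (t - \<tau>) is nonnegative and
  nondecreasing, F \<le> 0 and F t = 0. As k may blow up at 0 and need not be differentiable, the
  second mean value theorem is applied on [0, t - d], and then d \<rightarrow> 0. The boundary term
  is of size d k(d), which tends to 0 because k is integrable and monotone.\<close>

lemma monotone_kernel_integral_nonneg: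
  fixes k e F :: "real \<Rightarrow> real"
  assumes t: "t > 0" and k0: "\<And>s. s > 0 \<Longrightarrow> k s \<ge> 0" and kmono: "\<And>s r. 0 < s \<Longrightarrow> s \<le> r \<Longrightarrow> k r \<le> k s"
    and ki: "integrable (lebesgue_on {0<..<t}) k"
    and F': "\<And>s. s \<in> {0..t} \<Longrightarrow> (F has_real_derivative e s) (at s within {0..t})"
    and e: "continuous_on {0..t} e"
    and F: "\<And>s. s \<in> {0..t} \<Longrightarrow> F s \<le> 0" and Ft: "F t = 0"
  shows "(\<integral>\<tau>. k (t - \<tau>) * e \<tau> \<partial>lebesgue_on {0<..<t}) \<ge> 0"
proof -
  obtain M where M: "\<And>s. s \<in> {0..t} \<Longrightarrow> \<bar>e s\<bar> \<le> M" "M \<ge> 0"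
  proof -
    have "bounded (e ` {0..t})" using e compact_continuous_image compact_imp_bounded by blast
    then obtain M where "\<forall>y\<in>e ` {0..t}. norm y \<le> M" using bounded_iff by blast
    then have "\<bar>e s\<bar> \<le> max M 0" if "s \<in> {0..t}" for s
    proof -
      have "norm (e s) \<le> M" using \<open>\<forall>y\<in>e ` {0..t}. norm y \<le> M\<close> that by blast
      then show ?thesis by simp
    qed
    then show thesis by (rule that[of "max M 0"]) auto
  qed
  have km: "(\<lambda>\<tau>. if \<tau> \<in> {0<..<t} then k \<tau> else 0) \<in> borel_measurable lebesgue"
    using ki by (simp add: borel_measurable_if del: greaterThanLessThan_iff)
  have kli: "integrable lebesgue (\<lambda>\<tau>. if \<tau> \<in> {0<..<t} then k \<tau> else 0)"
  proof -
    have "(\<lambda>\<tau>. if \<tau> \<in> {0<..<t} then k \<tau> else 0) = (\<lambda>\<tau>. indicator {0<..<t} \<tau> *\<^sub>R k \<tau>)" by (auto simp: indicator_def)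
    then show ?thesis using ki by (simp add: integrable_restrict_space)
  qed
  define kr where "kr \<tau> = (if \<tau> \<in> {0<..<t} then k (t - \<tau>) else 0)" for \<tau>
  have kri: "integrable lebesgue kr"
  proof -
    have "(\<lambda>\<tau>. if t + -1 * \<tau> \<in> {0<..<t} then k (t + -1 * \<tau>) else 0) = kr" by (auto simp: kr_def)
    moreover have "(\<lambda>\<tau>. if \<tau> \<in> {0<..<t} then k \<tau> else 0) \<in> borel_measurable borel"
    proof -
      have "(\<lambda>s. - k s) \<in> borel_measurable (restrict_space borel {0<..<t})"
        using kmono by (intro borel_measurable_mono_on_fnc mono_onI) auto
      then have "(\<lambda>\<tau>. indicator {0<..<t} \<tau> * k \<tau>) \<in> borel_measurable borel"
        by (simp add: borel_measurable_restrict_space_iff)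
      moreover have "(\<lambda>\<tau>. if \<tau> \<in> {0<..<t} then k \<tau> else 0) = (\<lambda>\<tau>. indicator {0<..<t} \<tau> * k \<tau>)" by auto
      ultimately show ?thesis by simp
    qed
    ultimately show ?thesis
      using kli lborel_integrable_real_affine[of "\<lambda>\<tau>. if \<tau> \<in> {0<..<t} then k \<tau> else 0" "-1" t]
      by (simp add: integrable_completion)
  qed
  define P where "P \<tau> = (if \<tau> \<in> {0<..<t} then k (t - \<tau>) * e \<tau> else 0)" for \<tau>
  have Pi: "integrable lebesgue P"
  proof (rule Bochner_Integration.integrable_bound)
    show "integrable lebesgue (\<lambda>\<tau>. M * kr \<tau>)" using kri by simp
    have "e \<in> borel_measurable (lebesgue_on {0<..<t})"
      using e by (intro continuous_imp_measurable_on_sets_lebesgue) (auto intro: continuous_on_subset)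
    then have "(\<lambda>\<tau>. if \<tau> \<in> {0<..<t} then e \<tau> else 0) \<in> borel_measurable lebesgue"
      by (simp add: borel_measurable_if del: greaterThanLessThan_iff)
    then have "(\<lambda>\<tau>. kr \<tau> * (if \<tau> \<in> {0<..<t} then e \<tau> else 0)) \<in> borel_measurable lebesgue" using kri by measurable
    moreover have "(\<lambda>\<tau>. kr \<tau> * (if \<tau> \<in> {0<..<t} then e \<tau> else 0)) = P" by (auto simp: kr_def P_def)
    ultimately show "P \<in> borel_measurable lebesgue" by simp
    show "AE \<tau> in lebesgue. norm (P \<tau>) \<le> norm (M * kr \<tau>)"
    proof (rule AE_I2)
      fix \<tau>
      show "norm (P \<tau>) \<le> norm (M * kr \<tau>)"
      proof (cases "\<tau> \<in> {0<..<t}")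
        case True
        then have "\<bar>k (t - \<tau>)\<bar> * \<bar>e \<tau>\<bar> \<le> \<bar>k (t - \<tau>)\<bar> * M" using M by (intro mult_left_mono) auto
        then show ?thesis using True M(2) by (simp add: P_def kr_def abs_mult mult.commute)
      next
        case False
        then have "P \<tau> = 0" unfolding P_def by (rule if_not_P)
        then show ?thesis by simp
      qed
    qed
  qed
  have int: "(\<integral>\<tau>. k (t - \<tau>) * e \<tau> \<partial>lebesgue_on {0<..<t}) = (\<integral>\<tau>. P \<tau> \<partial>lebesgue)"
  proof -
    have "P = (\<lambda>\<tau>. indicator {0<..<t} \<tau> *\<^sub>R (k (t - \<tau>) * e \<tau>))" by (auto simp: P_def)
    then show ?thesis by (simp add: integral_restrict_space)
  qed
  \<comment> \<open>The 2 in the denominator makes every d n strictly smaller than t.\<close>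
  define d where "d n = t / real (n + 2)" for n :: nat
  have d: "0 < d n" "d n < t" for n using t by (auto simp: d_def divide_less_eq)
  have d0: "d \<longlonglongrightarrow> 0"
    using LIMSEQ_ignore_initial_segment[OF tendsto_mult_left[OF lim_1_over_n, of t], of 2] by (simp add: d_def[abs_def])
  have lower: "(\<integral>\<tau>. indicator {0..t - d n} \<tau> * P \<tau> \<partial>lebesgue) \<ge> - (M * (d n * k (d n)))" for n
  proof -
    have dn: "0 \<le> t - d n" "t - d n < t" using d[of n] by auto
    have FTC: "(e has_integral F b - F a) {a..b}" if "0 \<le> a" "a \<le> b" "b \<le> t" for a b
      using that by (intro fundamental_theorem_of_calculus)
        (auto simp: has_real_derivative_iff_has_vector_derivative[symmetric] intro!: DERIV_subset[OF F'])
    have eint: "e integrable_on {0..t - d n}" using FTC[of 0 "t - d n"] dn by auto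
    obtain c where c: "c \<in> {0..t - d n}"
      "((\<lambda>x. k (t - x) * e x) has_integral (k (t - 0) * integral {0..c} e + k (t - (t - d n)) * integral {c..t - d n} e)) {0..t - d n}"
      using second_mean_value_theorem_full[of e 0 "t - d n" "\<lambda>x. k (t - x)"] eint dn d kmono by auto
    have ic: "integral {0..c} e = F c - F 0" "integral {c..t - d n} e = F (t - d n) - F c"
      using FTC[of 0 c] FTC[of c "t - d n"] c dn by (auto intro: integral_unique)
    have "(\<integral>\<tau>. indicator {0..t - d n} \<tau> * P \<tau> \<partial>lebesgue) = (\<integral>\<tau>. P \<tau> \<partial>lebesgue_on {0..t - d n})"
      by (simp add: integral_restrict_space)
    also have "\<dots> = integral {0..t - d n} P"
      using integrable_mult_indicator[OF _ Pi, of "{0..t - d n}"] by (intro lebesgue_integral_eq_integral) (auto simp: integrable_restrict_space)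
    also have "\<dots> = integral {0..t - d n} (\<lambda>x. k (t - x) * e x)"
      by (rule integral_spike[of "{0}"]) (use dn in \<open>auto simp: P_def\<close>)
    also have "\<dots> = k t * (F c - F 0) + k (d n) * (F (t - d n) - F c)"
      using c(2) ic by (simp add: integral_unique)
    \<comment> \<open>The difference of the two sides is - k t * F 0 - (k (d n) - k t) * F c; both
      terms are nonnegative because F \<le> 0 and k is nonincreasing.\<close>
    also have "\<dots> \<ge> k (d n) * F (t - d n)"
    proof -
      have "k t * F 0 \<le> 0" using k0[OF t] F[of 0] t by (simp add: mult_nonneg_nonpos)
      moreover have "(k (d n) - k t) * F c \<le> 0"
        using kmono[of "d n" t] d[of n] F[of c] c(1) by (intro mult_nonneg_nonpos) auto
      ultimately show ?thesis by (simp add: algebra_simps)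
    qed
    finally have 1: "(\<integral>\<tau>. indicator {0..t - d n} \<tau> * P \<tau> \<partial>lebesgue) \<ge> k (d n) * F (t - d n)" .
    have "\<bar>F t - F (t - d n)\<bar> \<le> M * d n"
    proof -
      have "(e has_integral F t - F (t - d n)) {t - d n..t}" using FTC dn by auto
      then have "norm (F t - F (t - d n)) \<le> M * measure lborel (cbox (t - d n) t)"
        by (intro has_integral_bound[of _ e]) (use M dn in auto)
      then show ?thesis using d[of n] by simp
    qed
    then have "F (t - d n) \<ge> - (M * d n)" using Ft by simp
    then have "k (d n) * F (t - d n) \<ge> k (d n) * (- (M * d n))" using k0[OF d(1)[of n]] by (intro mult_left_mono)
    then show ?thesis using 1 by (simp add: mult_ac)
  qed
  have lim: "(\<lambda>n. \<integral>\<tau>. indicator {0..t - d n} \<tau> * P \<tau> \<partial>lebesgue) \<longlonglongrightarrow> (\<integral>\<tau>. P \<tau> \<partial>lebesgue)"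
  proof (rule integral_dominated_convergence[where w = "\<lambda>\<tau>. \<bar>P \<tau>\<bar>"])
    show "AE \<tau> in lebesgue. (\<lambda>n. indicator {0..t - d n} \<tau> * P \<tau>) \<longlonglongrightarrow> P \<tau>"
    proof (rule AE_I2)
      fix \<tau>
      show "(\<lambda>n. indicator {0..t - d n} \<tau> * P \<tau>) \<longlonglongrightarrow> P \<tau>"
      proof (cases "\<tau> \<in> {0<..<t}")
        case True
        then have "\<forall>\<^sub>F n in sequentially. d n < t - \<tau>" using d0 by (intro order_tendstoD(2)[OF d0]) auto
        then have "\<forall>\<^sub>F n in sequentially. indicator {0..t - d n} \<tau> * P \<tau> = P \<tau>"
          by eventually_elim (use True in auto)
        then show ?thesis by (rule tendsto_eventually)
      next
        case False
        then have "P \<tau> = 0" unfolding P_def by (rule if_not_P)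
        then show ?thesis by simp
      qed
    qed
    show "(\<lambda>\<tau>. indicat_real {0..t - d n} \<tau> * P \<tau>) \<in> borel_measurable lebesgue" for n
      using Pi by (intro borel_measurable_times borel_measurable_indicator) auto
  qed (use Pi in \<open>auto simp: indicator_def\<close>)
  \<comment> \<open>By monotonicity d k(d) is at most the integral of k over (0,d).\<close>
  have dk: "(\<lambda>n. d n * k (d n)) \<longlonglongrightarrow> 0"
  proof (rule nonneg_squeeze_tendsto_0)
    have "(\<lambda>n. \<integral>s. indicator {0<..<d n} s * (if s \<in> {0<..<t} then k s else 0) \<partial>lebesgue) \<longlonglongrightarrow> (\<integral>s. 0 \<partial>(lebesgue :: real measure))"
    proof (rule integral_dominated_convergence[where w = "\<lambda>s. \<bar>if s \<in> {0<..<t} then k s else 0\<bar>"])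
      show "AE s in lebesgue. (\<lambda>n. indicator {0<..<d n} s * (if s \<in> {0<..<t} then k s else 0)) \<longlonglongrightarrow> 0"
      proof (rule AE_I2)
        fix s
        show "(\<lambda>n. indicator {0<..<d n} s * (if s \<in> {0<..<t} then k s else 0)) \<longlonglongrightarrow> 0"
        proof (cases "s > 0")
          case True
          have "\<forall>\<^sub>F n in sequentially. d n < s" using True by (intro order_tendstoD(2)[OF d0]) auto
          then have "\<forall>\<^sub>F n in sequentially. indicator {0<..<d n} s * (if s \<in> {0<..<t} then k s else 0) = 0"
            by eventually_elim auto
          then show ?thesis by (rule tendsto_eventually)
        qed simp
      qed
      show "integrable lebesgue (\<lambda>s. \<bar>if s \<in> {0<..<t} then k s else 0\<bar>)" using integrable_abs[OF kli] .
      show "(\<lambda>s. indicat_real {0<..<d n} s * (if s \<in> {0<..<t} then k s else 0)) \<in> borel_measurable lebesgue" for n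
        using km by (intro borel_measurable_times borel_measurable_indicator) auto
    qed (auto simp: indicator_def)
    then show "(\<lambda>n. \<integral>s. indicator {0<..<d n} s * (if s \<in> {0<..<t} then k s else 0) \<partial>lebesgue) \<longlonglongrightarrow> 0" by simp
    show "0 \<le> d n * k (d n)" for n using d(1)[of n] k0[of "d n"] by simp
    show "d n * k (d n) \<le> (\<integral>s. indicator {0<..<d n} s * (if s \<in> {0<..<t} then k s else 0) \<partial>lebesgue)" for n
    proof -
      have "d n * k (d n) = (\<integral>s. indicator {0<..<d n} s * k (d n) \<partial>lebesgue)"
        using d(1)[of n] by (simp add: measure_completion)
      also have "\<dots> \<le> (\<integral>s. indicator {0<..<d n} s * (if s \<in> {0<..<t} then k s else 0) \<partial>lebesgue)"
      proof (rule integral_mono)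
        show "integrable lebesgue (\<lambda>s. indicat_real {0<..<d n} s * k (d n))"
          using d(1)[of n] by (intro integrable_mult_left integrable_real_indicator) (auto simp: emeasure_completion)
        show "integrable lebesgue (\<lambda>s. indicat_real {0<..<d n} s * (if s \<in> {0<..<t} then k s else 0))"
          using integrable_mult_indicator[OF _ kli, of "{0<..<d n}"] by simp
        show "indicat_real {0<..<d n} s * k (d n) \<le> indicat_real {0<..<d n} s * (if s \<in> {0<..<t} then k s else 0)" for s
          using kmono[of s "d n"] d[of n] by (auto simp: indicator_def)
      qed
      finally show ?thesis .
    qed
  qed
  have "(\<lambda>n. - (M * (d n * k (d n)))) \<longlonglongrightarrow> - (M * 0)" by (intro tendsto_intros dk)
  then have "- (M * 0) \<le> (\<integral>\<tau>. P \<tau> \<partial>lebesgue)" by (rule LIMSEQ_le[OF _ lim]) (use lower in auto)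
  then show ?thesis using int by simp
qed

section \<open>Dense smooth functions\<close>

definition C1_causal :: "(real \<Rightarrow> real) \<Rightarrow> (real \<Rightarrow> real) \<Rightarrow> bool" where
  "C1_causal D d \<longleftrightarrow> (\<forall>t. (D has_real_derivative d t) (at t)) \<and> continuous_on UNIV d \<and>
     (\<forall>t\<le>0. D t = 0 \<and> d t = 0)"

text \<open>Causal C1 approximations of the unit step. Positivity at every positive time is what the
  minimum principle for the resolvent needs.\<close>

definition ramp :: "nat \<Rightarrow> real \<Rightarrow> real" where
  "ramp n t = tanh (real n * flat_fun 0 t)"

lemma ramp_C1: "C1_causal (ramp n) (\<lambda>t. (1 - (ramp n t)\<^sup>2) * (n * flat_fun 2 t))"
proof -
  have d: "(flat_fun 0 has_real_derivative flat_fun 2 t) (at t)" for t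
    using flat_fun_has_derivative[of 0 t] by (simp add: numeral_2_eq_2)
  have c: "continuous_on UNIV (flat_fun m)" for m using Ck_flat_fun[of 0 m] by simp
  have "(ramp n has_real_derivative (1 - (ramp n t)\<^sup>2) * (n * flat_fun 2 t)) (at t)" for t
    unfolding ramp_def[abs_def]
    by (rule has_field_derivative_tanh[OF _ DERIV_cmult[OF d]]) (simp add: cosh_real_nonzero)
  moreover have "continuous_on UNIV (\<lambda>t. (1 - (ramp n t)\<^sup>2) * (n * flat_fun 2 t))"
    unfolding ramp_def by (intro continuous_intros c) (simp add: cosh_real_nonzero)
  ultimately show ?thesis by (auto simp: C1_causal_def ramp_def flat_fun_def)
qed

lemma ramp_bounds: "0 \<le> ramp n t" "ramp n t \<le> 1" "\<lbrakk>n > 0; t > 0\<rbrakk> \<Longrightarrow> ramp n t > 0"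
  using tanh_real_lt_1[of "n * flat_fun 0 t"] by (auto simp: ramp_def flat_fun_def)

lemma ramp_tendsto: "t > 0 \<Longrightarrow> (\<lambda>n. ramp n t) \<longlonglongrightarrow> 1"
proof -
  assume "t > 0"
  then have "flat_fun 0 t > 0" by (simp add: flat_fun_def)
  then have "filterlim (\<lambda>n. flat_fun 0 t * real n) at_top sequentially"
    by (intro filterlim_tendsto_pos_mult_at_top[OF tendsto_const _ filterlim_real_sequentially])
  then have "(\<lambda>n. tanh (flat_fun 0 t * real n)) \<longlonglongrightarrow> 1" by (rule filterlim_compose[OF tanh_real_at_top])
  then show "(\<lambda>n. ramp n t) \<longlonglongrightarrow> 1" by (simp add: ramp_def mult.commute)
qed

text \<open>Four approximations, each costing at most \<epsilon>/4: truncation of f, continuous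
  functions, polynomials by Weierstrass, and multiplication with a ramp that makes the function and
  its derivative vanish for t \<le> 0.\<close>

lemma C1_causal_dense:
  fixes f :: "real \<Rightarrow> real"
  assumes f: "integrable lborel f" and T: "T > 0" and \<epsilon>: "\<epsilon> > 0"
  obtains D d where "C1_causal D d" "(\<integral>t. indicator {0<..<T} t * \<bar>D t - f t\<bar> \<partial>lborel) < \<epsilon>"
proof -
  let ?I = "\<lambda>t. indicat_real {0<..<T} t"
  have [measurable]: "f \<in> borel_measurable borel" using f by auto
  have finT: "integrable lborel (\<lambda>t. ?I t * c)" for c
    using T by (intro integrable_mult_left integrable_real_indicator) auto
  have bi: "integrable lborel (\<lambda>t. ?I t * \<bar>g t\<bar>)" if [measurable]: "g \<in> borel_measurable borel" and "\<And>t. t \<in> {0<..<T} \<Longrightarrow> \<bar>g t\<bar> \<le> c" for g c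
    by (rule Bochner_Integration.integrable_bound[OF finT[of c]]) (use that(2) in \<open>auto simp: indicator_def intro!: AE_I2\<close>, force)
  have fi: "integrable lborel (\<lambda>t. ?I t * \<bar>f t\<bar>)"
    by (rule Bochner_Integration.integrable_bound[OF f]) (auto simp: indicator_def)
  define fM where "fM M t = max (- real M) (min (real M) (f t))" for M t
  have fMm[measurable]: "fM M \<in> borel_measurable borel" for M unfolding fM_def[abs_def] by measurable
  have fMb: "\<bar>fM M t\<bar> \<le> real M" for M t by (auto simp: fM_def)
  have "(\<lambda>M. \<integral>t. ?I t * \<bar>fM M t - f t\<bar> \<partial>lborel) \<longlonglongrightarrow> (\<integral>t. 0 \<partial>(lborel :: real measure))"
  proof (rule integral_dominated_convergence[where w = "\<lambda>t. ?I t * \<bar>f t\<bar>"])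
    show "AE t in lborel. (\<lambda>M. ?I t * \<bar>fM M t - f t\<bar>) \<longlonglongrightarrow> 0"
    proof (rule AE_I2)
      fix t
      obtain M0 where M0: "\<bar>f t\<bar> \<le> real M0" using real_arch_simple by blast
      have "\<forall>\<^sub>F M in sequentially. ?I t * \<bar>fM M t - f t\<bar> = 0"
        using eventually_ge_at_top[of M0]
      proof eventually_elim
        case (elim M)
        then have "real M0 \<le> real M" by simp
        then have "\<bar>f t\<bar> \<le> real M" using M0 by linarith
        then show ?case by (auto simp: fM_def)
      qed
      then show "(\<lambda>M. ?I t * \<bar>fM M t - f t\<bar>) \<longlonglongrightarrow> 0" by (rule tendsto_eventually)
    qed
    show "AE t in lborel. norm (?I t * \<bar>fM M t - f t\<bar>) \<le> ?I t * \<bar>f t\<bar>" for M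
      by (rule AE_I2) (auto simp: fM_def indicator_def)
  qed (use fi in auto)
  then have "\<forall>\<^sub>F M in sequentially. (\<integral>t. ?I t * \<bar>fM M t - f t\<bar> \<partial>lborel) < \<epsilon> / 4"
    using \<epsilon> by (intro order_tendstoD(2)[of _ 0]) auto
  then obtain M where M: "(\<integral>t. ?I t * \<bar>fM M t - f t\<bar> \<partial>lborel) < \<epsilon> / 4"
    using eventually_happens'[OF sequentially_bot] by blast
  have fMi: "integrable lborel (\<lambda>t. ?I t * fM M t)"
    using bi[OF fMm fMb] by (rule Bochner_Integration.integrable_bound) (auto simp: abs_mult)
  \<comment> \<open>\<open>measurable_on\<close> provides continuous functions converging off a
    negligible set; \<open>G\<close> truncates them again, so that they have a common bound and
    dominated convergence applies.\<close>
  have "(\<lambda>t. ?I t * fM M t) measurable_on UNIV"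
  proof (rule integrable_subintervals_imp_measurable)
    fix a b :: real
    have "integrable lebesgue (\<lambda>t. ?I t * fM M t)" using fMi by (subst integrable_completion) auto
    then show "(\<lambda>t. ?I t * fM M t) integrable_on cbox a b"
      by (meson integrable_on_lebesgue integrable_on_subcbox subset_UNIV)
  qed
  then obtain N g where Ng: "negligible N" "\<forall>n. continuous_on UNIV (g n)"
    "\<forall>x. x \<notin> N \<longrightarrow> (\<lambda>n. g n x) \<longlonglongrightarrow> (if x \<in> UNIV then ?I x * fM M x else 0)"
    unfolding measurable_on_def by blast
  then have N: "negligible N" and g: "\<And>n. continuous_on UNIV (g n)"
    "\<And>x. x \<notin> N \<Longrightarrow> (\<lambda>n. g n x) \<longlonglongrightarrow> ?I x * fM M x"
    by simp_all
  define G where "G n t = max (- real M) (min (real M) (g n t))" for n t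
  have Gc: "continuous_on UNIV (G n)" for n unfolding G_def[abs_def] by (intro continuous_intros g)
  then have [measurable]: "G n \<in> borel_measurable borel" for n by (rule borel_measurable_continuous_onI)
  have Gb: "\<bar>G n t\<bar> \<le> real M" for n t by (auto simp: G_def)
  have AEN: "AE t in lborel. t \<notin> N"
  proof -
    have "N \<in> null_sets lebesgue" using N negligible_iff_null_sets by blast
    then have "AE t in lebesgue. t \<notin> N" by (rule AE_not_in)
    then show ?thesis by (simp add: AE_completion_iff)
  qed
  have "(\<lambda>n. \<integral>t. ?I t * \<bar>G n t - fM M t\<bar> \<partial>lborel) \<longlonglongrightarrow> (\<integral>t. 0 \<partial>(lborel :: real measure))"
  proof (rule integral_dominated_convergence[where w = "\<lambda>t. ?I t * (2 * M)"])
    show "AE t in lborel. (\<lambda>n. ?I t * \<bar>G n t - fM M t\<bar>) \<longlonglongrightarrow> 0"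
      using AEN
    proof eventually_elim
      case (elim t)
      show ?case
      proof (cases "t \<in> {0<..<T}")
        case True
        then have "(\<lambda>n. g n t) \<longlonglongrightarrow> fM M t" using g(2)[OF elim] by simp
        then have "(\<lambda>n. G n t) \<longlonglongrightarrow> max (- real M) (min (real M) (fM M t))"
          unfolding G_def by (intro tendsto_intros)
        moreover have "max (- real M) (min (real M) (fM M t)) = fM M t" using fMb[of M t] by auto
        ultimately have "(\<lambda>n. ?I t * \<bar>G n t - fM M t\<bar>) \<longlonglongrightarrow> ?I t * \<bar>fM M t - fM M t\<bar>"
          by (intro tendsto_intros) auto
        then show ?thesis by simp
      qed simp
    qed
    show "AE t in lborel. norm (?I t * \<bar>G n t - fM M t\<bar>) \<le> ?I t * (2 * M)" for n
    proof (rule AE_I2)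
      fix t
      have "\<bar>G n t - fM M t\<bar> \<le> 2 * M" using Gb[of n t] fMb[of M t] by linarith
      then show "norm (?I t * \<bar>G n t - fM M t\<bar>) \<le> ?I t * (2 * M)" by (auto simp: indicator_def)
    qed
  qed (use finT in auto)
  then have "\<forall>\<^sub>F n in sequentially. (\<integral>t. ?I t * \<bar>G n t - fM M t\<bar> \<partial>lborel) < \<epsilon> / 4"
    using \<epsilon> by (intro order_tendstoD(2)[of _ 0]) auto
  then obtain n where n: "(\<integral>t. ?I t * \<bar>G n t - fM M t\<bar> \<partial>lborel) < \<epsilon> / 4"
    using eventually_happens'[OF sequentially_bot] by blast
  \<comment> \<open>The uniform tolerance is chosen such that its integral over (0,T) is
    \<epsilon>/4.\<close>
  obtain p where p: "real_polynomial_function p" "\<And>x. x \<in> {0..T} \<Longrightarrow> \<bar>G n x - p x\<bar> < \<epsilon> / (4 * T)"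
    using Stone_Weierstrass_real_polynomial_function[of "{0..T}" "G n" "\<epsilon> / (4 * T)"] T \<epsilon> continuous_on_subset[OF Gc]
    by (metis compact_Icc divide_pos_pos mult_pos_pos subset_UNIV zero_less_numeral)
  obtain p' where p': "real_polynomial_function p'" "\<And>x. (p has_real_derivative p' x) (at x)"
    using has_real_derivative_polynomial_function[OF p(1)] by blast
  have pc: "continuous_on UNIV p" "continuous_on UNIV p'"
    using p(1) p'(1) continuous_on_polymonial_function by (auto simp: real_polynomial_function_eq intro: continuous_on_polymonial_function)
  then have [measurable]: "p \<in> borel_measurable borel" by (intro borel_measurable_continuous_onI)
  have [measurable]: "ramp j \<in> borel_measurable borel" for j
    using ramp_C1[of j] by (intro borel_measurable_continuous_onI continuous_at_imp_continuous_on) (auto simp: C1_causal_def intro: DERIV_isCont)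
  define P where "P = real M + \<epsilon> / (4 * T)"
  have pb: "\<bar>p t\<bar> \<le> P" if "t \<in> {0<..<T}" for t
    using p(2)[of t] Gb[of n t] that by (auto simp: P_def)
  have "(\<lambda>j. \<integral>t. ?I t * \<bar>p t * ramp j t - p t\<bar> \<partial>lborel) \<longlonglongrightarrow> (\<integral>t. 0 \<partial>(lborel :: real measure))"
  proof (rule integral_dominated_convergence[where w = "\<lambda>t. ?I t * P"])
    show "AE t in lborel. (\<lambda>j. ?I t * \<bar>p t * ramp j t - p t\<bar>) \<longlonglongrightarrow> 0"
    proof (rule AE_I2)
      fix t
      show "(\<lambda>j. ?I t * \<bar>p t * ramp j t - p t\<bar>) \<longlonglongrightarrow> 0"
      proof (cases "t \<in> {0<..<T}")
        case True
        then have "(\<lambda>j. ?I t * \<bar>p t * ramp j t - p t\<bar>) \<longlonglongrightarrow> ?I t * \<bar>p t * 1 - p t\<bar>"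
          by (intro tendsto_intros ramp_tendsto) auto
        then show ?thesis by simp
      qed simp
    qed
    show "AE t in lborel. norm (?I t * \<bar>p t * ramp j t - p t\<bar>) \<le> ?I t * P" for j
    proof (rule AE_I2)
      fix t
      have "\<bar>p t * ramp j t - p t\<bar> = \<bar>p t\<bar> * \<bar>ramp j t - 1\<bar>" by (simp add: abs_mult[symmetric] algebra_simps)
      also have "\<dots> \<le> \<bar>p t\<bar> * 1" using ramp_bounds[of j t] by (intro mult_left_mono) auto
      finally show "norm (?I t * \<bar>p t * ramp j t - p t\<bar>) \<le> ?I t * P" using pb[of t] by (auto simp: indicator_def)
    qed
  qed (use finT in auto)
  then have "\<forall>\<^sub>F j in sequentially. (\<integral>t. ?I t * \<bar>p t * ramp j t - p t\<bar> \<partial>lborel) < \<epsilon> / 4"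
    using \<epsilon> by (intro order_tendstoD(2)[of _ 0]) auto
  then obtain j where j: "(\<integral>t. ?I t * \<bar>p t * ramp j t - p t\<bar> \<partial>lborel) < \<epsilon> / 4"
    using eventually_happens'[OF sequentially_bot] by blast
  define D where "D t = p t * ramp j t" for t
  define d where "d t = p' t * ramp j t + ((1 - (ramp j t)\<^sup>2) * (j * flat_fun 2 t)) * p t" for t
  have rc: "C1_causal (ramp j) (\<lambda>t. (1 - (ramp j t)\<^sup>2) * (j * flat_fun 2 t))" by (rule ramp_C1)
  have "continuous_on UNIV (ramp j)"
    using rc by (intro continuous_at_imp_continuous_on) (auto simp: C1_causal_def intro: DERIV_isCont)
  then have C1: "C1_causal D d"
    using rc pc unfolding C1_causal_def D_def d_def
    by (auto intro!: continuous_intros DERIV_mult p')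
  have 1: "integrable lborel (\<lambda>t. ?I t * \<bar>D t - p t\<bar>)"
  proof (rule bi[of _ P])
    fix t assume t: "t \<in> {0<..<T}"
    have "\<bar>D t - p t\<bar> = \<bar>p t\<bar> * \<bar>ramp j t - 1\<bar>" by (simp add: D_def abs_mult[symmetric] algebra_simps)
    also have "\<dots> \<le> \<bar>p t\<bar> * 1" using ramp_bounds[of j t] by (intro mult_left_mono) auto
    finally show "\<bar>D t - p t\<bar> \<le> P" using pb[OF t] by simp
  qed (simp add: D_def)
  have 2: "integrable lborel (\<lambda>t. ?I t * \<bar>p t - G n t\<bar>)"
    by (rule bi[of _ "\<epsilon> / (4 * T)"]) (use p(2) in \<open>auto simp: abs_minus_commute intro!: less_imp_le\<close>)
  have 3: "integrable lborel (\<lambda>t. ?I t * \<bar>G n t - fM M t\<bar>)"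
    by (rule bi[of _ "2 * M"]) (auto intro: order_trans[OF abs_triangle_ineq4 order_trans[OF add_mono[OF Gb fMb]]])
  have 4: "integrable lborel (\<lambda>t. ?I t * \<bar>fM M t - f t\<bar>)"
    by (rule Bochner_Integration.integrable_bound[OF fi]) (auto simp: fM_def indicator_def)
  have I2: "(\<integral>t. ?I t * \<bar>p t - G n t\<bar> \<partial>lborel) \<le> (\<integral>t. ?I t * (\<epsilon> / (4 * T)) \<partial>lborel)"
    by (rule integral_mono[OF 2 finT]) (use p(2) in \<open>auto simp: indicator_def abs_minus_commute intro!: less_imp_le\<close>)
  also have "\<dots> = \<epsilon> / 4" using T by simp
  finally have I2: "(\<integral>t. ?I t * \<bar>p t - G n t\<bar> \<partial>lborel) \<le> \<epsilon> / 4" .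
  have "(\<integral>t. ?I t * \<bar>D t - f t\<bar> \<partial>lborel) \<le> (\<integral>t. ?I t * \<bar>D t - p t\<bar> + ?I t * \<bar>p t - G n t\<bar> + ?I t * \<bar>G n t - fM M t\<bar> + ?I t * \<bar>fM M t - f t\<bar> \<partial>lborel)"
  proof (rule integral_mono')
    show "integrable lborel (\<lambda>t. ?I t * \<bar>D t - p t\<bar> + ?I t * \<bar>p t - G n t\<bar> + ?I t * \<bar>G n t - fM M t\<bar> + ?I t * \<bar>fM M t - f t\<bar>)"
      by (intro Bochner_Integration.integrable_add 1 2 3 4)
  qed (auto simp: indicator_def)
  also have "\<dots> = (\<integral>t. ?I t * \<bar>D t - p t\<bar> \<partial>lborel) + (\<integral>t. ?I t * \<bar>p t - G n t\<bar> \<partial>lborel) + (\<integral>t. ?I t * \<bar>G n t - fM M t\<bar> \<partial>lborel) + (\<integral>t. ?I t * \<bar>fM M t - f t\<bar> \<partial>lborel)"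
    using 1 2 3 4 by simp
  also have "\<dots> < \<epsilon>" using I2 M n j by (simp add: D_def)
  finally show thesis using C1 that by blast
qed

text \<open>Only at the single point s = t can the indicators fail to converge.\<close>

lemma integral_indicator_continuous:
  fixes l :: "real \<Rightarrow> real"
  assumes l: "integrable lborel l"
  shows "continuous_on UNIV (\<lambda>t. \<integral>s. indicator {0<..<t} s * l s \<partial>lborel)"
proof -
  have [measurable]: "l \<in> borel_measurable borel" using l by auto
  define L where "L t = (\<integral>s. indicator {0<..<t} s * l s \<partial>lborel)" for t
  have "continuous_on UNIV L"
  proof (rule continuous_at_imp_continuous_on, rule ballI)
    fix t
    show "isCont L t"
      unfolding continuous_at_sequentially o_def
    proof (intro allI impI)
      fix x assume x: "x \<longlonglongrightarrow> t"
      show "(\<lambda>n. L (x n)) \<longlonglongrightarrow> L t"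
        unfolding L_def
      proof (rule integral_dominated_convergence[where w = "\<lambda>s. \<bar>l s\<bar>"])
        have "AE s in lborel. s \<notin> {t}" by (intro AE_not_in) (auto intro: finite_imp_null_set_lborel)
        then show "AE s in lborel. (\<lambda>n. indicator {0<..<x n} s * l s) \<longlonglongrightarrow> indicator {0<..<t} s * l s"
        proof eventually_elim
          case (elim s)
          consider "s < t" | "s > t" using elim by fastforce
          then have "\<forall>\<^sub>F n in sequentially. indicator {0<..<x n} s * l s = indicator {0<..<t} s * l s"
          proof cases
            case 1
            show ?thesis using order_tendstoD(1)[OF x 1] by eventually_elim (use 1 in \<open>auto simp: indicator_def\<close>)
          next
            case 2
            show ?thesis using order_tendstoD(2)[OF x 2] by eventually_elim (use 2 in \<open>auto simp: indicator_def\<close>)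
          qed
          then show ?case by (rule tendsto_eventually)
        qed
      qed (use l in \<open>auto simp: indicator_def\<close>)
    qed
  qed
  then show ?thesis by (simp add: L_def[abs_def])
qed

lemma integral_derivative:
  assumes "continuous_on UNIV d" "\<And>s. s \<in> {0..t} \<Longrightarrow> (D has_real_derivative d s) (at s within {0..t})" "D 0 = 0" "t \<ge> 0"
  shows "(\<integral>s. indicator {0<..<t} s * d s \<partial>lborel) = D t"
proof -
  have c: "continuous_on {0..t} d" using assms(1) continuous_on_subset by blast
  have "(d has_integral D t - D 0) {0..t}"
    using assms by (intro fundamental_theorem_of_calculus) (auto simp: has_real_derivative_iff_has_vector_derivative)
  moreover have "set_integrable lborel {0..t} d"
    unfolding set_integrable_def using borel_integrable_atLeastAtMost'[OF c] by (simp add: set_integrable_def)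
  then have "(LINT x:{0..t}|lborel. d x) = integral {0..t} d" by (rule set_borel_integral_eq_integral(2))
  moreover have "(\<integral>s. indicator {0<..<t} s * d s \<partial>lborel) = (LINT x:{0..t}|lborel. d x)"
    unfolding set_lebesgue_integral_def
  proof (rule integral_cong_AE)
    have "AE s in lborel. s \<notin> {0, t}" by (intro AE_not_in) (auto intro: finite_imp_null_set_lborel)
    then show "AE s in lborel. indicator {0<..<t} s * d s = indicator {0..t} s *\<^sub>R d s"
      by eventually_elim (auto simp: indicator_def)
  qed (use borel_measurable_continuous_onI[OF assms(1)] in auto)
  ultimately show ?thesis using assms(3) by (simp add: integral_unique)
qed

section \<open>Volterra equations with monotone kernels\<close>

text \<open>Intended for kernels cut off to (0,T), which makes them integrable on the line at the
  price that k * l = 1 survives on (0,T) only; causality keeps all arguments inside that interval.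
  The monotonicity conditions concern k alone.\<close>

locale volterra_pair =
  fixes T :: real and k l :: "real \<Rightarrow> real"
  assumes T: "T > 0"
    and k: "integrable lborel k" "\<And>t. t \<le> 0 \<Longrightarrow> k t = 0" "\<And>t. k t \<ge> 0" "\<And>s r. 0 < s \<Longrightarrow> s \<le> r \<Longrightarrow> k r \<le> k s"
    and l: "integrable lborel l" "\<And>t. t \<le> 0 \<Longrightarrow> l t = 0"
    and kl: "AE t in lborel. 0 < t \<and> t < T \<longrightarrow> cv k l t = 1"
begin

abbreviation unit :: "real \<Rightarrow> real" where "unit \<equiv> indicator {0<..<T}"

lemma meas [measurable]: "k \<in> borel_measurable borel" "l \<in> borel_measurable borel"
  using k l by auto

lemma unit_integrable: "integrable lborel unit"
  using T by (intro integrable_real_indicator) auto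

lemma unit_causal: "t \<le> 0 \<Longrightarrow> unit t = 0" by simp

lemma cv_kl:
  assumes f: "integrable lborel f" "\<And>t. t \<le> 0 \<Longrightarrow> f t = 0" and t: "t \<le> T"
  shows "cv (cv k l) f t = cv unit f t"
proof -
  have "cv f (cv k l) t = cv f unit t"
    by (rule cv_cong_right[OF f(2) cv_causal[OF k(2) l(2)] unit_causal _ t]) (use f kl in \<open>auto elim!: eventually_mono\<close>)
  then show ?thesis by (simp add: cv_commute[of _ f])
qed

text \<open>The function d may grow after T, so it is frozen at its value at T before
  \<open>cv_bounded_continuous\<close> is applied; by causality the change is invisible up to
  T.\<close>

lemma cv_bounded_C0:
  assumes d: "continuous_on UNIV d" "\<And>t. t \<le> 0 \<Longrightarrow> d t = 0" and f: "integrable lborel f" "\<And>t. t \<le> 0 \<Longrightarrow> f t = 0"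
  obtains e where "continuous_on UNIV e" "\<And>t. t \<le> T \<Longrightarrow> e t = cv f d t" "\<And>t. t \<le> 0 \<Longrightarrow> e t = 0"
proof -
  define c where "c t = d (min t T)" for t
  have cc: "continuous_on UNIV c" unfolding c_def by (rule continuous_on_compose2[OF d(1)]) (auto intro!: continuous_intros)
  have "bounded (d ` {0..T})"
    using continuous_on_subset[OF d(1)] compact_continuous_image compact_imp_bounded by (metis compact_Icc subset_UNIV)
  then obtain B where B: "\<And>y. y \<in> d ` {0..T} \<Longrightarrow> norm y \<le> B" unfolding bounded_iff by blast
  have cb: "\<bar>c t\<bar> \<le> max B 0" for t
  proof (cases "t \<le> 0")
    case True then show ?thesis using d(2)[of t] T by (simp add: c_def)
  next
    case False
    then have "min t T \<in> {0..T}" using T by auto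
    then have "norm (d (min t T)) \<le> B" using B by blast
    then show ?thesis by (simp add: c_def)
  qed
  have [measurable]: "f \<in> borel_measurable borel" "c \<in> borel_measurable borel" "d \<in> borel_measurable borel"
    using f cc d by (auto intro: borel_measurable_continuous_onI)
  have c0: "\<And>t. t \<le> 0 \<Longrightarrow> c t = 0" using d T by (auto simp: c_def)
  show thesis
  proof (rule that[of "cv f c"])
    show "continuous_on UNIV (cv f c)" by (rule cv_bounded_continuous[OF f(1) cc cb])
    show "cv f c t = cv f d t" if "t \<le> T" for t
      by (rule cv_cong_right[OF f(2) c0 d(2) _ that]) (auto simp: c_def)
    show "cv f c t = 0" if "t \<le> 0" for t using cv_causal[OF f(2) c0 that] .
  qed
qed

text \<open>Take \<omega> = l * d and let w be its primitive. Associativity gives k * \<omega> = 1 *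
  d = D and l * D = 1 * \<omega> = w. The first identity is obtained at every time of (0,T), because
  later arguments evaluate it at single points.\<close>

lemma smooth_solution:
  assumes D: "C1_causal D d"
  obtains w \<omega> where "continuous_on UNIV \<omega>" "\<And>t. t \<le> 0 \<Longrightarrow> \<omega> t = 0" "w 0 = 0"
    "\<And>t. t \<in> {0..T} \<Longrightarrow> (w has_real_derivative \<omega> t) (at t within {0..T})"
    "\<And>t. 0 < t \<Longrightarrow> t < T \<Longrightarrow> cv k \<omega> t = D t"
    "AE t in lborel. 0 < t \<and> t < T \<longrightarrow> cv l D t = w t"
proof -
  have d: "continuous_on UNIV d" "\<And>t. t \<le> 0 \<Longrightarrow> d t = 0" "\<And>t. (D has_real_derivative d t) (at t)" "\<And>t. t \<le> 0 \<Longrightarrow> D t = 0"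
    using D by (auto simp: C1_causal_def)
  have Dc: "continuous_on UNIV D" using d(3) by (intro continuous_at_imp_continuous_on) (auto intro: DERIV_isCont)
  have [measurable]: "d \<in> borel_measurable borel" "D \<in> borel_measurable borel" using d(1) Dc by (auto intro: borel_measurable_continuous_onI)
  obtain \<omega> where o: "continuous_on UNIV \<omega>" "\<And>t. t \<le> T \<Longrightarrow> \<omega> t = cv l d t" "\<And>t. t \<le> 0 \<Longrightarrow> \<omega> t = 0"
    using cv_bounded_C0[OF d(1,2) l] by blast
  have [measurable]: "\<omega> \<in> borel_measurable borel" using o by (auto intro: borel_measurable_continuous_onI)
  define w where "w t = integral {0..t} \<omega>" for t
  have w0: "w 0 = 0" by (simp add: w_def)
  have wd: "(w has_real_derivative \<omega> t) (at t within {0..T})" if "t \<in> {0..T}" for t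
    unfolding w_def[abs_def] using that by (intro integral_has_real_derivative continuous_on_subset[OF o(1)]) auto
  \<comment> \<open>\<open>cv_assoc\<close> asks for integrable factors, so d is cut off outside
    (0,T).\<close>
  define dT where "dT t = unit t * d t" for t
  have dTi: "integrable lborel dT"
  proof -
    have "set_integrable lborel {0..T} d" using borel_integrable_atLeastAtMost'[OF continuous_on_subset[OF d(1)]] by blast
    then have "integrable lborel (\<lambda>t. indicator {0..T} t *\<^sub>R d t)" unfolding set_integrable_def .
    from integrable_mult_indicator[OF _ this, of "{0<..<T}"]
    have "integrable lborel (\<lambda>t. unit t *\<^sub>R (indicator {0..T} t *\<^sub>R d t))" by simp
    moreover have "(\<lambda>t. unit t *\<^sub>R (indicator {0..T} t *\<^sub>R d t)) = dT" by (auto simp: dT_def indicator_def)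
    ultimately show ?thesis by simp
  qed
  have dT0: "\<And>t. t \<le> 0 \<Longrightarrow> dT t = 0" by (simp add: dT_def)
  have [measurable]: "dT \<in> borel_measurable borel" using dTi by auto
  have ld: "cv l d t = cv l dT t" if "t \<le> T" for t
    by (rule cv_cong_right[OF l(2) d(2) dT0 _ that]) (auto simp: dT_def)
  have kio: "cv k \<omega> t = cv k (cv l dT) t" if "t \<le> T" for t
    by (rule cv_cong_right[OF k(2) o(3) cv_causal[OF l(2) dT0] _ that]) (auto simp: o(2) ld)
  have Dint: "cv unit dT t = D t" if "0 < t" "t \<le> T" for t
  proof -
    have "cv unit dT t = (\<integral>s. indicator {0<..<t} s * dT s \<partial>lborel)" by (rule cv_step[OF dT0 that(2)])
    also have "\<dots> = (\<integral>s. indicator {0<..<t} s * d s \<partial>lborel)"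
      using that by (intro Bochner_Integration.integral_cong) (auto simp: dT_def indicator_def)
    also have "\<dots> = D t" using that d by (intro integral_derivative DERIV_subset[OF d(3)]) auto
    finally show ?thesis .
  qed
  have "AE t in lborel. 0 < t \<and> t < T \<longrightarrow> cv k \<omega> t = D t"
    using cv_assoc[OF k(1) l(1) dTi]
  proof eventually_elim
    case (elim t)
    then show ?case using kio[of t] cv_kl[OF dTi dT0, of t] Dint[of t] by auto
  qed
  \<comment> \<open>A continuous version of k * \<omega> upgrades the identity from almost every t
    to every t.\<close>
  moreover obtain e where e: "continuous_on UNIV e" "\<And>t. t \<le> T \<Longrightarrow> e t = cv k \<omega> t" "\<And>t. t \<le> 0 \<Longrightarrow> e t = 0"
    by (rule cv_bounded_C0[OF o(1,3) k(1,2)]) (assumption | (rule that; assumption))+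
  ultimately have ae: "AE t in lborel. 0 < t \<and> t < T \<longrightarrow> e t = D t" by (auto elim!: eventually_mono)
  have keq: "cv k \<omega> t = D t" if "0 < t" "t < T" for t
    using continuous_AE_eq[OF e(1) Dc ae that] e(2)[of t] that by simp
  have wint: "cv unit \<omega> t = w t" if "0 < t" "t \<le> T" for t
  proof -
    have "cv unit \<omega> t = (\<integral>s. indicator {0<..<t} s * \<omega> s \<partial>lborel)" by (rule cv_step[OF o(3) that(2)])
    also have "\<dots> = w t"
      using that o w0 by (intro integral_derivative DERIV_subset[OF wd]) auto
    finally show ?thesis .
  qed
  have "AE t in lborel. 0 < t \<and> t < T \<longrightarrow> cv l D t = w t"
    using cv_assoc[OF unit_integrable l(1) dTi] cv_assoc[OF l(1) unit_integrable dTi]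
  proof eventually_elim
    case (elim t)
    show ?case
    proof
      assume t: "0 < t \<and> t < T"
      have "cv l D t = cv l (cv unit dT) t"
        by (rule cv_cong_right[OF l(2) d(4) cv_causal[OF unit_causal dT0], where T = T]) (use t Dint in auto)
      also have "\<dots> = cv (cv l unit) dT t" using elim by simp
      also have "\<dots> = cv (cv unit l) dT t" by (simp add: cv_def cv_commute[of l unit, unfolded cv_def])
      also have "\<dots> = cv unit (cv l dT) t" using elim by simp
      also have "\<dots> = cv unit \<omega> t"
        by (rule cv_cong_right[OF unit_causal cv_causal[OF l(2) dT0] o(3), where T = T]) (use t o(2) ld in auto)
      finally show "cv l D t = w t" using wint t by simp
    qed
  qed
  then show thesis using that[OF o(1,3) w0 wd keq] by blast
qed

lemma cv_eq_lebesgue_on: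
  assumes "f \<in> borel_measurable borel" "\<And>s. s \<le> 0 \<Longrightarrow> f s = 0"
  shows "cv k f t = (\<integral>\<tau>. k (t - \<tau>) * f \<tau> \<partial>lebesgue_on {0<..<t})"
proof -
  have [measurable]: "f \<in> borel_measurable borel" by fact
  have "(\<integral>\<tau>. k (t - \<tau>) * f \<tau> \<partial>lebesgue_on {0<..<t}) = (\<integral>\<tau>. indicator {0<..<t} \<tau> * (k (t - \<tau>) * f \<tau>) \<partial>lborel)"
    by (rule integrable_lebesgue_on_lborel(2)) measurable
  also have "\<dots> = cv k f t"
    unfolding cv_def
  proof (rule Bochner_Integration.integral_cong)
    fix \<tau> show "indicator {0<..<t} \<tau> * (k (t - \<tau>) * f \<tau>) = k (t - \<tau>) * f \<tau>"
      using k(2)[of "t - \<tau>"] assms(2)[of \<tau>] by (cases "\<tau> \<le> 0 \<or> \<tau> \<ge> t") (auto simp: indicator_def)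
  qed simp
  finally show ?thesis by simp
qed

lemma k_integrable_on: "integrable (lebesgue_on {0<..<t}) k"
  using integrable_mult_indicator[OF _ k(1), of "{0<..<t}"] by (subst integrable_lebesgue_on_lborel(1)) auto

text \<open>
  \<open>w = l * ramp j\<close> solves \<open>k * w' = ramp j > 0\<close>; at a negative minimum of \<open>w\<close> the monotonicity of \<open>k\<close> would force
  \<open>k * w' \<le> 0\<close>. Hence \<open>l * ramp j \<ge> 0\<close>, and \<open>ramp j \<rightarrow> 1\<close> on \<open>(0,\<infinity>)\<close>.
\<close>

lemma resolvent_integral_nonneg:
  assumes t: "0 < t" "t \<le> T"
  shows "(\<integral>s. indicator {0<..<t} s * l s \<partial>lborel) \<ge> 0"
proof -
  have pos: "w t \<ge> 0" if j: "j > 0" and w: "continuous_on UNIV \<omega>" "\<And>t. t \<le> 0 \<Longrightarrow> \<omega> t = 0" "w 0 = 0"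
    "\<And>t. t \<in> {0..T} \<Longrightarrow> (w has_real_derivative \<omega> t) (at t within {0..T})"
    "\<And>t. 0 < t \<Longrightarrow> t < T \<Longrightarrow> cv k \<omega> t = ramp j t" and t: "0 < t" "t < T" for j w \<omega> t
  proof (rule ccontr)
    assume neg: "\<not> w t \<ge> 0"
    have wc: "continuous_on {0..t} w"
      by (rule DERIV_continuous_on[where D = \<omega>]) (rule DERIV_subset[OF w(4)], use t in auto)
    obtain s where s: "s \<in> {0..t}" "\<And>r. r \<in> {0..t} \<Longrightarrow> w s \<le> w r"
      using continuous_attains_inf[OF compact_Icc _ wc] t by auto
    have ws: "w s < 0" using s(2)[of t] neg t by auto
    then have s0: "0 < s" "s < T" using s(1) w(3) t by (cases "s = 0", auto)
    have "(\<integral>\<tau>. k (s - \<tau>) * (- \<omega> \<tau>) \<partial>lebesgue_on {0<..<s}) \<ge> 0"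
    proof (rule monotone_kernel_integral_nonneg[OF s0(1) k(3,4) k_integrable_on, of "\<lambda>\<tau>. w s - w \<tau>"])
      show "((\<lambda>\<tau>. w s - w \<tau>) has_real_derivative - \<omega> r) (at r within {0..s})" if "r \<in> {0..s}" for r
        using DERIV_diff[OF DERIV_const DERIV_subset[OF w(4)[of r]], of "{0..s}" "w s"] that s s0 by auto
      show "continuous_on {0..s} (\<lambda>\<tau>. - \<omega> \<tau>)" using continuous_on_subset[OF w(1)] by (intro continuous_intros) auto
    qed (use s in auto)
    then have "cv k \<omega> s \<le> 0"
      using cv_eq_lebesgue_on[OF borel_measurable_continuous_onI[OF w(1)] w(2)] by simp
    then show False using w(5)[OF s0] ramp_bounds(3)[OF j s0(1)] by simp
  qed
  have nn: "AE t in lborel. 0 < t \<and> t < T \<longrightarrow> cv l (ramp j) t \<ge> 0" if j: "j > 0" for j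
  proof -
    obtain w \<omega> where w: "continuous_on UNIV \<omega>" "\<And>t. t \<le> 0 \<Longrightarrow> \<omega> t = 0" "w 0 = 0"
      "\<And>t. t \<in> {0..T} \<Longrightarrow> (w has_real_derivative \<omega> t) (at t within {0..T})"
      "\<And>t. 0 < t \<Longrightarrow> t < T \<Longrightarrow> cv k \<omega> t = ramp j t"
      "AE t in lborel. 0 < t \<and> t < T \<longrightarrow> cv l (ramp j) t = w t"
      by (rule smooth_solution[OF ramp_C1[of j]]) (rule that; assumption)
    show ?thesis using w(6) pos[OF j w(1-5)] by (auto elim!: eventually_mono)
  qed
  have [measurable]: "ramp j \<in> borel_measurable borel" for j
    using ramp_C1[of j] by (intro borel_measurable_continuous_onI continuous_at_imp_continuous_on) (auto simp: C1_causal_def intro: DERIV_isCont)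
  have lim: "(\<lambda>j. cv l (ramp j) t) \<longlonglongrightarrow> (\<integral>s. indicator {0<..<t} s * l s \<partial>lborel)" for t
  proof -
    have "(\<lambda>j. \<integral>s. ramp j (t - s) * l s \<partial>lborel) \<longlonglongrightarrow> (\<integral>s. indicator {0<..<t} s * l s \<partial>lborel)"
    proof (rule integral_dominated_convergence[where w = "\<lambda>s. \<bar>l s\<bar>"])
      show "AE s in lborel. (\<lambda>j. ramp j (t - s) * l s) \<longlonglongrightarrow> indicator {0<..<t} s * l s"
      proof (rule AE_I2)
        fix s
        consider "s \<le> 0" | "s \<ge> t" | "0 < s" "s < t" by linarith
        then show "(\<lambda>j. ramp j (t - s) * l s) \<longlonglongrightarrow> indicator {0<..<t} s * l s"
        proof cases
          case 1 then show ?thesis using l(2) by simp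
        next
          case 2
          then have "ramp j (t - s) = 0" for j using ramp_C1[of j] by (simp add: C1_causal_def)
          then show ?thesis using 2 by simp
        next
          case 3
          then have "(\<lambda>j. ramp j (t - s) * l s) \<longlonglongrightarrow> 1 * l s" by (intro tendsto_intros ramp_tendsto) auto
          then show ?thesis using 3 by simp
        qed
      qed
      show "AE s in lborel. norm (ramp j (t - s) * l s) \<le> \<bar>l s\<bar>" for j
        using ramp_bounds[of j] by (auto simp: abs_mult intro!: mult_left_le_one_le)
    qed (use l in auto)
    then show ?thesis by (subst cv_commute) (simp add: cv_def)
  qed
  define L where "L t = (\<integral>s. indicator {0<..<t} s * l s \<partial>lborel)" for t
  have "AE t in lborel. \<forall>j>0. 0 < t \<and> t < T \<longrightarrow> cv l (ramp j) t \<ge> 0"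
    unfolding AE_all_countable by (intro allI AE_impI) (rule nn)
  then have aeL: "AE t in lborel. 0 < t \<and> t < T \<longrightarrow> L t \<ge> 0"
  proof eventually_elim
    case (elim t)
    show ?case
    proof
      assume "0 < t \<and> t < T"
      then have "\<forall>j\<ge>1. cv l (ramp j) t \<ge> 0" using elim by auto
      then show "L t \<ge> 0" unfolding L_def by (intro LIMSEQ_le_const[OF lim]) blast
    qed
  qed
  have Lc: "continuous_on UNIV L"
    unfolding L_def by (rule integral_indicator_continuous[OF l(1)])
  have LT: "L r \<ge> 0" if "0 < r" "r < T" for r
  proof -
    \<comment> \<open>The inequality L \<ge> 0, known almost everywhere, is rewritten as the
      equation min L 0 = 0, to which \<open>continuous_AE_eq\<close> applies.\<close>
    have "continuous_on UNIV (\<lambda>t. min (L t) 0)" by (intro continuous_intros Lc)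
    then have "(\<lambda>t. min (L t) 0) r = (\<lambda>_. 0) r"
      by (rule continuous_AE_eq[OF _ continuous_on_const, where a = 0 and b = T]) (use aeL that in \<open>auto elim!: eventually_mono\<close>)
    then show ?thesis by simp
  qed
  have "L t \<ge> 0"
  proof (cases "t < T")
    case False
    then have "t = T" using t by simp
    have tend: "(\<lambda>n. T - T / real (n + 2)) \<longlonglongrightarrow> T - 0"
      using LIMSEQ_ignore_initial_segment[OF tendsto_mult_left[OF lim_1_over_n, of T], of 2] by (intro tendsto_intros) simp
    have "isCont L T" using Lc by (simp add: continuous_on_eq_continuous_at)
    then have "(\<lambda>n. L (T - T / real (n + 2))) \<longlonglongrightarrow> L T" using isCont_tendsto_compose[OF _ tend] by simp
    moreover have "L (T - T / real (n + 2)) \<ge> 0" for n using T by (intro LT) (auto simp: field_simps add_pos_nonneg)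
    ultimately have "L T \<ge> 0" by (intro LIMSEQ_le_const) auto
    then show ?thesis using \<open>t = T\<close> by simp
  qed (use LT t in auto)
  then show ?thesis by (simp add: L_def)
qed

text \<open>The adjoint of convolution with l on (0,T), applied to the constant 1; compare
  \<open>integral_cv_interval\<close>.\<close>

definition weight :: "real \<Rightarrow> real" where
  "weight t = (\<integral>s. indicator {0<..<T - t} s * l s \<partial>lborel)"

lemma weight_nonneg: "0 < t \<Longrightarrow> t < T \<Longrightarrow> weight t \<ge> 0"
  unfolding weight_def using resolvent_integral_nonneg[of "T - t"] by auto

lemma abs_weight_le: "\<bar>weight t\<bar> \<le> (\<integral>s. \<bar>l s\<bar> \<partial>lborel)"
proof -
  have "\<bar>weight t\<bar> \<le> (\<integral>s. \<bar>indicator {0<..<T - t} s * l s\<bar> \<partial>lborel)" unfolding weight_def by (rule integral_abs_bound)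
  also have "\<dots> \<le> (\<integral>s. \<bar>l s\<bar> \<partial>lborel)"
    by (rule integral_mono') (use l(1) in \<open>auto simp: indicator_def\<close>)
  finally show ?thesis .
qed

lemma weight_measurable [measurable]: "weight \<in> borel_measurable borel"
proof (rule borel_measurable_continuous_onI)
  show "continuous_on UNIV weight"
    unfolding weight_def[abs_def]
    by (rule continuous_on_compose2[OF integral_indicator_continuous[OF l(1)]]) (auto intro!: continuous_intros)
qed

text \<open>On (0,T), p is the time derivative of J (y0 + w), and J (y0 + w) - J y0 = 1 * p = l * (k
  * p). Its integral over (0,T) is therefore the integral of k * p against \<open>weight\<close>.
  The nonnegativity of \<open>weight\<close> then admits the pointwise bound of k * p by D J'(y0 +
  w), which comes from \<open>monotone_kernel_integral_nonneg\<close>.\<close>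

lemma convex_inequality:
  assumes D: "C1_causal D d"
    and J: "\<And>r. (J has_real_derivative J' r) (at r)" "continuous_on UNIV J'"
      "\<And>a b. J' a * (b - a) \<le> J b - J a" "\<And>r. \<bar>J' r\<bar> \<le> 1"
    and w: "continuous_on UNIV \<omega>" "\<And>t. t \<le> 0 \<Longrightarrow> \<omega> t = 0" "w 0 = 0"
      "\<And>t. t \<in> {0..T} \<Longrightarrow> (w has_real_derivative \<omega> t) (at t within {0..T})"
      "\<And>t. 0 < t \<Longrightarrow> t < T \<Longrightarrow> cv k \<omega> t = D t"
  shows "(\<integral>t. unit t * (J (y0 + w t) - J y0) \<partial>lborel)
    \<le> (\<integral>t. unit t * (weight t * (D t * J' (y0 + w t))) \<partial>lborel)"
proof -
  have wc: "continuous_on {0..T} w" by (rule DERIV_continuous_on[OF w(4)])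
  define p where "p t = indicator {0..T} t * (J' (y0 + w t) * \<omega> t)" for t
  have pcont: "continuous_on {0..T} (\<lambda>t. J' (y0 + w t) * \<omega> t)"
    by (intro continuous_intros wc continuous_on_compose2[OF J(2)] continuous_on_subset[OF w(1)]) auto
  have pi: "integrable lborel p"
    using borel_integrable_atLeastAtMost'[OF pcont] by (simp add: set_integrable_def p_def[abs_def])
  have p0: "\<And>t. t \<le> 0 \<Longrightarrow> p t = 0" using w(2) by (auto simp: p_def indicator_def)
  have [measurable]: "p \<in> borel_measurable borel" "\<omega> \<in> borel_measurable borel"
    using pi w(1) by (auto intro: borel_measurable_continuous_onI)
  have ptwise: "cv k p t \<le> D t * J' (y0 + w t)" if t: "0 < t" "t < T" for t
  proof -
    \<comment> \<open>F is minus the gap between J and its tangent at y0 + w t, taken along the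
      path: convexity gives F \<le> 0, with equality at \<tau> = t, and the derivative of F is the
      integrand below.\<close>
    define F where "F \<tau> = J' (y0 + w t) * (w \<tau> - w t) - (J (y0 + w \<tau>) - J (y0 + w t))" for \<tau>
    have wd: "(w has_real_derivative \<omega> r) (at r within {0..t})" if "r \<in> {0..t}" for r
      by (rule DERIV_subset[OF w(4)]) (use that t in auto)
    have Fd: "(F has_real_derivative (J' (y0 + w t) * (\<omega> r - 0) - (J' (y0 + w r) * (0 + \<omega> r) - 0))) (at r within {0..t})" if "r \<in> {0..t}" for r
      unfolding F_def[abs_def]
      by (intro DERIV_diff DERIV_cmult DERIV_const wd[OF that] DERIV_chain2[OF J(1)] DERIV_add)
    have "(\<integral>\<tau>. k (t - \<tau>) * (J' (y0 + w t) * \<omega> \<tau> - p \<tau>) \<partial>lebesgue_on {0<..<t}) \<ge> 0"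
    proof (rule monotone_kernel_integral_nonneg[OF t(1) k(3,4) k_integrable_on, of F])
      show "(F has_real_derivative J' (y0 + w t) * \<omega> r - p r) (at r within {0..t})" if "r \<in> {0..t}" for r
        using Fd[OF that] that t by (simp add: p_def)
      have "continuous_on {0..t} (\<lambda>r. J' (y0 + w t) * \<omega> r - J' (y0 + w r) * \<omega> r)"
        using t by (intro continuous_intros continuous_on_subset[OF w(1)] continuous_on_subset[OF pcont]) auto
      then show "continuous_on {0..t} (\<lambda>r. J' (y0 + w t) * \<omega> r - p r)"
        by (rule continuous_on_eq) (use t in \<open>auto simp: p_def\<close>)
      show "F s \<le> 0" for s using J(3)[of "y0 + w t" "y0 + w s"] by (simp add: F_def)
      show "F t = 0" by (simp add: F_def)
    qed
    moreover have "(\<integral>\<tau>. k (t - \<tau>) * (J' (y0 + w t) * \<omega> \<tau> - p \<tau>) \<partial>lebesgue_on {0<..<t})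
       = cv k (\<lambda>\<tau>. J' (y0 + w t) * \<omega> \<tau> - p \<tau>) t"
      by (rule cv_eq_lebesgue_on[symmetric]) (use w(2) p0 in auto)
    moreover have "cv k (\<lambda>\<tau>. J' (y0 + w t) * \<omega> \<tau> - p \<tau>) t = J' (y0 + w t) * cv k \<omega> t - cv k p t"
    proof -
      obtain B where B: "\<And>y. y \<in> \<omega> ` {0..T} \<Longrightarrow> norm y \<le> B"
        using compact_imp_bounded[OF compact_continuous_image[OF continuous_on_subset[OF w(1)] compact_Icc, of 0 T]]
        unfolding bounded_iff by auto
      have i0: "integrable lborel (\<lambda>\<tau>. k (t - \<tau>) * C)" for C using integrable_shift_reflect(3)[OF k(1), of t] by simp
      have ob: "\<bar>\<omega> \<tau>\<bar> \<le> B" if "0 \<le> \<tau>" "\<tau> \<le> t" for \<tau> using B[of "\<omega> \<tau>"] that t by auto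
      have B0: "B \<ge> 0" using ob[of 0] t by auto
      \<comment> \<open>Beyond t the factor k (t - \<tau>) vanishes, so a bound for the other factor
        on [0,t] is enough.\<close>
      have kz: "\<bar>k (t - \<tau>) * q\<bar> \<le> k (t - \<tau>) * B" if "0 \<le> \<tau> \<Longrightarrow> \<tau> \<le> t \<Longrightarrow> \<bar>q\<bar> \<le> B" "\<tau> < 0 \<Longrightarrow> q = 0" for \<tau> q
      proof -
        consider "\<tau> < 0" | "0 \<le> \<tau>" "\<tau> \<le> t" | "\<tau> > t" by linarith
        then show ?thesis
        proof cases
          case 1 then show ?thesis using that(2) B0 k(3) by simp
        next
          case 2 then show ?thesis using that(1) k(3)[of "t - \<tau>"] by (simp add: abs_mult mult_left_mono)
        next
          case 3 then show ?thesis using k(2)[of "t - \<tau>"] by simp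
        qed
      qed
      have i1: "integrable lborel (\<lambda>\<tau>. k (t - \<tau>) * \<omega> \<tau>)"
        by (rule Bochner_Integration.integrable_bound[OF i0[of B]]) (use kz ob w(2) B0 k(3) in \<open>auto intro!: AE_I2\<close>)
      have pb: "\<bar>p \<tau>\<bar> \<le> B" if "0 \<le> \<tau>" "\<tau> \<le> t" for \<tau>
      proof -
        have "\<bar>p \<tau>\<bar> \<le> 1 * \<bar>\<omega> \<tau>\<bar>" using J(4)[of "y0 + w \<tau>"] by (auto simp: p_def indicator_def abs_mult intro!: mult_left_le_one_le)
        then show ?thesis using ob[OF that] by simp
      qed
      have i2: "integrable lborel (\<lambda>\<tau>. k (t - \<tau>) * p \<tau>)"
        by (rule Bochner_Integration.integrable_bound[OF i0[of B]]) (use kz pb p0 B0 k(3) in \<open>auto intro!: AE_I2\<close>)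
      have "cv k (\<lambda>\<tau>. J' (y0 + w t) * \<omega> \<tau> - p \<tau>) t = (\<integral>\<tau>. J' (y0 + w t) * (k (t - \<tau>) * \<omega> \<tau>) - k (t - \<tau>) * p \<tau> \<partial>lborel)"
        unfolding cv_def by (simp add: algebra_simps)
      also have "\<dots> = J' (y0 + w t) * cv k \<omega> t - cv k p t"
        using i1 i2 by (simp add: cv_def)
      finally show ?thesis .
    qed
    ultimately show ?thesis using w(5)[OF t] by (simp add: mult.commute)
  qed
  have q: "cv unit p t = J (y0 + w t) - J y0" if t: "0 < t" "t < T" for t
  proof -
    have "cv unit p t = (\<integral>s. indicator {0<..<t} s * p s \<partial>lborel)" by (rule cv_step[OF p0]) (use t in auto)
    also have "\<dots> = (\<integral>s. indicator {0<..<t} s * (J' (y0 + w s) * \<omega> s) \<partial>lborel)"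
      using t by (intro Bochner_Integration.integral_cong) (auto simp: p_def indicator_def)
    also have "\<dots> = (\<integral>s. indicator {0..t} s *\<^sub>R (J' (y0 + w s) * \<omega> s) \<partial>lborel)"
    proof (rule integral_cong_AE)
      have "AE s in lborel. s \<notin> {0, t}" by (intro AE_not_in) (auto intro: finite_imp_null_set_lborel)
      then show "AE s in lborel. indicator {0<..<t} s * (J' (y0 + w s) * \<omega> s) = indicator {0..t} s *\<^sub>R (J' (y0 + w s) * \<omega> s)"
        by eventually_elim (auto simp: indicator_def)
      have "(\<lambda>s. indicator {0<..<t} s * p s) \<in> borel_measurable borel" "(\<lambda>s. indicator {0..t} s * p s) \<in> borel_measurable borel" by measurable
      moreover have "(\<lambda>s. indicator {0<..<t} s * p s) = (\<lambda>s. indicator {0<..<t} s * (J' (y0 + w s) * \<omega> s))"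
        "(\<lambda>s. indicator {0..t} s * p s) = (\<lambda>s. indicator {0..t} s *\<^sub>R (J' (y0 + w s) * \<omega> s))"
        using t by (auto simp: p_def indicator_def)
      ultimately show "(\<lambda>s. indicator {0<..<t} s * (J' (y0 + w s) * \<omega> s)) \<in> borel_measurable lborel"
        "(\<lambda>s. indicator {0..t} s *\<^sub>R (J' (y0 + w s) * \<omega> s)) \<in> borel_measurable lborel" by simp_all
    qed
    also have "\<dots> = (\<integral>s. indicator {0..t} s *\<^sub>R (J' (y0 + w s) * (0 + \<omega> s)) \<partial>lborel)" by simp
    also have "\<dots> = J (y0 + w t) - J (y0 + w 0)"
    proof -
      have tc: "continuous_on {0..t} (\<lambda>s. J' (y0 + w s) * (0 + \<omega> s))"
        using continuous_on_subset[OF pcont, of "{0..t}"] t by simp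
      have "((\<lambda>s. J' (y0 + w s) * (0 + \<omega> s)) has_integral J (y0 + w t) - J (y0 + w 0)) {0..t}"
      proof (intro fundamental_theorem_of_calculus)
        fix r assume "r \<in> {0..t}"
        then have "(w has_real_derivative \<omega> r) (at r within {0..t})" by (intro DERIV_subset[OF w(4)]) (use t in auto)
        then show "((\<lambda>s. J (y0 + w s)) has_vector_derivative J' (y0 + w r) * (0 + \<omega> r)) (at r within {0..t})"
          unfolding has_real_derivative_iff_has_vector_derivative[symmetric]
          by (intro DERIV_chain2[OF J(1)] DERIV_add DERIV_const)
      qed (use t in auto)
      then show ?thesis
        using set_borel_integral_eq_integral(2)[OF borel_integrable_atLeastAtMost'[OF tc]]
        by (simp only: set_lebesgue_integral_def integral_unique)
    qed
    finally show ?thesis using w(3) by simp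
  qed
  have "(\<integral>t. unit t * (J (y0 + w t) - J y0) \<partial>lborel) = (\<integral>t. unit t * cv l (cv k p) t \<partial>lborel)"
  proof (rule integral_cong_AE)
    have "AE t in lborel. cv (cv l k) p t = cv l (cv k p) t" by (rule cv_assoc[OF l(1) k(1) pi])
    moreover have "cv l k = cv k l" using cv_commute[of l k] by (rule ext)
    ultimately have ae: "AE t in lborel. cv (cv k l) p t = cv l (cv k p) t" by simp
    show "AE t in lborel. unit t * (J (y0 + w t) - J y0) = unit t * cv l (cv k p) t"
      using ae
    proof eventually_elim
      case (elim t)
      then show ?case using q[of t] cv_kl[OF pi p0, of t] by (auto simp: indicator_def)
    qed
    have "(\<lambda>t. unit t * (J (y0 + w t) - J y0)) = (\<lambda>t. unit t * cv unit p t)"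
      using q by (auto simp: indicator_def)
    then show "(\<lambda>t. unit t * (J (y0 + w t) - J y0)) \<in> borel_measurable lborel" by simp
  qed measurable
  also have "\<dots> = (\<integral>t. unit t * (weight t * cv k p t) \<partial>lborel)"
    unfolding weight_def by (rule integral_cv_interval[OF l cv_integrable(2)[OF k(1) pi] cv_causal[OF k(2) p0]])
  also have "\<dots> \<le> (\<integral>t. unit t * (weight t * (D t * J' (y0 + w t))) \<partial>lborel)"
  proof (rule integral_mono)
    show "integrable lborel (\<lambda>t. unit t * (weight t * cv k p t))"
    proof (rule Bochner_Integration.integrable_bound)
      show "integrable lborel (\<lambda>t. (\<integral>s. \<bar>l s\<bar> \<partial>lborel) * cv k p t)" using cv_integrable(2)[OF k(1) pi] by simp
      show "AE t in lborel. norm (unit t * (weight t * cv k p t)) \<le> norm ((\<integral>s. \<bar>l s\<bar> \<partial>lborel) * cv k p t)"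
        using order_trans[OF abs_weight_le abs_ge_self] by (intro AE_I2) (auto simp: abs_mult indicator_def intro!: mult_right_mono)
    qed measurable
    have Dc: "continuous_on {0..T} D" using D by (auto simp: C1_causal_def intro!: continuous_at_imp_continuous_on DERIV_isCont)
    have "continuous_on {0..T} (\<lambda>t. D t * J' (y0 + w t))"
      by (intro continuous_intros Dc wc continuous_on_compose2[OF J(2)]) auto
    then have DJ: "integrable lborel (\<lambda>t. indicator {0..T} t *\<^sub>R (D t * J' (y0 + w t)))"
      using borel_integrable_atLeastAtMost' unfolding set_integrable_def by blast
    show "integrable lborel (\<lambda>t. unit t * (weight t * (D t * J' (y0 + w t))))"
    proof (rule Bochner_Integration.integrable_bound)
      show "integrable lborel (\<lambda>t. (\<integral>s. \<bar>l s\<bar> \<partial>lborel) * (indicator {0..T} t *\<^sub>R (D t * J' (y0 + w t))))" using DJ by simp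
      have "(\<lambda>t. unit t * weight t * (indicator {0..T} t *\<^sub>R (D t * J' (y0 + w t)))) \<in> borel_measurable lborel"
        using borel_measurable_integrable[OF DJ] by (intro borel_measurable_times) auto
      moreover have "(\<lambda>t. unit t * weight t * (indicator {0..T} t *\<^sub>R (D t * J' (y0 + w t)))) = (\<lambda>t. unit t * (weight t * (D t * J' (y0 + w t))))"
        by (auto simp: indicator_def)
      ultimately show "(\<lambda>t. unit t * (weight t * (D t * J' (y0 + w t)))) \<in> borel_measurable lborel" by simp
      show "AE t in lborel. norm (unit t * (weight t * (D t * J' (y0 + w t)))) \<le> norm ((\<integral>s. \<bar>l s\<bar> \<partial>lborel) * (indicator {0..T} t *\<^sub>R (D t * J' (y0 + w t))))"
        using order_trans[OF abs_weight_le abs_ge_self] by (intro AE_I2) (auto simp: abs_mult indicator_def intro!: mult_right_mono)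
    qed
    show "unit t * (weight t * cv k p t) \<le> unit t * (weight t * (D t * J' (y0 + w t)))" for t
      using ptwise[of t] weight_nonneg[of t] by (auto simp: indicator_def intro!: mult_left_mono)
  qed
  finally show ?thesis .
qed

text \<open>Convolving the equation with l gives 1 * w = 1 * (l * D) almost everywhere, so the
  primitive R of the difference r vanishes almost everywhere, hence throughout (0,T) by continuity.
  All integrals of r over subintervals are then zero.\<close>

lemma solution_formula:
  assumes w: "integrable lborel w" "\<And>t. t \<le> 0 \<Longrightarrow> w t = 0" and D: "integrable lborel D" "\<And>t. t \<le> 0 \<Longrightarrow> D t = 0"
    and eq: "AE t in lborel. 0 < t \<and> t < T \<longrightarrow> cv k w t = cv unit D t"
  shows "AE t in lborel. 0 < t \<and> t < T \<longrightarrow> cv l D t = w t"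
proof -
  have [measurable]: "w \<in> borel_measurable borel" "D \<in> borel_measurable borel" using w D by auto
  define r where "r t = w t - cv l D t" for t
  have ri: "integrable lborel r" unfolding r_def[abs_def] using w cv_integrable(2)[OF l(1) D(1)] by simp
  define R where "R t = (\<integral>s. indicator {0<..<t} s * r s \<partial>lborel)" for t
  have Rc: "continuous_on UNIV R" unfolding R_def by (rule integral_indicator_continuous[OF ri])
  have ind: "integrable lborel (\<lambda>s. indicator {0<..<t} s * f s)" if "integrable lborel f" for f :: "real \<Rightarrow> real" and t :: real
    using integrable_mult_indicator[OF _ that, of "{0<..<t}"] by simp
  have "AE t in lborel. 0 < t \<and> t < T \<longrightarrow> R t = 0"
    using cv_assoc[OF l(1) k(1) w(1)] cv_assoc[OF l(1) unit_integrable D(1)] cv_assoc[OF unit_integrable l(1) D(1)]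
  proof eventually_elim
    case (elim t)
    show ?case
    proof
      assume t: "0 < t \<and> t < T"
      have c: "cv l k = cv k l" "cv l unit = cv unit l" by (rule ext, rule cv_commute)+
      have "cv unit w t = cv (cv k l) w t" using cv_kl[OF w, of t] t by simp
      also have "\<dots> = cv l (cv k w) t" using elim(1) by (simp add: c)
      also have "\<dots> = cv l (cv unit D) t"
        by (rule cv_cong_right[OF l(2) cv_causal[OF k(2) w(2)] cv_causal[OF unit_causal D(2)], where T = T]) (use t eq in auto)
      also have "\<dots> = cv unit (cv l D) t" using elim(2,3) by (simp add: c)
      finally have "(\<integral>s. indicator {0<..<t} s * w s \<partial>lborel) = (\<integral>s. indicator {0<..<t} s * cv l D s \<partial>lborel)"
        using cv_step[OF w(2), where t = t and T = T] cv_step[OF cv_causal[OF l(2) D(2)], where t = t and T = T] t by simp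
      then show "R t = 0"
        using ind[OF w(1)] ind[OF cv_integrable(2)[OF l(1) D(1)]] by (simp add: R_def r_def right_diff_distrib)
    qed
  qed
  then have R0: "R t = 0" if "0 < t" "t < T" for t
    by (rule continuous_AE_eq[OF Rc continuous_on_const, where a = 0 and b = T and t = t]) (use that in auto)
  have "AE s in lebesgue_on {0<..<T}. r s = 0"
  proof (rule fundamental_lemma_boxes)
    show "L1_loc {0<..<T} r"
      unfolding L1_loc_def
    proof (intro allI impI)
      fix K assume "compact K \<and> K \<subseteq> {0<..<T}"
      then have "K \<in> sets borel" by (auto intro: borel_compact)
      then show "integrable (lebesgue_on K) r"
        using integrable_mult_indicator[OF _ ri, of K] ri by (subst integrable_lebesgue_on_lborel(1)) auto
    qed
    fix a b :: real assume ab: "cbox a b \<subseteq> {0<..<T}"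
    show "(\<integral>x. r x \<partial>lebesgue_on (cbox a b)) = 0"
    proof (cases "a \<le> b")
      case True
      then have ab': "0 < a" "b < T" using ab by auto
      have "(\<integral>x. r x \<partial>lebesgue_on (cbox a b)) = (\<integral>s. indicator (cbox a b) s * r s \<partial>lborel)"
        using ri by (intro integrable_lebesgue_on_lborel(2)) auto
      also have "\<dots> = (\<integral>s. indicator {0<..<b} s * r s - indicator {0<..<a} s * r s \<partial>lborel)"
      proof (rule integral_cong_AE)
        have "AE s in lborel. s \<notin> {a, b}" by (intro AE_not_in) (auto intro: finite_imp_null_set_lborel)
        then show "AE s in lborel. indicator (cbox a b) s * r s = indicator {0<..<b} s * r s - indicator {0<..<a} s * r s"
          by eventually_elim (use True ab' in \<open>auto simp: indicator_def\<close>)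
      qed (use ri in auto)
      also have "\<dots> = R b - R a" unfolding R_def using ind[OF ri] by simp
      finally show ?thesis using R0[of a] R0[of b] True ab' by simp
    qed simp
  qed simp
  then have "AE s in lborel. s \<in> {0<..<T} \<longrightarrow> r s = 0" by (subst (asm) AE_lebesgue_on_iff_lborel) auto
  then show ?thesis by eventually_elim (auto simp: r_def)
qed

text \<open>A smooth convex approximation of the absolute value from above, within distance
  \<epsilon>, with derivative bounded by 1.\<close>

lemma sqrt_convex:
  fixes \<epsilon> :: real assumes e: "\<epsilon> > 0"
  defines "J \<equiv> \<lambda>r. sqrt (r\<^sup>2 + \<epsilon>\<^sup>2)"
  shows "(J has_real_derivative r / J r) (at r)" "continuous_on UNIV (\<lambda>r. r / J r)"
    "a / J a * (b - a) \<le> J b - J a" "\<bar>r / J r\<bar> \<le> 1" "\<bar>r\<bar> \<le> J r" "J r \<le> \<bar>r\<bar> + \<epsilon>"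
proof -
  have pos: "r\<^sup>2 + \<epsilon>\<^sup>2 > 0" for r using e by (simp add: add_nonneg_pos)
  then have Jp: "J r > 0" for r by (simp add: J_def)
  have Jq: "(J r)\<^sup>2 = r\<^sup>2 + \<epsilon>\<^sup>2" for r using pos[of r] by (simp add: J_def)
  show "(J has_real_derivative r / J r) (at r)"
    unfolding J_def using pos[of r] by (auto intro!: derivative_eq_intros simp: field_simps)
  show "continuous_on UNIV (\<lambda>r. r / J r)"
    unfolding J_def using pos by (intro continuous_intros) (auto simp: less_imp_neq[symmetric] dest: order_less_imp_not_eq2)
  show le: "\<bar>r\<bar> \<le> J r" for r using e unfolding J_def by (intro real_le_rsqrt) simp
  show "\<bar>r / J r\<bar> \<le> 1" using le[of r] Jp[of r] by (simp add: abs_divide abs_of_pos)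
  show "J r \<le> \<bar>r\<bar> + \<epsilon>" unfolding J_def using e by (intro real_le_lsqrt) (auto simp: power2_sum)
  \<comment> \<open>Cauchy-Schwarz for the vectors (a, \<epsilon>) and (b, \<epsilon>); subtracting
    J a * J a = a * a + \<open>\<epsilon>\<^sup>2\<close> turns it into the tangent
    inequality.\<close>
  have "(a * b + \<epsilon>\<^sup>2)\<^sup>2 \<le> (J a * J b)\<^sup>2"
  proof -
    have "(J a * J b)\<^sup>2 = (a\<^sup>2 + \<epsilon>\<^sup>2) * (b\<^sup>2 + \<epsilon>\<^sup>2)" by (simp only: power_mult_distrib Jq)
    also have "\<dots> = (a * b + \<epsilon>\<^sup>2)\<^sup>2 + \<epsilon>\<^sup>2 * (a - b)\<^sup>2" by (simp add: power2_eq_square algebra_simps)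
    finally show ?thesis by simp
  qed
  then have "a * b + \<epsilon>\<^sup>2 \<le> J a * J b" by (rule power2_le_imp_le) (simp add: Jp less_imp_le)
  moreover have "J a * J a = a * a + \<epsilon>\<^sup>2" using Jq[of a] by (simp add: power2_eq_square)
  ultimately have "a * (b - a) \<le> J a * (J b - J a)" by (simp add: right_diff_distrib)
  then show "a / J a * (b - a) \<le> J b - J a" using Jp[of a] by (simp add: divide_le_eq mult.commute)
qed

text \<open>\<open>convex_inequality\<close> needs smooth data. If Dn is smooth and close to D in
  L1(0,T), then wn = l * Dn is close to w = l * D by \<open>cv_norm_le\<close>. The inequality thus
  passes to D and w while J is still smooth; only afterwards does \<epsilon> \<rightarrow> 0 turn J
  into the absolute value and J' into sgn, since J' must be continuous in the first limit.\<close>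

theorem sgn_inequality:
  assumes w: "integrable lborel w" "\<And>t. t \<le> 0 \<Longrightarrow> w t = 0" and D: "integrable lborel D" "\<And>t. t \<le> 0 \<Longrightarrow> D t = 0"
    and eq: "AE t in lborel. 0 < t \<and> t < T \<longrightarrow> cv k w t = cv unit D t"
  shows "(\<integral>t. unit t * \<bar>y0 + w t\<bar> \<partial>lborel) - T * \<bar>y0\<bar>
    \<le> (\<integral>t. unit t * (weight t * (D t * sgn (y0 + w t))) \<partial>lborel)"
proof -
  have [measurable]: "w \<in> borel_measurable borel" "D \<in> borel_measurable borel" using w D by auto
  define nl where "nl = (\<integral>s. \<bar>l s\<bar> \<partial>lborel)"
  have weight_le: "\<bar>weight t\<bar> \<le> nl" for t unfolding nl_def by (rule abs_weight_le)
  have nl0: "nl \<ge> 0" using weight_le[of 0] by linarith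
  have wform: "AE t in lborel. 0 < t \<and> t < T \<longrightarrow> cv l D t = w t" by (rule solution_formula[OF w D eq])
  define P where "P n Dn d wn \<omega> \<longleftrightarrow> C1_causal Dn d \<and> (\<integral>t. unit t * \<bar>Dn t - D t\<bar> \<partial>lborel) < 1 / real (Suc n) \<and>
      continuous_on UNIV \<omega> \<and> (\<forall>t\<le>0. \<omega> t = 0) \<and> wn 0 = 0 \<and>
      (\<forall>t\<in>{0..T}. (wn has_real_derivative \<omega> t) (at t within {0..T})) \<and>
      (\<forall>t. 0 < t \<longrightarrow> t < T \<longrightarrow> cv k \<omega> t = Dn t) \<and> (AE t in lborel. 0 < t \<and> t < T \<longrightarrow> cv l Dn t = wn t)"
    for n :: nat and Dn d wn \<omega>
  have ex: "\<exists>Dn d wn \<omega>. P n Dn d wn \<omega>" for n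
  proof -
    obtain Dn d where C: "C1_causal Dn d" "(\<integral>t. unit t * \<bar>Dn t - D t\<bar> \<partial>lborel) < 1 / real (Suc n)"
      by (rule C1_causal_dense[OF D(1) T, of "1 / real (Suc n)"]) auto
    obtain wn \<omega> where "continuous_on UNIV \<omega>" "\<And>t. t \<le> 0 \<Longrightarrow> \<omega> t = 0" "wn 0 = 0"
      "\<And>t. t \<in> {0..T} \<Longrightarrow> (wn has_real_derivative \<omega> t) (at t within {0..T})"
      "\<And>t. 0 < t \<Longrightarrow> t < T \<Longrightarrow> cv k \<omega> t = Dn t"
      "AE t in lborel. 0 < t \<and> t < T \<longrightarrow> cv l Dn t = wn t"
      by (rule smooth_solution[OF C(1)]) (rule that; assumption)
    with C show ?thesis unfolding P_def by (intro exI[of _ Dn] exI[of _ d] exI[of _ wn] exI[of _ \<omega>]) simp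
  qed
  obtain Dn d wn \<omega> where C0: "\<And>n. P n (Dn n) (d n) (wn n) (\<omega> n)"
    using ex by metis
  have C: "\<And>n. C1_causal (Dn n) (d n)" "\<And>n. (\<integral>t. unit t * \<bar>Dn n t - D t\<bar> \<partial>lborel) < 1 / real (Suc n)"
      "\<And>n. continuous_on UNIV (\<omega> n)" "\<And>n t. t \<le> 0 \<Longrightarrow> \<omega> n t = 0" "\<And>n. wn n 0 = 0"
      "\<And>n t. t \<in> {0..T} \<Longrightarrow> (wn n has_real_derivative \<omega> n t) (at t within {0..T})"
      "\<And>n t. 0 < t \<Longrightarrow> t < T \<Longrightarrow> cv k (\<omega> n) t = Dn n t" "\<And>n. AE t in lborel. 0 < t \<and> t < T \<longrightarrow> cv l (Dn n) t = wn n t"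
    using C0 unfolding P_def by blast+
  have Dc: "continuous_on UNIV (Dn n)" for n
    using C(1)[of n] by (auto simp: C1_causal_def intro!: continuous_at_imp_continuous_on DERIV_isCont)
  have [measurable]: "Dn n \<in> borel_measurable borel" for n using Dc by (rule borel_measurable_continuous_onI)
  have Dn0: "Dn n t = 0" if "t \<le> 0" for n t using C(1)[of n] that by (auto simp: C1_causal_def)
  have wnc: "continuous_on {0..T} (wn n)" for n by (rule DERIV_continuous_on[OF C(6)])
  \<comment> \<open>Nothing is known of wn outside [0,T], so measurability is stated after
    multiplication with the indicator.\<close>
  have uw: "(\<lambda>t. unit t * f (wn n t)) \<in> borel_measurable borel" if "continuous_on UNIV f" for f :: "real \<Rightarrow> real" and n
  proof -
    have "continuous_on {0<..<T} (\<lambda>t. f (wn n t))"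
      by (intro continuous_on_compose2[OF that continuous_on_subset[OF wnc]]) auto
    then show ?thesis using borel_measurable_continuous_on_indicator[of "{0<..<T}" "\<lambda>t. f (wn n t)"] by simp
  qed
  have uDi: "integrable lborel (\<lambda>t. unit t * Dn n t)" for n
  proof -
    have "integrable lborel (\<lambda>t. indicator {0..T} t *\<^sub>R Dn n t)"
      using borel_integrable_atLeastAtMost'[OF continuous_on_subset[OF Dc]] unfolding set_integrable_def by blast
    from integrable_mult_indicator[OF _ this, of "{0<..<T}"]
    have "integrable lborel (\<lambda>t. unit t *\<^sub>R (indicator {0..T} t *\<^sub>R Dn n t))" by simp
    moreover have "(\<lambda>t. unit t *\<^sub>R (indicator {0..T} t *\<^sub>R Dn n t)) = (\<lambda>t. unit t * Dn n t)" by (auto simp: indicator_def)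
    ultimately show ?thesis by simp
  qed
  have uD: "integrable lborel (\<lambda>t. unit t * D t)" using integrable_mult_indicator[OF _ D(1), of "{0<..<T}"] by simp
  \<comment> \<open>Dn need not be integrable on the whole line. The cut off difference is, and by
    causality its convolution with l agrees with wn - w on (0,T).\<close>
  define E where "E n t = unit t * Dn n t - unit t * D t" for n t
  have Ei: "integrable lborel (E n)" for n unfolding E_def[abs_def] using uDi uD by simp
  have En: "(\<integral>t. \<bar>E n t\<bar> \<partial>lborel) < 1 / real (Suc n)" for n
  proof -
    have "\<bar>E n t\<bar> = unit t * \<bar>Dn n t - D t\<bar>" for t by (auto simp: E_def indicator_def)
    then show ?thesis using C(2)[of n] by simp
  qed
  have wE: "AE t in lborel. unit t * (wn n t - w t) = unit t * cv l (E n) t" for n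
    using C(8)[of n] wform cv_integrable(1)[OF l(1) uDi[of n]] cv_integrable(1)[OF l(1) uD]
  proof eventually_elim
    case (elim t)
    show ?case
    proof (cases "0 < t \<and> t < T")
      case True
      have "cv l (Dn n) t = cv l (\<lambda>t. unit t * Dn n t) t"
        by (rule cv_cong_right[OF l(2) Dn0, where T = T]) (use True in auto)
      moreover have "cv l D t = cv l (\<lambda>t. unit t * D t) t"
        by (rule cv_cong_right[OF l(2) D(2), where T = T]) (use True in auto)
      moreover have "cv l (E n) t = cv l (\<lambda>t. unit t * Dn n t) t - cv l (\<lambda>t. unit t * D t) t"
        using elim(3,4) by (simp add: cv_def E_def right_diff_distrib)
      ultimately show ?thesis using elim(1,2) True by simp
    qed auto
  qed
  have uwn: "(\<lambda>t. unit t * (wn n t - w t)) \<in> borel_measurable borel" for n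
  proof -
    have "(\<lambda>t. unit t * wn n t - unit t * w t) \<in> borel_measurable borel"
      using uw[of "\<lambda>x. x" n] by (intro borel_measurable_diff) (auto intro: continuous_intros)
    then show ?thesis by (simp add: right_diff_distrib)
  qed
  have wdi: "integrable lborel (\<lambda>t. unit t * (wn n t - w t))" for n
  proof (rule integrable_cong_AE_imp)
    show "integrable lborel (\<lambda>t. unit t * cv l (E n) t)"
      using integrable_mult_indicator[OF _ cv_integrable(2)[OF l(1) Ei], of "{0<..<T}"] by simp
    show "AE t in lborel. unit t * cv l (E n) t = unit t * (wn n t - w t)"
      using wE[of n] by eventually_elim (rule sym)
  qed (use uwn in simp)
  have wconv: "(\<integral>t. \<bar>unit t * (wn n t - w t)\<bar> \<partial>lborel) \<le> nl * (1 / real (Suc n))" for n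
  proof -
    have "(\<integral>t. \<bar>unit t * (wn n t - w t)\<bar> \<partial>lborel) = (\<integral>t. \<bar>unit t * cv l (E n) t\<bar> \<partial>lborel)"
      using wE[of n] wdi[of n] cv_integrable(2)[OF l(1) Ei[of n]] by (intro integral_cong_AE) (auto elim!: eventually_mono)
    also have "\<dots> \<le> (\<integral>t. \<bar>cv l (E n) t\<bar> \<partial>lborel)"
      by (rule integral_mono') (use cv_integrable(2)[OF l(1) Ei] in \<open>auto simp: indicator_def\<close>)
    also have "\<dots> \<le> nl * (\<integral>t. \<bar>E n t\<bar> \<partial>lborel)" unfolding nl_def by (rule cv_norm_le[OF l(1) Ei])
    also have "\<dots> \<le> nl * (1 / real (Suc n))" using En[of n] nl0 by (intro mult_left_mono) auto
    finally show ?thesis .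
  qed
  have n0: "(\<lambda>n. nl * (1 / real (Suc n))) \<longlonglongrightarrow> 0"
    using tendsto_mult_left[OF LIMSEQ_Suc[OF lim_1_over_n], of nl] by simp
  have "(\<lambda>n. \<integral>t. norm (unit t * (wn n t - w t)) \<partial>lborel) \<longlonglongrightarrow> 0"
    by (rule nonneg_squeeze_tendsto_0[OF n0]) (use wconv in auto)
  then obtain r :: "nat \<Rightarrow> nat" where r: "strict_mono r" "AE t in lborel. (\<lambda>n. unit t * (wn (r n) t - w t)) \<longlonglongrightarrow> 0"
    using tendsto_L1_AE_subseq[of lborel "\<lambda>n t. unit t * (wn n t - w t)"] wdi by blast
  have ui: "integrable lborel (\<lambda>t. unit t * c)" for c using unit_integrable by simp
  have uy: "integrable lborel (\<lambda>t. unit t * \<bar>y0 + w t\<bar>)"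
  proof -
    have "integrable lborel (\<lambda>t. unit t * y0 + unit t * w t)" using ui integrable_mult_indicator[OF _ w(1), of "{0<..<T}"] by simp
    then have "integrable lborel (\<lambda>t. \<bar>unit t * y0 + unit t * w t\<bar>)" by (rule integrable_abs)
    moreover have "(\<lambda>t. \<bar>unit t * y0 + unit t * w t\<bar>) = (\<lambda>t. unit t * \<bar>y0 + w t\<bar>)" by (auto simp: indicator_def)
    ultimately show ?thesis by simp
  qed
  \<comment> \<open>The loss T * \<epsilon> comes from J y0 \<le> \<bar>y0\<bar> + \<epsilon>,
    integrated over (0,T).\<close>
  have step: "(\<integral>t. unit t * \<bar>y0 + w t\<bar> \<partial>lborel) - T * \<bar>y0\<bar> - T * \<epsilon>
      \<le> (\<integral>t. unit t * (weight t * (D t * ((y0 + w t) / sqrt ((y0 + w t)\<^sup>2 + \<epsilon>\<^sup>2)))) \<partial>lborel)" if e: "\<epsilon> > 0" for \<epsilon>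
  proof -
    define J where "J r = sqrt (r\<^sup>2 + \<epsilon>\<^sup>2)" for r
    define J' where "J' r = r / J r" for r
    have J: "\<And>r. (J has_real_derivative J' r) (at r)" "continuous_on UNIV J'"
      "\<And>a b. J' a * (b - a) \<le> J b - J a" "\<And>r. \<bar>J' r\<bar> \<le> 1" "\<And>r. \<bar>r\<bar> \<le> J r" "\<And>r. J r \<le> \<bar>r\<bar> + \<epsilon>"
      using sqrt_convex[OF e] unfolding J'_def[abs_def] J_def[abs_def] by blast+
    have Jc: "continuous_on UNIV J" using J(1) by (intro continuous_at_imp_continuous_on) (auto intro: DERIV_isCont)
    have J'm[measurable]: "J' \<in> borel_measurable borel" using J(2) by (rule borel_measurable_continuous_onI)
    have Jlip: "\<bar>J a - J b\<bar> \<le> \<bar>a - b\<bar>" for a b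
    proof -
      have le: "J' c * x \<le> \<bar>x\<bar>" for c x
      proof -
        have "J' c * x \<le> \<bar>J' c\<bar> * \<bar>x\<bar>" by (simp add: abs_mult[symmetric])
        also have "\<dots> \<le> 1 * \<bar>x\<bar>" by (intro mult_right_mono J(4)) simp
        finally show ?thesis by simp
      qed
      show ?thesis using J(3)[of a b] J(3)[of b a] le[of a "a - b"] le[of b "b - a"]
        by (simp add: abs_le_iff algebra_simps abs_minus_commute)
    qed
    have Jpc: "continuous_on UNIV (\<lambda>x. J' (y0 + x))" "continuous_on UNIV (\<lambda>x. J (y0 + x) - J y0)"
      by (intro continuous_intros continuous_on_compose2[OF J(2)] continuous_on_compose2[OF Jc]; simp)+
    have low: "(\<integral>t. unit t * \<bar>y0 + w t\<bar> \<partial>lborel) - T * \<bar>y0\<bar> - T * \<epsilon> - nl * (1 / real (Suc n))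
        \<le> (\<integral>t. unit t * (J (y0 + wn n t) - J y0) \<partial>lborel)" for n
    proof -
      have "(\<integral>t. unit t * \<bar>y0 + w t\<bar> \<partial>lborel) - T * \<bar>y0\<bar> - T * \<epsilon> - (\<integral>t. \<bar>unit t * (wn n t - w t)\<bar> \<partial>lborel)
         = (\<integral>t. unit t * \<bar>y0 + w t\<bar> - unit t * \<bar>y0\<bar> - unit t * \<epsilon> - \<bar>unit t * (wn n t - w t)\<bar> \<partial>lborel)"
        using uy ui integrable_abs[OF wdi[of n]] T by simp
      also have "\<dots> \<le> (\<integral>t. unit t * (J (y0 + wn n t) - J y0) \<partial>lborel)"
      proof (rule integral_mono)
        show "integrable lborel (\<lambda>t. unit t * \<bar>y0 + w t\<bar> - unit t * \<bar>y0\<bar> - unit t * \<epsilon> - \<bar>unit t * (wn n t - w t)\<bar>)"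
          using uy ui integrable_abs[OF wdi[of n]] by simp
        show "integrable lborel (\<lambda>t. unit t * (J (y0 + wn n t) - J y0))"
        proof (rule Bochner_Integration.integrable_bound)
          show "integrable lborel (\<lambda>t. \<bar>unit t * (wn n t - w t)\<bar> + \<bar>w t\<bar>)" using integrable_abs[OF wdi[of n]] integrable_abs[OF w(1)] by simp
          show "(\<lambda>t. unit t * (J (y0 + wn n t) - J y0)) \<in> borel_measurable lborel"
            using uw[OF Jpc(2), of n] unfolding measurable_lborel2 .
          show "AE t in lborel. norm (unit t * (J (y0 + wn n t) - J y0)) \<le> norm (\<bar>unit t * (wn n t - w t)\<bar> + \<bar>w t\<bar>)"
          proof (rule AE_I2)
            fix t
            have "\<bar>J (y0 + wn n t) - J y0\<bar> \<le> \<bar>wn n t - w t\<bar> + \<bar>w t\<bar>" using Jlip[of "y0 + wn n t" y0] by linarith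
            then show "norm (unit t * (J (y0 + wn n t) - J y0)) \<le> norm (\<bar>unit t * (wn n t - w t)\<bar> + \<bar>w t\<bar>)"
              by (auto simp: indicator_def)
          qed
        qed
        show "unit t * \<bar>y0 + w t\<bar> - unit t * \<bar>y0\<bar> - unit t * \<epsilon> - \<bar>unit t * (wn n t - w t)\<bar> \<le> unit t * (J (y0 + wn n t) - J y0)" for t
        proof -
          have "\<bar>y0 + w t\<bar> - \<bar>y0\<bar> - \<epsilon> - \<bar>wn n t - w t\<bar> \<le> J (y0 + wn n t) - J y0"
            using J(5)[of "y0 + wn n t"] J(6)[of y0] by linarith
          then show ?thesis by (auto simp: indicator_def)
        qed
      qed
      finally show ?thesis using wconv[of n] by linarith
    qed
    have up: "(\<integral>t. unit t * (J (y0 + wn n t) - J y0) \<partial>lborel)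
       \<le> (\<integral>t. unit t * (weight t * (D t * J' (y0 + wn n t))) \<partial>lborel) + nl * (1 / real (Suc n))" for n
    proof -
      have uJ: "(\<lambda>t. unit t * J' (y0 + wn n t)) \<in> borel_measurable borel"
        using uw[OF Jpc(1)] .
      have zi: "integrable lborel (\<lambda>t. unit t * (weight t * (f t * J' (y0 + wn n t))))" if fi: "integrable lborel (\<lambda>t. unit t * f t)" for f :: "real \<Rightarrow> real"
      proof (rule Bochner_Integration.integrable_bound)
        show "integrable lborel (\<lambda>t. nl * (unit t * f t))" using fi by simp
        have "(\<lambda>t. (unit t * J' (y0 + wn n t)) * (weight t * (unit t * f t))) \<in> borel_measurable borel"
          using borel_measurable_integrable[OF fi] unfolding measurable_lborel2
          by (intro borel_measurable_times[OF uJ borel_measurable_times[OF weight_measurable]])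
        moreover have "(\<lambda>t. (unit t * J' (y0 + wn n t)) * (weight t * (unit t * f t))) = (\<lambda>t. unit t * (weight t * (f t * J' (y0 + wn n t))))"
          by (auto simp: indicator_def)
        ultimately show "(\<lambda>t. unit t * (weight t * (f t * J' (y0 + wn n t)))) \<in> borel_measurable lborel" by simp
        show "AE t in lborel. norm (unit t * (weight t * (f t * J' (y0 + wn n t)))) \<le> norm (nl * (unit t * f t))"
        proof (rule AE_I2)
          fix t
          have "\<bar>weight t\<bar> * (\<bar>f t\<bar> * \<bar>J' (y0 + wn n t)\<bar>) \<le> nl * (\<bar>f t\<bar> * 1)"
            using weight_le J(4) nl0 by (intro mult_mono) auto
          then show "norm (unit t * (weight t * (f t * J' (y0 + wn n t)))) \<le> norm (nl * (unit t * f t))"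
            using nl0 by (auto simp: indicator_def abs_mult)
        qed
      qed
      have "(\<integral>t. unit t * (J (y0 + wn n t) - J y0) \<partial>lborel) \<le> (\<integral>t. unit t * (weight t * (Dn n t * J' (y0 + wn n t))) \<partial>lborel)"
        by (rule convex_inequality[OF C(1) J(1-4) C(3,4,5,6,7)])
      also have "\<dots> \<le> (\<integral>t. unit t * (weight t * (D t * J' (y0 + wn n t))) + nl * \<bar>E n t\<bar> \<partial>lborel)"
      proof (rule integral_mono)
        show "integrable lborel (\<lambda>t. unit t * (weight t * (Dn n t * J' (y0 + wn n t))))" by (rule zi[OF uDi])
        show "integrable lborel (\<lambda>t. unit t * (weight t * (D t * J' (y0 + wn n t))) + nl * \<bar>E n t\<bar>)"
          using zi[OF uD] integrable_abs[OF Ei[of n]] by simp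
        fix t
        have "weight t * ((Dn n t - D t) * J' (y0 + wn n t)) \<le> \<bar>weight t\<bar> * (\<bar>Dn n t - D t\<bar> * \<bar>J' (y0 + wn n t)\<bar>)"
          by (simp add: abs_mult[symmetric])
        also have "\<dots> \<le> nl * (\<bar>Dn n t - D t\<bar> * 1)" using weight_le J(4) nl0 by (intro mult_mono) auto
        finally have "weight t * (Dn n t * J' (y0 + wn n t)) \<le> weight t * (D t * J' (y0 + wn n t)) + nl * \<bar>Dn n t - D t\<bar>"
          by (simp add: algebra_simps)
        then show "unit t * (weight t * (Dn n t * J' (y0 + wn n t))) \<le> unit t * (weight t * (D t * J' (y0 + wn n t))) + nl * \<bar>E n t\<bar>"
          using nl0 by (auto simp: indicator_def E_def)
      qed
      also have "\<dots> = (\<integral>t. unit t * (weight t * (D t * J' (y0 + wn n t))) \<partial>lborel) + nl * (\<integral>t. \<bar>E n t\<bar> \<partial>lborel)"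
        using zi[OF uD] integrable_abs[OF Ei[of n]] by simp
      also have "nl * (\<integral>t. \<bar>E n t\<bar> \<partial>lborel) \<le> nl * (1 / real (Suc n))" using En[of n] nl0 by (intro mult_left_mono) auto
      finally show ?thesis by simp
    qed
    have lim: "(\<lambda>n. \<integral>t. unit t * (weight t * (D t * J' (y0 + wn (r n) t))) \<partial>lborel) \<longlonglongrightarrow> (\<integral>t. unit t * (weight t * (D t * J' (y0 + w t))) \<partial>lborel)"
    proof (rule integral_dominated_convergence[where w = "\<lambda>t. nl * \<bar>D t\<bar>"])
      show "integrable lborel (\<lambda>t. nl * \<bar>D t\<bar>)" using integrable_abs[OF D(1)] by simp
      show "AE t in lborel. norm (unit t * (weight t * (D t * J' (y0 + wn (r n) t)))) \<le> nl * \<bar>D t\<bar>" for n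
      proof (rule AE_I2)
        fix t
        have "\<bar>weight t\<bar> * (\<bar>D t\<bar> * \<bar>J' (y0 + wn (r n) t)\<bar>) \<le> nl * (\<bar>D t\<bar> * 1)"
          using weight_le J(4) nl0 by (intro mult_mono) auto
        then show "norm (unit t * (weight t * (D t * J' (y0 + wn (r n) t)))) \<le> nl * \<bar>D t\<bar>"
          using nl0 by (auto simp: indicator_def abs_mult)
      qed
      show "(\<lambda>t. unit t * (weight t * (D t * J' (y0 + wn (r n) t)))) \<in> borel_measurable lborel" for n
      proof -
        have "(\<lambda>t. unit t * J' (y0 + wn (r n) t)) \<in> borel_measurable borel"
          using uw[OF Jpc(1)] .
        then have "(\<lambda>t. (unit t * J' (y0 + wn (r n) t)) * (weight t * D t)) \<in> borel_measurable borel"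
          by (rule borel_measurable_times) measurable
        then show ?thesis by (simp add: mult_ac)
      qed
      show "AE t in lborel. (\<lambda>n. unit t * (weight t * (D t * J' (y0 + wn (r n) t)))) \<longlonglongrightarrow> unit t * (weight t * (D t * J' (y0 + w t)))"
        using r(2)
      proof eventually_elim
        case (elim t)
        show ?case
        proof (cases "t \<in> {0<..<T}")
          case True
          then have "(\<lambda>n. wn (r n) t) \<longlonglongrightarrow> w t" using elim by (simp add: LIM_zero_iff)
          moreover have "isCont J' (y0 + w t)" using J(2) by (simp add: continuous_on_eq_continuous_at)
          ultimately have "(\<lambda>n. J' (y0 + wn (r n) t)) \<longlonglongrightarrow> J' (y0 + w t)"
            by (intro isCont_tendsto_compose[of _ J'] tendsto_intros)
          then show ?thesis by (intro tendsto_intros)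
        qed simp
      qed
    qed measurable
    \<comment> \<open>One of the two error terms comes from replacing wn by w on the left
      (\<open>low\<close>), the other from replacing Dn by D on the right
      (\<open>up\<close>).\<close>
    have lim2: "(\<lambda>n. (\<integral>t. unit t * (weight t * (D t * J' (y0 + wn (r n) t))) \<partial>lborel) + 2 * (nl * (1 / real (Suc (r n)))))
        \<longlonglongrightarrow> (\<integral>t. unit t * (weight t * (D t * J' (y0 + w t))) \<partial>lborel) + 2 * 0"
      by (intro tendsto_intros lim LIMSEQ_subseq_LIMSEQ[OF n0 r(1), unfolded o_def])
    have "(\<integral>t. unit t * \<bar>y0 + w t\<bar> \<partial>lborel) - T * \<bar>y0\<bar> - T * \<epsilon> \<le> (\<integral>t. unit t * (weight t * (D t * J' (y0 + w t))) \<partial>lborel) + 2 * 0"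
    proof (rule LIMSEQ_le_const[OF lim2], intro exI allI impI)
      fix n :: nat
      show "(\<integral>t. unit t * \<bar>y0 + w t\<bar> \<partial>lborel) - T * \<bar>y0\<bar> - T * \<epsilon>
         \<le> (\<integral>t. unit t * (weight t * (D t * J' (y0 + wn (r n) t))) \<partial>lborel) + 2 * (nl * (1 / real (Suc (r n))))"
        using low[of "r n"] up[of "r n"] by linarith
    qed
    then show ?thesis by (simp add: J'_def J_def)
  qed
  define \<epsilon> where "\<epsilon> n = 1 / real (Suc n)" for n
  have e0: "\<epsilon> \<longlonglongrightarrow> 0" unfolding \<epsilon>_def[abs_def] by (rule LIMSEQ_Suc[OF lim_1_over_n])
  have ep: "\<epsilon> n > 0" for n by (simp add: \<epsilon>_def)
  have lim: "(\<lambda>n. \<integral>t. unit t * (weight t * (D t * ((y0 + w t) / sqrt ((y0 + w t)\<^sup>2 + (\<epsilon> n)\<^sup>2)))) \<partial>lborel)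
     \<longlonglongrightarrow> (\<integral>t. unit t * (weight t * (D t * sgn (y0 + w t))) \<partial>lborel)"
  proof (rule integral_dominated_convergence[where w = "\<lambda>t. nl * \<bar>D t\<bar>"])
    show "integrable lborel (\<lambda>t. nl * \<bar>D t\<bar>)" using integrable_abs[OF D(1)] by simp
    show "AE t in lborel. norm (unit t * (weight t * (D t * ((y0 + w t) / sqrt ((y0 + w t)\<^sup>2 + (\<epsilon> n)\<^sup>2))))) \<le> nl * \<bar>D t\<bar>" for n
    proof (rule AE_I2)
      fix t
      have "\<bar>weight t\<bar> * (\<bar>D t\<bar> * \<bar>(y0 + w t) / sqrt ((y0 + w t)\<^sup>2 + (\<epsilon> n)\<^sup>2)\<bar>) \<le> nl * (\<bar>D t\<bar> * 1)"
        using weight_le sqrt_convex(4)[OF ep] nl0 by (intro mult_mono) auto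
      then show "norm (unit t * (weight t * (D t * ((y0 + w t) / sqrt ((y0 + w t)\<^sup>2 + (\<epsilon> n)\<^sup>2))))) \<le> nl * \<bar>D t\<bar>"
        using nl0 by (auto simp: indicator_def abs_mult)
    qed
    show "AE t in lborel. (\<lambda>n. unit t * (weight t * (D t * ((y0 + w t) / sqrt ((y0 + w t)\<^sup>2 + (\<epsilon> n)\<^sup>2))))) \<longlonglongrightarrow> unit t * (weight t * (D t * sgn (y0 + w t)))"
    proof (rule AE_I2)
      fix t
      have "(\<lambda>n. y / sqrt (y\<^sup>2 + (\<epsilon> n)\<^sup>2)) \<longlonglongrightarrow> sgn y" for y :: real
      proof (cases "y = 0")
        case False
        have "(\<lambda>n. y / sqrt (y\<^sup>2 + (\<epsilon> n)\<^sup>2)) \<longlonglongrightarrow> y / sqrt (y\<^sup>2 + 0\<^sup>2)"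
          by (intro tendsto_intros e0) (use False in auto)
        then show ?thesis using False by (simp add: sgn_if abs_if split: if_splits)
      qed simp
      then show "(\<lambda>n. unit t * (weight t * (D t * ((y0 + w t) / sqrt ((y0 + w t)\<^sup>2 + (\<epsilon> n)\<^sup>2))))) \<longlonglongrightarrow> unit t * (weight t * (D t * sgn (y0 + w t)))"
        by (intro tendsto_intros)
    qed
  qed measurable
  have lim2: "(\<lambda>n. (\<integral>t. unit t * (weight t * (D t * ((y0 + w t) / sqrt ((y0 + w t)\<^sup>2 + (\<epsilon> n)\<^sup>2)))) \<partial>lborel) + T * \<epsilon> n)
     \<longlonglongrightarrow> (\<integral>t. unit t * (weight t * (D t * sgn (y0 + w t))) \<partial>lborel) + T * 0"
    by (intro tendsto_intros lim e0)
  have "(\<integral>t. unit t * \<bar>y0 + w t\<bar> \<partial>lborel) - T * \<bar>y0\<bar> \<le> (\<integral>t. unit t * (weight t * (D t * sgn (y0 + w t))) \<partial>lborel) + T * 0"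
    by (rule LIMSEQ_le_const[OF lim2]) (use step[OF ep] in \<open>auto simp: algebra_simps\<close>)
  then show ?thesis by simp
qed

end

section \<open>From kernels on the half line to integrable kernels\<close>

text \<open>The exceptional set for k enters through s \<mapsto> t - s. It is enclosed in a Borel
  null set, whose reflection is again null.\<close>

lemma conv_eq_cv:
  assumes kb: "kb \<in> borel_measurable borel" "\<And>s. s \<notin> {0<..<T} \<Longrightarrow> kb s = 0"
    and wb: "wb \<in> borel_measurable borel" "\<And>s. s \<notin> {0<..<T} \<Longrightarrow> wb s = 0"
    and k: "AE s in lborel. 0 < s \<and> s < T \<longrightarrow> k s = kb s"
    and w: "AE s in lborel. 0 < s \<and> s < T \<longrightarrow> w s = wb s"
    and t: "t \<le> T"
  shows "conv k w t = cv kb wb t"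
proof -
  have [measurable]: "kb \<in> borel_measurable borel" "wb \<in> borel_measurable borel" by fact+
  obtain N where N: "N \<in> sets lborel" "emeasure lborel N = 0" "\<And>s. s \<notin> N \<Longrightarrow> 0 < s \<and> s < T \<longrightarrow> k s = kb s"
    using k by (auto simp: eventually_ae_filter null_sets_def)
  have [measurable]: "N \<in> sets borel" using N by simp
  have "AE s in lborel. s \<notin> N" using N by (intro AE_not_in) auto
  then have "AE s in lborel. t + -1 * s \<notin> N" by (rule AE_borel_affine[rotated 2]) auto
  then have kr: "AE s in lborel. 0 < t - s \<and> t - s < T \<longrightarrow> k (t - s) = kb (t - s)"
    using N(3) by (auto elim!: eventually_mono)
  have ae: "AE s in lebesgue_on {0<..<t}. kb (t - s) * wb s = k (t - s) * w s"
    unfolding AE_lebesgue_on_iff_lborel[OF lmeasurable_interval(2)[THEN fmeasurableD, of 0 t, unfolded box_real]]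
    using kr w by eventually_elim (use t in auto)
  have m: "(\<lambda>s. kb (t - s) * wb s) \<in> borel_measurable (lebesgue_on {0<..<t})"
    by (intro measurable_restrict_space1 measurable_completion) simp
  have "conv k w t = (\<integral>s. kb (t - s) * wb s \<partial>lebesgue_on {0<..<t})"
    unfolding conv_def
    by (rule integral_cong_AE[OF borel_measurable_lebesgue_on_AE[OF _ m ae] m]) (use ae in \<open>auto elim!: eventually_mono\<close>)
  also have "\<dots> = (\<integral>s. indicator {0<..<t} s * (kb (t - s) * wb s) \<partial>lborel)"
    by (rule integrable_lebesgue_on_lborel(2)) measurable
  also have "\<dots> = cv kb wb t"
    unfolding cv_def
  proof (rule Bochner_Integration.integral_cong)
    fix s show "indicator {0<..<t} s * (kb (t - s) * wb s) = kb (t - s) * wb s"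
      using kb(2)[of "t - s"] wb(2)[of s] by (cases "s \<le> 0 \<or> s \<ge> t") (auto simp: indicator_def)
  qed simp
  finally show ?thesis .
qed

lemma interval_borel_version:
  fixes f :: "real \<Rightarrow> real"
  assumes f: "integrable (lebesgue_on {0<..<T}) f"
  obtains g where "integrable lborel g" "\<And>s. s \<notin> {0<..<T} \<Longrightarrow> g s = 0" "AE s in lborel. 0 < s \<and> s < T \<longrightarrow> f s = g s"
proof -
  obtain f' where f': "f' \<in> borel_measurable borel" "AE s in lebesgue_on {0<..<T}. f s = f' s"
    by (rule lebesgue_on_ex_borel[of "{0<..<T}" f]) (use f in auto)
  have "integrable (lebesgue_on {0<..<T}) f'"
    by (rule integrable_cong_AE_imp[OF f _ f'(2)]) (use f' in \<open>auto intro!: measurable_restrict_space1 measurable_completion\<close>)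
  then have i: "integrable lborel (\<lambda>s. indicator {0<..<T} s * f' s)"
    using f' by (subst (asm) integrable_lebesgue_on_lborel(1)) auto
  show thesis
  proof (rule that[OF i])
    have "AE s in lborel. s \<in> {0<..<T} \<longrightarrow> f s = f' s"
      using f'(2) by (subst (asm) AE_lebesgue_on_iff_lborel) auto
    then show "AE s in lborel. 0 < s \<and> s < T \<longrightarrow> f s = indicator {0<..<T} s * f' s"
      by eventually_elim auto
  qed simp
qed

text \<open>A version of k chosen almost everywhere could lose monotonicity; since monotone
  functions are Borel measurable, k itself is cut off to (0,T). For l, of which only integrals
  matter, any Borel version will do.\<close>

lemma kernel_volterra_pair:
  assumes T: "T > 0" and K: "kernel_assumption T k l"
  obtains kb lb where "volterra_pair T kb lb" "\<And>s. s \<notin> {0<..<T} \<Longrightarrow> kb s = 0" "\<And>s. s \<notin> {0<..<T} \<Longrightarrow> lb s = 0"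
    "AE s in lborel. 0 < s \<and> s < T \<longrightarrow> k s = kb s" "AE s in lborel. 0 < s \<and> s < T \<longrightarrow> l s = lb s"
proof -
  have k: "integrable (lebesgue_on {0<..<T}) k" "\<And>t. t > 0 \<Longrightarrow> k t \<ge> 0" "antimono_on {0<..} k"
    and l: "integrable (lebesgue_on {0<..<T}) l" and kl: "AE t in lebesgue_on {0<..}. conv k l t = 1"
    using K T unfolding kernel_assumption_def L1_loc_half_line_def by auto
  define kb where "kb s = indicator {0<..<T} s * k s" for s
  have mono: "k r \<le> k s" if "0 < s" "s \<le> r" for s r
    using k(3) that unfolding monotone_on_def by auto
  have kbm: "kb \<in> borel_measurable borel"
  proof -
    have "(\<lambda>s. - k s) \<in> borel_measurable (restrict_space borel {0<..<T})"
      using mono by (intro borel_measurable_mono_on_fnc mono_onI) auto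
    then show ?thesis by (simp add: borel_measurable_restrict_space_iff kb_def[abs_def])
  qed
  have kbi: "integrable lborel kb"
  proof -
    have "integrable lebesgue kb" using k(1) by (simp add: integrable_restrict_space kb_def[abs_def])
    then show ?thesis using kbm by (subst (asm) integrable_completion) auto
  qed
  have kk: "AE s in lborel. 0 < s \<and> s < T \<longrightarrow> k s = kb s" by (simp add: kb_def)
  obtain lb where lb: "integrable lborel lb" "\<And>s. s \<notin> {0<..<T} \<Longrightarrow> lb s = 0" "AE s in lborel. 0 < s \<and> s < T \<longrightarrow> l s = lb s"
    by (rule interval_borel_version[OF l]) (rule that; assumption)
  have kb0: "\<And>s. s \<notin> {0<..<T} \<Longrightarrow> kb s = 0" by (simp add: kb_def)
  have c: "conv k l t = cv kb lb t" if "t \<le> T" for t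
    by (rule conv_eq_cv[OF kbm kb0 _ lb(2) kk lb(3) that]) (use lb(1) in auto)
  have kl': "AE t in lborel. 0 < t \<longrightarrow> conv k l t = 1"
    using kl by (subst (asm) AE_lebesgue_on_iff_lborel) auto
  have vp: "volterra_pair T kb lb"
  proof
    show "AE t in lborel. 0 < t \<and> t < T \<longrightarrow> cv kb lb t = 1"
      using kl' by eventually_elim (use c in auto)
    show "kb r \<le> kb s" if "0 < s" "s \<le> r" for s r
      using that mono[OF that] k(2)[of s] by (auto simp: kb_def indicator_def)
  qed (use T kbi lb kb0 k(2) in \<open>auto simp: kb_def indicator_def\<close>)
  show thesis by (rule that[OF vp kb0 lb(2) kk lb(3)])
qed

section \<open>Elements of Bochner spaces as functions on the cylinder\<close>

lemma elts_L1: "f \<in> elts (Lp_space 1 \<Omega>) \<longleftrightarrow> integrable (lebesgue_on \<Omega>) f"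
  using integrable_norm_iff[of f "lebesgue_on \<Omega>"] by (auto simp: Lp_space_def)

lemma nrm_L1: "nrm (Lp_space 1 \<Omega>) f = (\<integral>x. \<bar>f x\<bar> \<partial>lebesgue_on \<Omega>)"
  by (simp add: Lp_space_def)

lemma simple_fun_expand:
  assumes "simple_fun T X s" "t \<in> {0<..<T}"
  shows "s t x = (\<Sum>v\<in>s ` {0<..<T}. indicator (s -` {v} \<inter> {0<..<T}) t * v x)"
proof -
  have fin: "finite (s ` {0<..<T})" using assms(1) by (simp add: simple_fun_def simple_function_def)
  have "(\<Sum>v\<in>s ` {0<..<T}. indicator (s -` {v} \<inter> {0<..<T}) t * v x) = (\<Sum>v\<in>s ` {0<..<T}. if v = s t then v x else 0)"
    by (rule sum.cong) (use assms(2) in \<open>auto simp: indicator_def\<close>)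
  also have "\<dots> = s t x" using fin assms(2) by simp
  finally show ?thesis by simp
qed

text \<open>A simple function is a finite sum of products of an indicator in t with a value in x,
  and each product is jointly integrable.\<close>

lemma simple_fun_joint_integrable:
  fixes \<Omega> :: "'a::euclidean_space set"
  assumes O: "open \<Omega>" and s: "simple_fun T (Lp_space 1 \<Omega>) s"
  shows "integrable (lebesgue_on ({0<..<T} \<times> \<Omega>)) (\<lambda>z. s (fst z) (snd z))"
proof -
  have fin: "finite (s ` {0<..<T})" and meas: "\<And>v. v \<in> s ` {0<..<T} \<Longrightarrow> s -` {v} \<inter> {0<..<T} \<in> sets (lebesgue_on {0<..<T})"
    using s by (auto simp: simple_fun_def simple_function_def)
  have "integrable (lebesgue_on ({0<..<T} \<times> \<Omega>)) (\<lambda>z. \<Sum>v\<in>s ` {0<..<T}. indicator (s -` {v} \<inter> {0<..<T}) (fst z) * v (snd z))"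
  proof (intro Bochner_Integration.integrable_sum integrable_tensor O)
    fix v assume v: "v \<in> s ` {0<..<T}"
    interpret finite_measure "lebesgue_on {0<..<T}" by (rule finite_measure_lebesgue_on) simp
    show "integrable (lebesgue_on {0<..<T}) (indicator (s -` {v} \<inter> {0<..<T}) :: real \<Rightarrow> real)"
      using meas[OF v] by (intro integrable_real_indicator) (auto simp: emeasure_eq_measure)
    show "integrable (lebesgue_on \<Omega>) v" using s v by (auto simp: simple_fun_def elts_L1)
  qed simp
  moreover have "integrable (lebesgue_on ({0<..<T} \<times> \<Omega>)) (\<lambda>z. s (fst z) (snd z)) \<longleftrightarrow>
      integrable (lebesgue_on ({0<..<T} \<times> \<Omega>)) (\<lambda>z. \<Sum>v\<in>s ` {0<..<T}. indicator (s -` {v} \<inter> {0<..<T}) (fst z) * v (snd z))"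
    by (rule Bochner_Integration.integrable_cong) (use simple_fun_expand[OF s] in auto)
  ultimately show ?thesis by blast
qed

text \<open>Beppo Levi: the integral of the sum is the sum of the integrals, so the sum is finite
  almost everywhere.\<close>

lemma summable_integral_AE:
  fixes f :: "nat \<Rightarrow> 'a \<Rightarrow> real"
  assumes f: "\<And>k. integrable M (f k)" "\<And>k x. f k x \<ge> 0" and s: "summable (\<lambda>k. \<integral>x. f k x \<partial>M)"
  shows "AE x in M. summable (\<lambda>k. f k x)"
proof -
  have m: "f k \<in> borel_measurable M" for k using f by auto
  have "(\<integral>\<^sup>+x. (\<Sum>k. ennreal (f k x)) \<partial>M) = (\<Sum>k. \<integral>\<^sup>+x. ennreal (f k x) \<partial>M)"
    by (rule nn_integral_suminf) (use m in measurable)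
  also have "\<dots> = (\<Sum>k. ennreal (\<integral>x. f k x \<partial>M))" using f by (simp add: nn_integral_eq_integral)
  also have "\<dots> = ennreal (\<Sum>k. \<integral>x. f k x \<partial>M)" using s f by (intro suminf_ennreal2) auto
  finally have "(\<integral>\<^sup>+x. (\<Sum>k. ennreal (f k x)) \<partial>M) \<noteq> \<infinity>" by simp
  then have "AE x in M. (\<Sum>k. ennreal (f k x)) \<noteq> \<infinity>"
    by (intro nn_integral_PInf_AE) (use m in measurable)
  then show ?thesis
    by eventually_elim (use f(2) in \<open>auto intro!: summable_suminf_not_top\<close>)
qed

text \<open>An element of a Bochner space has slices that may be altered on null sets separately for
  each t, so D itself need not be jointly measurable. The approximating simple functions are, and F
  is their almost everywhere limit along a subsequence.\<close>

lemma bochner_L1_joint: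
  fixes \<Omega> :: "'a::euclidean_space set"
  assumes O: "open \<Omega>" and D: "D \<in> bochner_Lp 1 T (Lp_space 1 \<Omega>)"
  obtains F where "integrable (lebesgue_on ({0<..<T} \<times> \<Omega>)) F"
    "AE t in lebesgue_on {0<..<T}. AE x in lebesgue_on \<Omega>. D t x = F (t, x)"
proof -
  let ?I = "lebesgue_on {0<..<T}" and ?O = "lebesgue_on \<Omega>" and ?Q = "lebesgue_on ({0<..<T} \<times> \<Omega>)"
  interpret finite_measure ?I by (rule finite_measure_lebesgue_on) simp
  obtain s where s: "\<And>n::nat. simple_fun T (Lp_space 1 \<Omega>) (s n)"
    and conv: "AE t in ?I. integrable ?O (D t) \<and> (\<lambda>n. \<integral>x. \<bar>D t x - s n t x\<bar> \<partial>?O) \<longlonglongrightarrow> 0"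
    using D unfolding bochner_Lp_def bochner_measurable_def by (auto simp: elts_L1 nrm_L1)
  have sL: "integrable ?O (s n t)" if "t \<in> {0<..<T}" for n t using s[of n] that by (auto simp: simple_fun_def elts_L1)
  note sj = simple_fun_joint_integrable[OF O s]
  define a where "a n t = (\<integral>x. \<bar>D t x - s n t x\<bar> \<partial>?O)" for n t
  define b where "b n m t = (\<integral>x. \<bar>s m t x - s n t x\<bar> \<partial>?O)" for n m t
  have bm: "b n m \<in> borel_measurable ?I" for n m
  proof -
    have "integrable ?Q (\<lambda>z. \<bar>s m (fst z) (snd z) - s n (fst z) (snd z)\<bar>)" using sj by simp
    from Fubini_lebesgue_on(2)[OF _ O this] show ?thesis by (simp add: b_def[abs_def])
  qed
  \<comment> \<open>The distance of D t to s n t is measurable in t as the limit in m of the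
    distances of s m t to s n t, which are measurable by Fubini.\<close>
  have am: "a n \<in> borel_measurable ?I" for n
  proof (rule borel_measurable_lebesgue_on_AE)
    show "(\<lambda>t. lim (\<lambda>m. b n m t)) \<in> borel_measurable ?I" by (rule borel_measurable_lim_metric) (rule bm)
    have "AE t in ?I. t \<in> {0<..<T}" by (rule AE_I2) simp
    with conv show "AE t in ?I. lim (\<lambda>m. b n m t) = a n t"
    proof eventually_elim
      case (elim t)
      have "(\<lambda>m. b n m t) \<longlonglongrightarrow> a n t"
      proof (rule LIM_zero_cancel, rule Lim_null_comparison)
        show "(\<lambda>m. \<integral>x. \<bar>D t x - s m t x\<bar> \<partial>?O) \<longlonglongrightarrow> 0" using elim by simp
        have "norm (b n m t - a n t) \<le> (\<integral>x. \<bar>D t x - s m t x\<bar> \<partial>?O)" for m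
        proof -
          have "b n m t - a n t = (\<integral>x. \<bar>s m t x - s n t x\<bar> - \<bar>D t x - s n t x\<bar> \<partial>?O)"
            unfolding a_def b_def using elim sL by (intro Bochner_Integration.integral_diff[symmetric]) auto
          also have "norm \<dots> \<le> (\<integral>x. norm (\<bar>s m t x - s n t x\<bar> - \<bar>D t x - s n t x\<bar>) \<partial>?O)" by (rule integral_norm_bound)
          also have "\<dots> \<le> (\<integral>x. \<bar>D t x - s m t x\<bar> \<partial>?O)"
            using elim sL by (intro integral_mono) auto
          finally show ?thesis .
        qed
        then show "\<forall>\<^sub>F m in sequentially. norm (b n m t - a n t) \<le> (\<integral>x. \<bar>D t x - s m t x\<bar> \<partial>?O)" by simp
      qed
      then show ?case by (rule limI)
    qed
  qed simp
  have a0: "a n t \<ge> 0" for n t by (simp add: a_def integral_nonneg_AE)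
  \<comment> \<open>The a n tend to 0 for almost every t without an integrable majorant. Truncation
    at 1 permits dominated convergence on the finite interval; along a subsequence the truncated
    values are summable at almost every t, and then the truncation is inactive from some index
    on.\<close>
  have mi: "integrable ?I (\<lambda>t. min 1 (a n t))" for n
    by (rule integrable_const_bound[of _ 1]) (use a0 am in auto)
  have "(\<lambda>n. \<integral>t. min 1 (a n t) \<partial>?I) \<longlonglongrightarrow> (\<integral>t. 0 \<partial>?I)"
  proof (rule integral_dominated_convergence[where w = "\<lambda>_. 1"])
    show "AE t in ?I. (\<lambda>n. min 1 (a n t)) \<longlonglongrightarrow> 0"
      using conv
    proof eventually_elim
      case (elim t)
      then have "(\<lambda>n. a n t) \<longlonglongrightarrow> 0" by (simp add: a_def)
      then have "(\<lambda>n. min 1 (a n t)) \<longlonglongrightarrow> min 1 0" by (intro tendsto_intros)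
      then show ?case by simp
    qed
  qed (use am a0 in auto)
  then have lim: "(\<lambda>n. \<integral>t. min 1 (a n t) \<partial>?I) \<longlonglongrightarrow> 0" by simp
  have "\<exists>n. (\<integral>t. min 1 (a n t) \<partial>?I) < (1 / 2) ^ j" for j :: nat
    using eventually_happens'[OF sequentially_bot order_tendstoD(2)[OF lim, of "(1 / 2) ^ j"]] by auto
  then obtain r where r: "\<And>j. (\<integral>t. min 1 (a (r j) t) \<partial>?I) < (1 / 2) ^ j" by metis
  have "summable (\<lambda>j. \<integral>t. min 1 (a (r j) t) \<partial>?I)"
    by (rule summable_comparison_test'[OF summable_geometric[of "1 / 2 :: real"], of 0]) (use r a0 in \<open>auto intro!: less_imp_le simp: integral_nonneg_AE\<close>)
  then have "AE t in ?I. summable (\<lambda>j. min 1 (a (r j) t))"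
    using mi a0 by (intro summable_integral_AE) auto
  moreover have "AE t in ?I. t \<in> {0<..<T}" by (rule AE_I2) simp
  ultimately have key: "AE t in ?I. AE x in ?O. (\<lambda>j. s (r j) t x) \<longlonglongrightarrow> D t x"
    using conv
  proof eventually_elim
    case (elim t)
    have "\<forall>\<^sub>F j in sequentially. min 1 (a (r j) t) < 1"
      using summable_LIMSEQ_zero[OF elim(1)] by (rule order_tendstoD) simp
    then have "\<forall>\<^sub>F j in sequentially. min 1 (a (r j) t) = a (r j) t" by eventually_elim simp
    then have "summable (\<lambda>j. a (r j) t)" using elim(1) summable_cong[of "\<lambda>j. min 1 (a (r j) t)" "\<lambda>j. a (r j) t"] by simp
    then have "AE x in ?O. summable (\<lambda>j. \<bar>D t x - s (r j) t x\<bar>)"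
      unfolding a_def using elim sL by (intro summable_integral_AE) auto
    then show ?case
    proof eventually_elim
      case (elim x)
      then have "(\<lambda>j. D t x - s (r j) t x) \<longlonglongrightarrow> 0" using summable_LIMSEQ_zero tendsto_rabs_zero_iff by blast
      from tendsto_diff[OF tendsto_const[of "D t x"] this] show ?case by simp
    qed
  qed
  define F where "F z = lim (\<lambda>j. s (r j) (fst z) (snd z))" for z
  have Fm: "F \<in> borel_measurable ?Q"
    unfolding F_def[abs_def] by (rule borel_measurable_lim_metric) (use sj in auto)
  have FD: "AE t in ?I. AE x in ?O. D t x = F (t, x)"
    using key
  proof eventually_elim
    case (elim t)
    then show ?case by eventually_elim (simp add: F_def limI)
  qed
  have "integrable ?Q F"
  proof (rule integrable_lebesgue_on_prodI[OF _ O Fm])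
    show "integrable ?I (\<lambda>t. \<integral>x. \<bar>D t x\<bar> \<partial>?O)"
    proof -
      have "integrable ?I (\<lambda>t. (\<integral>x. \<bar>D t x\<bar> \<partial>?O) powr 1)" using D by (simp add: bochner_Lp_def nrm_L1)
      then show ?thesis by (simp add: integral_nonneg_AE)
    qed
    have Fs: "AE t in ?I. (\<lambda>x. F (t, x)) \<in> borel_measurable ?O"
      using FD conv
    proof eventually_elim
      case (elim t)
      then show ?case by (rule_tac borel_measurable_lebesgue_on_AE[of _ "D t"]) (use O in auto)
    qed
    show "AE t in ?I. integrable ?O (\<lambda>x. F (t, x)) \<and> (\<integral>x. \<bar>F (t, x)\<bar> \<partial>?O) \<le> (\<integral>x. \<bar>D t x\<bar> \<partial>?O)"
      using FD conv Fs
    proof eventually_elim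
      case (elim t)
      have i: "integrable ?O (\<lambda>x. F (t, x))" using elim by (rule_tac integrable_cong_AE_imp[of _ "D t"]) auto
      have "(\<integral>x. \<bar>F (t, x)\<bar> \<partial>?O) = (\<integral>x. \<bar>D t x\<bar> \<partial>?O)"
        using elim i by (intro integral_cong_AE) (auto elim!: eventually_mono)
      then show ?case using i by simp
    qed
  qed simp
  then show thesis using FD that by blast
qed

lemma integral_times_bounded_tendsto:
  fixes e :: "'a \<Rightarrow> real"
  assumes f: "\<And>n. integrable M (f n)" "integrable M F" and e: "e \<in> borel_measurable M" "\<And>x. x \<in> space M \<Longrightarrow> \<bar>e x\<bar> \<le> C"
    and lim: "(\<lambda>n. \<integral>x. \<bar>f n x - F x\<bar> \<partial>M) \<longlonglongrightarrow> (0::real)"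
  shows "(\<lambda>n. \<integral>x. f n x * e x \<partial>M) \<longlonglongrightarrow> (\<integral>x. F x * e x \<partial>M)"
proof (rule LIM_zero_cancel, rule Lim_null_comparison)
  show "(\<lambda>n. C * (\<integral>x. \<bar>f n x - F x\<bar> \<partial>M)) \<longlonglongrightarrow> 0" using tendsto_mult_left[OF lim, of C] by simp
  have i: "integrable M (\<lambda>x. g x * e x)" if "integrable M g" for g
    by (rule Bochner_Integration.integrable_bound[of _ "\<lambda>x. C * g x"])
       (use that e in \<open>auto simp: abs_mult mult.commute intro!: AE_I2 mult_right_mono order_trans[OF e(2) abs_ge_self]\<close>)
  have "norm ((\<integral>x. f n x * e x \<partial>M) - (\<integral>x. F x * e x \<partial>M)) \<le> C * (\<integral>x. \<bar>f n x - F x\<bar> \<partial>M)" for n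
  proof -
    have "(\<integral>x. f n x * e x \<partial>M) - (\<integral>x. F x * e x \<partial>M) = (\<integral>x. (f n x - F x) * e x \<partial>M)"
      using i[OF f(1)] i[OF f(2)] by (simp add: left_diff_distrib)
    also have "norm \<dots> \<le> (\<integral>x. norm ((f n x - F x) * e x) \<partial>M)" by (rule integral_norm_bound)
    also have "\<dots> \<le> (\<integral>x. C * \<bar>f n x - F x\<bar> \<partial>M)"
    proof (rule integral_mono)
      show "integrable M (\<lambda>x. norm ((f n x - F x) * e x))" using i[of "\<lambda>x. f n x - F x"] f by simp
      show "norm ((f n x - F x) * e x) \<le> C * \<bar>f n x - F x\<bar>" if "x \<in> space M" for x
        using e(2)[OF that] by (simp add: abs_mult mult.commute mult_right_mono)
    qed (use f in simp)
    finally show ?thesis by simp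
  qed
  then show "\<forall>\<^sub>F n in sequentially. norm ((\<integral>x. f n x * e x \<partial>M) - (\<integral>x. F x * e x \<partial>M)) \<le> C * (\<integral>x. \<bar>f n x - F x\<bar> \<partial>M)" by simp
qed

text \<open>For simple functions the identity is Fubini's theorem, and both sides are continuous
  under the two L1 convergences that define the Bochner integral. It replaces vector-valued
  integrals by integrals over the cylinder.\<close>

lemma bochner_integral_pairing:
  fixes \<Omega> :: "'a::euclidean_space set"
  assumes O: "open \<Omega>" and y: "has_bochner_integral_in T (Lp_space 1 \<Omega>) f y"
    and F: "integrable (lebesgue_on ({0<..<T} \<times> \<Omega>)) F" "AE t in lebesgue_on {0<..<T}. AE x in lebesgue_on \<Omega>. f t x = F (t, x)"
    and e: "e \<in> borel_measurable (lebesgue_on \<Omega>)" "\<And>x. x \<in> \<Omega> \<Longrightarrow> \<bar>e x\<bar> \<le> C"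
  shows "(\<integral>x. y x * e x \<partial>lebesgue_on \<Omega>) = (\<integral>z. F z * e (snd z) \<partial>lebesgue_on ({0<..<T} \<times> \<Omega>))"
proof -
  let ?I = "lebesgue_on {0<..<T}" and ?O = "lebesgue_on \<Omega>" and ?Q = "lebesgue_on ({0<..<T} \<times> \<Omega>)"
  have oI: "open {0<..<T}" by simp
  obtain s where s: "\<And>n::nat. simple_fun T (Lp_space 1 \<Omega>) (s n)"
    and l1: "(\<lambda>n. \<integral>\<^sup>+ t. ennreal (\<integral>x. \<bar>f t x - s n t x\<bar> \<partial>?O) \<partial>?I) \<longlonglongrightarrow> 0"
    and l2: "(\<lambda>n. \<integral>x. \<bar>(\<integral>t. s n t x \<partial>?I) - y x\<bar> \<partial>?O) \<longlonglongrightarrow> 0" and yi: "integrable ?O y"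
    using y unfolding has_bochner_integral_in_def by (auto simp: nrm_L1 elts_L1)
  note sj = simple_fun_joint_integrable[OF O s]
  have em: "(\<lambda>z. e (snd z)) \<in> borel_measurable ?Q" using measurable_lebesgue_on_snd[OF oI O e(1)] .
  have "(\<lambda>n. \<integral>x. (\<integral>t. s n t x \<partial>?I) * e x \<partial>?O) \<longlonglongrightarrow> (\<integral>x. y x * e x \<partial>?O)"
    using Fubini_lebesgue_on(5)[OF oI O sj] e yi l2
    by (intro integral_times_bounded_tendsto[where C = C]) auto
  moreover have "(\<integral>x. (\<integral>t. s n t x \<partial>?I) * e x \<partial>?O) = (\<integral>z. s n (fst z) (snd z) * e (snd z) \<partial>?Q)" for n
  proof -
    have "integrable ?Q (\<lambda>z. s n (fst z) (snd z) * e (snd z))"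
      by (rule Bochner_Integration.integrable_bound[of _ "\<lambda>z. C * s n (fst z) (snd z)"])
         (use sj[of n] em e(2) in \<open>auto simp: abs_mult mult.commute intro!: AE_I2 mult_right_mono order_trans[OF e(2) abs_ge_self]\<close>)
    from Fubini_lebesgue_on(6)[OF oI O this] show ?thesis by simp
  qed
  moreover have "(\<lambda>n. \<integral>z. s n (fst z) (snd z) * e (snd z) \<partial>?Q) \<longlonglongrightarrow> (\<integral>z. F z * e (snd z) \<partial>?Q)"
  proof (rule integral_times_bounded_tendsto[OF sj F(1) em])
    have di: "integrable ?Q (\<lambda>z. \<bar>s n (fst z) (snd z) - F z\<bar>)" for n using sj F(1) by simp
    have "ennreal (\<integral>z. \<bar>s n (fst z) (snd z) - F z\<bar> \<partial>?Q) = (\<integral>\<^sup>+ t. ennreal (\<integral>x. \<bar>f t x - s n t x\<bar> \<partial>?O) \<partial>?I)" for n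
    proof -
      have "ennreal (\<integral>z. \<bar>s n (fst z) (snd z) - F z\<bar> \<partial>?Q) = ennreal (\<integral>t. \<integral>x. \<bar>s n t x - F (t, x)\<bar> \<partial>?O \<partial>?I)"
        using Fubini_lebesgue_on(3)[OF oI O di] by simp
      also have "\<dots> = (\<integral>\<^sup>+t. ennreal (\<integral>x. \<bar>s n t x - F (t, x)\<bar> \<partial>?O) \<partial>?I)"
        using Fubini_lebesgue_on(2)[OF oI O di] by (intro nn_integral_eq_integral[symmetric]) (auto simp: integral_nonneg_AE)
      also have "\<dots> = (\<integral>\<^sup>+ t. ennreal (\<integral>x. \<bar>f t x - s n t x\<bar> \<partial>?O) \<partial>?I)"
      proof (rule nn_integral_cong_AE)
        have "AE t in ?I. t \<in> {0<..<T}" by (rule AE_I2) simp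
        then show "AE t in ?I. ennreal (\<integral>x. \<bar>s n t x - F (t, x)\<bar> \<partial>?O) = ennreal (\<integral>x. \<bar>f t x - s n t x\<bar> \<partial>?O)"
          using F(2) Fubini_lebesgue_on(1)[OF oI O F(1)]
        proof eventually_elim
          case (elim t)
          have st: "integrable ?O (s n t)" using s[of n] elim(1) by (auto simp: simple_fun_def elts_L1)
          have "AE x in ?O. F (t, x) = f t x" using elim(2) by eventually_elim simp
          then have "f t \<in> borel_measurable ?O"
            by (rule borel_measurable_lebesgue_on_AE[rotated 2]) (use O elim(3) in auto)
          then have "(\<integral>x. \<bar>s n t x - F (t, x)\<bar> \<partial>?O) = (\<integral>x. \<bar>f t x - s n t x\<bar> \<partial>?O)"
            using elim(2,3) st by (intro integral_cong_AE) (auto elim!: eventually_mono)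
          then show ?case by simp
        qed
      qed
      finally show ?thesis .
    qed
    then have "(\<lambda>n. ennreal (\<integral>z. \<bar>s n (fst z) (snd z) - F z\<bar> \<partial>?Q)) \<longlonglongrightarrow> ennreal 0" using l1 by simp
    then show "(\<lambda>n. \<integral>z. \<bar>s n (fst z) (snd z) - F z\<bar> \<partial>?Q) \<longlonglongrightarrow> 0"
      by (subst (asm) tendsto_ennreal_iff) (auto simp: integral_nonneg_AE)
  qed (use e(2) in auto)
  ultimately show ?thesis using LIMSEQ_unique by simp blast
qed

section \<open>Weak time derivatives\<close>

lemma test_funs_deriv:
  fixes \<rho> :: "real \<Rightarrow> real"
  assumes "\<rho> \<in> test_funs S"
  shows "(\<rho> has_real_derivative deriv \<rho> t) (at t)" "deriv \<rho> \<in> test_funs S"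
proof -
  obtain C where "\<And>k. Ck k \<rho>" using test_funsE[OF assms] by metis
  note d = Ck_Suc_has_derivative[OF this]
  have lin: "frechet_derivative \<rho> (at t) s = frechet_derivative \<rho> (at t) 1 * s" for t s
  proof -
    have "frechet_derivative \<rho> (at t) (s *\<^sub>R 1) = s *\<^sub>R frechet_derivative \<rho> (at t) 1"
      by (rule linear_cmul[OF has_derivative_linear[OF d]])
    then show ?thesis by (simp add: mult.commute)
  qed
  have dd: "(\<rho> has_real_derivative frechet_derivative \<rho> (at t) 1) (at t)" for t
    unfolding has_field_derivative_def
    by (rule has_derivative_eq_rhs[OF d]) (rule ext, rule lin)
  then have eq: "deriv \<rho> t = frechet_derivative \<rho> (at t) 1" for t by (rule DERIV_imp_deriv)
  show "(\<rho> has_real_derivative deriv \<rho> t) (at t)" using dd eq by simp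
  have "deriv \<rho> = (\<lambda>t. frechet_derivative \<rho> (at t) 1)" using eq by (rule ext)
  then show "deriv \<rho> \<in> test_funs S" using test_funs_derivative[OF assms, where e = 1] by simp
qed

lemma test_funs_eq_0: "\<theta> \<in> test_funs S \<Longrightarrow> x \<notin> S \<Longrightarrow> \<theta> x = 0"
  by (metis subsetD test_funsE)

text \<open>The vanishing mean makes the primitive from the left vanish to the right of the support
  of f as well.\<close>

lemma test_fun_antiderivative:
  fixes f :: "real \<Rightarrow> real"
  assumes f: "f \<in> test_funs {0<..<T}" and z: "(\<integral>s. f s \<partial>lborel) = 0"
  obtains \<theta> where "\<theta> \<in> test_funs {0<..<T}" "\<And>t. (\<theta> has_real_derivative f t) (at t)"
proof -
  obtain C where C: "compact C" "C \<subseteq> {0<..<T}" "\<And>x. x \<notin> C \<Longrightarrow> f x = 0" "\<And>k. Ck k f"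
    using test_funsE[OF f] by metis
  have fc: "continuous_on UNIV f" using test_funs_continuous[OF f] .
  have f0: "f s = 0" if "s \<le> 0 \<or> s \<ge> T" for s using test_funs_eq_0[OF f, of s] that by auto
  have fi: "integrable lborel f"
  proof -
    have "integrable lborel (\<lambda>s. indicator C s *\<^sub>R f s)"
      using borel_integrable_compact[OF C(1)] continuous_on_subset[OF fc] by blast
    moreover have "(\<lambda>s. indicator C s *\<^sub>R f s) = f" using C(3) by (auto simp: indicator_def fun_eq_iff)
    ultimately show ?thesis by simp
  qed
  define \<theta> where "\<theta> t = (\<integral>s. indicator {..t} s * f s \<partial>lborel)" for t
  have eqI: "\<theta> t = integral {A..t} f" if "A \<le> 0" "A \<le> t" for A t
  proof -
    have "\<theta> t = (\<integral>s. indicator {A..t} s *\<^sub>R f s \<partial>lborel)"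
      unfolding \<theta>_def using that f0 by (intro Bochner_Integration.integral_cong) (auto simp: indicator_def)
    also have "\<dots> = integral {A..t} f"
      using set_borel_integral_eq_integral(2)[OF borel_integrable_atLeastAtMost'[OF continuous_on_subset[OF fc]], of A t]
      by (simp add: set_lebesgue_integral_def)
    finally show ?thesis .
  qed
  have der: "(\<theta> has_real_derivative f t) (at t)" for t
  proof -
    \<comment> \<open>Every A \<le> 0 to the left of t is an admissible lower limit; this choice
      makes t an interior point of [A, t + 1].\<close>
    define A where "A = min (t - 1) 0"
    have "((\<lambda>u. integral {A..u} f) has_real_derivative f t) (at t within {A..t + 1})"
      by (rule integral_has_real_derivative) (auto intro: continuous_on_subset[OF fc] simp: A_def)
    then have "((\<lambda>u. integral {A..u} f) has_real_derivative f t) (at t)"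
      by (subst (asm) at_within_interior) (auto simp: A_def)
    then show ?thesis
      by (rule has_field_derivative_transform_within_open[of _ _ _ "{A<..}"]) (auto intro!: eqI[symmetric] simp: A_def)
  qed
  have "\<theta> \<in> test_funs {0<..<T}"
  proof (cases "C = {}")
    case True
    then have "f = (\<lambda>_. 0)" using C(3) by auto
    then have "\<theta> = (\<lambda>_. 0)" by (simp add: \<theta>_def fun_eq_iff)
    then show ?thesis by (intro test_funsI[of _ "{}"]) (auto intro: Ck_const)
  next
    case False
    obtain p q where pq: "p \<in> C" "q \<in> C" "\<And>x. x \<in> C \<Longrightarrow> p \<le> x" "\<And>x. x \<in> C \<Longrightarrow> x \<le> q"
      using compact_attains_inf[OF C(1) False] compact_attains_sup[OF C(1) False] by metis
    show ?thesis
    proof (rule test_funsI[of _ "{p..q}"])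
      show "Ck k \<theta>" for k
      proof (cases k)
        case 0
        then show ?thesis using der by (auto intro!: continuous_at_imp_continuous_on DERIV_isCont)
      next
        case (Suc j)
        have "Ck (Suc j) \<theta>"
        proof (rule Ck_SucI[OF der[THEN has_field_derivative_imp_has_derivative]])
          show "Ck j (\<lambda>x. f x * e)" for e by (intro Ck_mult C(4) Ck_const)
        qed
        then show ?thesis using Suc by simp
      qed
      have "p \<in> {0<..<T}" "q \<in> {0<..<T}" using pq(1,2) C(2) by blast+
      then show "{p..q} \<subseteq> {0<..<T}" by auto
      fix t assume t: "t \<notin> {p..q}"
      show "\<theta> t = 0"
      proof (cases "t < p")
        case True
        then have "indicator {..t} s * f s = 0" for s using C(3)[of s] pq(3)[of s] by (cases "s \<in> C") (auto simp: indicator_def)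
        then show ?thesis unfolding \<theta>_def by (simp only: Bochner_Integration.integral_zero)
      next
        case False
        then have "indicator {..t} s * f s = f s" for s using C(3)[of s] pq(4)[of s] t by (cases "s \<in> C") (auto simp: indicator_def)
        then show ?thesis using z by (simp only: \<theta>_def)
      qed
    qed auto
  qed
  then show thesis using der that by blast
qed

lemma integral_test_deriv_tail:
  assumes \<theta>: "\<theta> \<in> test_funs {0<..<T}" and s: "0 < s" "s < T"
  shows "(\<integral>t. indicator {s<..} t * deriv \<theta> t \<partial>lebesgue_on {0<..<T}) = - \<theta> s"
proof -
  have t0: "\<theta> 0 = 0" "\<theta> T = 0" using test_funs_eq_0[OF \<theta>] by auto
  have c: "continuous_on UNIV (deriv \<theta>)" using test_funs_continuous[OF test_funs_deriv(2)[OF \<theta>]] .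
  have [measurable]: "deriv \<theta> \<in> borel_measurable borel" using c by (rule borel_measurable_continuous_onI)
  have D: "(\<integral>t. indicator {0<..<u} t * deriv \<theta> t \<partial>lborel) = \<theta> u" if "u \<ge> 0" for u
    by (rule integral_derivative[where D = \<theta> and d = "deriv \<theta>", OF c _ t0(1) that]) (rule has_field_derivative_at_within[OF test_funs_deriv(1)[OF \<theta>]])
  have i: "integrable lborel (\<lambda>t. indicator {0<..<u} t * deriv \<theta> t)" for u
  proof -
    have "integrable lborel (\<lambda>t. indicator {0..u} t *\<^sub>R deriv \<theta> t)"
      using borel_integrable_atLeastAtMost'[OF continuous_on_subset[OF c]] unfolding set_integrable_def by blast
    then show ?thesis by (rule Bochner_Integration.integrable_bound) (auto simp: indicator_def)
  qed
  have "(\<integral>t. indicator {s<..} t * deriv \<theta> t \<partial>lebesgue_on {0<..<T}) = (\<integral>t. indicator {0<..<T} t * (indicator {s<..} t * deriv \<theta> t) \<partial>lborel)"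
    by (rule integrable_lebesgue_on_lborel(2)) measurable
  also have "\<dots> = (\<integral>t. indicator {0<..<T} t * deriv \<theta> t - indicator {0<..<s} t * deriv \<theta> t \<partial>lborel)"
  proof (rule integral_cong_AE)
    have "AE t in lborel. t \<notin> {s}" by (intro AE_not_in) (auto intro: finite_imp_null_set_lborel)
    then show "AE t in lborel. indicator {0<..<T} t * (indicator {s<..} t * deriv \<theta> t) = indicator {0<..<T} t * deriv \<theta> t - indicator {0<..<s} t * deriv \<theta> t"
      by eventually_elim (use s in \<open>auto simp: indicator_def\<close>)
  qed measurable
  also have "\<dots> = - \<theta> s" using i D[of T] D[of s] s t0 by simp
  finally show ?thesis .
qed

lemma integral_lebesgue_on_sub:
  fixes f :: "'a::euclidean_space \<Rightarrow> real"
  assumes "A \<in> sets lebesgue" "B \<in> sets lebesgue" "A \<subseteq> B"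
  shows "(\<integral>x. f x \<partial>lebesgue_on A) = (\<integral>x. indicator A x * f x \<partial>lebesgue_on B)"
proof -
  have "(\<lambda>x. indicator B x *\<^sub>R (indicator A x * f x)) = (\<lambda>x. indicator A x *\<^sub>R f x)"
    using assms(3) by (auto simp: indicator_def fun_eq_iff)
  then show ?thesis using assms by (simp add: integral_restrict_space)
qed

lemma test_fun_times_integrable:
  fixes \<psi> :: "real \<Rightarrow> real"
  assumes "\<psi> \<in> test_funs S" "integrable (lebesgue_on {0<..<T}) r"
  shows "integrable (lebesgue_on {0<..<T}) (\<lambda>t. \<psi> t * r t)"
proof -
  obtain B where B: "\<And>x. \<bar>\<psi> x\<bar> \<le> B" "B \<ge> 0" using test_funs_bounded[OF assms(1)] by metis
  have "\<psi> \<in> borel_measurable (lebesgue_on {0<..<T})"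
    using borel_measurable_continuous_onI[OF test_funs_continuous[OF assms(1)]] by (intro measurable_restrict_space1 measurable_completion) simp
  then show ?thesis
    by (rule_tac Bochner_Integration.integrable_bound[of _ "\<lambda>t. B * r t"]) (use B assms(2) in \<open>auto simp: abs_mult intro!: mult_right_mono\<close>)
qed

text \<open>Du Bois-Reymond: H minus the primitive P of D has zero weak derivative, so it is
  constant almost everywhere. The constant is 0 because the continuous representative G of H and the
  primitive P both vanish at time 0.\<close>

lemma weak_primitive:
  fixes H D G :: "real \<Rightarrow> real"
  assumes T: "T > 0" and H: "integrable (lebesgue_on {0<..<T}) H" and D: "integrable (lebesgue_on {0<..<T}) D"
    and weak: "\<And>\<theta>. \<theta> \<in> test_funs {0<..<T} \<Longrightarrow>
      (\<integral>t. deriv \<theta> t * H t \<partial>lebesgue_on {0<..<T}) = - (\<integral>t. \<theta> t * D t \<partial>lebesgue_on {0<..<T})"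
    and G: "continuous_on {0..T} G" "G 0 = 0" "AE t in lebesgue_on {0<..<T}. H t = G t"
  shows "AE t in lebesgue_on {0<..<T}. H t = (\<integral>s. indicator {0<..<t} s * D s \<partial>lebesgue_on {0<..<T})"
proof -
  let ?I = "lebesgue_on {0<..<T}"
  have oI: "open {0<..<T}" by simp
  have SI: "{0<..<T} \<in> sets lebesgue" by simp
  interpret finite_measure ?I by (rule finite_measure_lebesgue_on) simp
  obtain Db where Db: "integrable lborel Db" "\<And>s. s \<notin> {0<..<T} \<Longrightarrow> Db s = 0" "AE s in lborel. 0 < s \<and> s < T \<longrightarrow> D s = Db s"
    by (rule interval_borel_version[OF D]) (rule that; assumption)
  define P where "P t = (\<integral>s. indicator {0<..<t} s * Db s \<partial>lborel)" for t
  have Pc: "continuous_on UNIV P" unfolding P_def by (rule integral_indicator_continuous[OF Db(1)])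
  have DDb: "AE s in ?I. D s = Db s" unfolding AE_lebesgue_on_iff_lborel[OF SI] using Db(3) by eventually_elim auto
  have Dbm: "Db \<in> borel_measurable borel" using Db(1) by auto
  have PD: "(\<integral>s. indicator {0<..<t} s * D s \<partial>?I) = P t" for t
  proof -
    have "(\<integral>s. indicator {0<..<t} s * D s \<partial>?I) = (\<integral>s. indicator {0<..<t} s * Db s \<partial>?I)"
    proof (rule integral_cong_AE)
      show "(\<lambda>s. indicat_real {0<..<t} s * D s) \<in> borel_measurable ?I"
        by (rule borel_measurable_times[OF measurable_restrict_space1[OF borel_measurable_indicator] borel_measurable_integrable[OF D]]) simp
      show "(\<lambda>s. indicat_real {0<..<t} s * Db s) \<in> borel_measurable ?I"
        using Dbm by (intro measurable_restrict_space1 measurable_completion) simp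
    qed (use DDb in \<open>auto elim!: eventually_mono\<close>)
    also have "\<dots> = (\<integral>s. indicator {0<..<T} s * (indicator {0<..<t} s * Db s) \<partial>lborel)"
      using Dbm by (intro integrable_lebesgue_on_lborel(2)) auto
    also have "\<dots> = P t" unfolding P_def using Db(2) by (intro Bochner_Integration.integral_cong) (auto simp: indicator_def)
    finally show ?thesis .
  qed
  have Pi: "integrable ?I P"
  proof -
    have "integrable lborel (\<lambda>t. indicator {0..T} t *\<^sub>R P t)"
      using borel_integrable_atLeastAtMost'[OF continuous_on_subset[OF Pc]] unfolding set_integrable_def by blast
    then have "integrable lborel (\<lambda>t. indicator {0<..<T} t * P t)"
      by (rule Bochner_Integration.integrable_bound) (use borel_measurable_continuous_onI[OF Pc] in \<open>auto simp: indicator_def\<close>)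
    then show ?thesis using borel_measurable_continuous_onI[OF Pc] by (subst integrable_lebesgue_on_lborel(1)) auto
  qed
  have parts: "(\<integral>t. deriv \<theta> t * P t \<partial>?I) = - (\<integral>t. \<theta> t * D t \<partial>?I)" if \<theta>: "\<theta> \<in> test_funs {0<..<T}" for \<theta>
  proof -
    have di: "integrable ?I (deriv \<theta>)" using test_fun_times_integrable[OF test_funs_deriv(2)[OF \<theta>], of T "\<lambda>_. 1"] by simp
    define K where "K z = deriv \<theta> (fst z) * (indicator {0<..<fst z} (snd z) * D (snd z))" for z :: "real \<times> real"
    have "integrable (lebesgue_on ({0<..<T} \<times> {0<..<T})) K"
    proof (rule Bochner_Integration.integrable_bound)
      show ti: "integrable (lebesgue_on ({0<..<T} \<times> {0<..<T})) (\<lambda>z. deriv \<theta> (fst z) * D (snd z))"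
        by (rule integrable_tensor[OF oI oI di D])
      have "{z :: real \<times> real. 0 < snd z \<and> snd z < fst z} \<in> sets borel"
        by (intro borel_open open_Collect_conj open_Collect_less continuous_intros)
      then have "(\<lambda>z. indicat_real {z :: real \<times> real. 0 < snd z \<and> snd z < fst z} z * (deriv \<theta> (fst z) * D (snd z))) \<in> borel_measurable (lebesgue_on ({0<..<T} \<times> {0<..<T}))"
        by (intro borel_measurable_times[OF measurable_restrict_space1[OF borel_measurable_indicator] borel_measurable_integrable[OF ti]]) auto
      moreover have "(\<lambda>z. indicat_real {z :: real \<times> real. 0 < snd z \<and> snd z < fst z} z * (deriv \<theta> (fst z) * D (snd z))) = K"
        by (auto simp: K_def indicator_def)
      ultimately show "K \<in> borel_measurable (lebesgue_on ({0<..<T} \<times> {0<..<T}))" by simp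
    qed (auto simp: K_def indicator_def)
    note F = Fubini_lebesgue_on[OF oI oI this]
    have "(\<integral>t. deriv \<theta> t * P t \<partial>?I) = (\<integral>t. \<integral>s. K (t, s) \<partial>?I \<partial>?I)"
      by (simp add: K_def PD)
    also have "\<dots> = (\<integral>s. \<integral>t. K (t, s) \<partial>?I \<partial>?I)" using F(3) F(6) by simp
    also have "\<dots> = (\<integral>s. - (\<theta> s * D s) \<partial>?I)"
    proof (rule Bochner_Integration.integral_cong)
      fix s assume "s \<in> space ?I"
      then have s: "0 < s" "s < T" by auto
      have "(\<integral>t. K (t, s) \<partial>?I) = (\<integral>t. (indicator {s<..} t * deriv \<theta> t) * D s \<partial>?I)"
        using s by (intro Bochner_Integration.integral_cong) (auto simp: K_def indicator_def)
      also have "\<dots> = - (\<theta> s * D s)" using integral_test_deriv_tail[OF \<theta> s] by simp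
      finally show "(\<integral>t. K (t, s) \<partial>?I) = - (\<theta> s * D s)" .
    qed simp
    finally show ?thesis by simp
  qed
  define r where "r t = H t - P t" for t
  have ri: "integrable ?I r" unfolding r_def[abs_def] using H Pi by simp
  have r0: "(\<integral>t. deriv \<theta> t * r t \<partial>?I) = 0" if \<theta>: "\<theta> \<in> test_funs {0<..<T}" for \<theta>
    using test_fun_times_integrable[OF test_funs_deriv(2)[OF \<theta>] H] test_fun_times_integrable[OF test_funs_deriv(2)[OF \<theta>] Pi]
      weak[OF \<theta>] parts[OF \<theta>] by (simp add: r_def right_diff_distrib)
  \<comment> \<open>A fixed test function with nonzero mean: subtracting a multiple of it from
    \<psi> leaves mean zero, hence the derivative of a test function. The middle third is merely a
    closed box inside (0,T).\<close>
  define q where "q = cutoff_box (T / 3) (2 * T / 3) (Suc 0)"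
  have q: "q \<in> test_funs {0<..<T}" unfolding q_def using T by (intro cutoff_box_test_fun) auto
  have tint: "integrable lborel \<psi> \<and> (\<integral>t. \<psi> t \<partial>lborel) = (\<integral>t. \<psi> t \<partial>?I)" if p: "\<psi> \<in> test_funs {0<..<T}" for \<psi>
  proof -
    have m: "\<psi> \<in> borel_measurable borel" using test_funs_continuous[OF p] by (rule borel_measurable_continuous_onI)
    have "integrable ?I \<psi>" using test_fun_times_integrable[OF p, of T "\<lambda>_. 1"] by simp
    moreover have "(\<lambda>t. indicator {0<..<T} t * \<psi> t) = \<psi>" using test_funs_eq_0[OF p] by (auto simp: indicator_def fun_eq_iff)
    ultimately show ?thesis using m by (simp add: integrable_lebesgue_on_lborel)
  qed
  define c0 where "c0 = (\<integral>t. q t \<partial>lborel)"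
  have c0: "c0 \<noteq> 0"
  proof
    assume "c0 = 0"
    then have "AE t in lborel. q t = 0"
      using tint[OF q] cutoff_box_bounds(1) unfolding c0_def q_def by (subst (asm) integral_nonneg_eq_0_iff_AE) (auto intro!: AE_I2)
    then have "q (T / 2) = (\<lambda>_. 0) (T / 2)"
      by (intro continuous_AE_eq[OF test_funs_continuous[OF q] continuous_on_const, where a = 0 and b = T]) (use T in auto)
    moreover have "q (T / 2) > 0"
      using T box_bump_pos_iff[of "T / 3" "2 * T / 3" "T / 2"] by (auto simp: q_def cutoff_box_def)
    ultimately show False by simp
  qed
  define C where "C = (\<integral>t. q t * r t \<partial>?I) / c0"
  have "AE t in ?I. r t - C = 0"
  proof (rule fundamental_lemma)
    show "L1_loc {0<..<T} (\<lambda>t. r t - C)"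
      by (rule integrable_L1_loc) (use ri in simp_all)
    fix \<psi> assume p: "\<psi> \<in> test_funs {0<..<T}"
    define m where "m = (\<integral>t. \<psi> t \<partial>lborel)"
    define f where "f t = 1 * \<psi> t + (- (m / c0)) * q t" for t
    have f: "f \<in> test_funs {0<..<T}" unfolding f_def by (rule test_funs_diff_scale[OF p q])
    have "(\<integral>t. f t \<partial>lborel) = 0" using tint[OF p] tint[OF q] c0 by (simp add: f_def c0_def m_def)
    then obtain \<theta> where \<theta>: "\<theta> \<in> test_funs {0<..<T}" "\<And>t. (\<theta> has_real_derivative f t) (at t)"
      using test_fun_antiderivative[OF f] by metis
    have "deriv \<theta> t = f t" for t using \<theta>(2) DERIV_imp_deriv by blast
    then have "0 = (\<integral>t. f t * r t \<partial>?I)" using r0[OF \<theta>(1)] by simp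
    also have "\<dots> = (\<integral>t. \<psi> t * r t - (m / c0) * (q t * r t) \<partial>?I)" by (simp add: f_def algebra_simps)
    also have "\<dots> = (\<integral>t. \<psi> t * r t \<partial>?I) - C * m"
      using test_fun_times_integrable[OF p ri] test_fun_times_integrable[OF q ri] by (simp add: C_def)
    also have "\<dots> = (\<integral>t. \<psi> t * (r t - C) \<partial>?I)"
      using test_fun_times_integrable[OF p ri] test_fun_times_integrable[OF p, of T "\<lambda>_. 1"] tint[OF p]
      by (simp add: right_diff_distrib m_def)
    finally show "(\<integral>t. \<psi> t * (r t - C) \<partial>?I) = 0" by simp
  qed simp
  then have rC: "AE t in ?I. G t - P t = C" using G(3) by eventually_elim (simp add: r_def)
  \<comment> \<open>G is continuous on [0,T] only; clamping the argument extends it continuously to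
    the line.\<close>
  define Gc where "Gc t = G (max 0 (min T t))" for t
  have Gcc: "continuous_on UNIV Gc"
    unfolding Gc_def by (rule continuous_on_compose2[OF G(1)]) (use T in \<open>auto intro!: continuous_intros\<close>)
  have uc: "continuous_on UNIV (\<lambda>t. Gc t - P t)" by (intro continuous_intros Gcc Pc)
  have "AE t in lborel. t \<in> {0<..<T} \<longrightarrow> G t - P t = C" using rC unfolding AE_lebesgue_on_iff_lborel[OF SI] .
  then have ae: "AE t in lborel. 0 < t \<and> t < T \<longrightarrow> Gc t - P t = C" by eventually_elim (auto simp: Gc_def)
  have eq: "Gc t - P t = C" if "t \<in> {0<..<T}" for t
    by (rule continuous_AE_eq[OF uc continuous_on_const, where a = 0 and b = T]) (use ae that in auto)
  have "Gc 0 - P 0 = C"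
    by (rule continuous_constant_on_closure[where S = "{0<..<T}" and f = "\<lambda>t. Gc t - P t"], rule continuous_on_subset[OF uc])
       (use eq T in auto)
  moreover have "Gc 0 = 0" "P 0 = 0" using G(2) T by (auto simp: Gc_def P_def)
  ultimately have C0: "C = 0" by simp
  show ?thesis
    using rC G(3) by eventually_elim (simp add: PD C0)
qed

section \<open>Functions on the cylinder\<close>

lemma integrable_lebesgue_on_prodI2:
  fixes A :: "'a::euclidean_space set" and B :: "'b::euclidean_space set" and f :: "'a \<times> 'b \<Rightarrow> real"
  assumes AB: "open A" "open B" and f: "f \<in> borel_measurable (lebesgue_on (A \<times> B))"
    and bound: "AE x in lebesgue_on B. integrable (lebesgue_on A) (\<lambda>t. f (t, x)) \<and> (\<integral>t. \<bar>f (t, x)\<bar> \<partial>lebesgue_on A) \<le> g x"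
    and g: "integrable (lebesgue_on B) g"
  shows "integrable (lebesgue_on (A \<times> B)) f"
proof (rule integrableI_bounded[OF f])
  have "(\<integral>\<^sup>+z. ennreal (norm (f z)) \<partial>lebesgue_on (A \<times> B)) = (\<integral>\<^sup>+x. \<integral>\<^sup>+t. ennreal (norm (f (t, x))) \<partial>lebesgue_on A \<partial>lebesgue_on B)"
    by (rule Tonelli_lebesgue_on(2)[OF AB]) (use f in measurable)
  also have "\<dots> \<le> (\<integral>\<^sup>+x. ennreal (norm (g x)) \<partial>lebesgue_on B)"
  proof (rule nn_integral_mono_AE, rule eventually_mono[OF bound])
    fix x assume x: "integrable (lebesgue_on A) (\<lambda>t. f (t, x)) \<and> (\<integral>t. \<bar>f (t, x)\<bar> \<partial>lebesgue_on A) \<le> g x"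
    then have "(\<integral>\<^sup>+t. ennreal (norm (f (t, x))) \<partial>lebesgue_on A) = ennreal (\<integral>t. norm (f (t, x)) \<partial>lebesgue_on A)"
      by (intro nn_integral_eq_integral integrable_norm) auto
    also have "\<dots> \<le> ennreal (norm (g x))" using x by (intro ennreal_leI) auto
    finally show "(\<integral>\<^sup>+t. ennreal (norm (f (t, x))) \<partial>lebesgue_on A) \<le> ennreal (norm (g x))" .
  qed
  also have "\<dots> < \<infinity>" using g by (simp add: integrable_iff_bounded)
  finally show "(\<integral>\<^sup>+z. ennreal (norm (f z)) \<partial>lebesgue_on (A \<times> B)) < \<infinity>" .
qed

text \<open>Representatives on the whole space that vanish off S, so that their sections in time can
  be convolved with \<open>cv\<close>.\<close>

definition borel_on :: "'a::euclidean_space set \<Rightarrow> ('a \<Rightarrow> real) \<Rightarrow> bool" where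
  "borel_on S f \<longleftrightarrow> integrable lborel f \<and> (\<forall>x. x \<notin> S \<longrightarrow> f x = 0)"

lemma borel_on_integrable:
  assumes "borel_on S f" "S \<in> sets borel" shows "integrable (lebesgue_on S) f" "(\<integral>x. f x \<partial>lebesgue_on S) = (\<integral>x. f x \<partial>lborel)"
proof -
  have m: "f \<in> borel_measurable borel" using assms(1) by (auto simp: borel_on_def)
  have eq: "(\<lambda>x. indicator S x * f x) = f" using assms(1) by (auto simp: borel_on_def indicator_def fun_eq_iff)
  show "integrable (lebesgue_on S) f" "(\<integral>x. f x \<partial>lebesgue_on S) = (\<integral>x. f x \<partial>lborel)"
    unfolding integrable_lebesgue_on_lborel[OF assms(2) m] eq using assms(1) by (simp_all add: borel_on_def)
qed

lemma borel_on_exists: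
  fixes F :: "'a::euclidean_space \<Rightarrow> real"
  assumes S: "S \<in> sets borel" and F: "integrable (lebesgue_on S) F"
  obtains W where "borel_on S W" "AE z in lebesgue_on S. F z = W z"
proof -
  have SL: "S \<in> sets lebesgue" using S by auto
  obtain f' where f': "f' \<in> borel_measurable borel" "AE s in lebesgue_on S. F s = f' s"
    by (rule lebesgue_on_ex_borel[OF SL, of F]) (use F in auto)
  have "integrable (lebesgue_on S) f'"
    by (rule integrable_cong_AE_imp[OF F _ f'(2)]) (use f' in \<open>auto intro!: measurable_restrict_space1 measurable_completion\<close>)
  then have i: "integrable lborel (\<lambda>s. indicator S s * f' s)"
    using f' S by (subst (asm) integrable_lebesgue_on_lborel(1)) auto
  have "AE s in lebesgue_on S. s \<in> S" by (rule AE_I2) simp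
  then have "AE s in lebesgue_on S. F s = indicator S s * f' s" using f'(2) by eventually_elim simp
  then show thesis using i by (intro that[of "\<lambda>s. indicator S s * f' s"]) (auto simp: borel_on_def)
qed

lemma borel_on_sections:
  fixes W :: "real \<times> 'a::euclidean_space \<Rightarrow> real"
  assumes W: "borel_on ({0<..<T} \<times> \<Omega>) W"
  shows "AE x in lborel. borel_on {0<..<T} (\<lambda>t. W (t, x))"
    and "(\<lambda>t. W (t, x)) \<in> borel_measurable borel" "W \<in> borel_measurable borel"
    and "t \<notin> {0<..<T} \<Longrightarrow> W (t, x) = 0" "x \<notin> \<Omega> \<Longrightarrow> W (t, x) = 0"
    and "integrable lborel (\<lambda>x. \<integral>t. \<bar>W (t, x)\<bar> \<partial>lborel)"
proof -
  have i: "integrable (lborel \<Otimes>\<^sub>M lborel) W" using W by (simp add: borel_on_def lborel_prod)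
  then show m: "W \<in> borel_measurable borel" using W by (auto simp: borel_on_def)
  then show "(\<lambda>t. W (t, x)) \<in> borel_measurable borel" by (simp add: borel_prod[symmetric])
  show "t \<notin> {0<..<T} \<Longrightarrow> W (t, x) = 0" "x \<notin> \<Omega> \<Longrightarrow> W (t, x) = 0" using W by (auto simp: borel_on_def)
  have "integrable (lborel \<Otimes>\<^sub>M lborel) (\<lambda>(x, t). W (t, x))" using lborel_pair.integrable_product_swap[OF i] .
  from lborel_pair.AE_integrable_fst'[OF this] have "AE x in lborel. integrable lborel (\<lambda>t. W (t, x))" by simp
  then show "AE x in lborel. borel_on {0<..<T} (\<lambda>t. W (t, x))"
    by eventually_elim (use W in \<open>auto simp: borel_on_def\<close>)
  have "integrable (lborel \<Otimes>\<^sub>M lborel) (\<lambda>z. \<bar>W z\<bar>)" using i by simp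
  from lborel_pair.integrable_fst'[OF lborel_pair.integrable_product_swap[OF this]]
  show "integrable lborel (\<lambda>x. \<integral>t. \<bar>W (t, x)\<bar> \<partial>lborel)" by simp
qed

text \<open>\<open>cv_norm_le\<close> bounds the convolution for almost every fixed x, and the bound
  is integrable in x.\<close>

lemma cv_joint:
  fixes W :: "real \<times> 'a::euclidean_space \<Rightarrow> real"
  assumes O: "open \<Omega>" and W: "borel_on ({0<..<T} \<times> \<Omega>) W" and kb: "integrable lborel kb"
  shows "(\<lambda>z. cv kb (\<lambda>s. W (s, snd z)) (fst z)) \<in> borel_measurable borel"
    and "integrable (lebesgue_on ({0<..<T} \<times> \<Omega>)) (\<lambda>z. cv kb (\<lambda>s. W (s, snd z)) (fst z))"
proof -
  have [measurable]: "kb \<in> borel_measurable borel" using kb by auto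
  have Wm[measurable]: "W \<in> borel_measurable (borel \<Otimes>\<^sub>M borel)" using borel_on_sections(3)[OF W] by (simp add: borel_prod)
  have "(\<lambda>z. \<integral>s. kb (fst z - s) * W (s, snd z) \<partial>lborel) \<in> borel_measurable (borel \<Otimes>\<^sub>M borel)"
    by measurable
  then show m: "(\<lambda>z. cv kb (\<lambda>s. W (s, snd z)) (fst z)) \<in> borel_measurable borel"
    by (simp add: cv_def borel_prod)
  have S: "{0<..<T} \<in> sets borel" "\<Omega> \<in> sets borel" using O by auto
  show "integrable (lebesgue_on ({0<..<T} \<times> \<Omega>)) (\<lambda>z. cv kb (\<lambda>s. W (s, snd z)) (fst z))"
  proof (rule integrable_lebesgue_on_prodI2[OF _ O])
    show "(\<lambda>z. cv kb (\<lambda>s. W (s, snd z)) (fst z)) \<in> borel_measurable (lebesgue_on ({0<..<T} \<times> \<Omega>))"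
      using m by (intro measurable_restrict_space1 measurable_completion) simp
    have "integrable lborel (\<lambda>x. indicator \<Omega> x * ((\<integral>s. \<bar>kb s\<bar> \<partial>lborel) * (\<integral>s. \<bar>W (s, x)\<bar> \<partial>lborel)))"
      using integrable_mult_indicator[OF _ integrable_mult_right[OF borel_on_sections(6)[OF W]], of \<Omega>] S by simp
    then show "integrable (lebesgue_on \<Omega>) (\<lambda>x. (\<integral>s. \<bar>kb s\<bar> \<partial>lborel) * (\<integral>s. \<bar>W (s, x)\<bar> \<partial>lborel))"
      using S borel_measurable_integrable[OF borel_on_sections(6)[OF W]] by (subst integrable_lebesgue_on_lborel(1)) auto
    have "AE x in lborel. x \<in> \<Omega> \<longrightarrow> integrable (lebesgue_on {0<..<T}) (\<lambda>t. cv kb (\<lambda>s. W (s, x)) t) \<and>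
        (\<integral>t. \<bar>cv kb (\<lambda>s. W (s, x)) t\<bar> \<partial>lebesgue_on {0<..<T}) \<le> (\<integral>s. \<bar>kb s\<bar> \<partial>lborel) * (\<integral>s. \<bar>W (s, x)\<bar> \<partial>lborel)"
      using borel_on_sections(1)[OF W]
    proof (eventually_elim, intro impI)
      fix x assume "borel_on {0<..<T} (\<lambda>t. W (t, x))"
      then have wi: "integrable lborel (\<lambda>s. W (s, x))" by (simp add: borel_on_def)
      have ci: "integrable lborel (cv kb (\<lambda>s. W (s, x)))" by (rule cv_integrable(2)[OF kb wi])
      have i: "integrable lborel (\<lambda>t. indicator {0<..<T} t * cv kb (\<lambda>s. W (s, x)) t)"
        using integrable_mult_indicator[OF _ ci, of "{0<..<T}"] by simp
      have cm: "cv kb (\<lambda>s. W (s, x)) \<in> borel_measurable borel" using ci by auto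
      have "(\<integral>t. \<bar>cv kb (\<lambda>s. W (s, x)) t\<bar> \<partial>lebesgue_on {0<..<T}) = (\<integral>t. indicator {0<..<T} t * \<bar>cv kb (\<lambda>s. W (s, x)) t\<bar> \<partial>lborel)"
        using cm by (intro integrable_lebesgue_on_lborel(2)) auto
      also have "\<dots> \<le> (\<integral>t. \<bar>cv kb (\<lambda>s. W (s, x)) t\<bar> \<partial>lborel)"
        by (rule integral_mono') (use ci in \<open>auto simp: indicator_def\<close>)
      also have "\<dots> \<le> (\<integral>s. \<bar>kb s\<bar> \<partial>lborel) * (\<integral>s. \<bar>W (s, x)\<bar> \<partial>lborel)" by (rule cv_norm_le[OF kb wi])
      finally show "integrable (lebesgue_on {0<..<T}) (\<lambda>t. cv kb (\<lambda>s. W (s, x)) t) \<and>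
        (\<integral>t. \<bar>cv kb (\<lambda>s. W (s, x)) t\<bar> \<partial>lebesgue_on {0<..<T}) \<le> (\<integral>s. \<bar>kb s\<bar> \<partial>lborel) * (\<integral>s. \<bar>W (s, x)\<bar> \<partial>lborel)"
        using i cm by (subst integrable_lebesgue_on_lborel(1)) auto
    qed
    then show "AE x in lebesgue_on \<Omega>. integrable (lebesgue_on {0<..<T}) (\<lambda>t. cv kb (\<lambda>s. W (s, snd (t, x))) (fst (t, x))) \<and>
        (\<integral>t. \<bar>cv kb (\<lambda>s. W (s, snd (t, x))) (fst (t, x))\<bar> \<partial>lebesgue_on {0<..<T}) \<le> (\<integral>s. \<bar>kb s\<bar> \<partial>lborel) * (\<integral>s. \<bar>W (s, x)\<bar> \<partial>lborel)"
      using O by (subst AE_lebesgue_on_iff_lborel) auto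
  qed simp
qed

lemma integrable_cylinder_times:
  fixes F :: "real \<times> 'a::euclidean_space \<Rightarrow> real"
  assumes O: "open \<Omega>" and F: "integrable (lebesgue_on ({0<..<T} \<times> \<Omega>)) F"
    and g: "g \<in> borel_measurable (lebesgue_on ({0<..<T} \<times> \<Omega>))" "\<And>z. z \<in> {0<..<T} \<times> \<Omega> \<Longrightarrow> \<bar>g z\<bar> \<le> C"
  shows "integrable (lebesgue_on ({0<..<T} \<times> \<Omega>)) (\<lambda>z. g z * F z)"
proof (rule Bochner_Integration.integrable_bound)
  show "integrable (lebesgue_on ({0<..<T} \<times> \<Omega>)) (\<lambda>z. C * F z)" using F by simp
  show "AE z in lebesgue_on ({0<..<T} \<times> \<Omega>). norm (g z * F z) \<le> norm (C * F z)"
  proof (rule AE_I2)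
    fix z assume "z \<in> space (lebesgue_on ({0<..<T} \<times> \<Omega>))"
    then have "\<bar>g z\<bar> \<le> \<bar>C\<bar>" using g(2)[of z] by simp
    then show "norm (g z * F z) \<le> norm (C * F z)" by (simp add: abs_mult mult_right_mono)
  qed
qed (use F g in auto)

text \<open>Realises the time derivative of h as one function D on the cylinder. For the last claim,
  integration over a spatial box reduces it to \<open>weak_primitive\<close> for a scalar function
  of time; the difference of the two sides then has zero integral over every box and
  vanishes.\<close>

lemma W11_zero_L1_joint:
  fixes \<Omega> :: "'a::euclidean_space set"
  assumes O: "open \<Omega>" and T: "T > 0" and h: "h \<in> W11_zero T (Lp_space 1 \<Omega>)"
    and hj: "integrable (lebesgue_on ({0<..<T} \<times> \<Omega>)) (\<lambda>z. h (fst z) (snd z))"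
  obtains D where "borel_on ({0<..<T} \<times> \<Omega>) D"
    "\<forall>\<theta>\<in>test_funs {0<..<T}. \<forall>e\<in>borel_measurable (lebesgue_on \<Omega>). \<forall>C. (\<forall>x\<in>\<Omega>. \<bar>e x\<bar> \<le> C) \<longrightarrow>
       (\<integral>z. (deriv \<theta> (fst z) * h (fst z) (snd z)) * e (snd z) \<partial>lebesgue_on ({0<..<T} \<times> \<Omega>))
       = - (\<integral>z. (\<theta> (fst z) * D z) * e (snd z) \<partial>lebesgue_on ({0<..<T} \<times> \<Omega>))"
    "AE z in lebesgue_on ({0<..<T} \<times> \<Omega>). h (fst z) (snd z) = cv (indicator {0<..<T}) (\<lambda>s. D (s, snd z)) (fst z)"
proof -
  let ?I = "lebesgue_on {0<..<T}" and ?O = "lebesgue_on \<Omega>" and ?Q = "lebesgue_on ({0<..<T} \<times> \<Omega>)"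
  have oI: "open {0<..<T}" by simp
  have oQ: "open ({0<..<T} \<times> \<Omega>)" using O by (intro open_Times) auto
  have Qb: "{0<..<T} \<times> \<Omega> \<in> sets borel" using oQ by auto
  obtain g where g: "has_W11_deriv T (Lp_space 1 \<Omega>) h g" using h by (auto simp: W11_zero_def W11_def)
  have gL: "g \<in> bochner_Lp 1 T (Lp_space 1 \<Omega>)" using g by (simp add: has_W11_deriv_def)
  obtain F where F: "integrable ?Q F" "AE t in ?I. AE x in ?O. g t x = F (t, x)"
    using bochner_L1_joint[OF O gL] by blast
  obtain D where D: "borel_on ({0<..<T} \<times> \<Omega>) D" "AE z in ?Q. F z = D z"
    using borel_on_exists[OF Qb F(1)] by blast
  have Di: "integrable ?Q D" by (rule borel_on_integrable(1)[OF D(1) Qb])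
  have gD: "AE t in ?I. AE x in ?O. g t x = D (t, x)"
    using F(2) AE_lebesgue_on_prodD(1)[OF oI O D(2)]
  proof eventually_elim
    case (elim t)
    then show ?case by eventually_elim simp
  qed
  have fstm: "(\<lambda>z. \<psi> (fst z)) \<in> borel_measurable ?Q" if "continuous_on UNIV \<psi>" for \<psi> :: "real \<Rightarrow> real"
    using borel_measurable_continuous_onI[OF that]
    by (intro measurable_lebesgue_on_fst[OF oI O] measurable_restrict_space1 measurable_completion) simp
  have weak: "(\<integral>z. (deriv \<theta> (fst z) * h (fst z) (snd z)) * e (snd z) \<partial>?Q) = - (\<integral>z. (\<theta> (fst z) * D z) * e (snd z) \<partial>?Q)"
    if \<theta>: "\<theta> \<in> test_funs {0<..<T}" and e: "e \<in> borel_measurable ?O" "\<And>x. x \<in> \<Omega> \<Longrightarrow> \<bar>e x\<bar> \<le> C" for \<theta> e C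
  proof -
    obtain y where y1: "has_bochner_integral_in T (Lp_space 1 \<Omega>) (\<lambda>t b. deriv \<theta> t * h t b) y"
      and y2: "has_bochner_integral_in T (Lp_space 1 \<Omega>) (\<lambda>t b. - (\<theta> t * g t b)) y"
      using g \<theta> unfolding has_W11_deriv_def by blast
    obtain B1 where B1: "\<And>x. \<bar>deriv \<theta> x\<bar> \<le> B1" using test_funs_bounded[OF test_funs_deriv(2)[OF \<theta>]] by metis
    obtain B2 where B2: "\<And>x. \<bar>\<theta> x\<bar> \<le> B2" using test_funs_bounded[OF \<theta>] by metis
    have i1: "integrable ?Q (\<lambda>z. deriv \<theta> (fst z) * h (fst z) (snd z))"
      by (rule integrable_cylinder_times[OF O hj fstm[OF test_funs_continuous[OF test_funs_deriv(2)[OF \<theta>]]]]) (rule B1)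
    have i2: "integrable ?Q (\<lambda>z. - (\<theta> (fst z) * D z))"
      using integrable_cylinder_times[OF O Di fstm[OF test_funs_continuous[OF \<theta>]] B2] by simp
    have "(\<integral>z. (deriv \<theta> (fst z) * h (fst z) (snd z)) * e (snd z) \<partial>?Q) = (\<integral>x. y x * e x \<partial>?O)"
      by (rule bochner_integral_pairing[OF O y1 i1 _ e, symmetric]) simp_all
    also have "\<dots> = (\<integral>z. - (\<theta> (fst z) * D z) * e (snd z) \<partial>?Q)"
    proof (rule bochner_integral_pairing[OF O y2 i2 _ e])
      show "AE t in ?I. AE x in ?O. - (\<theta> t * g t x) = - (\<theta> (fst (t, x)) * D (t, x))"
        using gD
      proof eventually_elim
        case (elim t)
        then show ?case by eventually_elim simp
      qed
    qed simp_all
    finally show ?thesis by simp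
  qed
  define V where "V z = cv (indicator {0<..<T}) (\<lambda>s. D (s, snd z)) (fst z)" for z
  have ui: "integrable lborel (indicator {0<..<T} :: real \<Rightarrow> real)" using T by (intro integrable_real_indicator) auto
  have Vi: "integrable ?Q V" unfolding V_def[abs_def] by (rule cv_joint(2)[OF O D(1) ui])
  define r where "r z = h (fst z) (snd z) - V z" for z
  have ri: "integrable ?Q r" unfolding r_def[abs_def] using hj Vi by simp
  have "vanishes_at T (Lp_space 1 \<Omega>) 0 h" using h by (simp add: W11_zero_def)
  then obtain gc where gc0: "\<forall>t\<in>{0..T}. gc t \<in> elts (Lp_space 1 \<Omega>) \<and>
      ((\<lambda>s. nrm (Lp_space 1 \<Omega>) (\<lambda>b. gc s b - gc t b)) \<longlongrightarrow> 0) (at t within {0..T})"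
    "AE t in ?I. h t \<in> elts (Lp_space 1 \<Omega>) \<and> nrm (Lp_space 1 \<Omega>) (\<lambda>b. h t b - gc t b) = 0"
    "nrm (Lp_space 1 \<Omega>) (gc 0) = 0"
    unfolding vanishes_at_def by blast
  have gc: "\<And>t. t \<in> {0..T} \<Longrightarrow> integrable ?O (gc t)"
      "\<And>t. t \<in> {0..T} \<Longrightarrow> ((\<lambda>s. \<integral>x. \<bar>gc s x - gc t x\<bar> \<partial>?O) \<longlongrightarrow> 0) (at t within {0..T})"
      "AE t in ?I. integrable ?O (h t)" "AE t in ?I. (\<integral>x. \<bar>h t x - gc t x\<bar> \<partial>?O) = 0" "(\<integral>x. \<bar>gc 0 x\<bar> \<partial>?O) = 0"
    using gc0(1,3) gc0(2)[unfolded AE_conj_iff] unfolding elts_L1 nrm_L1 by blast+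
  have "AE z in ?Q. r z = 0"
  proof (rule fundamental_lemma_boxes[OF oQ])
    show "L1_loc ({0<..<T} \<times> \<Omega>) r"
      by (rule integrable_L1_loc[OF open_Times_lebesgue[OF oI O] ri])
    fix a b :: "real \<times> 'a" assume ab: "cbox a b \<subseteq> {0<..<T} \<times> \<Omega>"
    show "(\<integral>z. r z \<partial>lebesgue_on (cbox a b)) = 0"
    proof (cases "cbox a b = {}")
      case True
      then show ?thesis by simp
    next
      case False
      obtain a1 a2 b1 b2 where ab_eq: "a = (a1, a2)" "b = (b1, b2)" by (metis prod.collapse)
      have cb: "cbox a b = cbox a1 b1 \<times> cbox a2 b2" unfolding ab_eq by (rule cbox_Pair_eq)
      then have sub: "cbox a2 b2 \<subseteq> \<Omega>" using ab False unfolding cb times_subset_iff by auto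
      \<comment> \<open>The pairing in \<open>weak\<close> allows bounded measurable functions of x,
        so the spatial box can be tested through its indicator.\<close>
      define e where "e = indicat_real (cbox a2 b2)"
      have em: "e \<in> borel_measurable ?O" unfolding e_def by (rule measurable_restrict_space1[OF borel_measurable_indicator]) simp
      have eb: "\<bar>e x\<bar> \<le> 1" for x by (simp add: e_def indicator_def)
      have esm: "(\<lambda>z. e (snd z)) \<in> borel_measurable ?Q" by (rule measurable_lebesgue_on_snd[OF oI O em])
      have ie: "integrable ?Q (\<lambda>z. e (snd z) * G z)" if "integrable ?Q G" for G
        by (rule integrable_cylinder_times[OF O that esm]) (rule eb)
      define H where "H t = (\<integral>x. e x * h t x \<partial>?O)" for t
      define De where "De t = (\<integral>x. e x * D (t, x) \<partial>?O)" for t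
      \<comment> \<open>The continuous representative of h in time, integrated over the spatial box;
        it vanishes at 0 and so fixes the constant of integration.\<close>
      define Ge where "Ge t = (\<integral>x. e x * gc t x \<partial>?O)" for t
      have Hi: "integrable ?I H" using Fubini_lebesgue_on(2)[OF oI O ie[OF hj]] by (simp add: H_def[abs_def])
      have Dei: "integrable ?I De" using Fubini_lebesgue_on(2)[OF oI O ie[OF Di]] by (simp add: De_def[abs_def])
      have eo: "integrable ?O (\<lambda>x. e x * G x)" if "integrable ?O G" for G
        by (rule Bochner_Integration.integrable_bound[OF that]) (use that em eb in \<open>auto simp: abs_mult intro!: mult_left_le_one_le\<close>)
      have ediff: "\<bar>(\<integral>x. e x * G x \<partial>?O) - (\<integral>x. e x * G' x \<partial>?O)\<bar> \<le> (\<integral>x. \<bar>G x - G' x\<bar> \<partial>?O)" if "integrable ?O G" "integrable ?O G'" for G G'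
      proof -
        have "(\<integral>x. e x * G x \<partial>?O) - (\<integral>x. e x * G' x \<partial>?O) = (\<integral>x. e x * (G x - G' x) \<partial>?O)"
          using eo[OF that(1)] eo[OF that(2)] by (simp add: right_diff_distrib)
        also have "\<bar>\<dots>\<bar> \<le> (\<integral>x. \<bar>e x * (G x - G' x)\<bar> \<partial>?O)" by (rule integral_abs_bound)
        also have "\<dots> \<le> (\<integral>x. \<bar>G x - G' x\<bar> \<partial>?O)"
          by (rule integral_mono') (use that eb in \<open>auto simp: abs_mult intro!: mult_left_le_one_le\<close>)
        finally show ?thesis .
      qed
      have Hprim: "AE t in ?I. H t = (\<integral>s. indicator {0<..<t} s * De s \<partial>?I)"
      proof (rule weak_primitive[OF T Hi Dei, of Ge])
        fix \<theta> assume \<theta>: "\<theta> \<in> test_funs {0<..<T}"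
        obtain B1 where B1: "\<And>x. \<bar>deriv \<theta> x\<bar> \<le> B1" using test_funs_bounded[OF test_funs_deriv(2)[OF \<theta>]] by metis
        obtain B2 where B2: "\<And>x. \<bar>\<theta> x\<bar> \<le> B2" using test_funs_bounded[OF \<theta>] by metis
        have i1: "integrable ?Q (\<lambda>z. deriv \<theta> (fst z) * (e (snd z) * h (fst z) (snd z)))"
          by (rule integrable_cylinder_times[OF O ie[OF hj] fstm[OF test_funs_continuous[OF test_funs_deriv(2)[OF \<theta>]]]]) (rule B1)
        have i2: "integrable ?Q (\<lambda>z. \<theta> (fst z) * (e (snd z) * D z))"
          by (rule integrable_cylinder_times[OF O ie[OF Di] fstm[OF test_funs_continuous[OF \<theta>]]]) (rule B2)
        have "(\<integral>t. deriv \<theta> t * H t \<partial>?I) = (\<integral>z. deriv \<theta> (fst z) * (e (snd z) * h (fst z) (snd z)) \<partial>?Q)"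
          using Fubini_lebesgue_on(3)[OF oI O i1] by (simp add: H_def)
        also have "\<dots> = (\<integral>z. (deriv \<theta> (fst z) * h (fst z) (snd z)) * e (snd z) \<partial>?Q)" by (simp add: mult_ac)
        also have "\<dots> = - (\<integral>z. (\<theta> (fst z) * D z) * e (snd z) \<partial>?Q)" by (rule weak[OF \<theta> em eb])
        also have "\<dots> = - (\<integral>z. \<theta> (fst z) * (e (snd z) * D z) \<partial>?Q)" by (simp add: mult_ac)
        also have "\<dots> = - (\<integral>t. \<theta> t * De t \<partial>?I)"
          using Fubini_lebesgue_on(3)[OF oI O i2] by (simp add: De_def)
        finally show "(\<integral>t. deriv \<theta> t * H t \<partial>?I) = - (\<integral>t. \<theta> t * De t \<partial>?I)" .
      next
        show "continuous_on {0..T} Ge"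
          unfolding continuous_on_def
        proof
          fix t assume t: "t \<in> {0..T}"
          show "(Ge \<longlongrightarrow> Ge t) (at t within {0..T})"
          proof (rule LIM_zero_cancel, rule Lim_null_comparison[OF _ gc(2)[OF t]])
            show "\<forall>\<^sub>F s in at t within {0..T}. norm (Ge s - Ge t) \<le> (\<integral>x. \<bar>gc s x - gc t x\<bar> \<partial>?O)"
              unfolding eventually_at_filter Ge_def using ediff gc(1) t by (auto intro!: eventuallyI)
          qed
        qed
        show "Ge 0 = 0"
          using ediff[of "gc 0" "\<lambda>_. 0"] gc(1)[of 0] gc(5) T by (simp add: Ge_def)
        show "AE t in ?I. H t = Ge t"
        proof -
          have "AE t in ?I. t \<in> {0<..<T}" by (rule AE_I2) simp
          with gc(3,4) show ?thesis
          proof eventually_elim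
            case (elim t)
            then show ?case using ediff[of "h t" "gc t"] gc(1)[of t] by (simp add: H_def Ge_def)
          qed
        qed
      qed
      have Vt: "(\<integral>s. indicator {0<..<t} s * De s \<partial>?I) = (\<integral>x. e x * V (t, x) \<partial>?O)" if t: "t \<in> {0<..<T}" for t
      proof -
        have im: "(\<lambda>z. indicat_real {0<..<t} (fst z)) \<in> borel_measurable ?Q"
          by (intro measurable_lebesgue_on_fst[OF oI O] measurable_restrict_space1[OF borel_measurable_indicator]) simp
        have i: "integrable ?Q (\<lambda>z. indicator {0<..<t} (fst z) * (e (snd z) * D z))"
          by (rule integrable_cylinder_times[OF O ie[OF Di] im, of 1]) (simp add: indicator_def)
        have "(\<integral>s. indicator {0<..<t} s * De s \<partial>?I) = (\<integral>s. \<integral>x. indicator {0<..<t} s * (e x * D (s, x)) \<partial>?O \<partial>?I)"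
          by (simp add: De_def)
        also have "\<dots> = (\<integral>x. \<integral>s. indicator {0<..<t} s * (e x * D (s, x)) \<partial>?I \<partial>?O)"
          using Fubini_lebesgue_on(3)[OF oI O i] Fubini_lebesgue_on(6)[OF oI O i] by simp
        also have "\<dots> = (\<integral>x. e x * V (t, x) \<partial>?O)"
        proof (rule Bochner_Integration.integral_cong)
          fix x
          have "(\<integral>s. indicator {0<..<t} s * (e x * D (s, x)) \<partial>?I) = (\<integral>s. indicator {0<..<T} s * (indicator {0<..<t} s * (e x * D (s, x))) \<partial>lborel)"
            using borel_on_sections(2)[OF D(1)] by (intro integrable_lebesgue_on_lborel(2)) auto
          also have "\<dots> = (\<integral>s. e x * (indicator {0<..<t} s * D (s, x)) \<partial>lborel)"
            using t by (intro Bochner_Integration.integral_cong) (auto simp: indicator_def)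
          also have "\<dots> = e x * (\<integral>s. indicator {0<..<t} s * D (s, x) \<partial>lborel)" by simp
          also have "\<dots> = e x * V (t, x)"
            unfolding V_def using t borel_on_sections(4)[OF D(1)] by (subst cv_step) auto
          finally show "(\<integral>s. indicator {0<..<t} s * (e x * D (s, x)) \<partial>?I) = e x * V (t, x)" .
        qed simp
        finally show ?thesis .
      qed
      have "AE t in ?I. t \<in> {0<..<T}" by (rule AE_I2) simp
      with Hprim have r0: "AE t in ?I. (\<integral>x. e x * r (t, x) \<partial>?O) = 0"
        using Fubini_lebesgue_on(1)[OF oI O ie[OF hj]] Fubini_lebesgue_on(1)[OF oI O ie[OF Vi]]
      proof eventually_elim
        case (elim t)
        then show ?case by (simp add: r_def right_diff_distrib H_def Vt)
      qed
      have im: "(\<lambda>z. indicat_real (cbox a1 b1) (fst z)) \<in> borel_measurable ?Q"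
        by (intro measurable_lebesgue_on_fst[OF oI O] measurable_restrict_space1[OF borel_measurable_indicator]) simp
      have ir: "integrable ?Q (\<lambda>z. indicator (cbox a1 b1) (fst z) * (e (snd z) * r z))"
        by (rule integrable_cylinder_times[OF O ie[OF ri] im, of 1]) (simp add: indicator_def)
      have "(\<integral>z. r z \<partial>lebesgue_on (cbox a b)) = (\<integral>z. indicator (cbox a b) z * r z \<partial>?Q)"
        using ab open_Times_lebesgue[OF oI O] by (intro integral_lebesgue_on_sub) auto
      also have "\<dots> = (\<integral>z. indicator (cbox a1 b1) (fst z) * (e (snd z) * r z) \<partial>?Q)"
        by (rule Bochner_Integration.integral_cong) (auto simp: cb e_def indicator_def)
      also have "\<dots> = (\<integral>t. indicator (cbox a1 b1) t * (\<integral>x. e x * r (t, x) \<partial>?O) \<partial>?I)"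
        using Fubini_lebesgue_on(3)[OF oI O ir] by simp
      also have "\<dots> = (\<integral>t. 0 \<partial>?I)"
      proof (rule integral_cong_AE)
        show "(\<lambda>t. indicat_real (cbox a1 b1) t * (\<integral>x. e x * r (t, x) \<partial>?O)) \<in> borel_measurable ?I"
          using borel_measurable_integrable[OF Fubini_lebesgue_on(2)[OF oI O ir]] by simp
      qed (use r0 in \<open>auto elim!: eventually_mono\<close>)
      finally show ?thesis by simp
    qed
  qed
  then have "AE z in ?Q. h (fst z) (snd z) = cv (indicator {0<..<T}) (\<lambda>s. D (s, snd z)) (fst z)"
    by eventually_elim (simp add: r_def V_def)
  note V_eq = this
  show thesis
  proof (rule that[OF D(1) _ V_eq], intro ballI allI impI)
    fix \<theta> :: "real \<Rightarrow> real" and e :: "'a \<Rightarrow> real" and C :: real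
    assume e: "\<theta> \<in> test_funs {0<..<T}" "e \<in> borel_measurable ?O" "\<forall>x\<in>\<Omega>. \<bar>e x\<bar> \<le> C"
    show "(\<integral>z. (deriv \<theta> (fst z) * h (fst z) (snd z)) * e (snd z) \<partial>?Q) = - (\<integral>z. (\<theta> (fst z) * D z) * e (snd z) \<partial>?Q)"
      by (rule weak[OF e(1,2), of C]) (use e(3) in auto)
  qed
qed

section \<open>Test functions with separated variables\<close>

text \<open>All values of t \<mapsto> \<theta>(t) e lie on the line spanned by e, so this is all
  that has to be known of X; it covers \<open>H10\<close> and L2 at once.\<close>

definition homogeneous_along :: "'b fun_space \<Rightarrow> ('b \<Rightarrow> real) \<Rightarrow> bool" where
  "homogeneous_along X e \<longleftrightarrow>
     (\<forall>c. (\<lambda>x. c * e x) \<in> elts X \<and> nrm X (\<lambda>x. c * e x) = \<bar>c\<bar> * nrm X e) \<and> nrm X e \<ge> 0"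

lemma bounded_simple_approximation:
  fixes c :: "real \<Rightarrow> real"
  assumes c: "c \<in> borel_measurable (lebesgue_on {0<..<T})" and B: "\<And>t. \<bar>c t\<bar> \<le> B"
  obtains s where "\<And>n::nat. simple_function (lebesgue_on {0<..<T}) (s n)"
    "\<And>t. t \<in> {0<..<T} \<Longrightarrow> (\<lambda>n. s n t) \<longlonglongrightarrow> c t"
    "(\<lambda>n. \<integral>t. \<bar>c t - s n t\<bar> \<partial>lebesgue_on {0<..<T}) \<longlonglongrightarrow> 0"
    "\<And>n. integrable (lebesgue_on {0<..<T}) (s n)"
proof -
  let ?I = "lebesgue_on {0<..<T}"
  interpret finite_measure ?I by (rule finite_measure_lebesgue_on) simp
  obtain s where s: "\<And>n::nat. simple_function ?I (s n)" "\<And>t. t \<in> space ?I \<Longrightarrow> (\<lambda>n. s n t) \<longlonglongrightarrow> c t"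
    "\<And>n t. t \<in> space ?I \<Longrightarrow> dist (s n t) 0 \<le> 2 * dist (c t) 0"
    using borel_measurable_implies_sequence_metric[OF c, of 0] by metis
  \<comment> \<open>The approximating simple functions satisfy \<bar>s n t\<bar> \<le> 2 \<bar>c
    t\<bar>; hence the majorant 3 * B for their distance to c.\<close>
  have sb: "\<bar>s n t\<bar> \<le> 2 * B" if "t \<in> {0<..<T}" for n t
    using s(3)[of t n] B[of t] that by simp
  have sm: "s n \<in> borel_measurable ?I" for n using s(1) by (rule borel_measurable_simple_function)
  have lim: "(\<lambda>n. \<integral>t. \<bar>c t - s n t\<bar> \<partial>?I) \<longlonglongrightarrow> (\<integral>t. 0 \<partial>?I)"
  proof (rule integral_dominated_convergence[where w = "\<lambda>_. 3 * B"])
    show "AE t in ?I. (\<lambda>n. \<bar>c t - s n t\<bar>) \<longlonglongrightarrow> 0"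
    proof (rule AE_I2)
      fix t assume "t \<in> space ?I"
      then have "(\<lambda>n. \<bar>c t - s n t\<bar>) \<longlonglongrightarrow> \<bar>c t - c t\<bar>" by (intro tendsto_intros s(2))
      then show "(\<lambda>n. \<bar>c t - s n t\<bar>) \<longlonglongrightarrow> 0" by simp
    qed
    show "AE t in ?I. norm \<bar>c t - s n t\<bar> \<le> 3 * B" for n
    proof (rule AE_I2)
      fix t assume "t \<in> space ?I"
      then show "norm \<bar>c t - s n t\<bar> \<le> 3 * B" using sb[of t n] B[of t] by simp
    qed
  qed (use c sm in auto)
  have si: "integrable ?I (s n)" for n
    by (rule integrable_const_bound[of _ "2 * B"]) (use sb sm in \<open>auto intro!: AE_I2\<close>)
  show thesis by (rule that[OF s(1) s(2) _ si]) (use lim in auto)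
qed

lemma simple_fun_tensor:
  assumes "simple_function (lebesgue_on {0<..<T}) s" "homogeneous_along X e"
  shows "simple_fun T X (\<lambda>t x. s t * e x)"
proof -
  have "simple_function (lebesgue_on {0<..<T}) ((\<lambda>c x. c * e x) \<circ> s)" using assms(1) by (rule simple_function_compose)
  then show ?thesis using assms(2) by (simp add: simple_fun_def o_def homogeneous_along_def)
qed

lemma tensor_bochner_Lp:
  assumes c: "c \<in> borel_measurable (lebesgue_on {0<..<T})" "\<And>t. \<bar>c t\<bar> \<le> B" and X: "homogeneous_along X e" and p: "p > 0"
  shows "bochner_measurable T X (\<lambda>t x. c t * e x)" "(\<lambda>t x. c t * e x) \<in> bochner_Lp p T X"
proof -
  let ?I = "lebesgue_on {0<..<T}"
  interpret finite_measure ?I by (rule finite_measure_lebesgue_on) simp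
  obtain s where s: "\<And>n::nat. simple_function ?I (s n)" "\<And>t. t \<in> {0<..<T} \<Longrightarrow> (\<lambda>n. s n t) \<longlonglongrightarrow> c t"
    using bounded_simple_approximation[OF c] by metis
  have h: "\<And>a. (\<lambda>x. a * e x) \<in> elts X" "\<And>a. nrm X (\<lambda>x. a * e x) = \<bar>a\<bar> * nrm X e" "nrm X e \<ge> 0"
    using X by (auto simp: homogeneous_along_def)
  show bm: "bochner_measurable T X (\<lambda>t x. c t * e x)"
    unfolding bochner_measurable_def
  proof (intro exI[of _ "\<lambda>n t x. s n t * e x"] conjI allI)
    show "simple_fun T X (\<lambda>t x. s n t * e x)" for n by (rule simple_fun_tensor[OF s(1) X])
    show "AE t in ?I. (\<lambda>x. c t * e x) \<in> elts X \<and> (\<lambda>n. nrm X (\<lambda>b. c t * e b - s n t * e b)) \<longlonglongrightarrow> 0"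
    proof (rule AE_I2)
      fix t assume "t \<in> space ?I"
      then have "(\<lambda>n. \<bar>c t - s n t\<bar> * nrm X e) \<longlonglongrightarrow> \<bar>c t - c t\<bar> * nrm X e" by (intro tendsto_intros s(2)) simp
      moreover have "nrm X (\<lambda>b. c t * e b - s n t * e b) = \<bar>c t - s n t\<bar> * nrm X e" for n
        using h(2)[of "c t - s n t"] by (simp add: left_diff_distrib)
      ultimately show "(\<lambda>x. c t * e x) \<in> elts X \<and> (\<lambda>n. nrm X (\<lambda>b. c t * e b - s n t * e b)) \<longlonglongrightarrow> 0" using h(1) by simp
    qed
  qed
  have "integrable ?I (\<lambda>t. (\<bar>c t\<bar> * nrm X e) powr p)"
  proof (rule integrable_const_bound[of _ "(B * nrm X e) powr p"])
    show "AE t in ?I. norm ((\<bar>c t\<bar> * nrm X e) powr p) \<le> (B * nrm X e) powr p"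
    proof (rule AE_I2)
      fix t
      have "(\<bar>c t\<bar> * nrm X e) powr p \<le> (B * nrm X e) powr p"
        by (rule powr_mono2) (use p c(2)[of t] h(3) in \<open>simp_all add: mult_right_mono\<close>)
      then show "norm ((\<bar>c t\<bar> * nrm X e) powr p) \<le> (B * nrm X e) powr p" by simp
    qed
    show "(\<lambda>t. (\<bar>c t\<bar> * nrm X e) powr p) \<in> borel_measurable ?I" using c(1) by measurable
  qed
  then show "(\<lambda>t x. c t * e x) \<in> bochner_Lp p T X" using bm by (simp add: bochner_Lp_def h(2))
qed

lemma tensor_bochner_integral:
  assumes c: "c \<in> borel_measurable (lebesgue_on {0<..<T})" "\<And>t. \<bar>c t\<bar> \<le> B" and X: "homogeneous_along X e"
  shows "has_bochner_integral_in T X (\<lambda>t x. c t * e x) (\<lambda>x. (\<integral>t. c t \<partial>lebesgue_on {0<..<T}) * e x)"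
proof -
  let ?I = "lebesgue_on {0<..<T}"
  interpret finite_measure ?I by (rule finite_measure_lebesgue_on) simp
  obtain s where s: "\<And>n::nat. simple_function ?I (s n)" "\<And>t. t \<in> {0<..<T} \<Longrightarrow> (\<lambda>n. s n t) \<longlonglongrightarrow> c t"
    "(\<lambda>n. \<integral>t. \<bar>c t - s n t\<bar> \<partial>?I) \<longlonglongrightarrow> 0" "\<And>n. integrable ?I (s n)"
    by (rule bounded_simple_approximation[OF c]) (rule that; assumption)
  have ci: "integrable ?I c" by (rule integrable_const_bound[of _ B]) (simp add: c(2), rule c(1))
  have h: "\<And>a. (\<lambda>x. a * e x) \<in> elts X" "\<And>a. nrm X (\<lambda>x. a * e x) = \<bar>a\<bar> * nrm X e" "nrm X e \<ge> 0"
    using X by (auto simp: homogeneous_along_def)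
  have d: "nrm X (\<lambda>b. x * e b - y * e b) = \<bar>x - y\<bar> * nrm X e" for x y
    using h(2)[of "x - y"] by (simp add: left_diff_distrib)
  show ?thesis
    unfolding has_bochner_integral_in_def
  proof (intro conjI exI[of _ "\<lambda>n t x. s n t * e x"] allI)
    show "bochner_measurable T X (\<lambda>t x. c t * e x)" by (rule tensor_bochner_Lp(1)[OF c X zero_less_one])
    show "(\<lambda>x. (\<integral>t. c t \<partial>?I) * e x) \<in> elts X" by (rule h(1))
    show "simple_fun T X (\<lambda>t x. s n t * e x)" for n by (rule simple_fun_tensor[OF s(1) X])
    have "(\<integral>\<^sup>+t. ennreal (nrm X (\<lambda>b. c t * e b - s n t * e b)) \<partial>?I) = ennreal ((\<integral>t. \<bar>c t - s n t\<bar> \<partial>?I) * nrm X e)" for n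
    proof -
      have "(\<integral>\<^sup>+t. ennreal (\<bar>c t - s n t\<bar> * nrm X e) \<partial>?I) = ennreal (\<integral>t. \<bar>c t - s n t\<bar> * nrm X e \<partial>?I)"
        by (rule nn_integral_eq_integral) (use ci s(4) h(3) in auto)
      then show ?thesis by (simp add: d)
    qed
    moreover have "(\<lambda>n. ennreal ((\<integral>t. \<bar>c t - s n t\<bar> \<partial>?I) * nrm X e)) \<longlonglongrightarrow> ennreal (0 * nrm X e)"
      by (intro tendsto_ennrealI tendsto_intros s(3))
    ultimately show "(\<lambda>n. \<integral>\<^sup>+t. ennreal (nrm X (\<lambda>b. c t * e b - s n t * e b)) \<partial>?I) \<longlonglongrightarrow> 0" by simp
    have "(\<lambda>n. \<integral>t. s n t \<partial>?I) \<longlonglongrightarrow> (\<integral>t. c t \<partial>?I)"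
    proof (rule LIM_zero_cancel, rule Lim_null_comparison[OF _ s(3)])
      have "norm ((\<integral>t. s n t \<partial>?I) - (\<integral>t. c t \<partial>?I)) \<le> (\<integral>t. \<bar>c t - s n t\<bar> \<partial>?I)" for n
      proof -
        have "(\<integral>t. s n t \<partial>?I) - (\<integral>t. c t \<partial>?I) = (\<integral>t. s n t - c t \<partial>?I)" using s(4) ci by simp
        also have "norm \<dots> \<le> (\<integral>t. norm (s n t - c t) \<partial>?I)" by (rule integral_norm_bound)
        finally show ?thesis by (simp add: abs_minus_commute)
      qed
      then show "\<forall>\<^sub>F n in sequentially. norm ((\<integral>t. s n t \<partial>?I) - (\<integral>t. c t \<partial>?I)) \<le> (\<integral>t. \<bar>c t - s n t\<bar> \<partial>?I)" by simp
    qed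
    then have "(\<lambda>n. \<bar>(\<integral>t. s n t \<partial>?I) - (\<integral>t. c t \<partial>?I)\<bar> * nrm X e) \<longlonglongrightarrow> \<bar>(\<integral>t. c t \<partial>?I) - (\<integral>t. c t \<partial>?I)\<bar> * nrm X e"
      by (intro tendsto_intros)
    then show "(\<lambda>n. nrm X (\<lambda>b. (\<integral>t. s n t * e b \<partial>?I) - (\<integral>t. c t \<partial>?I) * e b)) \<longlonglongrightarrow> 0"
      by (simp add: d)
  qed
qed

lemma homogeneous_H10: "open \<Omega> \<Longrightarrow> e \<in> elts (H10 \<Omega>) \<Longrightarrow> homogeneous_along (H10 \<Omega>) e"
  using H10_lincomb[of \<Omega> e e _ 0] by (simp add: homogeneous_along_def nrm_H10 norm_H1_scale H10_imp_H1 norm_H1_nonneg)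

lemma homogeneous_L2: "L2fun \<Omega> e \<Longrightarrow> homogeneous_along (Lp_space 2 \<Omega>) e"
  using L2fun_scaleR[of \<Omega> e] by (simp add: homogeneous_along_def elts_L2 nrm_L2 power_mult_distrib real_sqrt_mult integral_nonneg_AE)

lemma integral_test_parts:
  assumes \<rho>: "\<rho> \<in> test_funs {0<..<T}" and \<theta>: "\<theta> \<in> test_funs {0<..<T}" and T: "T > 0"
  shows "(\<integral>t. deriv \<rho> t * \<theta> t \<partial>lebesgue_on {0<..<T}) = (\<integral>t. - (\<rho> t * deriv \<theta> t) \<partial>lebesgue_on {0<..<T})"
proof -
  let ?I = "lebesgue_on {0<..<T}"
  interpret finite_measure ?I by (rule finite_measure_lebesgue_on) simp
  have p: "(\<lambda>t. \<rho> t * \<theta> t) \<in> test_funs {0<..<T}" by (rule test_funs_mult[OF \<rho> \<theta>])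
  have d: "deriv (\<lambda>t. \<rho> t * \<theta> t) t = deriv \<rho> t * \<theta> t + deriv \<theta> t * \<rho> t" for t
    by (rule DERIV_imp_deriv[OF DERIV_mult[OF test_funs_deriv(1)[OF \<rho>] test_funs_deriv(1)[OF \<theta>]]])
  have c: "continuous_on UNIV (deriv (\<lambda>t. \<rho> t * \<theta> t))" using test_funs_continuous[OF test_funs_deriv(2)[OF p]] .
  have "(\<integral>t. deriv (\<lambda>t. \<rho> t * \<theta> t) t \<partial>?I) = (\<integral>t. indicator {0<..<T} t * deriv (\<lambda>t. \<rho> t * \<theta> t) t \<partial>lborel)"
    by (rule integrable_lebesgue_on_lborel(2)) (use borel_measurable_continuous_onI[OF c] in auto)
  also have "\<dots> = \<rho> T * \<theta> T"
    using test_funs_eq_0[OF \<rho>, of 0] T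
    by (intro integral_derivative[OF c has_field_derivative_at_within[OF test_funs_deriv(1)[OF p]]]) auto
  also have "\<dots> = 0" using test_funs_eq_0[OF \<rho>, of T] by simp
  finally have "(\<integral>t. deriv \<rho> t * \<theta> t + \<rho> t * deriv \<theta> t \<partial>?I) = 0" by (simp add: d mult.commute)
  moreover have "integrable ?I \<theta>" "integrable ?I (deriv \<theta>)"
    using test_fun_times_integrable[OF \<theta>, of T "\<lambda>_. 1"] test_fun_times_integrable[OF test_funs_deriv(2)[OF \<theta>], of T "\<lambda>_. 1"] by simp_all
  then have "integrable ?I (\<lambda>t. deriv \<rho> t * \<theta> t)" "integrable ?I (\<lambda>t. \<rho> t * deriv \<theta> t)"
    using test_fun_times_integrable[OF test_funs_deriv(2)[OF \<rho>]] test_fun_times_integrable[OF \<rho>] by blast+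
  ultimately show ?thesis by simp
qed

text \<open>Verifies for \<theta>(t) e(x) the conditions that \<open>weak_solution\<close> imposes
  on a test function and its derivatives, apart from the integrability of the products with the
  data.\<close>

lemma tensor_test:
  fixes \<Omega> :: "(real ^ 'd) set"
  assumes O: "open \<Omega>" and T: "T > 0" and e: "e \<in> elts (H10 \<Omega>)" "H1_grad \<Omega> e ge" and \<theta>: "\<theta> \<in> test_funs {0<..<T}"
  shows "Q_measurable T \<Omega> (\<lambda>t x. \<theta> t * e x)"
    and "(\<lambda>t x. \<theta> t * e x) \<in> bochner_Lp 2 T (H10 \<Omega>)"
    and "spatial_gradient T \<Omega> (\<lambda>t x. \<theta> t * e x) (\<lambda>t x. \<theta> t *\<^sub>R ge x)"
    and "Q_measurable T \<Omega> (\<lambda>t x. deriv \<theta> t * e x)"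
    and "has_W11_deriv T (Lp_space 2 \<Omega>) (\<lambda>t x. \<theta> t * e x) (\<lambda>t x. deriv \<theta> t * e x)"
    and "vanishes_at T (Lp_space 2 \<Omega>) T (\<lambda>t x. \<theta> t * e x)"
proof -
  let ?I = "lebesgue_on {0<..<T}"
  have oI: "open {0<..<T}" by simp
  have L2: "L2fun \<Omega> e" "L2fun \<Omega> ge" using e(2) by (auto simp: H1_grad_def)
  have cm: "c \<in> borel_measurable ?I" if "c \<in> test_funs {0<..<T}" for c
    using borel_measurable_continuous_onI[OF test_funs_continuous[OF that]] by (intro measurable_restrict_space1 measurable_completion) simp
  note d\<theta> = test_funs_deriv(2)[OF \<theta>]
  have em: "(\<lambda>z. e (snd z)) \<in> borel_measurable (lebesgue_on (cylinder T \<Omega>))"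
    "(\<lambda>z. ge (snd z)) \<in> borel_measurable (lebesgue_on (cylinder T \<Omega>))"
    using L2 by (auto intro!: measurable_lebesgue_on_snd[OF oI O] dest: L2funD(1))
  have tm: "(\<lambda>z. c (fst z)) \<in> borel_measurable (lebesgue_on (cylinder T \<Omega>))" if "c \<in> test_funs {0<..<T}" for c
    by (rule measurable_lebesgue_on_fst[OF oI O cm[OF that]])
  show "Q_measurable T \<Omega> (\<lambda>t x. \<theta> t * e x)" "Q_measurable T \<Omega> (\<lambda>t x. deriv \<theta> t * e x)"
    using borel_measurable_times[OF tm[OF \<theta>] em(1)] borel_measurable_times[OF tm[OF d\<theta>] em(1)]
    by (simp_all add: Q_measurable_def split_beta')
  obtain B where B: "\<And>x. \<bar>\<theta> x\<bar> \<le> B" using test_funs_bounded[OF \<theta>] by metis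
  obtain B' where B': "\<And>x. \<bar>deriv \<theta> x\<bar> \<le> B'" using test_funs_bounded[OF d\<theta>] by metis
  show "(\<lambda>t x. \<theta> t * e x) \<in> bochner_Lp 2 T (H10 \<Omega>)"
    by (rule tensor_bochner_Lp(2)[OF cm[OF \<theta>] B homogeneous_H10[OF O e(1)]]) simp
  show "spatial_gradient T \<Omega> (\<lambda>t x. \<theta> t * e x) (\<lambda>t x. \<theta> t *\<^sub>R ge x)"
    unfolding spatial_gradient_def
  proof
    show "Q_measurable T \<Omega> (\<lambda>t x. \<theta> t *\<^sub>R ge x)"
      using borel_measurable_scaleR[OF tm[OF \<theta>] em(2)] by (simp add: Q_measurable_def split_beta')
    have "has_weak_gradient \<Omega> (\<lambda>x. c * e x) (\<lambda>x. c *\<^sub>R ge x)" for c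
      using H1_grad_lincomb[OF O e(2) e(2), of c 0] by (simp add: H1_grad_def)
    then show "AE t in ?I. has_weak_gradient \<Omega> (\<lambda>x. \<theta> t * e x) (\<lambda>x. \<theta> t *\<^sub>R ge x)" by simp
  qed
  note hL = homogeneous_L2[OF L2(1)]
  show "has_W11_deriv T (Lp_space 2 \<Omega>) (\<lambda>t x. \<theta> t * e x) (\<lambda>t x. deriv \<theta> t * e x)"
    unfolding has_W11_deriv_def
  proof (intro conjI ballI)
    show "(\<lambda>t x. \<theta> t * e x) \<in> bochner_Lp 1 T (Lp_space 2 \<Omega>)" "(\<lambda>t x. deriv \<theta> t * e x) \<in> bochner_Lp 1 T (Lp_space 2 \<Omega>)"
      by (rule tensor_bochner_Lp(2)[OF cm[OF \<theta>] B hL], simp, rule tensor_bochner_Lp(2)[OF cm[OF d\<theta>] B' hL], simp)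
    fix \<rho> assume \<rho>: "\<rho> \<in> test_funs {0<..<T}"
    have t1: "(\<lambda>t. deriv \<rho> t * \<theta> t) \<in> test_funs {0<..<T}" by (rule test_funs_mult[OF test_funs_deriv(2)[OF \<rho>] \<theta>])
    have t2: "(\<lambda>t. - (\<rho> t * deriv \<theta> t)) \<in> test_funs {0<..<T}"
      using test_funs_diff_scale[OF test_funs_mult[OF \<rho> d\<theta>] test_funs_mult[OF \<rho> d\<theta>], of "-1" 0] by simp
    obtain B1 where B1: "\<And>x. \<bar>deriv \<rho> x * \<theta> x\<bar> \<le> B1" using test_funs_bounded[OF t1] by metis
    obtain B2 where B2: "\<And>x. \<bar>- (\<rho> x * deriv \<theta> x)\<bar> \<le> B2" using test_funs_bounded[OF t2] by metis
    have "has_bochner_integral_in T (Lp_space 2 \<Omega>) (\<lambda>t x. (deriv \<rho> t * \<theta> t) * e x) (\<lambda>x. (\<integral>t. deriv \<rho> t * \<theta> t \<partial>?I) * e x)"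
      by (rule tensor_bochner_integral[OF cm[OF t1] B1 hL])
    moreover have "has_bochner_integral_in T (Lp_space 2 \<Omega>) (\<lambda>t x. - (\<rho> t * deriv \<theta> t) * e x) (\<lambda>x. (\<integral>t. deriv \<rho> t * \<theta> t \<partial>?I) * e x)"
      unfolding integral_test_parts[OF \<rho> \<theta> T] by (rule tensor_bochner_integral[OF cm[OF t2] B2 hL])
    ultimately show "\<exists>y. has_bochner_integral_in T (Lp_space 2 \<Omega>) (\<lambda>t b. deriv \<rho> t * (\<theta> t * e b)) y \<and>
        has_bochner_integral_in T (Lp_space 2 \<Omega>) (\<lambda>t b. - (\<rho> t * (deriv \<theta> t * e b))) y"
      by (auto simp: mult.assoc)
  qed
  have h: "\<And>a. (\<lambda>x. a * e x) \<in> elts (Lp_space 2 \<Omega>)" "\<And>a. nrm (Lp_space 2 \<Omega>) (\<lambda>x. a * e x) = \<bar>a\<bar> * nrm (Lp_space 2 \<Omega>) e"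
    using hL by (auto simp: homogeneous_along_def)
  have hd: "nrm (Lp_space 2 \<Omega>) (\<lambda>b. x * e b - y * e b) = \<bar>x - y\<bar> * nrm (Lp_space 2 \<Omega>) e" for x y
    using h(2)[of "x - y"] by (simp add: left_diff_distrib)
  show "vanishes_at T (Lp_space 2 \<Omega>) T (\<lambda>t x. \<theta> t * e x)"
    unfolding vanishes_at_def
  proof (intro exI[of _ "\<lambda>t x. \<theta> t * e x"] conjI ballI)
    fix t assume "t \<in> {0..T}"
    show "(\<lambda>x. \<theta> t * e x) \<in> elts (Lp_space 2 \<Omega>)" by (rule h(1))
    have "(\<theta> \<longlongrightarrow> \<theta> t) (at t within {0..T})"
      using continuous_on_subset[OF test_funs_continuous[OF \<theta>], of "{0..T}"] \<open>t \<in> {0..T}\<close> by (auto simp: continuous_on_def)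
    then have "((\<lambda>s. \<bar>\<theta> s - \<theta> t\<bar> * nrm (Lp_space 2 \<Omega>) e) \<longlongrightarrow> \<bar>\<theta> t - \<theta> t\<bar> * nrm (Lp_space 2 \<Omega>) e) (at t within {0..T})"
      by (intro tendsto_intros)
    then show "((\<lambda>s. nrm (Lp_space 2 \<Omega>) (\<lambda>b. \<theta> s * e b - \<theta> t * e b)) \<longlongrightarrow> 0) (at t within {0..T})" by (simp add: hd)
  next
    show "AE t in ?I. (\<lambda>x. \<theta> t * e x) \<in> elts (Lp_space 2 \<Omega>) \<and> nrm (Lp_space 2 \<Omega>) (\<lambda>b. \<theta> t * e b - \<theta> t * e b) = 0"
      using h(1) hd[of 0 0] by simp
    show "nrm (Lp_space 2 \<Omega>) (\<lambda>x. \<theta> T * e x) = 0" using test_funs_eq_0[OF \<theta>, of T] h(2)[of 0] by simp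
  qed
qed

section \<open>The equation on time slices\<close>

lemma norm_matrix_vector_mult_le:
  fixes A :: "real ^ 'd ^ 'd"
  shows "norm (A *v x) \<le> (real CARD('d) * norm A) * norm x"
proof -
  have "norm (A *v x) \<le> (\<Sum>i\<in>UNIV. \<bar>(A *v x) $ i\<bar>)" by (rule norm_le_l1_cart)
  also have "\<dots> \<le> (\<Sum>i\<in>(UNIV::'d set). norm A * norm x)"
  proof (rule sum_mono)
    fix i
    have "\<bar>(A *v x) $ i\<bar> \<le> norm (A $ i) * norm x" by (simp add: matrix_vector_mul_component Cauchy_Schwarz_ineq2)
    also have "\<dots> \<le> norm A * norm x" by (intro mult_right_mono Finite_Cartesian_Product.norm_nth_le) simp
    finally show "\<bar>(A *v x) $ i\<bar> \<le> norm A * norm x" .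
  qed
  also have "\<dots> = (real CARD('d) * norm A) * norm x" by simp
  finally show ?thesis .
qed

lemma borel_measurable_matrix_vector_mult:
  fixes A :: "'a \<Rightarrow> real ^ 'd ^ 'd"
  assumes "A \<in> borel_measurable M" "G \<in> borel_measurable M"
  shows "(\<lambda>x. A x *v G x) \<in> borel_measurable M"
proof (rule borel_measurable_continuous_Pair[OF assms])
  have "(\<lambda>p :: (real ^ 'd ^ 'd) \<times> (real ^ 'd). fst p *v snd p) = (\<lambda>p. \<chi> i. (fst p $ i) \<bullet> snd p)"
    by (simp add: fun_eq_iff vec_eq_iff matrix_vector_mul_component)
  moreover have "continuous_on UNIV (\<lambda>p :: (real ^ 'd ^ 'd) \<times> (real ^ 'd). \<chi> i. (fst p $ i) \<bullet> snd p)" by (intro continuous_intros)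
  ultimately show "continuous_on UNIV (\<lambda>p :: (real ^ 'd ^ 'd) \<times> (real ^ 'd). fst p *v snd p)" by (simp only:)
qed

lemma has_weak_gradient_weak_gradient: "has_weak_gradient \<Omega> u g \<Longrightarrow> has_weak_gradient \<Omega> u (weak_gradient \<Omega> u)"
  unfolding weak_gradient_def by (rule someI[of "has_weak_gradient \<Omega> u"])

lemma finite_measure_cylinder:
  fixes T :: real and \<Omega> :: "'a::euclidean_space set"
  assumes "open \<Omega>" "bounded \<Omega>" shows "finite_measure (lebesgue_on ({0<..<T} \<times> \<Omega>))"
proof (rule finite_measure_lebesgue_on)
  have "bounded ({0<..<T} \<times> \<Omega>)" using assms(2) by (intro bounded_Times) auto
  then show "{0<..<T} \<times> \<Omega> \<in> lmeasurable"
    using assms(1) by (intro bounded_set_imp_lmeasurable open_Times_lebesgue) auto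
qed

lemma bochner_L2_joint:
  fixes u :: "real \<Rightarrow> real ^ 'd \<Rightarrow> real"
  assumes O: "open \<Omega>" and u: "Q_measurable T \<Omega> u" "u \<in> bochner_Lp 2 T (Lp_space 2 \<Omega>)"
  shows "integrable (lebesgue_on (cylinder T \<Omega>)) (\<lambda>z. (u (fst z) (snd z))\<^sup>2)"
proof (rule integrable_lebesgue_on_prodI[OF _ O])
  have "(\<lambda>z. u (fst z) (snd z)) \<in> borel_measurable (lebesgue_on (cylinder T \<Omega>))"
    using u(1) by (simp add: Q_measurable_def split_beta')
  then show "(\<lambda>z. (u (fst z) (snd z))\<^sup>2) \<in> borel_measurable (lebesgue_on (cylinder T \<Omega>))" by (rule borel_measurable_power)
  have "AE t in lebesgue_on {0<..<T}. u t \<in> elts (Lp_space 2 \<Omega>)"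
    using u(2) by (auto simp: bochner_Lp_def bochner_measurable_def AE_conj_iff)
  then show "AE t in lebesgue_on {0<..<T}. integrable (lebesgue_on \<Omega>) (\<lambda>x. (u (fst (t, x)) (snd (t, x)))\<^sup>2) \<and>
      (\<integral>x. \<bar>(u (fst (t, x)) (snd (t, x)))\<^sup>2\<bar> \<partial>lebesgue_on \<Omega>) \<le> nrm (Lp_space 2 \<Omega>) (u t) powr 2"
  proof eventually_elim
    case (elim t)
    then have "L2fun \<Omega> (u t)" by (simp add: elts_L2)
    from L2funD(2)[OF this] show ?case by (simp add: nrm_L2)
  qed
  show "integrable (lebesgue_on {0<..<T}) (\<lambda>t. nrm (Lp_space 2 \<Omega>) (u t) powr 2)"
    using u(2) by (simp add: bochner_Lp_def)
qed simp

text \<open>The \<open>H10\<close> norm of a slice controls the L2 norm of any weak gradient of it,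
  whichever representative G is given.\<close>

lemma bochner_H10_gradient:
  fixes w :: "real \<Rightarrow> real ^ 'd \<Rightarrow> real"
  assumes O: "open \<Omega>" and w: "w \<in> bochner_Lp 2 T (H10 \<Omega>)" and G: "spatial_gradient T \<Omega> w G"
  shows "integrable (lebesgue_on (cylinder T \<Omega>)) (\<lambda>z. (norm (G (fst z) (snd z)))\<^sup>2)"
    and "AE t in lebesgue_on {0<..<T}. H1_grad \<Omega> (w t) (G t)"
proof -
  have "AE t in lebesgue_on {0<..<T}. w t \<in> elts (H10 \<Omega>)"
    using w by (auto simp: bochner_Lp_def bochner_measurable_def AE_conj_iff)
  moreover have "AE t in lebesgue_on {0<..<T}. has_weak_gradient \<Omega> (w t) (G t)"
    using G by (simp add: spatial_gradient_def)
  ultimately show H: "AE t in lebesgue_on {0<..<T}. H1_grad \<Omega> (w t) (G t)"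
    by eventually_elim (rule H1_gradI[OF O H10_imp_H1])
  show "integrable (lebesgue_on (cylinder T \<Omega>)) (\<lambda>z. (norm (G (fst z) (snd z)))\<^sup>2)"
  proof (rule integrable_lebesgue_on_prodI[OF _ O])
    have "(\<lambda>z. G (fst z) (snd z)) \<in> borel_measurable (lebesgue_on (cylinder T \<Omega>))"
      using G by (simp add: spatial_gradient_def Q_measurable_def split_beta')
    then show "(\<lambda>z. (norm (G (fst z) (snd z)))\<^sup>2) \<in> borel_measurable (lebesgue_on (cylinder T \<Omega>))"
      by (rule borel_measurable_power[OF measurable_compose[OF _ borel_measurable_norm]])
    show "AE t in lebesgue_on {0<..<T}. integrable (lebesgue_on \<Omega>) (\<lambda>x. (norm (G (fst (t, x)) (snd (t, x))))\<^sup>2) \<and>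
        (\<integral>x. \<bar>(norm (G (fst (t, x)) (snd (t, x))))\<^sup>2\<bar> \<partial>lebesgue_on \<Omega>) \<le> nrm (H10 \<Omega>) (w t) powr 2"
      using H
    proof eventually_elim
      case (elim t)
      then have "L2fun \<Omega> (G t)" by (simp add: H1_grad_def)
      from L2funD(2)[OF this] show ?case by (simp add: nrm_H10 norm_H1_eq[OF O elim])
    qed
    show "integrable (lebesgue_on {0<..<T}) (\<lambda>t. nrm (H10 \<Omega>) (w t) powr 2)"
      using w by (simp add: bochner_Lp_def)
  qed simp
qed

lemma integrable_of_square:
  fixes f :: "'a \<Rightarrow> real"
  assumes "finite_measure M" "f \<in> borel_measurable M" "integrable M (\<lambda>x. (f x)\<^sup>2)"
  shows "integrable M f"
proof (rule Bochner_Integration.integrable_bound)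
  interpret finite_measure M by fact
  show "integrable M (\<lambda>x. 1 + (f x)\<^sup>2)" using assms(3) by simp
  have "\<bar>r\<bar> \<le> 1 + r\<^sup>2" for r :: real using zero_le_power2[of "\<bar>r\<bar> - 1"] by (simp add: power2_diff)
  then show "AE x in M. norm (f x) \<le> norm (1 + (f x)\<^sup>2)" by simp
qed fact

text \<open>For almost every x, \<open>conv_eq_cv\<close> applies to the Borel versions at all t
  \<le> T at once, so the exceptional set concerns x alone and lifts to a null set of the
  cylinder.\<close>

lemma conv_diff_joint:
  fixes u :: "real \<Rightarrow> 'a::euclidean_space \<Rightarrow> real"
  assumes O: "open \<Omega>"
    and kb: "integrable lborel kb" "\<And>s. s \<notin> {0<..<T} \<Longrightarrow> kb s = 0" "AE s in lborel. 0 < s \<and> s < T \<longrightarrow> k s = kb s"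
    and W: "borel_on ({0<..<T} \<times> \<Omega>) W" "AE z in lebesgue_on ({0<..<T} \<times> \<Omega>). u (fst z) (snd z) - u0 (snd z) = W z"
  shows "AE z in lebesgue_on ({0<..<T} \<times> \<Omega>). conv_diff k u u0 (fst z) (snd z) = cv kb (\<lambda>s. W (s, snd z)) (fst z)"
    and "integrable (lebesgue_on ({0<..<T} \<times> \<Omega>)) (\<lambda>z. conv_diff k u u0 (fst z) (snd z))"
proof -
  let ?Q = "lebesgue_on ({0<..<T} \<times> \<Omega>)"
  have oI: "open {0<..<T}" by simp
  have "AE x in lebesgue_on \<Omega>. AE t in lebesgue_on {0<..<T}. u t x - u0 x = W (t, x)"
    using AE_lebesgue_on_prodD(2)[OF oI O W(2)] by simp
  then have "AE x in lebesgue_on \<Omega>. \<forall>t\<le>T. conv_diff k u u0 t x = cv kb (\<lambda>s. W (s, x)) t"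
  proof eventually_elim
    case (elim x)
    have "AE t in lborel. 0 < t \<and> t < T \<longrightarrow> u t x - u0 x = W (t, x)"
      using elim by (simp add: AE_lebesgue_on_iff_lborel)
    moreover have "kb \<in> borel_measurable borel" using borel_measurable_integrable[OF kb(1)] by simp
    ultimately show ?case
      using borel_on_sections(2,4)[OF W(1)] kb(2,3)
      by (auto simp: conv_diff_def intro!: conv_eq_cv[of kb T])
  qed
  from AE_lebesgue_on_prod_snd[OF oI O this]
  have *: "AE z in ?Q. \<forall>t\<le>T. conv_diff k u u0 t (snd z) = cv kb (\<lambda>s. W (s, snd z)) t" .
  have Qs: "AE z in ?Q. z \<in> {0<..<T} \<times> \<Omega>"
    using open_Times_lebesgue[OF oI O] by (intro AE_I2) simp
  show eq: "AE z in ?Q. conv_diff k u u0 (fst z) (snd z) = cv kb (\<lambda>s. W (s, snd z)) (fst z)"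
    using * Qs by eventually_elim auto
  have i: "integrable ?Q (\<lambda>z. cv kb (\<lambda>s. W (s, snd z)) (fst z))" by (rule cv_joint(2)[OF O W(1) kb(1)])
  have eq': "AE z in ?Q. cv kb (\<lambda>s. W (s, snd z)) (fst z) = conv_diff k u u0 (fst z) (snd z)"
    using eq by (rule eventually_mono) simp
  show "integrable ?Q (\<lambda>z. conv_diff k u u0 (fst z) (snd z))"
    by (rule integrable_cong_AE_imp[OF i _ eq'])
      (rule borel_measurable_lebesgue_on_AE[OF open_Times_lebesgue[OF oI O] borel_measurable_integrable[OF i] eq'])
qed

lemma diffusion_flux:
  fixes A :: "real \<Rightarrow> real ^ 'd \<Rightarrow> real ^ 'd ^ 'd"
  assumes O: "open \<Omega>" and A: "diffusion_assumption T \<Omega> A" and G: "Q_measurable T \<Omega> G"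
    "integrable (lebesgue_on (cylinder T \<Omega>)) (\<lambda>z. (norm (G (fst z) (snd z)))\<^sup>2)"
  shows "L2fun (cylinder T \<Omega>) (\<lambda>z. A (fst z) (snd z) *v G (fst z) (snd z))"
proof -
  let ?Q = "lebesgue_on (cylinder T \<Omega>)"
  obtain C where C: "AE z in ?Q. norm (A (fst z) (snd z)) \<le> C"
    using A unfolding diffusion_assumption_def split_beta' by blast
  have Am: "(\<lambda>z. A (fst z) (snd z)) \<in> borel_measurable ?Q"
    using A by (simp add: diffusion_assumption_def split_beta')
  have Gm: "(\<lambda>z. G (fst z) (snd z)) \<in> borel_measurable ?Q" using G(1) by (simp add: Q_measurable_def split_beta')
  have GL: "L2fun (cylinder T \<Omega>) (\<lambda>z. G (fst z) (snd z))" using Gm G(2) by (simp add: L2fun_def)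
  show ?thesis
  proof (rule L2fun_bound[OF GL borel_measurable_matrix_vector_mult[OF Am Gm]])
    show "AE z in ?Q. norm (A (fst z) (snd z) *v G (fst z) (snd z)) \<le> (real CARD('d) * C) * norm (G (fst z) (snd z))"
      using C
    proof eventually_elim
      case (elim z)
      have "norm (A (fst z) (snd z) *v G (fst z) (snd z)) \<le> (real CARD('d) * norm (A (fst z) (snd z))) * norm (G (fst z) (snd z))"
        by (rule norm_matrix_vector_mult_le)
      also have "\<dots> \<le> (real CARD('d) * C) * norm (G (fst z) (snd z))"
        using elim by (intro mult_right_mono mult_left_mono) auto
      finally show ?case .
    qed
  qed
qed

text \<open>Fubini applied to the coordinates of F, which are integrable because the cylinder has
  finite measure, gives the measurability of almost every slice.\<close>

lemma L2fun_slices: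
  fixes F :: "real \<times> 'a::euclidean_space \<Rightarrow> 'b::euclidean_space"
  assumes O: "open \<Omega>" "bounded \<Omega>" and F: "L2fun ({0<..<T} \<times> \<Omega>) F"
  shows "AE t in lebesgue_on {0<..<T}. L2fun \<Omega> (\<lambda>x. F (t, x))"
proof -
  let ?Q = "lebesgue_on ({0<..<T} \<times> \<Omega>)"
  have oI: "open {0<..<T}" by simp
  have nF: "integrable ?Q (\<lambda>z. norm (F z))"
    by (rule integrable_of_square[OF finite_measure_cylinder[OF O] _ L2funD(2)[OF F]]) (use L2funD(1)[OF F] in simp)
  have "AE t in lebesgue_on {0<..<T}. \<forall>e\<in>Basis. (\<lambda>x. F (t, x) \<bullet> e) \<in> borel_measurable (lebesgue_on \<Omega>)"
  proof (rule eventually_ball_finite[OF finite_Basis], rule ballI)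
    fix e :: 'b assume e: "e \<in> Basis"
    have "integrable ?Q (\<lambda>z. F z \<bullet> e)"
      by (rule Bochner_Integration.integrable_bound[OF nF])
        (use L2funD(1)[OF F] Basis_le_norm[OF e] in auto)
    from Fubini_lebesgue_on(1)[OF oI O(1) this]
    show "AE t in lebesgue_on {0<..<T}. (\<lambda>x. F (t, x) \<bullet> e) \<in> borel_measurable (lebesgue_on \<Omega>)"
      by eventually_elim simp
  qed
  with Fubini_lebesgue_on(1)[OF oI O(1) L2funD(2)[OF F]] show ?thesis
    by eventually_elim (simp add: L2fun_def borel_measurable_euclidean_space[where f = "\<lambda>x. F (_, x)"])
qed

text \<open>Splits the weak formulation into its two uses. For the Volterra argument, W represents u
  - u0 and D represents the time derivative of k * (u - u0), with k * W = 1 * D for almost every x.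
  For the spatial argument there is the equation on time slices, where the exceptional set of times
  depends on e.\<close>

lemma weak_solution_slices:
  fixes u :: "real \<Rightarrow> real ^ 'd \<Rightarrow> real"
  assumes O: "open \<Omega>" "bounded \<Omega>" and T: "T > 0" and A: "diffusion_assumption T \<Omega> A"
    and kb: "integrable lborel kb" "\<And>s. s \<notin> {0<..<T} \<Longrightarrow> kb s = 0" "AE s in lborel. 0 < s \<and> s < T \<longrightarrow> k s = kb s"
    and u: "weak_solution T \<Omega> k A \<phi> u0 f u" and h: "conv_diff k u u0 \<in> W11_zero T (Lp_space 1 \<Omega>)"
    and u0: "integrable (lebesgue_on \<Omega>) u0" and f: "integrable (lebesgue_on (cylinder T \<Omega>)) (\<lambda>z. f (fst z) (snd z))"
  obtains W D G where "integrable (lebesgue_on (cylinder T \<Omega>)) (\<lambda>z. u (fst z) (snd z))"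
    "borel_on (cylinder T \<Omega>) W" "borel_on (cylinder T \<Omega>) D"
    "AE z in lebesgue_on (cylinder T \<Omega>). u (fst z) (snd z) - u0 (snd z) = W z"
    "AE x in lebesgue_on \<Omega>. AE t in lborel. 0 < t \<and> t < T \<longrightarrow> cv kb (\<lambda>s. W (s, x)) t = cv (indicator {0<..<T}) (\<lambda>s. D (s, x)) t"
    "AE t in lebesgue_on {0<..<T}. H1_grad \<Omega> (\<lambda>x. \<phi> (u t x)) (G t)"
    "L2fun (cylinder T \<Omega>) (\<lambda>z. A (fst z) (snd z) *v G (fst z) (snd z))"
    "\<forall>e\<in>elts (H10 \<Omega>). \<forall>ge C. H1_grad \<Omega> e ge \<longrightarrow> (\<forall>x. \<bar>e x\<bar> \<le> C) \<longrightarrow>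
       (AE t in lebesgue_on {0<..<T}. (\<integral>x. e x * D (t, x) + (A t x *v G t x) \<bullet> ge x - e x * f t x \<partial>lebesgue_on \<Omega>) = 0)"
proof -
  let ?I = "lebesgue_on {0<..<T}" and ?O = "lebesgue_on \<Omega>" and ?Q = "lebesgue_on (cylinder T \<Omega>)"
  interpret finite_measure ?Q by (rule finite_measure_cylinder[OF O])
  have oI: "open {0<..<T}" by simp
  have Qb: "cylinder T \<Omega> \<in> sets borel" using O by (intro borel_open open_Times) auto
  have um: "Q_measurable T \<Omega> u" and uL: "u \<in> bochner_Lp 2 T (Lp_space 2 \<Omega>)" and \<phi>: "(\<lambda>t x. \<phi> (u t x)) \<in> bochner_Lp 2 T (H10 \<Omega>)"
    using u by (auto simp: weak_solution_def W_phi_def)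
  obtain G where G: "spatial_gradient T \<Omega> (\<lambda>t x. \<phi> (u t x)) G"
    and eq: "\<And>\<eta> \<eta>\<^sub>t G\<^sub>\<eta>. Q_measurable T \<Omega> \<eta> \<Longrightarrow> \<eta> \<in> bochner_Lp 2 T (H10 \<Omega>) \<Longrightarrow> spatial_gradient T \<Omega> \<eta> G\<^sub>\<eta> \<Longrightarrow>
          Q_measurable T \<Omega> \<eta>\<^sub>t \<Longrightarrow> has_W11_deriv T (Lp_space 2 \<Omega>) \<eta> \<eta>\<^sub>t \<Longrightarrow> vanishes_at T (Lp_space 2 \<Omega>) T \<eta> \<Longrightarrow>
          integrable ?Q (\<lambda>z. \<eta>\<^sub>t (fst z) (snd z) * conv_diff k u u0 (fst z) (snd z)) \<Longrightarrow>
          integrable ?Q (\<lambda>z. f (fst z) (snd z) * \<eta> (fst z) (snd z)) \<Longrightarrow>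
          (\<integral>z. - \<eta>\<^sub>t (fst z) (snd z) * conv_diff k u u0 (fst z) (snd z) + (A (fst z) (snd z) *v G (fst z) (snd z)) \<bullet> G\<^sub>\<eta> (fst z) (snd z) \<partial>?Q)
          = (\<integral>z. f (fst z) (snd z) * \<eta> (fst z) (snd z) \<partial>?Q)"
    using u unfolding weak_solution_def split_beta' by blast
  note GH = bochner_H10_gradient[OF O(1) \<phi> G]
  have Gm: "Q_measurable T \<Omega> G" using G by (simp add: spatial_gradient_def)
  note AG = diffusion_flux[OF O(1) A Gm GH(1)]
  have ui: "integrable ?Q (\<lambda>z. u (fst z) (snd z))"
    by (rule integrable_of_square[OF finite_measure_axioms _ bochner_L2_joint[OF O(1) um uL]])
      (use um in \<open>simp add: Q_measurable_def split_beta'\<close>)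
  have one: "integrable ?I (\<lambda>_. 1 :: real)"
    using finite_measure.integrable_const[OF finite_measure_lebesgue_on[of "{0<..<T}"]] by simp
  have "integrable ?Q (\<lambda>z. 1 * u0 (snd z))" by (rule integrable_tensor[OF oI O(1) one u0])
  with ui have "integrable ?Q (\<lambda>z. u (fst z) (snd z) - u0 (snd z))" by simp
  then obtain W where W: "borel_on (cylinder T \<Omega>) W" "AE z in ?Q. u (fst z) (snd z) - u0 (snd z) = W z"
    by (rule borel_on_exists[OF Qb])
  have cd: "AE z in ?Q. conv_diff k u u0 (fst z) (snd z) = cv kb (\<lambda>s. W (s, snd z)) (fst z)"
      "integrable ?Q (\<lambda>z. conv_diff k u u0 (fst z) (snd z))"
    by (rule conv_diff_joint[OF O(1) kb W], assumption)+
  obtain D where D: "borel_on (cylinder T \<Omega>) D"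
    and Dw: "\<forall>\<theta>\<in>test_funs {0<..<T}. \<forall>e\<in>borel_measurable ?O. \<forall>C. (\<forall>x\<in>\<Omega>. \<bar>e x\<bar> \<le> C) \<longrightarrow>
       (\<integral>z. (deriv \<theta> (fst z) * conv_diff k u u0 (fst z) (snd z)) * e (snd z) \<partial>?Q) = - (\<integral>z. (\<theta> (fst z) * D z) * e (snd z) \<partial>?Q)"
    and Dc: "AE z in ?Q. conv_diff k u u0 (fst z) (snd z) = cv (indicator {0<..<T}) (\<lambda>s. D (s, snd z)) (fst z)"
    by (rule W11_zero_L1_joint[OF O(1) T h cd(2)]) (rule that; assumption)
  have "AE z in ?Q. cv kb (\<lambda>s. W (s, snd z)) (fst z) = cv (indicator {0<..<T}) (\<lambda>s. D (s, snd z)) (fst z)"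
    using cd(1) Dc by eventually_elim simp
  from AE_lebesgue_on_prodD(2)[OF oI O(1) this]
  have WD: "AE x in ?O. AE t in lborel. 0 < t \<and> t < T \<longrightarrow> cv kb (\<lambda>s. W (s, x)) t = cv (indicator {0<..<T}) (\<lambda>s. D (s, x)) t"
    by (simp add: AE_lebesgue_on_iff_lborel)
  have Di: "integrable ?Q D" by (rule borel_on_integrable(1)[OF D Qb])
  show thesis
  proof (rule that[OF ui W(1) D W(2) WD GH(2) AG], intro ballI allI impI)
    fix e ge C
    assume "e \<in> elts (H10 \<Omega>)" "H1_grad \<Omega> e ge" "\<forall>x. \<bar>e x\<bar> \<le> C"
    then have e: "e \<in> elts (H10 \<Omega>)" "H1_grad \<Omega> e ge" "\<And>x. \<bar>e x\<bar> \<le> C" by auto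
    have eL: "L2fun \<Omega> e" "L2fun \<Omega> ge" using e(2) by (auto simp: H1_grad_def)
    have em: "(\<lambda>z. e (snd z)) \<in> borel_measurable ?Q" by (rule measurable_lebesgue_on_snd[OF oI O(1) L2funD(1)[OF eL(1)]])
    have gm: "(\<lambda>z. ge (snd z)) \<in> borel_measurable ?Q" by (rule measurable_lebesgue_on_snd[OF oI O(1) L2funD(1)[OF eL(2)]])
    have "integrable ?Q (\<lambda>z. 1 * (norm (ge (snd z)))\<^sup>2)" by (rule integrable_tensor[OF oI O(1) one L2funD(2)[OF eL(2)]])
    then have gL: "L2fun (cylinder T \<Omega>) (\<lambda>z. ge (snd z))" using gm by (simp add: L2fun_def)
    have ie: "integrable ?Q (\<lambda>z. e (snd z) * F z)" if "integrable ?Q F" for F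
      by (rule integrable_cylinder_times[OF O(1) that em]) (rule e(3))
    have iAg: "integrable ?Q (\<lambda>z. (A (fst z) (snd z) *v G (fst z) (snd z)) \<bullet> ge (snd z))" by (rule L2fun_inner_integrable[OF AG gL])
    \<comment> \<open>The residual of the equation tested with e. Testing with \<theta>(t) e(x), and
      moving the time derivative off \<theta> by \<open>Dw\<close>, shows that its slice integrals
      are orthogonal to every \<theta>.\<close>
    define R where "R z = e (snd z) * D z + (A (fst z) (snd z) *v G (fst z) (snd z)) \<bullet> ge (snd z) - e (snd z) * f (fst z) (snd z)" for z
    have Ri: "integrable ?Q R" unfolding R_def[abs_def] using ie[OF Di] ie[OF f] iAg by simp
    have "AE t in ?I. (\<integral>x. R (t, x) \<partial>?O) = 0"
    proof (rule fundamental_lemma[OF oI])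
      show "L1_loc {0<..<T} (\<lambda>t. \<integral>x. R (t, x) \<partial>?O)"
        by (rule integrable_L1_loc[OF _ Fubini_lebesgue_on(2)[OF oI O(1) Ri]]) simp
      fix \<theta> assume \<theta>: "\<theta> \<in> test_funs {0<..<T}"
      obtain B1 where B1: "\<And>x. \<bar>deriv \<theta> x\<bar> \<le> B1" using test_funs_bounded[OF test_funs_deriv(2)[OF \<theta>]] by metis
      obtain B2 where B2: "\<And>x. \<bar>\<theta> x\<bar> \<le> B2" using test_funs_bounded[OF \<theta>] by metis
      have tm: "(\<lambda>z. c (fst z)) \<in> borel_measurable ?Q" if "c \<in> test_funs {0<..<T}" for c :: "real \<Rightarrow> real"
        using borel_measurable_continuous_onI[OF test_funs_continuous[OF that]]
        by (intro measurable_lebesgue_on_fst[OF oI O(1)] measurable_restrict_space1 measurable_completion) simp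
      have i1: "integrable ?Q (\<lambda>z. deriv \<theta> (fst z) * F z)" if "integrable ?Q F" for F
        by (rule integrable_cylinder_times[OF O(1) that tm[OF test_funs_deriv(2)[OF \<theta>]]]) (rule B1)
      have i2: "integrable ?Q (\<lambda>z. \<theta> (fst z) * F z)" if "integrable ?Q F" for F
        by (rule integrable_cylinder_times[OF O(1) that tm[OF \<theta>]]) (rule B2)
      note tt = tensor_test[OF O(1) T e(1,2) \<theta>]
      have j1: "integrable ?Q (\<lambda>z. (deriv \<theta> (fst z) * e (snd z)) * conv_diff k u u0 (fst z) (snd z))"
        using i1[OF ie[OF cd(2)]] by (simp add: mult.assoc)
      have j2: "integrable ?Q (\<lambda>z. f (fst z) (snd z) * (\<theta> (fst z) * e (snd z)))"
        using i2[OF ie[OF f]] by (simp add: mult_ac)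
      have j3: "integrable ?Q (\<lambda>z. (A (fst z) (snd z) *v G (fst z) (snd z)) \<bullet> (\<theta> (fst z) *\<^sub>R ge (snd z)))"
        using i2[OF iAg] by simp
      have j4: "integrable ?Q (\<lambda>z. \<theta> (fst z) * (e (snd z) * D z))" by (rule i2[OF ie[OF Di]])
      have "(\<integral>z. - (deriv \<theta> (fst z) * e (snd z)) * conv_diff k u u0 (fst z) (snd z) + (A (fst z) (snd z) *v G (fst z) (snd z)) \<bullet> (\<theta> (fst z) *\<^sub>R ge (snd z)) \<partial>?Q)
          = (\<integral>z. f (fst z) (snd z) * (\<theta> (fst z) * e (snd z)) \<partial>?Q)"
        by (rule eq[OF tt j1 j2])
      moreover have "(\<integral>z. - (deriv \<theta> (fst z) * e (snd z)) * conv_diff k u u0 (fst z) (snd z) + (A (fst z) (snd z) *v G (fst z) (snd z)) \<bullet> (\<theta> (fst z) *\<^sub>R ge (snd z)) \<partial>?Q)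
         = - (\<integral>z. (deriv \<theta> (fst z) * e (snd z)) * conv_diff k u u0 (fst z) (snd z) \<partial>?Q) + (\<integral>z. (A (fst z) (snd z) *v G (fst z) (snd z)) \<bullet> (\<theta> (fst z) *\<^sub>R ge (snd z)) \<partial>?Q)"
        using Bochner_Integration.integral_diff[OF j3 j1] by simp
      moreover have "(\<integral>z. (deriv \<theta> (fst z) * e (snd z)) * conv_diff k u u0 (fst z) (snd z) \<partial>?Q) = - (\<integral>z. \<theta> (fst z) * (e (snd z) * D z) \<partial>?Q)"
        using Dw[rule_format, OF \<theta> L2funD(1)[OF eL(1)], of C] e(3) by (simp add: mult_ac)
      moreover have "(\<integral>z. \<theta> (fst z) * R z \<partial>?Q) = (\<integral>z. \<theta> (fst z) * (e (snd z) * D z) \<partial>?Q)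
          + (\<integral>z. (A (fst z) (snd z) *v G (fst z) (snd z)) \<bullet> (\<theta> (fst z) *\<^sub>R ge (snd z)) \<partial>?Q) - (\<integral>z. f (fst z) (snd z) * (\<theta> (fst z) * e (snd z)) \<partial>?Q)"
      proof -
        have "(\<integral>z. \<theta> (fst z) * R z \<partial>?Q) = (\<integral>z. \<theta> (fst z) * (e (snd z) * D z)
            + (A (fst z) (snd z) *v G (fst z) (snd z)) \<bullet> (\<theta> (fst z) *\<^sub>R ge (snd z)) - f (fst z) (snd z) * (\<theta> (fst z) * e (snd z)) \<partial>?Q)"
          by (rule Bochner_Integration.integral_cong) (simp_all add: R_def algebra_simps)
        then show ?thesis
          by (simp only: Bochner_Integration.integral_diff[OF Bochner_Integration.integrable_add[OF j4 j3] j2] Bochner_Integration.integral_add[OF j4 j3])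
      qed
      ultimately have z: "(\<integral>z. \<theta> (fst z) * R z \<partial>?Q) = 0" by linarith
      have "(\<integral>t. \<theta> t * (\<integral>x. R (t, x) \<partial>?O) \<partial>?I) = (\<integral>z. \<theta> (fst z) * R z \<partial>?Q)"
        using Fubini_lebesgue_on(3)[OF oI O(1) i2[OF Ri]] by simp
      with z show "(\<integral>t. \<theta> t * (\<integral>x. R (t, x) \<partial>?O) \<partial>?I) = 0" by simp
    qed
    then show "AE t in ?I. (\<integral>x. e x * D (t, x) + (A t x *v G t x) \<bullet> ge x - e x * f t x \<partial>?O) = 0" by (simp add: R_def)
  qed
qed

section \<open>Testing a single time slice with an approximate sign\<close>

lemma tanh_scaled_tendsto_sgn: "(\<lambda>n. tanh (real n * r)) \<longlonglongrightarrow> sgn (r::real)"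
proof -
  have pos: "(\<lambda>n. tanh (real n * r)) \<longlonglongrightarrow> 1" if "r > 0" for r :: real
  proof -
    have "filterlim (\<lambda>n. r * real n) at_top sequentially"
      using that by (intro filterlim_tendsto_pos_mult_at_top[OF tendsto_const] filterlim_real_sequentially)
    then show ?thesis using filterlim_compose[OF tanh_real_at_top] by (simp add: mult.commute)
  qed
  show ?thesis
  proof (cases r "0::real" rule: linorder_cases)
    case less
    then have "(\<lambda>n. - tanh (real n * (- r))) \<longlonglongrightarrow> - 1" by (intro tendsto_minus pos) simp
    with less show ?thesis by simp
  qed (use pos in auto)
qed

lemma sgn_test_inequality:
  fixes \<Omega> :: "'a::euclidean_space set" and a b :: "nat \<Rightarrow> 'a \<Rightarrow> real"
  assumes O: "open \<Omega>" and g: "H1_grad \<Omega> y g" "H1_grad \<Omega> z h"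
    and a: "\<And>n. a n \<in> elts (H10 \<Omega>)" "(\<lambda>n. nrm (H10 \<Omega>) (\<lambda>x. y x - a n x)) \<longlonglongrightarrow> 0"
    and b: "\<And>n. b n \<in> elts (H10 \<Omega>)" "(\<lambda>n. nrm (H10 \<Omega>) (\<lambda>x. z x - b n x)) \<longlonglongrightarrow> 0"
    and F: "L2fun \<Omega> F" "AE x in lebesgue_on \<Omega>. F x \<bullet> (g x - h x) \<ge> 0"
    and D: "integrable (lebesgue_on \<Omega>) D" and f: "integrable (lebesgue_on \<Omega>) f"
    and id: "\<And>n m e. e = (\<lambda>x. tanh (real m * (a n x - b n x))) \<Longrightarrow>
      (\<integral>x. e x * D x \<partial>lebesgue_on \<Omega>) + (\<integral>x. F x \<bullet> weak_gradient \<Omega> e x \<partial>lebesgue_on \<Omega>) = (\<integral>x. e x * f x \<partial>lebesgue_on \<Omega>)"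
  shows "(\<integral>x. sgn (y x - z x) * D x \<partial>lebesgue_on \<Omega>) \<le> (\<integral>x. \<bar>f x\<bar> \<partial>lebesgue_on \<Omega>)"
proof -
  let ?O = "lebesgue_on \<Omega>"
  have "\<forall>n. \<exists>g'. H1_grad \<Omega> (a n) g'" "\<forall>n. \<exists>g'. H1_grad \<Omega> (b n) g'"
    using H1_E[OF O H10_imp_H1] a(1) b(1) by metis+
  then obtain ga gb where gab: "\<And>n. H1_grad \<Omega> (a n) (ga n)" "\<And>n. H1_grad \<Omega> (b n) (gb n)" by metis
  define w where "w n x = a n x - b n x" for n x
  define gw where "gw n x = ga n x - gb n x" for n x
  define W where "W x = y x - z x" for x
  define G where "G x = g x - h x" for x
  have wH: "H1_grad \<Omega> (w n) (gw n)" for n unfolding w_def[abs_def] gw_def[abs_def] by (rule H1_grad_diff[OF O gab])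
  have WH: "H1_grad \<Omega> W G" unfolding W_def[abs_def] G_def[abs_def] by (rule H1_grad_diff[OF O g])
  have w10: "w n \<in> elts (H10 \<Omega>)" for n
    using H10_lincomb[OF O a(1) b(1), of 1 n "-1" n] by (simp add: w_def[abs_def])
  have la: "(\<lambda>n. \<integral>x. (norm (y x - a n x))\<^sup>2 \<partial>?O) \<longlonglongrightarrow> 0" "(\<lambda>n. \<integral>x. (norm (g x - ga n x))\<^sup>2 \<partial>?O) \<longlonglongrightarrow> 0"
    using a(2) norm_H1_tendsto_iff[OF O H1_grad_diff[OF O g(1) gab(1)]] by (auto simp: nrm_H10)
  have lb: "(\<lambda>n. \<integral>x. (norm (z x - b n x))\<^sup>2 \<partial>?O) \<longlonglongrightarrow> 0" "(\<lambda>n. \<integral>x. (norm (h x - gb n x))\<^sup>2 \<partial>?O) \<longlonglongrightarrow> 0"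
    using b(2) norm_H1_tendsto_iff[OF O H1_grad_diff[OF O g(2) gab(2)]] by (auto simp: nrm_H10)
  have L2: "L2fun \<Omega> y" "L2fun \<Omega> z" "L2fun \<Omega> g" "L2fun \<Omega> h" "L2fun \<Omega> (a n)" "L2fun \<Omega> (b n)" "L2fun \<Omega> (ga n)" "L2fun \<Omega> (gb n)" for n
    using g gab by (auto simp: H1_grad_def)
  have lw: "(\<lambda>n. \<integral>x. (norm (w n x - W x))\<^sup>2 \<partial>?O) \<longlonglongrightarrow> 0"
  proof -
    have m: "(\<lambda>n. \<integral>x. (norm (- (z x - b n x)))\<^sup>2 \<partial>?O) \<longlonglongrightarrow> 0" using lb(1) by (simp only: norm_minus_cancel)
    have "(\<lambda>n. \<integral>x. (norm ((y x - a n x) + - (z x - b n x)))\<^sup>2 \<partial>?O) \<longlonglongrightarrow> 0"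
      by (rule L2_tendsto_add[OF L2fun_diff[OF L2(1,5)] L2fun_minus[OF L2fun_diff[OF L2(2,6)]] la(1) m])
    moreover have "norm ((y x - a n x) + - (z x - b n x)) = norm (w n x - W x)" for n x
      by (simp add: w_def W_def abs_real_def)
    ultimately show ?thesis by (simp only:)
  qed
  have lg: "(\<lambda>n. \<integral>x. (norm (gw n x - G x))\<^sup>2 \<partial>?O) \<longlonglongrightarrow> 0"
  proof -
    have m: "(\<lambda>n. \<integral>x. (norm (- (g x - ga n x)))\<^sup>2 \<partial>?O) \<longlonglongrightarrow> 0" using la(2) by (simp only: norm_minus_cancel)
    have "(\<lambda>n. \<integral>x. (norm (- (g x - ga n x) + (h x - gb n x)))\<^sup>2 \<partial>?O) \<longlonglongrightarrow> 0"
      by (rule L2_tendsto_add[OF L2fun_minus[OF L2fun_diff[OF L2(3,7)]] L2fun_diff[OF L2(4,8)] m lb(2)])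
    moreover have "- (g x - ga n x) + (h x - gb n x) = gw n x - G x" for n x
      by (simp add: gw_def G_def)
    ultimately show ?thesis by simp
  qed
  have wL: "L2fun \<Omega> (w n)" "L2fun \<Omega> (gw n)" "L2fun \<Omega> W" "L2fun \<Omega> G" for n
    using wH[of n] WH by (auto simp: H1_grad_def)
  have lim_bounded: "(\<lambda>n. \<integral>x. e n x * p x \<partial>?O) \<longlonglongrightarrow> (\<integral>x. E x * p x \<partial>?O)"
    if p: "integrable ?O p" and e: "\<And>n. e n \<in> borel_measurable ?O" "E \<in> borel_measurable ?O" "\<And>n x. \<bar>e n x\<bar> \<le> 1"
      and le: "AE x in ?O. (\<lambda>n. e n x) \<longlonglongrightarrow> E x" for p E :: "'a \<Rightarrow> real" and e :: "nat \<Rightarrow> 'a \<Rightarrow> real"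
  proof (rule integral_dominated_convergence[where w = "\<lambda>x. \<bar>p x\<bar>"])
    show "AE x in ?O. (\<lambda>n. e n x * p x) \<longlonglongrightarrow> E x * p x" using le by eventually_elim (intro tendsto_intros)
    show "AE x in ?O. norm (e n x * p x) \<le> \<bar>p x\<bar>" for n
      using e(3) by (intro AE_I2) (simp add: abs_mult mult_left_le_one_le)
  qed (use p e in auto)
  have tm: "(\<lambda>x. tanh (c * v x)) \<in> borel_measurable ?O" if "v \<in> borel_measurable ?O" for c and v :: "'a \<Rightarrow> real"
    using that by (intro borel_measurable_continuous_on[where f = "tanh :: real \<Rightarrow> real"] continuous_intros) auto
  have step: "(\<integral>x. tanh (real m * W x) * D x \<partial>?O) \<le> (\<integral>x. \<bar>f x\<bar> \<partial>?O)" for m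
  proof -
    let ?c = "real m"
    define q where "q n x = (?c * (1 - (tanh (?c * w n x))\<^sup>2)) *\<^sub>R gw n x" for n x
    define Q where "Q x = (?c * (1 - (tanh (?c * W x))\<^sup>2)) *\<^sub>R G x" for x
    obtain r :: "nat \<Rightarrow> nat" where r: "strict_mono r" "AE x in ?O. (\<lambda>n. w (r n) x) \<longlonglongrightarrow> W x"
      "(\<lambda>n. \<integral>x. (norm (q (r n) x - Q x))\<^sup>2 \<partial>?O) \<longlonglongrightarrow> 0"
      by (rule tanh_chain_limit[OF wL lw lg, of ?c]) (rule that, assumption, assumption, simp only: q_def Q_def)
    have eH: "H1_grad \<Omega> (\<lambda>x. tanh (?c * w n x)) (q n)" for n
      unfolding q_def[abs_def] by (rule H10_tanh(1)[OF O w10 wH])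
    have QH: "L2fun \<Omega> Q"
    proof (rule L2fun_bound[OF wL(4), of _ ?c])
      show "Q \<in> borel_measurable ?O" unfolding Q_def[abs_def]
        using tm[OF L2funD(1)[OF wL(3)], of ?c] L2funD(1)[OF wL(4)] by (intro borel_measurable_scaleR) auto
      show "AE x in ?O. norm (Q x) \<le> ?c * norm (G x)"
        using abs_tanh_le(3,4) by (intro AE_I2) (auto simp: Q_def abs_mult intro!: mult_right_mono mult_left_le)
    qed
    \<comment> \<open>The choice made by \<open>weak_gradient\<close> agrees almost everywhere with
      the chain rule gradient q, whose limit is known.\<close>
    have qF: "(\<integral>x. F x \<bullet> weak_gradient \<Omega> (\<lambda>x. tanh (?c * w n x)) x \<partial>?O) = (\<integral>x. q n x \<bullet> F x \<partial>?O)" for n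
    proof -
      have hw: "has_weak_gradient \<Omega> (\<lambda>x. tanh (?c * w n x)) (q n)" using eH[of n] by (simp add: H1_grad_def)
      note hw' = has_weak_gradient_weak_gradient[OF hw]
      have "weak_gradient \<Omega> (\<lambda>x. tanh (?c * w n x)) \<in> borel_measurable ?O" "q n \<in> borel_measurable ?O"
        using hw hw' L1_loc_measurable[OF O] by (auto simp: has_weak_gradient_def)
      then show ?thesis
        using weak_gradient_unique[OF O hw' hw] L2funD(1)[OF F(1)]
        by (intro integral_cong_AE borel_measurable_inner) (auto simp: inner_commute elim!: eventually_mono)
    qed
    have idn: "(\<integral>x. tanh (?c * w (r n) x) * D x \<partial>?O) + (\<integral>x. q (r n) x \<bullet> F x \<partial>?O) = (\<integral>x. tanh (?c * w (r n) x) * f x \<partial>?O)" for n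
      using id[of "\<lambda>x. tanh (?c * w (r n) x)" m "r n"] by (simp add: w_def qF[unfolded w_def])
    have wt: "AE x in ?O. (\<lambda>n. tanh (?c * w (r n) x)) \<longlonglongrightarrow> tanh (?c * W x)"
      using r(2) by eventually_elim (intro tendsto_intros, auto)
    have l1: "(\<lambda>n. \<integral>x. tanh (?c * w (r n) x) * D x \<partial>?O) \<longlonglongrightarrow> (\<integral>x. tanh (?c * W x) * D x \<partial>?O)"
      by (rule lim_bounded[OF D tm[OF L2funD(1)[OF wL(1)]] tm[OF L2funD(1)[OF wL(3)]] abs_tanh_le(1) wt])
    have l2: "(\<lambda>n. \<integral>x. tanh (?c * w (r n) x) * f x \<partial>?O) \<longlonglongrightarrow> (\<integral>x. tanh (?c * W x) * f x \<partial>?O)"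
      by (rule lim_bounded[OF f tm[OF L2funD(1)[OF wL(1)]] tm[OF L2funD(1)[OF wL(3)]] abs_tanh_le(1) wt])
    have l3: "(\<lambda>n. \<integral>x. q (r n) x \<bullet> F x \<partial>?O) \<longlonglongrightarrow> (\<integral>x. Q x \<bullet> F x \<partial>?O)"
      by (rule L2fun_inner_tendsto[OF _ QH F(1) r(3)]) (use eH in \<open>simp add: H1_grad_def\<close>)
    have "(\<integral>x. tanh (?c * W x) * D x \<partial>?O) + (\<integral>x. Q x \<bullet> F x \<partial>?O) = (\<integral>x. tanh (?c * W x) * f x \<partial>?O)"
      using LIMSEQ_unique[OF tendsto_add[OF l1 l3]] l2 idn by simp
    \<comment> \<open>Q is a nonnegative multiple of g - h, because tanh is increasing.\<close>
    moreover have "(\<integral>x. Q x \<bullet> F x \<partial>?O) \<ge> 0"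
    proof (rule integral_nonneg_AE)
      show "AE x in ?O. 0 \<le> Q x \<bullet> F x" using F(2)
      proof eventually_elim
        case (elim x)
        have "0 \<le> (?c * (1 - (tanh (?c * W x))\<^sup>2)) * (F x \<bullet> G x)"
          using elim abs_tanh_le(3)[of "?c * W x"] by (intro mult_nonneg_nonneg) (auto simp: G_def)
        then show ?case by (simp add: Q_def inner_commute)
      qed
    qed
    moreover have "(\<integral>x. tanh (?c * W x) * f x \<partial>?O) \<le> (\<integral>x. \<bar>f x\<bar> \<partial>?O)"
    proof (rule integral_mono')
      show "integrable ?O (\<lambda>x. \<bar>f x\<bar>)" using f by simp
      show "tanh (?c * W x) * f x \<le> \<bar>f x\<bar>" for x
      proof -
        have "tanh (?c * W x) * f x \<le> \<bar>tanh (?c * W x)\<bar> * \<bar>f x\<bar>" unfolding abs_mult[symmetric] by (rule abs_ge_self)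
        also have "\<dots> \<le> \<bar>f x\<bar>" using abs_tanh_le(1)[of "?c * W x"] by (intro mult_left_le_one_le) auto
        finally show ?thesis .
      qed
    qed simp
    ultimately show ?thesis by linarith
  qed
  have "(\<lambda>m. \<integral>x. tanh (real m * W x) * D x \<partial>?O) \<longlonglongrightarrow> (\<integral>x. sgn (W x) * D x \<partial>?O)"
    by (rule lim_bounded[OF D tm[OF L2funD(1)[OF wL(3)]] _ abs_tanh_le(1)])
      (use L2funD(1)[OF wL(3)] tanh_scaled_tendsto_sgn in \<open>auto\<close>)
  then show ?thesis using step by (intro LIMSEQ_le_const2[of _ "\<integral>x. sgn (W x) * D x \<partial>?O", unfolded W_def]) (auto simp: W_def)
qed

section \<open>Contraction for weak solutions\<close>

lemma borel_on_diff: "borel_on S f \<Longrightarrow> borel_on S g \<Longrightarrow> borel_on S (\<lambda>x. f x - g x)"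
  by (simp add: borel_on_def)

text \<open>\<open>sgn_inequality\<close> is used for almost every x with initial value y0 x and
  integrated over x. After exchanging the order of integration, the bound on the time slices can be
  inserted because \<open>weight\<close> is nonnegative; the L1 norm of l then bounds
  \<open>weight\<close>.\<close>

lemma volterra_contraction:
  fixes \<Omega> :: "'a::euclidean_space set" and v :: "real \<times> 'a \<Rightarrow> real"
  assumes V: "volterra_pair T k l" and O: "open \<Omega>"
    and v: "integrable (lebesgue_on ({0<..<T} \<times> \<Omega>)) v" and y0: "integrable (lebesgue_on \<Omega>) y0"
    and W: "borel_on ({0<..<T} \<times> \<Omega>) W" "AE z in lebesgue_on ({0<..<T} \<times> \<Omega>). v z - y0 (snd z) = W z"
    and D: "borel_on ({0<..<T} \<times> \<Omega>) D"
    and eq: "AE x in lebesgue_on \<Omega>. AE t in lborel. 0 < t \<and> t < T \<longrightarrow>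
      cv k (\<lambda>s. W (s, x)) t = cv (indicator {0<..<T}) (\<lambda>s. D (s, x)) t"
    and g: "integrable (lebesgue_on {0<..<T}) g" "\<And>t. g t \<ge> 0"
      "AE t in lebesgue_on {0<..<T}. (\<integral>x. sgn (v (t, x)) * D (t, x) \<partial>lebesgue_on \<Omega>) \<le> g t"
  shows "(\<integral>z. \<bar>v z\<bar> \<partial>lebesgue_on ({0<..<T} \<times> \<Omega>))
    \<le> T * (\<integral>x. \<bar>y0 x\<bar> \<partial>lebesgue_on \<Omega>) + (\<integral>s. \<bar>l s\<bar> \<partial>lborel) * (\<integral>t. g t \<partial>lebesgue_on {0<..<T})"
proof -
  interpret volterra_pair T k l by fact
  let ?I = "lebesgue_on {0<..<T}" and ?O = "lebesgue_on \<Omega>" and ?Q = "lebesgue_on ({0<..<T} \<times> \<Omega>)"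
  have oI: "open {0<..<T}" by simp
  have Ib: "{0<..<T} \<in> sets borel" by simp
  have Qb: "{0<..<T} \<times> \<Omega> \<in> sets borel" using O by (intro borel_open open_Times) auto
  have wm: "(\<lambda>z. weight (fst z)) \<in> borel_measurable ?Q"
    by (intro measurable_lebesgue_on_fst[OF oI O] measurable_restrict_space1 measurable_completion) simp
  have Di: "integrable ?Q D" by (rule borel_on_integrable(1)[OF D Qb])
  have sm: "(\<lambda>z. sgn (v z)) \<in> borel_measurable ?Q" using borel_measurable_integrable[OF v] by simp
  have sD: "integrable ?Q (\<lambda>z. sgn (v z) * D z)"
    by (rule integrable_cylinder_times[OF O Di sm, of 1]) (simp add: sgn_if)
  define P where "P z = weight (fst z) * (sgn (v z) * D z)" for z
  have Pi: "integrable ?Q P" unfolding P_def[abs_def] by (rule integrable_cylinder_times[OF O sD wm]) (rule abs_weight_le)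
  have sections: "AE x in ?O. borel_on {0<..<T} (\<lambda>t. H (t, x))" if "borel_on ({0<..<T} \<times> \<Omega>) H" for H
    using borel_on_sections(1)[OF that] O by (simp add: AE_lebesgue_on_iff_lborel eventually_mono)
  have va: "integrable ?Q (\<lambda>z. \<bar>v z\<bar>)" using v by simp
  have point: "AE x in ?O. (\<integral>t. \<bar>v (t, x)\<bar> \<partial>?I) \<le> T * \<bar>y0 x\<bar> + (\<integral>t. P (t, x) \<partial>?I)"
    using sections[OF W(1)] sections[OF D] AE_lebesgue_on_prodD(2)[OF oI O W(2)] eq
      Fubini_lebesgue_on(4)[OF oI O va] Fubini_lebesgue_on(4)[OF oI O Pi]
  proof eventually_elim
    case (elim x)
    define w where "w t = W (t, x)" for t
    define d where "d t = D (t, x)" for t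
    have w: "integrable lborel w" "\<And>t. t \<le> 0 \<Longrightarrow> w t = 0" and d: "integrable lborel d" "\<And>t. t \<le> 0 \<Longrightarrow> d t = 0"
      using elim(1,2) by (auto simp: borel_on_def w_def[abs_def] d_def[abs_def])
    have [measurable]: "w \<in> borel_measurable borel" "d \<in> borel_measurable borel"
      using borel_measurable_integrable[OF w(1)] borel_measurable_integrable[OF d(1)] by simp_all
    have vw: "AE t in ?I. v (t, x) = y0 x + w t" using elim(3) by eventually_elim (simp add: w_def)
    have eq1: "(\<integral>t. \<bar>v (t, x)\<bar> \<partial>?I) = (\<integral>t. unit t * \<bar>y0 x + w t\<bar> \<partial>lborel)"
    proof -
      have "(\<integral>t. \<bar>v (t, x)\<bar> \<partial>?I) = (\<integral>t. \<bar>y0 x + w t\<bar> \<partial>?I)"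
      proof (rule integral_cong_AE)
        show "(\<lambda>t. \<bar>v (t, x)\<bar>) \<in> borel_measurable ?I" using borel_measurable_integrable[OF elim(5)] .
        show "(\<lambda>t. \<bar>y0 x + w t\<bar>) \<in> borel_measurable ?I"
          by (intro measurable_restrict_space1 measurable_completion) simp
      qed (use vw in \<open>auto elim!: eventually_mono\<close>)
      also have "\<dots> = (\<integral>t. unit t * \<bar>y0 x + w t\<bar> \<partial>lborel)" by (rule integrable_lebesgue_on_lborel(2)[OF Ib]) measurable
      finally show ?thesis .
    qed
    have eq2: "(\<integral>t. P (t, x) \<partial>?I) = (\<integral>t. unit t * (weight t * (d t * sgn (y0 x + w t))) \<partial>lborel)"
    proof -
      have "(\<integral>t. P (t, x) \<partial>?I) = (\<integral>t. weight t * (d t * sgn (y0 x + w t)) \<partial>?I)"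
      proof (rule integral_cong_AE)
        show "(\<lambda>t. P (t, x)) \<in> borel_measurable ?I" using borel_measurable_integrable[OF elim(6)] .
        show "(\<lambda>t. weight t * (d t * sgn (y0 x + w t))) \<in> borel_measurable ?I"
          by (intro measurable_restrict_space1 measurable_completion) simp
        show "AE t in ?I. P (t, x) = weight t * (d t * sgn (y0 x + w t))"
          using vw by eventually_elim (simp add: P_def d_def mult_ac)
      qed
      also have "\<dots> = (\<integral>t. unit t * (weight t * (d t * sgn (y0 x + w t))) \<partial>lborel)" by (rule integrable_lebesgue_on_lborel(2)[OF Ib]) measurable
      finally show ?thesis .
    qed
    have "AE t in lborel. 0 < t \<and> t < T \<longrightarrow> cv k w t = cv unit d t" using elim(4) by (simp add: w_def[abs_def] d_def[abs_def])
    from sgn_inequality[OF w d this, of "y0 x"] show ?case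
      unfolding eq1 eq2 by linarith
  qed
  have "(\<integral>z. \<bar>v z\<bar> \<partial>?Q) = (\<integral>x. \<integral>t. \<bar>v (t, x)\<bar> \<partial>?I \<partial>?O)" by (rule Fubini_lebesgue_on(6)[OF oI O va, symmetric])
  also have "\<dots> \<le> (\<integral>x. T * \<bar>y0 x\<bar> + (\<integral>t. P (t, x) \<partial>?I) \<partial>?O)"
    by (rule integral_mono_AE[OF Fubini_lebesgue_on(5)[OF oI O va] _ point])
      (use Fubini_lebesgue_on(5)[OF oI O Pi] y0 in simp)
  also have "\<dots> = T * (\<integral>x. \<bar>y0 x\<bar> \<partial>?O) + (\<integral>x. \<integral>t. P (t, x) \<partial>?I \<partial>?O)"
    using Fubini_lebesgue_on(5)[OF oI O Pi] y0 by simp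
  also have "(\<integral>x. \<integral>t. P (t, x) \<partial>?I \<partial>?O) = (\<integral>t. \<integral>x. P (t, x) \<partial>?O \<partial>?I)"
    using Fubini_lebesgue_on(3,6)[OF oI O Pi] by simp
  also have "\<dots> \<le> (\<integral>t. (\<integral>s. \<bar>l s\<bar> \<partial>lborel) * g t \<partial>?I)"
  proof (rule integral_mono_AE[OF Fubini_lebesgue_on(2)[OF oI O Pi]])
    have "AE t in ?I. t \<in> {0<..<T}" by (rule AE_I2) simp
    with g(3) show "AE t in ?I. (\<integral>x. P (t, x) \<partial>?O) \<le> (\<integral>s. \<bar>l s\<bar> \<partial>lborel) * g t"
    proof eventually_elim
      case (elim t)
      have "(\<integral>x. P (t, x) \<partial>?O) = weight t * (\<integral>x. sgn (v (t, x)) * D (t, x) \<partial>?O)" by (simp add: P_def)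
      also have "\<dots> \<le> weight t * g t" using elim weight_nonneg by (intro mult_left_mono) auto
      also have "\<dots> \<le> (\<integral>s. \<bar>l s\<bar> \<partial>lborel) * g t" using abs_weight_le[of t] g(2) by (intro mult_right_mono) auto
      finally show ?case .
    qed
  qed (use g(1) in simp)
  also have "\<dots> = (\<integral>s. \<bar>l s\<bar> \<partial>lborel) * (\<integral>t. g t \<partial>?I)" by simp
  finally show ?thesis by simp
qed

lemma cv_diff_AE:
  assumes "integrable lborel f" "integrable lborel g" "integrable lborel h"
  shows "AE t in lborel. cv f (\<lambda>s. g s - h s) t = cv f g t - cv f h t"
  using cv_integrable(1)[OF assms(1,2)] cv_integrable(1)[OF assms(1,3)]
  by eventually_elim (simp add: cv_def right_diff_distrib)

text \<open>With a countable family \<open>E\<close> of test functions, both equations hold for all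
  members outside one null set of times; at the remaining times all hypotheses of
  \<open>sgn_test_inequality\<close> can be checked.\<close>

lemma slice_sgn_inequality:
  fixes \<Omega> :: "(real ^ 'd) set" and y z :: "real \<Rightarrow> real ^ 'd \<Rightarrow> real" and D1 D2 f1 f2 :: "real \<times> (real ^ 'd) \<Rightarrow> real"
  assumes O: "open \<Omega>" "bounded \<Omega>" and A: "diffusion_assumption T \<Omega> A"
    and yz: "y \<in> bochner_Lp 2 T (H10 \<Omega>)" "z \<in> bochner_Lp 2 T (H10 \<Omega>)"
    and G: "AE t in lebesgue_on {0<..<T}. H1_grad \<Omega> (y t) (G t)" "AE t in lebesgue_on {0<..<T}. H1_grad \<Omega> (z t) (H t)"
    and F: "L2fun (cylinder T \<Omega>) (\<lambda>p. A (fst p) (snd p) *v G (fst p) (snd p))"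
      "L2fun (cylinder T \<Omega>) (\<lambda>p. A (fst p) (snd p) *v H (fst p) (snd p))"
    and D: "integrable (lebesgue_on (cylinder T \<Omega>)) D1" "integrable (lebesgue_on (cylinder T \<Omega>)) D2"
    and f: "integrable (lebesgue_on (cylinder T \<Omega>)) f1" "integrable (lebesgue_on (cylinder T \<Omega>)) f2"
    and id1: "\<forall>e\<in>elts (H10 \<Omega>). \<forall>ge C. H1_grad \<Omega> e ge \<longrightarrow> (\<forall>x. \<bar>e x\<bar> \<le> C) \<longrightarrow>
       (AE t in lebesgue_on {0<..<T}. (\<integral>x. e x * D1 (t, x) + (A t x *v G t x) \<bullet> ge x - e x * f1 (t, x) \<partial>lebesgue_on \<Omega>) = 0)"
    and id2: "\<forall>e\<in>elts (H10 \<Omega>). \<forall>ge C. H1_grad \<Omega> e ge \<longrightarrow> (\<forall>x. \<bar>e x\<bar> \<le> C) \<longrightarrow>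
       (AE t in lebesgue_on {0<..<T}. (\<integral>x. e x * D2 (t, x) + (A t x *v H t x) \<bullet> ge x - e x * f2 (t, x) \<partial>lebesgue_on \<Omega>) = 0)"
  shows "AE t in lebesgue_on {0<..<T}.
    (\<integral>x. sgn (y t x - z t x) * (D1 (t, x) - D2 (t, x)) \<partial>lebesgue_on \<Omega>) \<le> (\<integral>x. \<bar>f1 (t, x) - f2 (t, x)\<bar> \<partial>lebesgue_on \<Omega>)"
proof -
  let ?I = "lebesgue_on {0<..<T}" and ?O = "lebesgue_on \<Omega>" and ?Q = "lebesgue_on (cylinder T \<Omega>)"
  have oI: "open {0<..<T}" by simp
  obtain a where a: "\<And>n::nat. simple_fun T (H10 \<Omega>) (a n)" "AE t in ?I. (\<lambda>n. nrm (H10 \<Omega>) (\<lambda>x. y t x - a n t x)) \<longlonglongrightarrow> 0"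
    using yz(1) by (auto simp: bochner_Lp_def bochner_measurable_def AE_conj_iff)
  obtain b where b: "\<And>n::nat. simple_fun T (H10 \<Omega>) (b n)" "AE t in ?I. (\<lambda>n. nrm (H10 \<Omega>) (\<lambda>x. z t x - b n t x)) \<longlonglongrightarrow> 0"
    using yz(2) by (auto simp: bochner_Lp_def bochner_measurable_def AE_conj_iff)
  define S where "S s = (\<Union>n::nat. s n ` {0<..<T})" for s :: "nat \<Rightarrow> real \<Rightarrow> real ^ 'd \<Rightarrow> real"
  have S: "countable (S s)" "\<And>e. e \<in> S s \<Longrightarrow> e \<in> elts (H10 \<Omega>)" if "\<And>n. simple_fun T (H10 \<Omega>) (s n)" for s
  proof -
    have "finite (s n ` {0<..<T})" for n
      using simple_functionD(1)[of ?I "s n"] that[of n] by (simp add: simple_fun_def)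
    then show "countable (S s)" unfolding S_def by (intro countable_UN) (auto intro: countable_finite)
    show "e \<in> elts (H10 \<Omega>)" if "e \<in> S s" for e
      using that \<open>\<And>n. simple_fun T (H10 \<Omega>) (s n)\<close> by (auto simp: S_def simple_fun_def)
  qed
  \<comment> \<open>Values of the simple functions for all indices and all times are combined
    freely: the set remains countable and contains the test function built from a n t and b n t for
    every n, m and t.\<close>
  define E where "E = (\<lambda>(m, p, q) x. tanh (real m * (p x - q x))) ` ((UNIV :: nat set) \<times> S a \<times> S b)"
  have E_countable: "countable E" unfolding E_def using S(1)[OF a(1)] S(1)[OF b(1)] by (intro countable_image countable_SIGMA) auto
  have EH: "e \<in> elts (H10 \<Omega>)" "H1_grad \<Omega> e (weak_gradient \<Omega> e)" "\<bar>e x\<bar> \<le> 1" if "e \<in> E" for e x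
  proof -
    from that obtain m p q where e: "e = (\<lambda>x. tanh (real m * (p x - q x)))" and pq: "p \<in> S a" "q \<in> S b" by (auto simp: E_def)
    have w: "(\<lambda>x. p x - q x) \<in> elts (H10 \<Omega>)"
      using H10_lincomb[OF O(1) S(2)[OF a(1) pq(1)] S(2)[OF b(1) pq(2)], of 1 "-1"] by simp
    obtain g where g: "H1_grad \<Omega> (\<lambda>x. p x - q x) g" by (rule H1_E[OF O(1) H10_imp_H1[OF w]])
    note ht = H10_tanh[OF O(1) w g, of "real m"]
    show "e \<in> elts (H10 \<Omega>)" unfolding e by (rule ht(2))
    have "has_weak_gradient \<Omega> e (weak_gradient \<Omega> e)"
      unfolding e using has_weak_gradient_weak_gradient ht(1) by (auto simp: H1_grad_def)
    then show "H1_grad \<Omega> e (weak_gradient \<Omega> e)" using H1_gradI[OF O(1) H1_I] ht(1) e by blast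
    show "\<bar>e x\<bar> \<le> 1" unfolding e by (rule abs_tanh_le)
  qed
  have i1: "AE t in ?I. \<forall>e\<in>E. (\<integral>x. e x * D1 (t, x) + (A t x *v G t x) \<bullet> weak_gradient \<Omega> e x - e x * f1 (t, x) \<partial>?O) = 0"
    unfolding AE_ball_countable[OF E_countable] using id1 EH by blast
  have i2: "AE t in ?I. \<forall>e\<in>E. (\<integral>x. e x * D2 (t, x) + (A t x *v H t x) \<bullet> weak_gradient \<Omega> e x - e x * f2 (t, x) \<partial>?O) = 0"
    unfolding AE_ball_countable[OF E_countable] using id2 EH by blast
  obtain \<nu> where \<nu>: "\<nu> > 0" "AE p in ?Q. \<forall>\<xi>. (A (fst p) (snd p) *v \<xi>) \<bullet> \<xi> \<ge> \<nu> * (norm \<xi>)\<^sup>2"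
    using A unfolding diffusion_assumption_def split_beta' by blast
  \<comment> \<open>Because the flux is linear in the gradient, positivity of the quadratic form is
    the monotonicity required for the difference of two solutions.\<close>
  have ell: "AE t in ?I. AE x in ?O. \<forall>\<xi>. (A t x *v \<xi>) \<bullet> \<xi> \<ge> 0"
    using AE_lebesgue_on_prodD(1)[OF oI O(1) \<nu>(2)]
  proof eventually_elim
    case (elim t)
    then show ?case
    proof eventually_elim
      case (elim x)
      show ?case
      proof
        fix \<xi> :: "real ^ 'd"
        have "0 \<le> \<nu> * (norm \<xi>)\<^sup>2" using \<nu>(1) by simp
        then show "0 \<le> (A t x *v \<xi>) \<bullet> \<xi>" using elim[rule_format, of \<xi>] by simp
      qed
    qed
  qed
  have tI: "AE t in ?I. t \<in> {0<..<T}" by (rule AE_I2) simp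
  show ?thesis
    using i1 i2 ell tI a(2) b(2) G L2fun_slices[OF O F(1)] L2fun_slices[OF O F(2)]
      Fubini_lebesgue_on(1)[OF oI O(1) D(1)] Fubini_lebesgue_on(1)[OF oI O(1) D(2)]
      Fubini_lebesgue_on(1)[OF oI O(1) f(1)] Fubini_lebesgue_on(1)[OF oI O(1) f(2)]
  proof eventually_elim
    case (elim t)
    have FL: "L2fun \<Omega> (\<lambda>x. A t x *v G t x)" "L2fun \<Omega> (\<lambda>x. A t x *v H t x)" using elim(9,10) by simp_all
    show ?case
    proof (rule sgn_test_inequality[OF O(1) elim(7,8) _ elim(5) _ elim(6) L2fun_diff[OF FL]])
      show "a n t \<in> elts (H10 \<Omega>)" "b n t \<in> elts (H10 \<Omega>)" for n
        using a(1)[of n] b(1)[of n] elim(4) by (auto simp: simple_fun_def)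
      show "AE x in ?O. 0 \<le> (A t x *v G t x - A t x *v H t x) \<bullet> (G t x - H t x)"
        using elim(3) by eventually_elim (simp add: matrix_vector_mult_diff_distrib[symmetric])
      show "integrable ?O (\<lambda>x. D1 (t, x) - D2 (t, x))" "integrable ?O (\<lambda>x. f1 (t, x) - f2 (t, x))"
        using elim(11-14) by auto
      fix n m e assume e: "e = (\<lambda>x. tanh (real m * (a n t x - b n t x)))"
      have "a n t \<in> S a" "b n t \<in> S b" unfolding S_def using elim(4) by blast+
      then have eE: "e \<in> E" unfolding E_def e by (intro image_eqI[of _ _ "(m, a n t, b n t)"]) auto
      note EH = EH[OF eE]
      have eL: "L2fun \<Omega> e" "L2fun \<Omega> (weak_gradient \<Omega> e)" using EH(2) by (auto simp: H1_grad_def)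
      have ie: "integrable ?O (\<lambda>x. e x * p x)" if "integrable ?O p" for p
        by (rule Bochner_Integration.integrable_bound[OF that])
          (use that L2funD(1)[OF eL(1)] EH(3) in \<open>auto simp: abs_mult intro!: mult_left_le_one_le\<close>)
      note iD = ie[OF elim(11)] ie[OF elim(12)] and iF = ie[OF elim(13)] ie[OF elim(14)]
      note iA = L2fun_inner_integrable[OF FL(1) eL(2)] L2fun_inner_integrable[OF FL(2) eL(2)]
      have "(\<integral>x. e x * D1 (t, x) \<partial>?O) + (\<integral>x. (A t x *v G t x) \<bullet> weak_gradient \<Omega> e x \<partial>?O) - (\<integral>x. e x * f1 (t, x) \<partial>?O) = 0"
        "(\<integral>x. e x * D2 (t, x) \<partial>?O) + (\<integral>x. (A t x *v H t x) \<bullet> weak_gradient \<Omega> e x \<partial>?O) - (\<integral>x. e x * f2 (t, x) \<partial>?O) = 0"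
        using elim(1)[rule_format, OF eE] elim(2)[rule_format, OF eE] iD iF iA by simp_all
      then show "(\<integral>x. e x * (D1 (t, x) - D2 (t, x)) \<partial>?O)
          + (\<integral>x. (A t x *v G t x - A t x *v H t x) \<bullet> weak_gradient \<Omega> e x \<partial>?O) = (\<integral>x. e x * (f1 (t, x) - f2 (t, x)) \<partial>?O)"
        using iD iF iA by (simp add: right_diff_distrib inner_diff_left)
    qed
  qed
qed

lemma weak_solution_contraction:
  fixes u1 u2 f1 f2 :: "real \<Rightarrow> real ^ 'd \<Rightarrow> real"
  assumes T: "T > 0" and O: "open \<Omega>" "bounded \<Omega>" and K: "kernel_assumption T k l" and A: "diffusion_assumption T \<Omega> A"
    and \<phi>: "strict_mono \<phi>"
    and u1: "weak_solution T \<Omega> k A \<phi> u01 f1 u1" "conv_diff k u1 u01 \<in> W11_zero T (Lp_space 1 \<Omega>)"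
      "integrable (lebesgue_on \<Omega>) u01" "integrable (lebesgue_on (cylinder T \<Omega>)) (\<lambda>z. f1 (fst z) (snd z))"
    and u2: "weak_solution T \<Omega> k A \<phi> u02 f2 u2" "conv_diff k u2 u02 \<in> W11_zero T (Lp_space 1 \<Omega>)"
      "integrable (lebesgue_on \<Omega>) u02" "integrable (lebesgue_on (cylinder T \<Omega>)) (\<lambda>z. f2 (fst z) (snd z))"
  shows "integrable (lebesgue_on (cylinder T \<Omega>)) (\<lambda>z. u1 (fst z) (snd z) - u2 (fst z) (snd z))"
    and "(\<integral>z. \<bar>u1 (fst z) (snd z) - u2 (fst z) (snd z)\<bar> \<partial>lebesgue_on (cylinder T \<Omega>))
      \<le> T * (\<integral>x. \<bar>u01 x - u02 x\<bar> \<partial>lebesgue_on \<Omega>)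
        + (\<integral>t. \<bar>l t\<bar> \<partial>lebesgue_on {0<..<T}) * (\<integral>z. \<bar>f1 (fst z) (snd z) - f2 (fst z) (snd z)\<bar> \<partial>lebesgue_on (cylinder T \<Omega>))"
proof -
  let ?I = "lebesgue_on {0<..<T}" and ?O = "lebesgue_on \<Omega>" and ?Q = "lebesgue_on (cylinder T \<Omega>)"
  have oI: "open {0<..<T}" by simp
  have Qb: "cylinder T \<Omega> \<in> sets borel" using O by (intro borel_open open_Times) auto
  obtain kb lb where kl: "volterra_pair T kb lb" and kb: "\<And>s. s \<notin> {0<..<T} \<Longrightarrow> kb s = 0" "AE s in lborel. 0 < s \<and> s < T \<longrightarrow> k s = kb s"
    and lb: "\<And>s. s \<notin> {0<..<T} \<Longrightarrow> lb s = 0" "AE s in lborel. 0 < s \<and> s < T \<longrightarrow> l s = lb s"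
    by (rule kernel_volterra_pair[OF T K]) blast
  have kbi: "integrable lborel kb" and lbi: "integrable lborel lb" using kl by (auto simp: volterra_pair_def)
  have lbb: "lb \<in> borel_measurable borel" using borel_measurable_integrable[OF lbi] by simp
  obtain W1 D1 G1 where s1: "integrable ?Q (\<lambda>z. u1 (fst z) (snd z))"
    "borel_on (cylinder T \<Omega>) W1" "borel_on (cylinder T \<Omega>) D1"
    "AE z in ?Q. u1 (fst z) (snd z) - u01 (snd z) = W1 z"
    "AE x in ?O. AE t in lborel. 0 < t \<and> t < T \<longrightarrow> cv kb (\<lambda>s. W1 (s, x)) t = cv (indicator {0<..<T}) (\<lambda>s. D1 (s, x)) t"
    "AE t in ?I. H1_grad \<Omega> (\<lambda>x. \<phi> (u1 t x)) (G1 t)"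
    "L2fun (cylinder T \<Omega>) (\<lambda>z. A (fst z) (snd z) *v G1 (fst z) (snd z))"
    "\<forall>e\<in>elts (H10 \<Omega>). \<forall>ge C. H1_grad \<Omega> e ge \<longrightarrow> (\<forall>x. \<bar>e x\<bar> \<le> C) \<longrightarrow>
       (AE t in ?I. (\<integral>x. e x * D1 (t, x) + (A t x *v G1 t x) \<bullet> ge x - e x * f1 t x \<partial>?O) = 0)"
    by (rule weak_solution_slices[OF O T A kbi kb u1]) (assumption | (rule that; assumption))+
  obtain W2 D2 G2 where s2: "integrable ?Q (\<lambda>z. u2 (fst z) (snd z))"
    "borel_on (cylinder T \<Omega>) W2" "borel_on (cylinder T \<Omega>) D2"
    "AE z in ?Q. u2 (fst z) (snd z) - u02 (snd z) = W2 z"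
    "AE x in ?O. AE t in lborel. 0 < t \<and> t < T \<longrightarrow> cv kb (\<lambda>s. W2 (s, x)) t = cv (indicator {0<..<T}) (\<lambda>s. D2 (s, x)) t"
    "AE t in ?I. H1_grad \<Omega> (\<lambda>x. \<phi> (u2 t x)) (G2 t)"
    "L2fun (cylinder T \<Omega>) (\<lambda>z. A (fst z) (snd z) *v G2 (fst z) (snd z))"
    "\<forall>e\<in>elts (H10 \<Omega>). \<forall>ge C. H1_grad \<Omega> e ge \<longrightarrow> (\<forall>x. \<bar>e x\<bar> \<le> C) \<longrightarrow>
       (AE t in ?I. (\<integral>x. e x * D2 (t, x) + (A t x *v G2 t x) \<bullet> ge x - e x * f2 t x \<partial>?O) = 0)"
    by (rule weak_solution_slices[OF O T A kbi kb u2]) (assumption | (rule that; assumption))+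
  show ui: "integrable ?Q (\<lambda>z. u1 (fst z) (snd z) - u2 (fst z) (snd z))" using s1(1) s2(1) by simp
  have \<phi>L: "(\<lambda>t x. \<phi> (u1 t x)) \<in> bochner_Lp 2 T (H10 \<Omega>)" "(\<lambda>t x. \<phi> (u2 t x)) \<in> bochner_Lp 2 T (H10 \<Omega>)"
    using u1(1) u2(1) by (auto simp: weak_solution_def W_phi_def)
  \<comment> \<open>The slice inequality involves the sign of \<phi>(u1) - \<phi>(u2), the Volterra
    argument that of u1 - u2.\<close>
  have sgn_\<phi>: "sgn (\<phi> r - \<phi> s) = sgn (r - s)" for r s
    using \<phi> strict_mono_less[OF \<phi>] by (auto simp: sgn_if strict_mono_eq)
  have energy: "AE t in ?I. (\<integral>x. sgn (u1 t x - u2 t x) * (D1 (t, x) - D2 (t, x)) \<partial>?O) \<le> (\<integral>x. \<bar>f1 t x - f2 t x\<bar> \<partial>?O)"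
    using slice_sgn_inequality[OF O A \<phi>L s1(6) s2(6) s1(7) s2(7) borel_on_integrable(1)[OF s1(3) Qb] borel_on_integrable(1)[OF s2(3) Qb] u1(4) u2(4)]
      s1(8) s2(8) by (simp add: sgn_\<phi>)
  have eq: "AE x in ?O. AE t in lborel. 0 < t \<and> t < T \<longrightarrow>
      cv kb (\<lambda>s. W1 (s, x) - W2 (s, x)) t = cv (indicator {0<..<T}) (\<lambda>s. D1 (s, x) - D2 (s, x)) t"
  proof -
    have unit: "integrable lborel (indicator {0<..<T} :: real \<Rightarrow> real)" using T by (intro integrable_real_indicator) auto
    have sections: "AE x in ?O. integrable lborel (\<lambda>t. H (t, x))" if "borel_on (cylinder T \<Omega>) H" for H
      using borel_on_sections(1)[OF that] O by (auto simp: AE_lebesgue_on_iff_lborel borel_on_def elim!: eventually_mono)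
    show ?thesis
      using sections[OF s1(2)] sections[OF s2(2)] sections[OF s1(3)] sections[OF s2(3)] s1(5) s2(5)
    proof eventually_elim
      case (elim x)
      show ?case
        using cv_diff_AE[OF kbi elim(1,2)] cv_diff_AE[OF unit elim(3,4)] elim(5,6)
        by eventually_elim simp
    qed
  qed
  have fi: "integrable ?Q (\<lambda>z. \<bar>f1 (fst z) (snd z) - f2 (fst z) (snd z)\<bar>)" using u1(4) u2(4) by simp
  have W: "AE z in ?Q. (u1 (fst z) (snd z) - u2 (fst z) (snd z)) - (u01 (snd z) - u02 (snd z)) = W1 z - W2 z"
    using s1(4) s2(4) by eventually_elim simp
  have "(\<integral>z. \<bar>u1 (fst z) (snd z) - u2 (fst z) (snd z)\<bar> \<partial>?Q)
      \<le> T * (\<integral>x. \<bar>u01 x - u02 x\<bar> \<partial>?O) + (\<integral>s. \<bar>lb s\<bar> \<partial>lborel) * (\<integral>t. \<integral>x. \<bar>f1 t x - f2 t x\<bar> \<partial>?O \<partial>?I)"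
    by (rule volterra_contraction[OF kl O(1) ui _ borel_on_diff[OF s1(2) s2(2)] W borel_on_diff[OF s1(3) s2(3)] eq])
      (use u1(3) u2(3) Fubini_lebesgue_on(2)[OF oI O(1) fi] energy in \<open>auto intro: integral_nonneg_AE\<close>)
  also have "(\<integral>t. \<integral>x. \<bar>f1 t x - f2 t x\<bar> \<partial>?O \<partial>?I) = (\<integral>z. \<bar>f1 (fst z) (snd z) - f2 (fst z) (snd z)\<bar> \<partial>?Q)"
    using Fubini_lebesgue_on(3)[OF oI O(1) fi] by simp
  also have "(\<integral>s. \<bar>lb s\<bar> \<partial>lborel) = (\<integral>t. \<bar>l t\<bar> \<partial>?I)"
  proof -
    have li: "integrable ?I l" using K T by (simp add: kernel_assumption_def L1_loc_half_line_def)
    have "(\<integral>t. \<bar>l t\<bar> \<partial>?I) = (\<integral>t. \<bar>lb t\<bar> \<partial>?I)"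
    proof (rule integral_cong_AE)
      show "(\<lambda>t. \<bar>l t\<bar>) \<in> borel_measurable ?I" using borel_measurable_integrable[OF li] by simp
      show "(\<lambda>t. \<bar>lb t\<bar>) \<in> borel_measurable ?I"
        using lbb by (intro measurable_restrict_space1 measurable_completion) simp
      show "AE t in ?I. \<bar>l t\<bar> = \<bar>lb t\<bar>" using lb(2) by (auto simp: AE_lebesgue_on_iff_lborel elim!: eventually_mono)
    qed
    also have "\<dots> = (\<integral>t. indicator {0<..<T} t * \<bar>lb t\<bar> \<partial>lborel)"
      using lbb by (intro integrable_lebesgue_on_lborel(2)) auto
    also have "\<dots> = (\<integral>t. \<bar>lb t\<bar> \<partial>lborel)"
      using lb(1) by (intro Bochner_Integration.integral_cong) (auto simp: indicator_def)
    finally show ?thesis by simp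
  qed
  finally show "(\<integral>z. \<bar>u1 (fst z) (snd z) - u2 (fst z) (snd z)\<bar> \<partial>?Q)
      \<le> T * (\<integral>x. \<bar>u01 x - u02 x\<bar> \<partial>?O) + (\<integral>t. \<bar>l t\<bar> \<partial>?I) * (\<integral>z. \<bar>f1 (fst z) (snd z) - f2 (fst z) (snd z)\<bar> \<partial>?Q)" .
qed

section \<open>Passage to the limit\<close>

text \<open>The lower bound \<mu> on the derivative beyond R gives at least linear growth at both
  ends, so the intermediate value theorem reaches every y.\<close>

lemma nonlinearity_bij:
  assumes "nonlinearity_assumption \<phi>"
  shows "isCont \<phi> r" "surj \<phi>"
proof -
  have d: "\<phi> differentiable (at r)" for r
    using assms by (auto simp: nonlinearity_assumption_def C1_differentiable_on_def intro: differentiableI_vector)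
  then have D: "(\<phi> has_real_derivative deriv \<phi> r) (at r)" for r
    by (simp add: DERIV_deriv_iff_real_differentiable)
  show cont: "isCont \<phi> r" for r by (rule DERIV_isCont[OF D])
  obtain \<mu> R where \<mu>: "\<mu> > 0" "R > 0" "\<And>r. \<bar>r\<bar> > R \<Longrightarrow> \<mu> \<le> deriv \<phi> r"
    using assms by (auto simp: nonlinearity_assumption_def)
  have grow: "\<mu> * (y - x) \<le> \<phi> y - \<phi> x" if "x < y" "\<And>r. x < r \<Longrightarrow> r < y \<Longrightarrow> R < \<bar>r\<bar>" for x y
  proof -
    have "\<exists>z>x. z < y \<and> \<phi> y - \<phi> x = (y - x) * deriv \<phi> z" by (rule MVT2[OF that(1) D])
    then obtain z where z: "z > x" "z < y" "\<phi> y - \<phi> x = (y - x) * deriv \<phi> z" by blast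
    have "\<mu> * (y - x) \<le> deriv \<phi> z * (y - x)" using \<mu>(3)[of z] that z by (intro mult_right_mono) auto
    with z(3) show ?thesis by (simp add: mult.commute)
  qed
  show "surj \<phi>"
    unfolding surj_def
  proof
    fix y
    \<comment> \<open>Large enough for \<mu> * s to compensate y together with either boundary
      value, so the same s serves both ends; the summand 1 makes it positive.\<close>
    define s where "s = (\<bar>y\<bar> + \<bar>\<phi> R\<bar> + \<bar>\<phi> (- R)\<bar>) / \<mu> + 1"
    have s: "s > 0" "\<mu> * s \<ge> \<bar>y\<bar> + \<bar>\<phi> R\<bar> + \<bar>\<phi> (- R)\<bar>" using \<mu>(1) by (auto simp: s_def field_simps add_pos_nonneg)
    have "\<mu> * ((R + s) - R) \<le> \<phi> (R + s) - \<phi> R" by (rule grow) (use s(1) \<mu>(2) in auto)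
    then have "\<phi> (R + s) \<ge> y"
      using s(2) abs_ge_self[of y] abs_ge_minus_self[of "\<phi> R"] abs_ge_zero[of "\<phi> (- R)"] by simp
    moreover have "\<mu> * (- R - (- R - s)) \<le> \<phi> (- R) - \<phi> (- R - s)" by (rule grow) (use s(1) \<mu>(2) in auto)
    then have "\<phi> (- R - s) \<le> y"
      using s(2) abs_ge_minus_self[of y] abs_ge_self[of "\<phi> (- R)"] abs_ge_zero[of "\<phi> R"] by simp
    ultimately have "\<exists>x\<ge>- R - s. x \<le> R + s \<and> \<phi> x = y" using s \<mu>(2) cont by (intro IVT) auto
    then show "\<exists>x. y = \<phi> x" by auto
  qed
qed

lemma isCont_inv:
  fixes \<phi> :: "real \<Rightarrow> real"
  assumes "\<And>r. isCont \<phi> r" "surj \<phi>" "inj \<phi>"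
  shows "isCont (inv \<phi>) y"
proof -
  obtain x where y: "y = \<phi> x" using assms(2) by auto
  show ?thesis unfolding y
    by (rule isCont_inverse_function[of 1]) (use assms in auto)
qed

text \<open>Truncation is nonexpansive, which makes the estimate for truncated data uniform in m and
  n.\<close>

lemma trunc_bounds: "\<bar>trunc m n r\<bar> \<le> \<bar>r\<bar>" "\<bar>trunc m n r - trunc m n s\<bar> \<le> \<bar>r - s\<bar>"
  by (auto simp: trunc_def)

lemma integrable_trunc:
  assumes "integrable M f" shows "integrable M (\<lambda>x. trunc m n (f x))"
proof (rule Bochner_Integration.integrable_bound[OF assms])
  show "(\<lambda>x. trunc m n (f x)) \<in> borel_measurable M"
    unfolding trunc_def using borel_measurable_integrable[OF assms] by measurable
qed (simp add: trunc_bounds)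

lemma integral_trunc_diff_le:
  fixes f g :: "'a \<Rightarrow> real"
  assumes "integrable M f" "integrable M g"
  shows "(\<integral>x. \<bar>trunc m n (f x) - trunc m n (g x)\<bar> \<partial>M) \<le> (\<integral>x. \<bar>f x - g x\<bar> \<partial>M)"
  by (rule integral_mono') (use assms trunc_bounds(2) in auto)

text \<open>Fatou's lemma for the inner and then for the outer limit. Writing \<bar>g\<bar> as a
  nested liminf lets measurability come from f.\<close>

lemma integral_iterated_limit_le:
  fixes f :: "nat \<Rightarrow> nat \<Rightarrow> 'a \<Rightarrow> real"
  assumes f: "\<And>m n. integrable M (f m n)" and R: "\<And>m n. (\<integral>x. \<bar>f m n x\<bar> \<partial>M) \<le> R"
    and lim: "AE x in M. \<exists>w. (\<forall>n. (\<lambda>m. f m n x) \<longlonglongrightarrow> w n) \<and> w \<longlonglongrightarrow> g x"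
  shows "(\<integral>x. \<bar>g x\<bar> \<partial>M) \<le> R"
proof (rule integral_real_bounded)
  show "R \<ge> 0" by (rule order_trans[OF _ R[of 0 0]]) simp
  have [measurable]: "f m n \<in> borel_measurable M" for m n using f by simp
  have "(\<integral>\<^sup>+x. ennreal \<bar>g x\<bar> \<partial>M) = (\<integral>\<^sup>+x. liminf (\<lambda>n. liminf (\<lambda>m. ennreal \<bar>f m n x\<bar>)) \<partial>M)"
  proof (rule nn_integral_cong_AE)
    show "AE x in M. ennreal \<bar>g x\<bar> = liminf (\<lambda>n. liminf (\<lambda>m. ennreal \<bar>f m n x\<bar>))"
      using lim
    proof eventually_elim
      case (elim x)
      then obtain w where w: "\<And>n. (\<lambda>m. f m n x) \<longlonglongrightarrow> w n" "w \<longlonglongrightarrow> g x" by blast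
      have "liminf (\<lambda>m. ennreal \<bar>f m n x\<bar>) = ennreal \<bar>w n\<bar>" for n
        by (rule lim_imp_Liminf) (auto intro!: tendsto_ennrealI tendsto_rabs w)
      moreover have "liminf (\<lambda>n. ennreal \<bar>w n\<bar>) = ennreal \<bar>g x\<bar>"
        by (rule lim_imp_Liminf) (auto intro!: tendsto_ennrealI tendsto_rabs w)
      ultimately show ?case by simp
    qed
  qed
  also have "\<dots> \<le> liminf (\<lambda>n. \<integral>\<^sup>+x. liminf (\<lambda>m. ennreal \<bar>f m n x\<bar>) \<partial>M)"
    by (rule nn_integral_liminf) measurable
  also have "\<dots> \<le> liminf (\<lambda>n. ennreal R)"
  proof (intro Liminf_mono always_eventually allI)
    fix n
    have "(\<integral>\<^sup>+x. liminf (\<lambda>m. ennreal \<bar>f m n x\<bar>) \<partial>M) \<le> liminf (\<lambda>m. \<integral>\<^sup>+x. ennreal \<bar>f m n x\<bar> \<partial>M)"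
      by (rule nn_integral_liminf) measurable
    also have "\<dots> \<le> liminf (\<lambda>m::nat. ennreal R)"
    proof (intro Liminf_mono always_eventually allI)
      fix m
      have "(\<integral>\<^sup>+x. ennreal \<bar>f m n x\<bar> \<partial>M) = ennreal (\<integral>x. \<bar>f m n x\<bar> \<partial>M)"
        by (rule nn_integral_eq_integral) (use f in auto)
      also have "\<dots> \<le> ennreal R" by (rule ennreal_leI[OF R])
      finally show "(\<integral>\<^sup>+x. ennreal \<bar>f m n x\<bar> \<partial>M) \<le> ennreal R" .
    qed
    also have "\<dots> = ennreal R" by (simp add: Liminf_const)
    finally show "(\<integral>\<^sup>+x. liminf (\<lambda>m. ennreal \<bar>f m n x\<bar>) \<partial>M) \<le> ennreal R" .
  qed
  also have "\<dots> = ennreal R" by (simp add: Liminf_const)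
  finally show "(\<integral>\<^sup>+x. ennreal \<bar>g x\<bar> \<partial>M) \<le> ennreal R" .
qed

theorem mainTheorem3:
  fixes T :: real and \<Omega> :: "(real ^ 'd) set"
    and k l \<phi> b :: "real \<Rightarrow> real"
    and A :: "real \<Rightarrow> real ^ 'd \<Rightarrow> real ^ 'd ^ 'd"
    and u0 :: "nat \<Rightarrow> real ^ 'd \<Rightarrow> real"
    and f v :: "nat \<Rightarrow> real \<Rightarrow> real ^ 'd \<Rightarrow> real"
    and u :: "nat \<Rightarrow> nat \<Rightarrow> nat \<Rightarrow> real \<Rightarrow> real ^ 'd \<Rightarrow> real"
  assumes "T > 0" and "bounded_domain \<Omega>"
    and "kernel_assumption T k l"
    and "diffusion_assumption T \<Omega> A"
    and "nonlinearity_assumption \<phi>"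
    and "b = inv \<phi>"
    and "\<And>i. i \<in> {1, 2} \<Longrightarrow> integrable (lebesgue_on \<Omega>) (u0 i)"
    and "\<And>i. i \<in> {1, 2} \<Longrightarrow> integrable (lebesgue_on (cylinder T \<Omega>)) (\<lambda>(t, x). f i t x)"
    and "\<And>i. i \<in> {1, 2} \<Longrightarrow> entropy_solution T \<Omega> k A \<phi> (u0 i) (f i) (v i)"
    and "\<And>i m n. i \<in> {1, 2} \<Longrightarrow> m \<ge> 1 \<Longrightarrow> n \<ge> 1 \<Longrightarrow>
           weak_solution T \<Omega> k A \<phi> (\<lambda>x. trunc m n (u0 i x)) (\<lambda>t x. trunc m n (f i t x)) (u i m n)"
    and "\<And>i m n. i \<in> {1, 2} \<Longrightarrow> m \<ge> 1 \<Longrightarrow> n \<ge> 1 \<Longrightarrow>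
           conv_diff k (u i m n) (\<lambda>x. trunc m n (u0 i x)) \<in> W11_zero T (Lp_space 1 \<Omega>)"
    and "\<And>i. i \<in> {1, 2} \<Longrightarrow>
           (AE (t, x) in lebesgue_on (cylinder T \<Omega>).
              \<exists>w. (\<forall>n\<ge>1. (\<lambda>m. \<phi> (u i m n t x)) \<longlonglongrightarrow> w n) \<and> w \<longlonglongrightarrow> v i t x)"
  shows "norm_L1 (cylinder T \<Omega>) (\<lambda>(t, x). b (v 1 t x) - b (v 2 t x))
         \<le> T * norm_L1 \<Omega> (\<lambda>x. u0 1 x - u0 2 x)
           + norm_L1 {0<..<T} l * norm_L1 (cylinder T \<Omega>) (\<lambda>(t, x). f 1 t x - f 2 t x)"
proof -
  let ?I = "lebesgue_on {0<..<T}" and ?O = "lebesgue_on \<Omega>" and ?Q = "lebesgue_on (cylinder T \<Omega>)"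
  have O: "open \<Omega>" "bounded \<Omega>" using assms(2) by (auto simp: bounded_domain_def)
  have \<phi>: "strict_mono \<phi>" using assms(5) by (simp add: nonlinearity_assumption_def)
  have inj: "inj \<phi>" using \<phi> by (rule strict_mono_imp_inj_on)
  \<comment> \<open>Continuity of b turns limits of \<phi>(u) into limits of u, so the contraction
    for u can be carried to b(v).\<close>
  have b: "isCont b r" "b (\<phi> r) = r" for r
    unfolding assms(6) using isCont_inv[OF nonlinearity_bij[OF assms(5)] inj] inj by auto
  have u0: "integrable ?O (u0 1)" "integrable ?O (u0 2)" using assms(7) by auto
  have f: "integrable ?Q (\<lambda>z. f 1 (fst z) (snd z))" "integrable ?Q (\<lambda>z. f 2 (fst z) (snd z))"
    using assms(8) by (auto simp: split_beta')
  define R where "R = T * (\<integral>x. \<bar>u0 1 x - u0 2 x\<bar> \<partial>?O)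
    + (\<integral>t. \<bar>l t\<bar> \<partial>?I) * (\<integral>z. \<bar>f 1 (fst z) (snd z) - f 2 (fst z) (snd z)\<bar> \<partial>?Q)"
  \<comment> \<open>The truncated problems are given for indices from 1 on, hence the shift by
    \<open>Suc\<close>, which leaves the iterated limit unchanged.\<close>
  define \<delta> where "\<delta> m n z = u 1 (Suc m) (Suc n) (fst z) (snd z) - u 2 (Suc m) (Suc n) (fst z) (snd z)" for m n and z :: "real \<times> (real ^ 'd)"
  have sol: "weak_solution T \<Omega> k A \<phi> (\<lambda>x. trunc (Suc m) (Suc n) (u0 i x)) (\<lambda>t x. trunc (Suc m) (Suc n) (f i t x)) (u i (Suc m) (Suc n))"
    "conv_diff k (u i (Suc m) (Suc n)) (\<lambda>x. trunc (Suc m) (Suc n) (u0 i x)) \<in> W11_zero T (Lp_space 1 \<Omega>)"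
    if "i \<in> {1, 2}" for i m n
    using assms(10,11)[OF that, of "Suc m" "Suc n"] by auto
  have i12: "1 \<in> {1, 2::nat}" "2 \<in> {1, 2::nat}" by auto
  note con = weak_solution_contraction[OF assms(1) O assms(3,4) \<phi> sol[OF i12(1)] integrable_trunc[OF u0(1)] integrable_trunc[OF f(1)]
      sol[OF i12(2)] integrable_trunc[OF u0(2)] integrable_trunc[OF f(2)]]
  have \<delta>: "integrable ?Q (\<delta> m n)" for m n unfolding \<delta>_def[abs_def] by (rule con(1))
  have \<delta>R: "(\<integral>z. \<bar>\<delta> m n z\<bar> \<partial>?Q) \<le> R" for m n
  proof -
    have "(\<integral>z. \<bar>\<delta> m n z\<bar> \<partial>?Q) \<le> T * (\<integral>x. \<bar>trunc (Suc m) (Suc n) (u0 1 x) - trunc (Suc m) (Suc n) (u0 2 x)\<bar> \<partial>?O)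
        + (\<integral>t. \<bar>l t\<bar> \<partial>?I) * (\<integral>z. \<bar>trunc (Suc m) (Suc n) (f 1 (fst z) (snd z)) - trunc (Suc m) (Suc n) (f 2 (fst z) (snd z))\<bar> \<partial>?Q)"
      unfolding \<delta>_def by (rule con(2))
    also have "\<dots> \<le> R"
      unfolding R_def using assms(1)
      by (intro add_mono mult_left_mono integral_trunc_diff_le u0 f) (auto intro: integral_nonneg_AE)
    finally show ?thesis .
  qed
  have "(\<integral>z. \<bar>b (v 1 (fst z) (snd z)) - b (v 2 (fst z) (snd z))\<bar> \<partial>?Q) \<le> R"
  proof (rule integral_iterated_limit_le[OF \<delta> \<delta>R])
    have lim: "AE z in ?Q. \<exists>w. (\<forall>n\<ge>1. (\<lambda>m. \<phi> (u i m n (fst z) (snd z))) \<longlonglongrightarrow> w n) \<and> w \<longlonglongrightarrow> v i (fst z) (snd z)" if "i \<in> {1, 2}" for i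
      using assms(12)[OF that] by (simp add: split_beta')
    show "AE z in ?Q. \<exists>w. (\<forall>n. (\<lambda>m. \<delta> m n z) \<longlonglongrightarrow> w n) \<and> w \<longlonglongrightarrow> b (v 1 (fst z) (snd z)) - b (v 2 (fst z) (snd z))"
      using lim[OF i12(1)] lim[OF i12(2)]
    proof eventually_elim
      case (elim z)
      have ex: "\<exists>w. (\<forall>n. (\<lambda>m. u i (Suc m) (Suc n) (fst z) (snd z)) \<longlonglongrightarrow> w n) \<and> w \<longlonglongrightarrow> b (v i (fst z) (snd z))"
        if ex\<phi>: "\<exists>w. (\<forall>n\<ge>1. (\<lambda>m. \<phi> (u i m n (fst z) (snd z))) \<longlonglongrightarrow> w n) \<and> w \<longlonglongrightarrow> v i (fst z) (snd z)" for i
      proof -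
        obtain w where w: "\<And>n. n \<ge> 1 \<Longrightarrow> (\<lambda>m. \<phi> (u i m n (fst z) (snd z))) \<longlonglongrightarrow> w n" "w \<longlonglongrightarrow> v i (fst z) (snd z)"
          using ex\<phi> by blast
        have "(\<lambda>m. u i (Suc m) (Suc n) (fst z) (snd z)) \<longlonglongrightarrow> b (w (Suc n))" for n
          using isCont_tendsto_compose[OF b(1) LIMSEQ_Suc[OF w(1)[of "Suc n"]]] by (simp add: b(2))
        moreover have "(\<lambda>n. b (w (Suc n))) \<longlonglongrightarrow> b (v i (fst z) (snd z))"
          by (rule isCont_tendsto_compose[OF b(1) LIMSEQ_Suc[OF w(2)]])
        ultimately show ?thesis by (intro exI[of _ "\<lambda>n. b (w (Suc n))"] conjI allI)
      qed
      obtain w1 w2 where w: "\<And>n. (\<lambda>m. u 1 (Suc m) (Suc n) (fst z) (snd z)) \<longlonglongrightarrow> w1 n" "w1 \<longlonglongrightarrow> b (v 1 (fst z) (snd z))"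
        "\<And>n. (\<lambda>m. u 2 (Suc m) (Suc n) (fst z) (snd z)) \<longlonglongrightarrow> w2 n" "w2 \<longlonglongrightarrow> b (v 2 (fst z) (snd z))"
        using ex[OF elim(1)] ex[OF elim(2)] by blast
      then show ?case
        by (intro exI[of _ "\<lambda>n. w1 n - w2 n"]) (auto simp: \<delta>_def intro!: tendsto_diff)
    qed
  qed
  then show ?thesis by (simp add: norm_L1_def R_def split_beta')
qed

end
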